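(* For every integer $d\geq 4$ there exists a sticky Cantor set in $\mathbb{R}^d$; that is, there exists a (tamely or wildly) embedded Cantor set $C\subset\mathbb{R}^d$ and a number $\epsilon>0$ such that there is no ambient isotopy $h_t\colon\mathbb{R}^d\to\mathbb{R}^d$, $t\in[0,1]$, with $h_0=\mathrm{id}$, $|h_t(x)-x|<\epsilon$ for all $x\in\mathbb{R}^d$ and $t\in[0,1]$, and $h_1(C)\cap C=\emptyset$.
   Context: A Cantor set in $\mathbb{R}^d$ is a subset homeomorphic to the standard middle-thirds Cantor set. A subset $C\subset\mathbb{R}^d$ is called sticky if it cannot be isotoped off of itself by any sufficiently small ambient isotopy, i.e. there is $\epsilon>0$ such that no ambient isotopy of $\mathbb{R}^d$ starting at the identity and moving every point by less than $\epsilon$ at all times ends at a homeomorphism $h_1$ with $h_1(C)\cap C=\emptyset$. *)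

theory Defs
  imports "HOL-Analysis.Analysis"
begin

fun cantor_stage :: "nat \<Rightarrow> real set" where
  "cantor_stage 0 = {0..1}"
| "cantor_stage (Suc n) =
     (\<lambda>x. x / 3) ` cantor_stage n \<union> (\<lambda>x. 2/3 + x / 3) ` cantor_stage n"

definition cantor_set :: "real set" where
  "cantor_set = (\<Inter>n. cantor_stage n)"

definition is_cantor_set :: "'a::topological_space set \<Rightarrow> bool" where
  "is_cantor_set C \<longleftrightarrow> C homeomorphic cantor_set"

definition ambient_isotopy :: "(real \<Rightarrow> 'a::real_normed_vector \<Rightarrow> 'a) \<Rightarrow> bool" where
  "ambient_isotopy h \<longleftrightarrow>
     continuous_on ({0..1} \<times> UNIV) (\<lambda>(t, x). h t x) \<and>
     (\<forall>t\<in>{0..1}. \<exists>g. homeomorphism UNIV UNIV (h t) g) \<and>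
     h 0 = id"

definition sticky :: "'a::real_normed_vector set \<Rightarrow> bool" where
  "sticky C \<longleftrightarrow> (\<exists>\<epsilon>>0. \<not> (\<exists>h. ambient_isotopy h \<and>
       (\<forall>t\<in>{0..1}. \<forall>x. norm (h t x - x) < \<epsilon>) \<and>
       h 1 ` C \<inter> C = {}))"

end

theory Submission
  imports Defs "HOL-Homology.Homology"
begin

text \<open>
  Let \<open>m = d - 2 \<ge> 2\<close>. Start with a thickened round \<open>m\<close>-sphere and replace it repeatedly by
  \<open>spherical Bing doubles\<close>: two thin thickened spheres, one folded over each hemisphere. Precomposing
  each fold with a suitable self-map of the sphere makes the leaves of a deep enough tree of doubles
  arbitrarily small, so the intersection \<open>A\<close> of the stages is a Cantor set.

  The leaf spheres of a tree are disjoint with acyclic complements in degree 2, hence every Massey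
  product of the dual classes has a defining system, that is, a flat connection with unipotent
  upper triangular holonomy. At each double the meridian is the commutator of the meridians of the
  two halves; inductively the holonomy of the meridian of the root is \<open>1 + c E\<^sub>i\<^sub>k\<close> with \<open>c \<noteq> 0\<close>,
  where \<open>i..<k\<close> is the block of leaves of the tree.

  Let \<open>B\<close> be a copy of \<open>A\<close> whose root sphere crosses that of \<open>A\<close> transversally at a point, and
  \<open>C = A \<union> B\<close>. If \<open>h\<close> is close to the identity and \<open>h B\<close> misses \<open>A\<close>, then late stages of \<open>A\<close> and
  \<open>h B\<close> are disjoint, and their leaves carry a common flat connection. A small torus around the
  crossing point makes the two root meridians commute, but \<open>1 + c E\<^sub>0\<^sub>a\<close> and \<open>1 + c' E\<^sub>a\<^sub>N\<close> have the
  commutator entry \<open>c * c' \<noteq> 0\<close>.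
\<close>

section \<open>Singular chains and Mayer-Vietoris\<close>

text \<open>The homeomorphism \<open>h\<close> is only known to be continuous, injective and close
  to the identity, so about the position of \<open>h B\<close> relative to \<open>A\<close> nothing
  is available beyond disjointness, and no fundamental group can be computed. A flat connection asks
  only for homology: it exists because each single leaf complement has no second homology, and this
  holds for every leaf since its embedding extends to a convex open set containing the disc that the
  sphere bounds. That vanishing and the torus around the crossing are what four dimensions are
  needed for. The stage that separates \<open>A\<close> from \<open>h B\<close> depends on
  \<open>h\<close>, so the matrices have no bounded size, whereas the admissible displacement must
  not depend on the stage; it comes from the tubes of radius 1/8 around the two roots alone.
  Nontriviality is carried by one real number per tree: a leaf has the number 1 and a double has the
  product of the numbers of its halves, so it never becomes zero.\<close>

definition bounds :: "nat \<Rightarrow> 'a::topological_space set \<Rightarrow> 'a chain \<Rightarrow> bool" where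
  "bounds p U z \<longleftrightarrow> (\<exists>c. singular_chain (Suc p) (top_of_set U) c \<and> chain_boundary (Suc p) c = z)"

text \<open>Homology is unreduced here: \<open>chain_boundary 0\<close> is zero, so in degree 0 only
  the empty set qualifies. Degree 0 is therefore handled through injectivity statements about
  \<open>bounds 0\<close>.\<close>

definition acyc :: "nat \<Rightarrow> 'a::topological_space set \<Rightarrow> bool" where
  "acyc p U \<longleftrightarrow> (\<forall>z. singular_chain p (top_of_set U) z \<longrightarrow> chain_boundary p z = 0 \<longrightarrow> bounds p U z)"

lemma boundsI:
  "singular_chain (Suc p) (top_of_set U) c \<Longrightarrow> chain_boundary (Suc p) c = z \<Longrightarrow> bounds p U z"
  by (auto simp: bounds_def)

lemma singular_chain_Int:
  assumes "singular_chain p (top_of_set U) c" "singular_chain p (top_of_set V) c"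
  shows "singular_chain p (top_of_set (U \<inter> V)) c"
  using assms by (auto simp: singular_chain_subtopology)

lemma singular_chain_top_of_set_mono:
  "singular_chain p (top_of_set U) c \<Longrightarrow> U \<subseteq> V \<Longrightarrow> singular_chain p (top_of_set V) c"
  using singular_chain_mono by blast

lemma chain_boundary_boundary_Suc:
  "singular_chain (Suc (Suc p)) X c \<Longrightarrow> chain_boundary (Suc p) (chain_boundary (Suc (Suc p)) c) = 0"
  using chain_boundary_boundary_alt by blast

text \<open>The set excised is the complement of \<open>U\<close> in the union: it is closed and
  contained in the open set \<open>V\<close>, so sufficiently fine subdivision puts each simplex
  into \<open>U\<close> or into \<open>V\<close>.\<close>

lemma subdivision_split:
  fixes U V :: "'a::topological_space set"
  assumes "open U" "open V" "singular_chain p (top_of_set (U \<union> V)) c"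
  obtains n d e where "singular_chain p (top_of_set U) d" "singular_chain p (top_of_set V) e"
    "(singular_subdivision p ^^ n) c = d + e"
proof -
  let ?X = "top_of_set (U \<union> V)"
  let ?U = "(U \<union> V) - U"
  have oU: "openin ?X U" and oV: "openin ?X V"
    using assms by (auto simp: openin_open)
  have "closedin ?X ?U"
    using oU by (auto simp: closedin_def double_diff)
  then have cl: "?X closure_of ?U \<subseteq> ?X interior_of V"
    using interior_of_openin[OF oV] by (simp add: closure_of_closedin) blast
  have c: "singular_chain p (subtopology ?X (U \<union> V)) c"
    using assms(3) by (simp add: subtopology_subtopology)
  obtain n d e where "singular_chain p (subtopology ?X ((U \<union> V) - ?U)) d"
     "singular_chain p (subtopology ?X V) e" "(singular_subdivision p ^^ n) c = d + e"
    using excised_chain_exists[OF cl _ c] by (metis Un_upper2)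
  moreover have "(U \<union> V) \<inter> ((U \<union> V) - ?U) = U" "(U \<union> V) \<inter> V = V" by auto
  ultimately show thesis
    using that by (simp add: subtopology_subtopology)
qed

text \<open>\<open>h\<close> is the chain homotopy from the identity to iterated subdivision. It is
  additive and respects every subspace, so one and the same \<open>h\<close> can be applied to
  chains of \<open>U\<close>, of \<open>V\<close> and of the union.\<close>

lemma subdivision_filling:
  fixes U V :: "'a::topological_space set"
  assumes "open U" "open V" "singular_chain (Suc p) (top_of_set (U \<union> V)) w"
  obtains d e h where "singular_chain (Suc p) (top_of_set U) d" "singular_chain (Suc p) (top_of_set V) e"
    "\<And>X c. singular_chain p X c \<Longrightarrow> singular_chain (Suc p) X (h c)"
    "\<And>c c'. h (c - c') = h c - h c'"
    "chain_boundary (Suc p) d + chain_boundary (Suc p) e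
       = chain_boundary (Suc p) w + chain_boundary (Suc p) (h (chain_boundary (Suc p) w))"
proof -
  obtain n d e where de: "singular_chain (Suc p) (top_of_set U) d" "singular_chain (Suc p) (top_of_set V) e"
    "(singular_subdivision (Suc p) ^^ n) w = d + e"
    by (rule subdivision_split[OF assms]) (rule that)
  obtain h where h: "\<And>p. h p 0 = (0 :: 'a chain)"
        "\<And>p c1 c2. h p (c1-c2) = h p c1 - h p c2"
        "\<And>p X c. singular_chain p X c \<Longrightarrow> singular_chain (Suc p) X (h p c)"
        "\<And>p X c. singular_chain p X c
                 \<Longrightarrow> chain_boundary (Suc p) (h p c) + h (p - Suc 0) (chain_boundary p c)
                   = (singular_subdivision p ^^ n) c - c"
    by (rule chain_homotopic_iterated_singular_subdivision[where n=n]) (rule that)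
  have "d + e = w + chain_boundary (Suc (Suc p)) (h (Suc p) w) + h p (chain_boundary (Suc p) w)"
    using h(4)[OF assms(3)] de(3) by (simp add: algebra_simps)
  then have "chain_boundary (Suc p) (d + e) = chain_boundary (Suc p) w
      + chain_boundary (Suc p) (h p (chain_boundary (Suc p) w))"
    using chain_boundary_boundary_Suc[OF h(3)[OF assms(3)]] by (simp add: chain_boundary_add)
  then show thesis
    using that[OF de(1,2) h(3) h(2)] by (simp add: chain_boundary_add)
qed

text \<open>Exactness of Mayer-Vietoris at the intersection: two fillings of \<open>z\<close> differ
  by a cycle of the union, and splitting a filling of that cycle corrects both to a common
  chain.\<close>

lemma bounds_Int:
  fixes U V :: "'a::topological_space set"
  assumes "open U" "open V" "bounds p U z" "bounds p V z" "acyc (Suc p) (U \<union> V)"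
  shows "bounds p (U \<inter> V) z"
proof -
  obtain u v where u: "singular_chain (Suc p) (top_of_set U) u" "chain_boundary (Suc p) u = z"
    and v: "singular_chain (Suc p) (top_of_set V) v" "chain_boundary (Suc p) v = z"
    using assms(3,4) by (auto simp: bounds_def)
  have "singular_chain (Suc p) (top_of_set (U \<union> V)) (u - v)"
    using u v by (meson Un_upper1 Un_upper2 singular_chain_diff singular_chain_top_of_set_mono)
  moreover have "chain_boundary (Suc p) (u - v) = 0"
    using u v by (simp add: chain_boundary_diff)
  ultimately obtain w where w: "singular_chain (Suc (Suc p)) (top_of_set (U \<union> V)) w"
      "chain_boundary (Suc (Suc p)) w = u - v"
    using assms(5) by (auto simp: acyc_def bounds_def)
  obtain d e h where de: "singular_chain (Suc (Suc p)) (top_of_set U) d" "singular_chain (Suc (Suc p)) (top_of_set V) e"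
    and h: "\<And>X c. singular_chain (Suc p) X c \<Longrightarrow> singular_chain (Suc (Suc p)) X (h c)"
    "\<And>c c'. h (c - c') = h c - h c'"
    and eq: "chain_boundary (Suc (Suc p)) d + chain_boundary (Suc (Suc p)) e
       = chain_boundary (Suc (Suc p)) w + chain_boundary (Suc (Suc p)) (h (chain_boundary (Suc (Suc p)) w))"
    using subdivision_filling[OF assms(1,2) w(1)] by blast
  \<comment> \<open>The subdivision of \<open>u\<close> would also contain the term
    \<open>h z\<close>. It is left out on purpose, so that the boundary of \<open>q\<close> is
    \<open>z\<close> itself and not its subdivision.\<close>
  define q where "q = u + chain_boundary (Suc (Suc p)) (h u) - chain_boundary (Suc (Suc p)) d"
  have q2: "q = v + chain_boundary (Suc (Suc p)) (h v) + chain_boundary (Suc (Suc p)) e"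
    using eq unfolding w(2) h(2) q_def chain_boundary_diff by (simp add: algebra_simps)
  have "singular_chain (Suc p) (top_of_set U) q"
    unfolding q_def using u de h(1)
    by (meson singular_chain_add singular_chain_boundary_alt singular_chain_diff)
  moreover have "singular_chain (Suc p) (top_of_set V) q"
    unfolding q2 using v de h(1)
    by (meson singular_chain_add singular_chain_boundary_alt singular_chain_diff)
  moreover have "chain_boundary (Suc p) q = z"
    unfolding q_def chain_boundary_diff chain_boundary_add u(2)
    using chain_boundary_boundary_Suc[OF h(1)[OF u(1)]] chain_boundary_boundary_Suc[OF de(1)] by simp
  ultimately show ?thesis
    by (blast intro: boundsI singular_chain_Int)
qed

lemma acyc_Int:
  fixes U V :: "'a::topological_space set"
  assumes "open U" "open V" "acyc p U" "acyc p V" "acyc (Suc p) (U \<union> V)"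
  shows "acyc p (U \<inter> V)"
  unfolding acyc_def
proof (intro allI impI)
  fix z assume "singular_chain p (top_of_set (U \<inter> V)) z" "chain_boundary p z = 0"
  then have "bounds p U z" "bounds p V z"
    using assms(3,4) unfolding acyc_def by (meson Int_lower1 Int_lower2 singular_chain_top_of_set_mono)+
  then show "bounds p (U \<inter> V) z"
    using assms bounds_Int by blast
qed

text \<open>Exactness of Mayer-Vietoris at the middle term; \<open>U\<close> will be a sphere
  complement and \<open>V\<close> an open neighbourhood of the sphere.\<close>

lemma acyc_excision:
  fixes U V :: "'a::topological_space set"
  assumes "open U" "open V" "acyc p (U \<inter> V)" "acyc p (U \<union> V)"
  shows "acyc p U"
  unfolding acyc_def
proof (intro allI impI)
  fix z assume z: "singular_chain p (top_of_set U) z" "chain_boundary p z = 0"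
  then obtain w where w: "singular_chain (Suc p) (top_of_set (U \<union> V)) w" "chain_boundary (Suc p) w = z"
    using assms(4) unfolding acyc_def bounds_def by (meson Un_upper1 singular_chain_top_of_set_mono)
  obtain d e h where de: "singular_chain (Suc p) (top_of_set U) d" "singular_chain (Suc p) (top_of_set V) e"
    and h: "\<And>X c. singular_chain p X c \<Longrightarrow> singular_chain (Suc p) X (h c)"
      "\<And>c c'. h (c - c') = h c - h c'"
    and eq: "chain_boundary (Suc p) d + chain_boundary (Suc p) e = z + chain_boundary (Suc p) (h z)"
    by (rule subdivision_filling[OF assms(1,2) w(1), unfolded w(2)]) (rule that)
  define q where "q = chain_boundary (Suc p) e"
  have q2: "q = z + chain_boundary (Suc p) (h z) - chain_boundary (Suc p) d"
    using eq by (simp add: q_def algebra_simps)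
  have bb: "chain_boundary p (chain_boundary (Suc p) c) = 0" if "singular_chain (Suc p) X c" for c and X :: "'a topology"
    using chain_boundary_boundary[OF that] by simp
  have "singular_chain p (top_of_set V) q"
    unfolding q_def using de singular_chain_boundary_alt by blast
  moreover have "singular_chain p (top_of_set U) q"
    unfolding q2 using de z h(1) by (meson singular_chain_add singular_chain_boundary_alt singular_chain_diff)
  moreover have "chain_boundary p q = 0"
    unfolding q_def using bb[OF de(2)] .
  ultimately obtain y where y: "singular_chain (Suc p) (top_of_set (U \<inter> V)) y" "chain_boundary (Suc p) y = q"
    using assms(3) unfolding acyc_def bounds_def by (meson singular_chain_Int)
  have "singular_chain (Suc p) (top_of_set U) (d + y - h z)"
    using de h(1)[OF z(1)] y by (meson Int_lower1 singular_chain_add singular_chain_diff singular_chain_top_of_set_mono)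
  moreover have "chain_boundary (Suc p) (d + y - h z) = z"
    using y q2 by (simp add: chain_boundary_diff chain_boundary_add algebra_simps)
  ultimately show "bounds p U z" by (rule boundsI)
qed

text \<open>Injectivity from the intersection into \<open>U\<close> is asked for instead of
  acyclicity of the intersection, so that degree 0 is covered: there the intersection is path
  connected or empty.\<close>

lemma acyc_Un:
  fixes U V :: "'a::topological_space set"
  assumes "open U" "open V" "acyc (Suc p) U" "acyc (Suc p) V"
    and inj: "\<And>y. singular_chain p (top_of_set (U \<inter> V)) y \<Longrightarrow> chain_boundary p y = 0 \<Longrightarrow> bounds p U y
         \<Longrightarrow> bounds p (U \<inter> V) y"
  shows "acyc (Suc p) (U \<union> V)"
  unfolding acyc_def
proof (intro allI impI)
  fix z assume z: "singular_chain (Suc p) (top_of_set (U \<union> V)) z" "chain_boundary (Suc p) z = 0"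
  obtain n d e where de: "singular_chain (Suc p) (top_of_set U) d" "singular_chain (Suc p) (top_of_set V) e"
    "(singular_subdivision (Suc p) ^^ n) z = d + e"
    by (rule subdivision_split[OF assms(1,2) z(1)]) (rule that)
  obtain h where h: "\<And>p. h p 0 = (0 :: 'a chain)"
        "\<And>p c1 c2. h p (c1-c2) = h p c1 - h p c2"
        "\<And>p X c. singular_chain p X c \<Longrightarrow> singular_chain (Suc p) X (h p c)"
        "\<And>p X c. singular_chain p X c
                 \<Longrightarrow> chain_boundary (Suc p) (h p c) + h (p - Suc 0) (chain_boundary p c)
                   = (singular_subdivision p ^^ n) c - c"
    by (rule chain_homotopic_iterated_singular_subdivision[where n=n]) (rule that)
  have zeq: "d + e = z + chain_boundary (Suc (Suc p)) (h (Suc p) z)"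
    using h(4)[OF z(1)] de(3) z(2) h(1) by (simp add: algebra_simps)
  have "chain_boundary (Suc p) d + chain_boundary (Suc p) e = 0"
    using zeq chain_boundary_boundary_Suc[OF h(3)[OF z(1)]] z(2)
    by (metis add.right_neutral chain_boundary_add)
  then have y2: "chain_boundary (Suc p) d = - chain_boundary (Suc p) e"
    by (simp add: eq_neg_iff_add_eq_0)
  let ?y = "chain_boundary (Suc p) d"
  have "singular_chain p (top_of_set (U \<inter> V)) ?y"
    using de singular_chain_boundary_alt y2 by (metis singular_chain_Int singular_chain_minus)
  moreover have "chain_boundary p ?y = 0"
    using chain_boundary_boundary[OF de(1)] by simp
  moreover have "bounds p U ?y" using de(1) by (auto intro: boundsI)
  ultimately obtain y where y: "singular_chain (Suc p) (top_of_set (U \<inter> V)) y" "chain_boundary (Suc p) y = ?y"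
    using inj unfolding bounds_def by blast
  have "bounds (Suc p) U (d - y)"
    using assms(3) y de unfolding acyc_def
    by (metis Int_lower1 chain_boundary_diff eq_iff_diff_eq_0 singular_chain_diff singular_chain_top_of_set_mono)
  moreover have "bounds (Suc p) V (e + y)"
    using assms(4) y de y2 unfolding acyc_def
    by (metis Int_lower2 chain_boundary_add add.right_inverse singular_chain_add singular_chain_top_of_set_mono)
  ultimately obtain \<alpha> \<beta> where ab: "singular_chain (Suc (Suc p)) (top_of_set U) \<alpha>" "chain_boundary (Suc (Suc p)) \<alpha> = d - y"
    "singular_chain (Suc (Suc p)) (top_of_set V) \<beta>" "chain_boundary (Suc (Suc p)) \<beta> = e + y"
    unfolding bounds_def by blast
  have "singular_chain (Suc (Suc p)) (top_of_set (U \<union> V)) (\<alpha> + \<beta> - h (Suc p) z)"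
    using ab h(3)[OF z(1)] by (meson Un_upper1 Un_upper2 singular_chain_add singular_chain_diff singular_chain_top_of_set_mono)
  moreover have "chain_boundary (Suc (Suc p)) (\<alpha> + \<beta> - h (Suc p) z) = z"
    using ab zeq by (simp add: chain_boundary_diff chain_boundary_add algebra_simps)
  ultimately show "bounds (Suc p) (U \<union> V) z" by (rule boundsI)
qed

lemma acyc_Un_acyc:
  fixes U V :: "'a::topological_space set"
  assumes "open U" "open V" "acyc (Suc p) U" "acyc (Suc p) V" "acyc p (U \<inter> V)"
  shows "acyc (Suc p) (U \<union> V)"
  using assms acyc_Un[of U V p] unfolding acyc_def by blast

text \<open>A 0-chain that bounds anywhere has augmentation zero, and in a path connected set the
  augmentation is the only invariant of a 0-chain.\<close>

lemma bounds_zero_path_connected: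
  fixes U W :: "'a::topological_space set"
  assumes pc: "path_connected U" and y: "singular_chain 0 (top_of_set U) y" and b: "bounds 0 W y"
  shows "bounds 0 U y"
proof (cases "y = 0")
  case True
  then show ?thesis by (auto intro!: boundsI[of 0 U 0])
next
  case False
  then obtain f where f: "singular_simplex 0 (top_of_set U) f"
    using y unfolding singular_chain_def by (metis keys_eq_empty ex_in_conv mem_Collect_eq subsetD)
  have pcs: "path_connected_space (top_of_set U)"
    using pc by simp
  \<comment> \<open>Each 0-chain is homologous to \<open>n\<close> copies of the simplex
    \<open>f\<close>, and extending the constant \<open>frag_of f\<close> additively reads off the
    same \<open>n\<close>. This is the augmentation.\<close>
  have hom: "\<exists>n. homologous_rel 0 (top_of_set U) {} d (frag_cmul n (frag_of f))
         \<and> frag_extend (\<lambda>x. frag_of f) d = frag_cmul n (frag_of f)"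
    if "singular_chain 0 (top_of_set U) d" for d
    using that unfolding singular_chain_def
  proof (induction d rule: frag_induction)
    case zero
    show ?case by (rule exI[of _ 0]) auto
  next
    case (one x)
    show ?case
      using iso_integer_zeroth_homology_group_aux[OF pcs _ f] one by (intro exI[of _ 1]) auto
  next
    case (diff a b)
    then obtain n m where "homologous_rel 0 (top_of_set U) {} a (frag_cmul n (frag_of f))"
        "frag_extend (\<lambda>x. frag_of f) a = frag_cmul n (frag_of f)"
        "homologous_rel 0 (top_of_set U) {} b (frag_cmul m (frag_of f))"
        "frag_extend (\<lambda>x. frag_of f) b = frag_cmul m (frag_of f)" by blast
    then show ?case
      by (intro exI[of _ "n-m"]) (auto simp: frag_cmul_diff_distrib frag_extend_diff intro: homologous_rel_diff)
  qed
  have "singular_chain (Suc 0) (top_of_set W) d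
          \<Longrightarrow> frag_extend (\<lambda>x. frag_of f) (chain_boundary (Suc 0) d) = 0" for d
      unfolding singular_chain_def
    proof (induction d rule: frag_induction)
      case (one x)
      then show ?case
        by (simp add: frag_extend_diff chain_boundary_of)
    next
      case (diff a b)
      then show ?case
        by (simp add: chain_boundary_diff frag_extend_diff)
    qed auto
  then have "frag_extend (\<lambda>x. frag_of f) y = 0" using b by (auto simp: bounds_def)
  with hom[OF y] have "homologous_rel 0 (top_of_set U) {} y 0"
    by auto
  then show ?thesis by (auto simp: homologous_rel_def singular_boundary bounds_def)
qed

lemma acyc_contractible:
  fixes U :: "'a::topological_space set"
  assumes "contractible U"
  shows "acyc (Suc p) U"
  unfolding acyc_def
proof (intro allI impI)
  fix z assume z: "singular_chain (Suc p) (top_of_set U) z" "chain_boundary (Suc p) z = 0"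
  obtain a where "homotopic_with_canon (\<lambda>x. True) U U id (\<lambda>x. a)"
    using assms by (auto simp: contractible_def)
  then have hom: "homotopic_with (\<lambda>h. h \<in> {} \<rightarrow> {}) (top_of_set U) (top_of_set U) id (\<lambda>x. a)"
    by (simp add: homotopic_with_mono)
  have cyc: "singular_relcycle (Suc p) (top_of_set U) {} z" using z by (simp add: singular_cycle)
  have h: "homologous_rel (Suc p) (top_of_set U) {} (chain_map (Suc p) id z) (chain_map (Suc p) (\<lambda>x. a) z)"
    using homotopic_imp_homologous_rel_chain_maps[OF hom cyc] .
  have idz: "chain_map (Suc p) id z = z"
    using chain_map_id_gen[OF z(1)] by simp
  have cm: "continuous_map (top_of_set U) (top_of_set {a}) (\<lambda>x. a)" by simp
  have "singular_relcycle (Suc p) (top_of_set {a}) {} (chain_map (Suc p) (\<lambda>x. a) z)"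
    using singular_relcycle_chain_map[OF cyc cm] by simp
  then have b: "singular_relboundary (Suc p) (top_of_set {a}) {} (chain_map (Suc p) (\<lambda>x. a) z)"
    by (subst singular_boundary_eq_cycle_singleton) auto
  show "bounds (Suc p) U z"
  proof (cases "U = {}")
    case True
    then have "z = 0" using z(1) by (simp add: singular_chain_empty)
    then show ?thesis by (auto intro!: boundsI[of _ _ 0])
  next
    case False
    have "continuous_map (top_of_set U) (top_of_set U) (\<lambda>x. a)"
      using hom homotopic_with_imp_continuous_maps by blast
    then have "(\<lambda>x. a) \<in> topspace (top_of_set U) \<rightarrow> topspace (top_of_set U)"
      by (simp only: continuous_map_def)
    then have "a \<in> U" using False by (simp add: Pi_iff) blast
    then have "singular_relboundary (Suc p) (top_of_set U) {} (chain_map (Suc p) (\<lambda>x. a) z)"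
      using singular_boundary_mono[OF _ b, of U] by auto
    then have "singular_relboundary (Suc p) (top_of_set U) {} z"
      using h idz unfolding homologous_rel_def by (metis diff_add_cancel singular_relboundary_add)
    then show ?thesis by (simp add: singular_boundary bounds_def)
  qed
qed

lemma bounds_image:
  assumes "continuous_on U f" "f ` U \<subseteq> V" "bounds p U z"
  shows "bounds p V (chain_map p f z)"
proof -
  obtain c where c: "singular_chain (Suc p) (top_of_set U) c" "chain_boundary (Suc p) c = z"
    using assms by (auto simp: bounds_def)
  have cm: "continuous_map (top_of_set U) (top_of_set V) f"
    using assms by auto
  show ?thesis
    using singular_chain_chain_map[OF c(1) cm] chain_boundary_chain_map[OF c(1), of f] c(2)
    by (intro boundsI) auto
qed

lemma acyc_homeomorphic:
  assumes "homeomorphism U V f g" "acyc p U"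
  shows "acyc p V"
  unfolding acyc_def
proof (intro allI impI)
  fix z assume z: "singular_chain p (top_of_set V) z" "chain_boundary p z = 0"
  have cg: "continuous_map (top_of_set V) (top_of_set U) g"
    using assms(1) by (auto simp: homeomorphism_def)
  have "singular_chain p (top_of_set U) (chain_map p g z)"
    using singular_chain_chain_map[OF z(1) cg] .
  moreover have "chain_boundary p (chain_map p g z) = 0"
    using chain_boundary_chain_map[OF z(1), of g] z(2) by simp
  ultimately have "bounds p U (chain_map p g z)" using assms(2) by (auto simp: acyc_def)
  then have "bounds p V (chain_map p f (chain_map p g z))"
    by (rule bounds_image[rotated 2]) (use assms(1) in \<open>auto simp: homeomorphism_def\<close>)
  moreover have "chain_map p f (chain_map p g z) = z"
    using chain_map_compose[of p f g] chain_map_id_gen[OF z(1), of "f \<circ> g"] assms(1)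
    by (auto simp: homeomorphism_def fun_eq_iff)
  ultimately show "bounds p V z" by simp
qed

section \<open>Cochains with real values\<close>

definition cochain_eval :: "('b \<Rightarrow> real) \<Rightarrow> ('b \<Rightarrow>\<^sub>0 int) \<Rightarrow> real" where
  "cochain_eval c z = (\<Sum>i\<in>Poly_Mapping.keys z. of_int (Poly_Mapping.lookup z i) * c i)"

lemma cochain_eval_superset:
  "finite A \<Longrightarrow> Poly_Mapping.keys z \<subseteq> A \<Longrightarrow>
    cochain_eval c z = (\<Sum>i\<in>A. of_int (Poly_Mapping.lookup z i) * c i)"
  unfolding cochain_eval_def by (rule sum.mono_neutral_left) (auto simp: in_keys_iff)

lemma cochain_eval_0 [simp]: "cochain_eval c 0 = 0"
  by (simp add: cochain_eval_def)

lemma cochain_eval_of [simp]: "cochain_eval c (frag_of x) = c x"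
  by (simp add: cochain_eval_def)

lemma cochain_eval_diff: "cochain_eval c (a - b) = cochain_eval c a - cochain_eval c b"
proof -
  let ?A = "Poly_Mapping.keys a \<union> Poly_Mapping.keys b"
  have "cochain_eval c (a - b) = (\<Sum>i\<in>?A. of_int (Poly_Mapping.lookup (a - b) i) * c i)"
    by (rule cochain_eval_superset) (auto simp: keys_diff)
  moreover have "cochain_eval c a = (\<Sum>i\<in>?A. of_int (Poly_Mapping.lookup a i) * c i)"
    "cochain_eval c b = (\<Sum>i\<in>?A. of_int (Poly_Mapping.lookup b i) * c i)"
    by (auto intro: cochain_eval_superset)
  ultimately show ?thesis
    by (simp add: lookup_minus algebra_simps sum_subtractf)
qed

lemma cochain_eval_minus: "cochain_eval c (- a) = - cochain_eval c a"
  using cochain_eval_diff[of c 0 a] by simp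

lemma cochain_eval_add: "cochain_eval c (a + b) = cochain_eval c a + cochain_eval c b"
  using cochain_eval_diff[of c a "-b"] by (simp add: cochain_eval_minus)

lemma cochain_eval_sum: "finite I \<Longrightarrow> cochain_eval c (sum g I) = (\<Sum>i\<in>I. cochain_eval c (g i))"
  by (induction I rule: finite_induct) (auto simp: cochain_eval_add)

lemma cochain_eval_cmul: "cochain_eval c (frag_cmul k a) = of_int k * cochain_eval c a"
  by (cases "k = 0") (auto simp: cochain_eval_def sum_distrib_left mult.assoc keys_cmul_iff
      intro!: sum.cong)

text \<open>The real numbers form a divisible group, so a homomorphism into them extends from any
  subgroup. Homomorphisms are represented by their graphs.\<close>

definition hom_graph :: "(('b \<Rightarrow>\<^sub>0 int) \<times> real) set \<Rightarrow> bool" where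
  "hom_graph G \<longleftrightarrow> (0,0) \<in> G \<and> (\<forall>x r y s. (x,r) \<in> G \<longrightarrow> (y,s) \<in> G \<longrightarrow> (x - y, r - s) \<in> G)
     \<and> (\<forall>r. (0,r) \<in> G \<longrightarrow> r = 0)"

lemma hom_graph_minus: "hom_graph G \<Longrightarrow> (x,r) \<in> G \<Longrightarrow> (-x,-r) \<in> G"
  unfolding hom_graph_def by (metis diff_0)

lemma hom_graph_add: "hom_graph G \<Longrightarrow> (x,r) \<in> G \<Longrightarrow> (y,s) \<in> G \<Longrightarrow> (x+y,r+s) \<in> G"
  using hom_graph_minus[of G y s] unfolding hom_graph_def by (metis diff_minus_eq_add)

lemma hom_graph_cmul:
  assumes "hom_graph G" "(x,r) \<in> G"
  shows "(frag_cmul k x, of_int k * r) \<in> G"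
proof -
  have nat: "(frag_cmul (int n) x, of_int (int n) * r) \<in> G" for n
  proof (induction n)
    case 0
    then show ?case using assms by (simp add: hom_graph_def)
  next
    case (Suc n)
    then show ?case
      using hom_graph_add[OF assms(1) Suc assms(2)] by (simp add: frag_cmul_distrib algebra_simps)
  qed
  show ?thesis
  proof (cases "k \<ge> 0")
    case True
    then show ?thesis using nat[of "nat k"] by simp
  next
    case False
    then show ?thesis using hom_graph_minus[OF assms(1) nat[of "nat (-k)"]] by simp
  qed
qed

lemma hom_graph_unique: "hom_graph G \<Longrightarrow> (x,r) \<in> G \<Longrightarrow> (x,s) \<in> G \<Longrightarrow> r = s"
  unfolding hom_graph_def by (metis cancel_comm_monoid_add_class.diff_cancel eq_iff_diff_eq_0)

lemma hom_graph_extend_one: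
  assumes G: "hom_graph G"
  obtains G' r where "hom_graph G'" "G \<subseteq> G'" "(x,r) \<in> G'"
proof -
  obtain r where r: "\<And>k s. (frag_cmul k x, s) \<in> G \<Longrightarrow> s = of_int k * r"
  proof (cases "\<exists>n s. n \<noteq> 0 \<and> (frag_cmul n x, s) \<in> G")
    case True
    then obtain n s where n: "n \<noteq> 0" "(frag_cmul n x, s) \<in> G" by blast
    \<comment> \<open>A value \<open>s\<close> already given to \<open>n\<close> times
      \<open>x\<close> forces \<open>s / n\<close> on \<open>x\<close>; this is the use of
      divisibility. Consistency follows by comparing two multiples of \<open>x\<close> at a common
      multiple.\<close>
    show thesis
    proof (rule that[of "s / of_int n"])
      fix k s' assume "(frag_cmul k x, s') \<in> G"
      then have "(frag_cmul n (frag_cmul k x), of_int n * s') \<in> G"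
        by (rule hom_graph_cmul[OF G])
      moreover have "(frag_cmul k (frag_cmul n x), of_int k * s) \<in> G"
        by (rule hom_graph_cmul[OF G n(2)])
      ultimately have "of_int n * s' = of_int k * s"
        using hom_graph_unique[OF G] by (simp add: mult.commute)
      then show "s' = of_int k * (s / of_int n)" using n(1) by (simp add: field_simps)
    qed
  next
    case False
    show thesis
    proof (rule that[of 0])
      fix k s' assume *: "(frag_cmul k x, s') \<in> G"
      then have "k = 0" using False by blast
      then show "s' = of_int k * 0" using * G by (simp add: hom_graph_def)
    qed
  qed
  define G' where "G' = {(h + frag_cmul k x, s + of_int k * r) | h k s. (h,s) \<in> G}"
  have "hom_graph G'"
    unfolding hom_graph_def
  proof (intro conjI allI impI)
    show "(0,0) \<in> G'" unfolding G'_def using G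
      by (auto simp: hom_graph_def intro!: exI[of _ 0])
    fix y s y' s' assume "(y,s) \<in> G'" "(y',s') \<in> G'"
    then obtain h k t h' k' t' where *: "y = h + frag_cmul k x" "s = t + of_int k * r" "(h,t) \<in> G"
      "y' = h' + frag_cmul k' x" "s' = t' + of_int k' * r" "(h',t') \<in> G"
      unfolding G'_def by blast
    then have "(h - h', t - t') \<in> G" using G unfolding hom_graph_def by blast
    then show "(y - y', s - s') \<in> G'"
      unfolding G'_def using * by (auto simp: frag_cmul_diff_distrib algebra_simps
          intro!: exI[of _ "h - h'"] exI[of _ "k - k'"] exI[of _ "t - t'"])
  next
    fix s assume "(0,s) \<in> G'"
    then obtain h k t where *: "0 = h + frag_cmul k x" "s = t + of_int k * r" "(h,t) \<in> G"
      unfolding G'_def by blast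
    then have "h = frag_cmul (-k) x" by (simp add: eq_neg_iff_add_eq_0 flip: minus_frag_cmul)
    then have "t = of_int (-k) * r" using r *(3) by blast
    then show "s = 0" using *(2) by simp
  qed
  moreover have "G \<subseteq> G'" unfolding G'_def by (force intro: exI[of _ 0])
  moreover have "(x, r) \<in> G'"
  proof -
    have "(0,0) \<in> G" using G by (simp add: hom_graph_def)
    then have "(0 + frag_cmul 1 x, 0 + of_int 1 * r) \<in> G'" unfolding G'_def by blast
    then show ?thesis by simp
  qed
  ultimately show thesis using that by blast
qed

lemma hom_graph_extend:
  assumes G: "hom_graph G"
  obtains F where "\<And>x y. F (x - y) = F x - F y" "\<And>x r. (x,r) \<in> G \<Longrightarrow> F x = (r::real)"
proof -
  let ?A = "{G'. hom_graph G' \<and> G \<subseteq> G'}"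
  have "\<exists>M\<in>?A. \<forall>X\<in>?A. M \<subseteq> X \<longrightarrow> X = M"
  proof (rule subset_Zorn_nonempty)
    show "?A \<noteq> {}" using G by auto
    fix C assume C: "C \<noteq> {}" "subset.chain ?A C"
    then have hg: "hom_graph X" "G \<subseteq> X" if "X \<in> C" for X
      using that unfolding subset.chain_def by auto
    have "hom_graph (\<Union>C)"
      unfolding hom_graph_def
    proof (intro conjI allI impI)
      show "(0,0) \<in> \<Union>C" using C hg(1) unfolding hom_graph_def by blast
      fix x r y s assume "(x,r) \<in> \<Union>C" "(y,s) \<in> \<Union>C"
      then obtain X Y where XY: "X \<in> C" "(x,r) \<in> X" "Y \<in> C" "(y,s) \<in> Y" by blast
      have "X \<subseteq> Y \<or> Y \<subseteq> X" using C(2) XY unfolding subset.chain_def by blast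
      then have "\<exists>Z\<in>C. (x,r) \<in> Z \<and> (y,s) \<in> Z" using XY by blast
      then show "(x - y, r - s) \<in> \<Union>C" using hg(1) unfolding hom_graph_def by blast
    next
      fix r assume "(0,r) \<in> \<Union>C"
      then show "r = 0" using hg(1) unfolding hom_graph_def by blast
    qed
    then show "\<Union>C \<in> ?A" using C hg(2) by blast
  qed
  then obtain M where M: "hom_graph M" "G \<subseteq> M" and max: "\<And>X. hom_graph X \<Longrightarrow> M \<subseteq> X \<Longrightarrow> X = M"
    by (smt (verit) dual_order.trans mem_Collect_eq)
  have total: "\<exists>r. (x,r) \<in> M" for x
    using hom_graph_extend_one[OF M(1), of x] max by metis
  define F where "F x = (SOME r. (x,r) \<in> M)" for x
  have F: "(x, F x) \<in> M" for x unfolding F_def using total by (rule someI_ex)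
  show thesis
  proof (rule that[of F])
    show "F (x - y) = F x - F y" for x y
      using F M(1) hom_graph_unique[OF M(1)] unfolding hom_graph_def by blast
    show "F x = r" if "(x,r) \<in> G" for x r
      using F M hom_graph_unique[OF M(1)] that by blast
  qed
qed

text \<open>Cochains are total functions and only their values on simplices of \<open>U\<close>
  matter, so restriction to a smaller set leaves the function unchanged.\<close>

definition cocycle :: "nat \<Rightarrow> 'a::topological_space set \<Rightarrow> (((nat \<Rightarrow> real) \<Rightarrow> 'a) \<Rightarrow> real) \<Rightarrow> bool" where
  "cocycle p U c \<longleftrightarrow> (\<forall>\<sigma>. singular_simplex (Suc p) (top_of_set U) \<sigma> \<longrightarrow>
     (\<Sum>k\<le>Suc p. (-1)^k * c (singular_face (Suc p) k \<sigma>)) = 0)"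

lemma cochain_eval_boundary:
  assumes "p > 0"
  shows "cochain_eval c (chain_boundary p (frag_of \<sigma>)) = (\<Sum>k\<le>p. (-1)^k * c (singular_face p k \<sigma>))"
  using assms by (simp add: chain_boundary_of cochain_eval_sum cochain_eval_cmul)

lemma cocycle_eval_boundary:
  assumes "cocycle p U c" "singular_chain (Suc p) (top_of_set U) w"
  shows "cochain_eval c (chain_boundary (Suc p) w) = 0"
  using assms(2) unfolding singular_chain_def
proof (induction w rule: frag_induction)
  case (one x)
  then show ?case
    using assms(1) by (subst cochain_eval_boundary) (auto simp: cocycle_def)
next
  case (diff a b)
  then show ?case by (simp add: chain_boundary_diff cochain_eval_diff)
qed auto

text \<open>Sending the boundary of \<open>z\<close> to \<open>c z\<close> is well defined, because
  two chains with the same boundary differ by a cycle, which bounds, and \<open>c\<close> vanishes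
  on boundaries. This homomorphism extends to all chains.\<close>

lemma cocycle_is_coboundary:
  assumes "p > 0" "acyc p U" "cocycle p U c"
  obtains e where "\<And>\<sigma>. singular_simplex p (top_of_set U) \<sigma> \<Longrightarrow>
     c \<sigma> = (\<Sum>k\<le>p. (-1)^k * e (singular_face p k \<sigma>))"
proof -
  define G where "G = {(chain_boundary p z, cochain_eval c z) | z. singular_chain p (top_of_set U) z}"
  have "hom_graph G"
    unfolding hom_graph_def
  proof (intro conjI allI impI)
    show "(0,0) \<in> G" unfolding G_def by (auto intro!: exI[of _ 0])
    fix x r y s assume "(x,r) \<in> G" "(y,s) \<in> G"
    then obtain z z' where "x = chain_boundary p z" "r = cochain_eval c z" "singular_chain p (top_of_set U) z"
      "y = chain_boundary p z'" "s = cochain_eval c z'" "singular_chain p (top_of_set U) z'"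
      unfolding G_def by blast
    then show "(x - y, r - s) \<in> G" unfolding G_def
      by (auto intro!: exI[of _ "z - z'"] simp: chain_boundary_diff cochain_eval_diff singular_chain_diff)
  next
    fix r assume "(0,r) \<in> G"
    then obtain z where z: "chain_boundary p z = 0" "r = cochain_eval c z" "singular_chain p (top_of_set U) z"
      unfolding G_def by auto
    then obtain w where "singular_chain (Suc p) (top_of_set U) w" "chain_boundary (Suc p) w = z"
      using assms(2) unfolding acyc_def bounds_def by blast
    then show "r = 0" using cocycle_eval_boundary[OF assms(3)] z(2) by blast
  qed
  then obtain F where F: "\<And>x y. F (x - y) = F x - F y" "\<And>x r. (x,r) \<in> G \<Longrightarrow> F x = (r::real)"
    using hom_graph_extend by blast
  have F0: "F 0 = 0" using F(1)[of 0 0] by simp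
  have Fc: "F z = cochain_eval (\<lambda>\<tau>. F (frag_of \<tau>)) z" for z
    using subset_UNIV
    by (induction z rule: frag_induction) (auto simp: F0 F(1) cochain_eval_diff)
  show thesis
  proof (rule that[of "\<lambda>\<tau>. F (frag_of \<tau>)"])
    fix \<sigma> assume "singular_simplex p (top_of_set U) \<sigma>"
    then have "(chain_boundary p (frag_of \<sigma>), c \<sigma>) \<in> G"
      unfolding G_def by (auto intro!: exI[of _ "frag_of \<sigma>"] simp: singular_chain_of)
    then have "F (chain_boundary p (frag_of \<sigma>)) = c \<sigma>" using F(2) by blast
    then show "c \<sigma> = (\<Sum>k\<le>p. (-1)^k * F (frag_of (singular_face p k \<sigma>)))"
      by (subst (asm) Fc) (simp add: cochain_eval_boundary[OF assms(1)])
  qed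
qed

text \<open>The hypothesis says that the class of \<open>z\<close> has infinite order, so mapping a
  boundary plus \<open>k\<close> times \<open>z\<close> to \<open>k\<close> is well defined; its
  extension to all chains is the cocycle.\<close>

lemma cocycle_detecting_cycle:
  assumes "p > 0" "\<And>k. bounds p U (frag_cmul k z) \<Longrightarrow> k = 0"
  obtains c where "cocycle p U c" "cochain_eval c z = 1"
proof -
  define G where "G = {(chain_boundary (Suc p) w + frag_cmul k z, of_int k :: real) | w k.
      singular_chain (Suc p) (top_of_set U) w}"
  have "hom_graph G"
    unfolding hom_graph_def
  proof (intro conjI allI impI)
    show "(0,0) \<in> G" unfolding G_def by (auto intro!: exI[of _ 0])
    fix x r y s assume "(x,r) \<in> G" "(y,s) \<in> G"
    then obtain w w' k k' where "x = chain_boundary (Suc p) w + frag_cmul k z" "r = of_int k"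
      "singular_chain (Suc p) (top_of_set U) w"
      "y = chain_boundary (Suc p) w' + frag_cmul k' z" "s = of_int k'"
      "singular_chain (Suc p) (top_of_set U) w'"
      unfolding G_def by blast
    then show "(x - y, r - s) \<in> G" unfolding G_def
      by (auto intro!: exI[of _ "w - w'"] exI[of _ "k - k'"]
          simp: chain_boundary_diff frag_cmul_diff_distrib singular_chain_diff)
  next
    fix r assume "(0,r) \<in> G"
    then obtain w k where w: "chain_boundary (Suc p) w + frag_cmul k z = 0" "r = of_int k"
        "singular_chain (Suc p) (top_of_set U) w"
      unfolding G_def by auto
    then have "chain_boundary (Suc p) (- w) = frag_cmul k z"
      by (simp add: chain_boundary_minus neg_eq_iff_add_eq_0)
    then have "bounds p U (frag_cmul k z)"
      using w(3) by (metis boundsI singular_chain_minus)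
    then show "r = 0" using assms(2) w(2) by simp
  qed
  then obtain F where F: "\<And>x y. F (x - y) = F x - F y" "\<And>x r. (x,r) \<in> G \<Longrightarrow> F x = (r::real)"
    using hom_graph_extend by blast
  have F0: "F 0 = 0" using F(1)[of 0 0] by simp
  have Fc: "F z = cochain_eval (\<lambda>\<tau>. F (frag_of \<tau>)) z" for z
    using subset_UNIV
    by (induction z rule: frag_induction) (auto simp: F0 F(1) cochain_eval_diff)
  show thesis
  proof (rule that[of "\<lambda>\<tau>. F (frag_of \<tau>)"])
    have "(z, 1) \<in> G" unfolding G_def by (auto intro!: exI[of _ 0] exI[of _ 1])
    then show "cochain_eval (\<lambda>\<tau>. F (frag_of \<tau>)) z = 1" using F(2) Fc by metis
    show "cocycle p U (\<lambda>\<tau>. F (frag_of \<tau>))"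
      unfolding cocycle_def
    proof (intro allI impI)
      fix \<sigma> assume "singular_simplex (Suc p) (top_of_set U) \<sigma>"
      then have "(chain_boundary (Suc p) (frag_of \<sigma>), 0) \<in> G"
        unfolding G_def by (auto intro!: exI[of _ "frag_of \<sigma>"] exI[of _ "0::int"] simp: singular_chain_of)
      then have "F (chain_boundary (Suc p) (frag_of \<sigma>)) = 0" using F(2) by blast
      then show "(\<Sum>k\<le>Suc p. (-1)^k * F (frag_of (singular_face (Suc p) k \<sigma>))) = 0"
        by (subst (asm) Fc) (simp only: cochain_eval_boundary[OF zero_less_Suc])
    qed
  qed
qed

section \<open>Flat systems of cochains\<close>

lemma singular_face_face:
  assumes "i \<le> j" "j \<le> p" "0 < p"
  shows "singular_face p i (singular_face (Suc p) (Suc j) f) = singular_face p j (singular_face (Suc p) i f)"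
proof -
  have eq: "simplical_face (Suc j) (simplical_face i x) = simplical_face i (simplical_face j x)"
    for x :: "nat \<Rightarrow> real"
    using assms by (auto simp: simplical_face_def fun_eq_iff)
  have "simplical_face m x \<in> standard_simplex p" if "m \<le> p" "x \<in> standard_simplex (p - Suc 0)" for m x
    using that assms simplical_face_in_standard_simplex[of p m x] by auto
  then show ?thesis
    using assms by (auto simp: singular_face_def restrict_def eq intro!: ext)
qed

text \<open>Over a 2-simplex this is the flatness equation for a strictly upper triangular matrix of
  1-cochains, where the entry \<open>(a, b)\<close> is only required to live off the sets with index in \<open>a..<b\<close>.\<close>

definition flat :: "(nat \<Rightarrow> 'a::topological_space set) \<Rightarrow> nat \<Rightarrow> nat
    \<Rightarrow> (nat \<Rightarrow> nat \<Rightarrow> ((nat \<Rightarrow> real) \<Rightarrow> 'a) \<Rightarrow> real) \<Rightarrow> bool" where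
  "flat U i k A \<longleftrightarrow> (\<forall>a b \<sigma>. i \<le> a \<longrightarrow> a < b \<longrightarrow> b \<le> k \<longrightarrow>
     singular_simplex 2 (top_of_set (\<Inter>l\<in>{a..<b}. U l)) \<sigma> \<longrightarrow>
     A a b (singular_face 2 1 \<sigma>) = A a b (singular_face 2 2 \<sigma>) + A a b (singular_face 2 0 \<sigma>)
       + (\<Sum>c\<in>{a<..<b}. A a c (singular_face 2 2 \<sigma>) * A c b (singular_face 2 0 \<sigma>)))"

lemma flat_subinterval: "flat U i k A \<Longrightarrow> i \<le> i' \<Longrightarrow> k' \<le> k \<Longrightarrow> flat U i' k' A"
  unfolding flat_def by (meson order_trans)

text \<open>The coboundary of a sum of cup products is a difference of triple products. Inserting
  the flatness equations of the shorter intervals, both sums run over the same triples by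
  associativity.\<close>

lemma massey_cocycle:
  fixes A :: "nat \<Rightarrow> nat \<Rightarrow> ((nat \<Rightarrow> real) \<Rightarrow> 'a::topological_space) \<Rightarrow> real"
  assumes "\<And>c. a < c \<Longrightarrow> c < b \<Longrightarrow> flat U a c A" "\<And>c. a < c \<Longrightarrow> c < b \<Longrightarrow> flat U c b A"
  shows "cocycle 2 (\<Inter>l\<in>{a..<b}. U l)
    (\<lambda>\<sigma>. \<Sum>c\<in>{a<..<b}. A a c (singular_face 2 2 \<sigma>) * A c b (singular_face 2 0 \<sigma>))"
  unfolding cocycle_def
proof (intro allI impI)
  fix \<sigma> assume s: "singular_simplex (Suc 2) (top_of_set (\<Inter>l\<in>{a..<b}. U l)) \<sigma>"
  \<comment> \<open>The numbers are the vertices of the tetrahedron: \<open>e01\<close> is the edge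
    from vertex 0 to vertex 1, and so on.\<close>
  define e01 e12 e23 e02 e13 where "e01 = singular_face 2 2 (singular_face (Suc 2) 3 \<sigma>)"
    and "e12 = singular_face 2 0 (singular_face (Suc 2) 3 \<sigma>)"
    and "e23 = singular_face 2 0 (singular_face (Suc 2) 0 \<sigma>)"
    and "e02 = singular_face 2 1 (singular_face (Suc 2) 3 \<sigma>)"
    and "e13 = singular_face 2 1 (singular_face (Suc 2) 0 \<sigma>)"
  have f: "singular_face 2 2 (singular_face (Suc 2) 0 \<sigma>) = e12"
      "singular_face 2 2 (singular_face (Suc 2) 1 \<sigma>) = e02"
      "singular_face 2 0 (singular_face (Suc 2) 1 \<sigma>) = e23"
      "singular_face 2 2 (singular_face (Suc 2) 2 \<sigma>) = e01"
      "singular_face 2 0 (singular_face (Suc 2) 2 \<sigma>) = e13"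
    using singular_face_face[of 0 2 2 \<sigma>] singular_face_face[of 1 2 2 \<sigma>] singular_face_face[of 0 0 2 \<sigma>]
      singular_face_face[of 2 2 2 \<sigma>] singular_face_face[of 0 1 2 \<sigma>]
    by (simp_all add: e01_def e12_def e23_def e02_def e13_def numeral_eq_Suc)
  have sub: "singular_simplex 2 (top_of_set (\<Inter>l\<in>{c..<d}. U l)) (singular_face (Suc 2) m \<sigma>)"
    if "a \<le> c" "d \<le> b" "m \<le> 3" for c d m
  proof -
    have "singular_simplex 2 (top_of_set (\<Inter>l\<in>{a..<b}. U l)) (singular_face (Suc 2) m \<sigma>)"
      using singular_simplex_singular_face[OF s, of m] that by simp
    moreover have "(\<Inter>l\<in>{a..<b}. U l) \<subseteq> (\<Inter>l\<in>{c..<d}. U l)"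
      using that by (intro INT_anti_mono) auto
    ultimately show ?thesis using singular_simplex_mono by blast
  qed
  have 1: "A a c e02 = A a c e01 + A a c e12 + (\<Sum>j\<in>{a<..<c}. A a j e01 * A j c e12)"
    if "c \<in> {a<..<b}" for c
    using assms(1)[of c] that sub[of a c 3] unfolding flat_def e02_def e01_def e12_def by auto
  have 2: "A c b e13 = A c b e12 + A c b e23 + (\<Sum>j\<in>{c<..<b}. A c j e12 * A j b e23)"
    if "c \<in> {a<..<b}" for c
    using assms(2)[of c] that sub[of c b 0] f(1) unfolding flat_def e13_def e23_def by auto
  have swap: "(\<Sum>c\<in>{a<..<b}. (\<Sum>j\<in>{a<..<c}. A a j e01 * A j c e12) * A c b e23)
     = (\<Sum>c\<in>{a<..<b}. A a c e01 * (\<Sum>j\<in>{c<..<b}. A c j e12 * A j b e23))"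
  proof -
    have "(\<Sum>c\<in>{a<..<b}. (\<Sum>j\<in>{a<..<c}. A a j e01 * A j c e12) * A c b e23)
      = (\<Sum>c\<in>{a<..<b}. \<Sum>j\<in>{j\<in>{a<..<b}. j < c}. A a j e01 * A j c e12 * A c b e23)"
      by (rule sum.cong) (auto simp: sum_distrib_right intro!: sum.cong)
    also have "\<dots> = (\<Sum>j\<in>{a<..<b}. \<Sum>c\<in>{c\<in>{a<..<b}. j < c}. A a j e01 * A j c e12 * A c b e23)"
      by (rule sum.swap_restrict) auto
    also have "\<dots> = (\<Sum>c\<in>{a<..<b}. A a c e01 * (\<Sum>j\<in>{c<..<b}. A c j e12 * A j b e23))"
      by (rule sum.cong) (auto simp: sum_distrib_left mult.assoc intro!: sum.cong)
    finally show ?thesis .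
  qed
  have "(\<Sum>c\<in>{a<..<b}. A a c e12 * A c b e23) - (\<Sum>c\<in>{a<..<b}. A a c e02 * A c b e23)
    + (\<Sum>c\<in>{a<..<b}. A a c e01 * A c b e13) - (\<Sum>c\<in>{a<..<b}. A a c e01 * A c b e12)
    = (\<Sum>c\<in>{a<..<b}. A a c e12 * A c b e23 - A a c e02 * A c b e23
        + A a c e01 * A c b e13 - A a c e01 * A c b e12)"
    by (simp add: sum_subtractf sum.distrib)
  also have "\<dots> = (\<Sum>c\<in>{a<..<b}. A a c e01 * (\<Sum>j\<in>{c<..<b}. A c j e12 * A j b e23)
      - (\<Sum>j\<in>{a<..<c}. A a j e01 * A j c e12) * A c b e23)"
    by (rule sum.cong) (auto simp: 1 2 algebra_simps)
  also have "\<dots> = 0" by (simp add: sum_subtractf swap)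
  finally have z: "(\<Sum>c\<in>{a<..<b}. A a c e12 * A c b e23) - (\<Sum>c\<in>{a<..<b}. A a c e02 * A c b e23)
    + (\<Sum>c\<in>{a<..<b}. A a c e01 * A c b e13) - (\<Sum>c\<in>{a<..<b}. A a c e01 * A c b e12) = 0" .
  define T where "T k = (\<Sum>c\<in>{a<..<b}. A a c (singular_face 2 2 (singular_face (Suc 2) k \<sigma>))
        * A c b (singular_face 2 0 (singular_face (Suc 2) k \<sigma>)))" for k
  have "T 0 - T 1 + T 2 - T 3 = 0"
    unfolding T_def f using z by (simp only: e01_def e12_def e23_def)
  then have "(\<Sum>k\<le>Suc 2. (-1)^k * T k) = 0"
    by (simp add: numeral_eq_Suc)
  then show "(\<Sum>k\<le>Suc 2. (-1)^k * (\<Sum>c\<in>{a<..<b}. A a c (singular_face 2 2 (singular_face (Suc 2) k \<sigma>))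
        * A c b (singular_face 2 0 (singular_face (Suc 2) k \<sigma>)))) = 0"
    by (simp only: T_def)
qed

text \<open>The removed sets are pairwise disjoint, so each further complement together with the
  intersection so far covers the whole contractible space, and Mayer-Vietoris passes vanishing to
  the intersection.\<close>

lemma acyc_2_Inter:
  fixes U :: "nat \<Rightarrow> 'a::real_normed_vector set"
  assumes "\<And>l. a \<le> l \<Longrightarrow> l < b \<Longrightarrow> open (U l) \<and> acyc 2 (U l)"
    and "\<And>l l'. a \<le> l \<Longrightarrow> l < l' \<Longrightarrow> l' < b \<Longrightarrow> U l \<union> U l' = UNIV"
  shows "acyc 2 (\<Inter>l\<in>{a..<b}. U l)"
  using assms
proof (induction b)
  case 0
  have "acyc (Suc 1) (UNIV :: 'a set)" by (rule acyc_contractible) (simp add: convex_imp_contractible)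
  then show ?case by (simp add: numeral_2_eq_2)
next
  case (Suc b)
  show ?case
  proof (cases "a \<le> b")
    case False
    have "acyc (Suc 1) (UNIV :: 'a set)" by (rule acyc_contractible) (simp add: convex_imp_contractible)
    then show ?thesis using False by (simp add: numeral_2_eq_2)
  next
    case True
    let ?W = "\<Inter>l\<in>{a..<b}. U l"
    have W: "acyc 2 ?W" using Suc by auto
    have oW: "open ?W" using Suc.prems(1) by (intro open_INT) auto
    have "U b \<union> ?W = UNIV"
    proof -
      have "x \<in> U b \<or> x \<in> U l" if "l \<in> {a..<b}" for x l
        using Suc.prems(2)[of l b] that by auto
      then show ?thesis by blast
    qed
    moreover have "acyc (Suc 2) (UNIV :: 'a set)" by (rule acyc_contractible) (simp add: convex_imp_contractible)
    ultimately have "acyc 2 (U b \<inter> ?W)"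
      using W oW Suc.prems(1)[of b] True by (intro acyc_Int) auto
    moreover have "(\<Inter>l\<in>{a..<Suc b}. U l) = U b \<inter> ?W"
      using True by (auto simp: atLeastLessThanSuc)
    ultimately show ?thesis by simp
  qed
qed

text \<open>A defining system for the Massey product of the classes dual to the removed sets: its
  obstructions vanish because the complements have no second homology.\<close>

theorem flat_system_exists:
  fixes U :: "nat \<Rightarrow> 'a::real_normed_vector set"
  assumes U: "\<And>l. l < L \<Longrightarrow> open (U l) \<and> acyc 2 (U l)"
    and cov: "\<And>l l'. l < l' \<Longrightarrow> l' < L \<Longrightarrow> U l \<union> U l' = UNIV"
    and \<alpha>: "\<And>l. l < L \<Longrightarrow> cocycle 1 (U l) (\<alpha> l)"
  obtains A where "\<And>l. l < L \<Longrightarrow> A l (Suc l) = \<alpha> l" "flat U 0 L A"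
proof -
  \<comment> \<open>Induction on the distance \<open>n\<close> from the diagonal: all entries at
    distance \<open>Suc n\<close> are solved for at once from those nearer to the diagonal.\<close>
  have "\<exists>A. (\<forall>l<L. A l (Suc l) = \<alpha> l) \<and> (\<forall>a b. a < b \<longrightarrow> b \<le> L \<longrightarrow> b - a \<le> n \<longrightarrow> flat U a b A)" for n
  proof (induction n)
    case 0
    show ?case by (intro exI[of _ "\<lambda>a b. \<alpha> a"]) auto
  next
    case (Suc n)
    then obtain A where A: "\<And>l. l < L \<Longrightarrow> A l (Suc l) = \<alpha> l"
        "\<And>a b. a < b \<Longrightarrow> b \<le> L \<Longrightarrow> b - a \<le> n \<Longrightarrow> flat U a b A" by blast
    have "\<exists>f. \<forall>\<sigma>. singular_simplex 2 (top_of_set (\<Inter>l\<in>{a..<b}. U l)) \<sigma> \<longrightarrow>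
       f (singular_face 2 1 \<sigma>) = f (singular_face 2 2 \<sigma>) + f (singular_face 2 0 \<sigma>)
       + (\<Sum>c\<in>{a<..<b}. A a c (singular_face 2 2 \<sigma>) * A c b (singular_face 2 0 \<sigma>))"
      if ab: "a < b" "b \<le> L" "b - a = Suc n" for a b
    proof -
      let ?c = "\<lambda>\<sigma>. \<Sum>c\<in>{a<..<b}. A a c (singular_face 2 2 \<sigma>) * A c b (singular_face 2 0 \<sigma>)"
      have coc: "cocycle 2 (\<Inter>l\<in>{a..<b}. U l) ?c"
        using ab by (intro massey_cocycle A(2)) auto
      have ac: "acyc 2 (\<Inter>l\<in>{a..<b}. U l)"
        using U cov ab by (intro acyc_2_Inter) auto
      obtain e where e: "\<And>\<sigma>. singular_simplex 2 (top_of_set (\<Inter>l\<in>{a..<b}. U l)) \<sigma> \<Longrightarrow>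
         ?c \<sigma> = (\<Sum>k\<le>2. (-1)^k * e (singular_face 2 k \<sigma>))"
        by (rule cocycle_is_coboundary[OF _ ac coc]) (simp, rule that)
      show ?thesis
      \<comment> \<open>Flatness equates the sum of products with minus the coboundary of the entry,
        hence the sign.\<close>
      proof (intro exI[of _ "\<lambda>\<tau>. - e \<tau>"] allI impI)
        fix \<sigma> assume "singular_simplex 2 (top_of_set (\<Inter>l\<in>{a..<b}. U l)) \<sigma>"
        then show "- e (singular_face 2 1 \<sigma>) = - e (singular_face 2 2 \<sigma>) + - e (singular_face 2 0 \<sigma>) + ?c \<sigma>"
          using e[of \<sigma>] by (simp add: numeral_2_eq_2)
      qed
    qed
    note ex = this
    define f where "f a b = (SOME f. \<forall>\<sigma>. singular_simplex 2 (top_of_set (\<Inter>l\<in>{a..<b}. U l)) \<sigma> \<longrightarrow>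
       f (singular_face 2 1 \<sigma>) = f (singular_face 2 2 \<sigma>) + f (singular_face 2 0 \<sigma>)
       + (\<Sum>c\<in>{a<..<b}. A a c (singular_face 2 2 \<sigma>) * A c b (singular_face 2 0 \<sigma>)))" for a b
    have f: "\<And>a b \<sigma>. a < b \<Longrightarrow> b \<le> L \<Longrightarrow> b - a = Suc n \<Longrightarrow>
       singular_simplex 2 (top_of_set (\<Inter>l\<in>{a..<b}. U l)) \<sigma> \<Longrightarrow>
       f a b (singular_face 2 1 \<sigma>) = f a b (singular_face 2 2 \<sigma>) + f a b (singular_face 2 0 \<sigma>)
       + (\<Sum>c\<in>{a<..<b}. A a c (singular_face 2 2 \<sigma>) * A c b (singular_face 2 0 \<sigma>))"
      unfolding f_def by (rule someI_ex[OF ex, rule_format])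
    \<comment> \<open>The superdiagonal must remain the prescribed cocycles, so that case comes
      first; for \<open>n = 0\<close> the choice \<open>f\<close> would be some arbitrary
      cocycle.\<close>
    define B where "B a b = (if b = Suc a then \<alpha> a else if b - a = Suc n then f a b else A a b)" for a b
    have BA: "B a b = A a b" if "b - a \<le> n" "a < b" "b \<le> L" for a b
      using that A(1) by (auto simp: B_def)
    have "flat U a b B" if ab: "a < b" "b \<le> L" "b - a \<le> Suc n" for a b
      unfolding flat_def
    proof (intro allI impI)
      fix a' b' \<sigma> assume *: "a \<le> a'" "a' < b'" "b' \<le> b"
        and s: "singular_simplex 2 (top_of_set (\<Inter>l\<in>{a'..<b'}. U l)) \<sigma>"
      have sum: "(\<Sum>c\<in>{a'<..<b'}. B a' c (singular_face 2 2 \<sigma>) * B c b' (singular_face 2 0 \<sigma>))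
         = (\<Sum>c\<in>{a'<..<b'}. A a' c (singular_face 2 2 \<sigma>) * A c b' (singular_face 2 0 \<sigma>))"
      proof (rule sum.cong)
        fix c assume "c \<in> {a'<..<b'}"
        then have "B a' c = A a' c" "B c b' = A c b'" using * ab by (auto intro!: BA)
        then show "B a' c (singular_face 2 2 \<sigma>) * B c b' (singular_face 2 0 \<sigma>)
            = A a' c (singular_face 2 2 \<sigma>) * A c b' (singular_face 2 0 \<sigma>)" by simp
      qed simp
      consider "b' = Suc a'" | "b' - a' = Suc n" "b' \<noteq> Suc a'" | "b' - a' \<le> n" "b' \<noteq> Suc a'"
        using * ab by linarith
      then show "B a' b' (singular_face 2 1 \<sigma>) = B a' b' (singular_face 2 2 \<sigma>) + B a' b' (singular_face 2 0 \<sigma>)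
         + (\<Sum>c\<in>{a'<..<b'}. B a' c (singular_face 2 2 \<sigma>) * B c b' (singular_face 2 0 \<sigma>))"
      proof cases
        case 1
        then have "cocycle 1 (U a') (\<alpha> a')" using \<alpha>[of a'] * ab by simp
        then have "(\<Sum>k\<le>Suc 1. (-1)^k * \<alpha> a' (singular_face (Suc 1) k \<sigma>)) = 0"
          using s 1 unfolding cocycle_def by (simp add: numeral_2_eq_2)
        moreover have "{a'<..<b'} = {}" using 1 by auto
        ultimately show ?thesis using 1 by (simp add: B_def numeral_2_eq_2)
      next
        case 2
        then show ?thesis unfolding sum using f[OF *(2) _ 2(1) s] * ab by (simp add: B_def)
      next
        case 3
        then have "flat U a' b' A" using * ab by (intro A(2)) auto
        then show ?thesis unfolding sum using 3 BA[of b' a'] * ab s by (simp add: flat_def)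
      qed
    qed
    moreover have "\<forall>l<L. B l (Suc l) = \<alpha> l" by (simp add: B_def)
    ultimately show ?case by blast
  qed
  from this[of L] obtain A where A: "\<forall>l<L. A l (Suc l) = \<alpha> l"
     "\<And>a b. a < b \<Longrightarrow> b \<le> L \<Longrightarrow> b - a \<le> L \<Longrightarrow> flat U a b A" by blast
  have "flat U 0 L A"
  proof (cases "L = 0")
    case True
    then show ?thesis by (simp add: flat_def)
  qed (use A(2)[of 0 L] in auto)
  then show thesis using that A(1) by blast
qed

section \<open>Unipotent holonomy\<close>

text \<open>Rows and columns are indexed by all natural numbers. Triangularity makes every product
  entry a finite sum, so a single ring serves trees with any number of leaves and any of their
  blocks.\<close>

typedef utri = "{A :: nat \<Rightarrow> nat \<Rightarrow> real. \<forall>a b. b < a \<longrightarrow> A a b = 0}"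
  morphisms entry Abs_utri
  by (rule exI[of _ "\<lambda>_ _. 0"]) auto

setup_lifting type_definition_utri

lemma entry_below: "b < a \<Longrightarrow> entry A a b = 0"
  using entry[of A] by auto

lemma utri_eqI: "(\<And>a b. a \<le> b \<Longrightarrow> entry A a b = entry B a b) \<Longrightarrow> A = B"
  by (metis entry_below entry_inject ext not_less)

instantiation utri :: ring_1
begin
lift_definition zero_utri :: utri is "\<lambda>_ _. 0" by simp
lift_definition one_utri :: utri is "\<lambda>a b. if a = b then 1 else 0" by simp
lift_definition plus_utri :: "utri \<Rightarrow> utri \<Rightarrow> utri" is "\<lambda>A B a b. A a b + B a b" by simp
lift_definition minus_utri :: "utri \<Rightarrow> utri \<Rightarrow> utri" is "\<lambda>A B a b. A a b - B a b" by simp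
lift_definition uminus_utri :: "utri \<Rightarrow> utri" is "\<lambda>A a b. - A a b" by simp
lift_definition times_utri :: "utri \<Rightarrow> utri \<Rightarrow> utri" is "\<lambda>A B a b. \<Sum>k\<in>{a..b}. A a k * B k b" by simp

instance
proof
  fix A B C :: utri
  show "A * B * C = A * (B * C)"
  proof (rule utri_eqI)
    fix a b :: nat
    have l: "(\<Sum>j\<in>{a..k}. entry A a j * entry B j k) = (\<Sum>j\<in>{a..b}. entry A a j * entry B j k)" if "k \<in> {a..b}" for k
      using that by (intro sum.mono_neutral_left) (auto simp: entry_below)
    have r: "(\<Sum>k\<in>{j..b}. entry B j k * entry C k b) = (\<Sum>k\<in>{a..b}. entry B j k * entry C k b)" if "j \<in> {a..b}" for j
      using that by (intro sum.mono_neutral_left) (auto simp: entry_below)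
    have "entry (A * B * C) a b = (\<Sum>k\<in>{a..b}. \<Sum>j\<in>{a..b}. entry A a j * entry B j k * entry C k b)"
      unfolding times_utri.rep_eq sum_distrib_right[symmetric] by (rule sum.cong) (auto simp: l)
    also have "\<dots> = (\<Sum>j\<in>{a..b}. \<Sum>k\<in>{a..b}. entry A a j * entry B j k * entry C k b)"
      by (rule sum.swap)
    also have "\<dots> = entry (A * (B * C)) a b"
      unfolding times_utri.rep_eq mult.assoc sum_distrib_left[symmetric] by (rule sum.cong) (auto simp: r)
    finally show "entry (A * B * C) a b = entry (A * (B * C)) a b" .
  qed
  have d: "(\<Sum>k\<in>{a..b}. (if a = k then 1 else 0) * f k) = (if a \<le> b then f a else (0::real))" for f :: "nat \<Rightarrow> real" and a b
    by (subst sum.cong[OF refl, of _ _ "\<lambda>k. if a = k then f a else 0"]) (auto simp: sum.delta)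
  have d': "(\<Sum>k\<in>{a..b}. f k * (if k = b then 1 else 0)) = (if a \<le> b then f b else (0::real))" for f :: "nat \<Rightarrow> real" and a b
    by (subst sum.cong[OF refl, of _ _ "\<lambda>k. if k = b then f b else 0"]) (auto simp: sum.delta)
  show "1 * A = A"
    by (rule utri_eqI) (simp add: times_utri.rep_eq one_utri.rep_eq d)
  show "A * 1 = A"
    by (rule utri_eqI) (simp add: times_utri.rep_eq one_utri.rep_eq d')
  show "(A + B) * C = A * C + B * C"
    by (rule utri_eqI) (simp add: times_utri.rep_eq plus_utri.rep_eq algebra_simps sum.distrib)
  show "A * (B + C) = A * B + A * C"
    by (rule utri_eqI) (simp add: times_utri.rep_eq plus_utri.rep_eq algebra_simps sum.distrib)
  have "entry (0::utri) 0 0 \<noteq> entry 1 0 0" by (simp add: zero_utri.rep_eq one_utri.rep_eq)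
  then show "(0::utri) \<noteq> 1" by metis
qed (rule utri_eqI; simp add: plus_utri.rep_eq minus_utri.rep_eq uminus_utri.rep_eq zero_utri.rep_eq)+
end

definition unipotent :: "utri \<Rightarrow> bool" where
  "unipotent A \<longleftrightarrow> (\<forall>a. entry A a a = 1)"

lemma entry_times_strict:
  assumes "a < b"
  shows "entry (A * B) a b = entry A a a * entry B a b + entry A a b * entry B b b
     + (\<Sum>c\<in>{a<..<b}. entry A a c * entry B c b)"
proof -
  have "{a..b} = insert a (insert b {a<..<b})" using assms by auto
  then show ?thesis using assms by (simp add: times_utri.rep_eq)
qed

lemma entry_times_diag: "entry (A * B) a a = entry A a a * entry B a a"
  by (simp add: times_utri.rep_eq)

lemma unipotent_mult: "unipotent A \<Longrightarrow> unipotent B \<Longrightarrow> unipotent (A * B)"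
  by (simp add: unipotent_def entry_times_diag)

text \<open>An off-diagonal entry satisfies \<open>x = 2 * x\<close> plus products of entries closer
  to the diagonal, which vanish by induction.\<close>

lemma unipotent_idempotent:
  assumes "unipotent A" "A * A = A"
  shows "A = 1"
proof (rule utri_eqI)
  have "entry A a b = 0" if "a < b" for a b
    using that
  proof (induction "b - a" arbitrary: a b rule: less_induct)
    case less
    have "entry (A * A) a b = 2 * entry A a b + (\<Sum>c\<in>{a<..<b}. entry A a c * entry A c b)"
      using less.prems assms(1) by (simp add: entry_times_strict unipotent_def)
    moreover have "(\<Sum>c\<in>{a<..<b}. entry A a c * entry A c b) = 0"
      using less by (intro sum.neutral) auto
    ultimately show ?case using assms(2) by simp
  qed
  then show "entry A a b = entry 1 a b" if "a \<le> b" for a b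
    using assms(1) that by (auto simp: one_utri.rep_eq unipotent_def order_le_less)
qed

text \<open>Matrix indices run over \<open>i..k\<close> inclusive, one more than the leaves
  \<open>i..<k\<close>: the entry \<open>(l, Suc l)\<close> belongs to the leaf \<open>l\<close>.
  Outside this block the matrix is the identity.\<close>

definition hol_simplex :: "(nat \<Rightarrow> nat \<Rightarrow> ((nat \<Rightarrow> real) \<Rightarrow> 'a) \<Rightarrow> real) \<Rightarrow> nat \<Rightarrow> nat \<Rightarrow> ((nat \<Rightarrow> real) \<Rightarrow> 'a) \<Rightarrow> utri" where
  "hol_simplex A i k \<tau> = Abs_utri (\<lambda>a b. if a = b then 1 else if i \<le> a \<and> a < b \<and> b \<le> k then A a b \<tau> else 0)"

lemma entry_hol_simplex:
  "entry (hol_simplex A i k \<tau>) a b = (if a = b then 1 else if i \<le> a \<and> a < b \<and> b \<le> k then A a b \<tau> else 0)"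
  unfolding hol_simplex_def by (subst Abs_utri_inverse) auto

lemma unipotent_hol_simplex [simp]: "unipotent (hol_simplex A i k \<tau>)"
  by (simp add: unipotent_def entry_hol_simplex)

lemma hol_simplex_mult:
  assumes "flat U i k A" and s: "singular_simplex 2 (top_of_set (\<Inter>l\<in>{i..<k}. U l)) \<sigma>"
  shows "hol_simplex A i k (singular_face 2 1 \<sigma>)
    = hol_simplex A i k (singular_face 2 2 \<sigma>) * hol_simplex A i k (singular_face 2 0 \<sigma>)"
proof (rule utri_eqI)
  fix a b :: nat assume "a \<le> b"
  show "entry (hol_simplex A i k (singular_face 2 1 \<sigma>)) a b
    = entry (hol_simplex A i k (singular_face 2 2 \<sigma>) * hol_simplex A i k (singular_face 2 0 \<sigma>)) a b"
  proof (cases "a = b")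
    case True
    then show ?thesis by (simp add: entry_times_diag entry_hol_simplex)
  next
    case False
    then have ab: "a < b" using \<open>a \<le> b\<close> by simp
    show ?thesis
    proof (cases "i \<le> a \<and> b \<le> k")
      case True
      have "(\<Inter>l\<in>{i..<k}. U l) \<subseteq> (\<Inter>l\<in>{a..<b}. U l)"
        using True by (intro INT_anti_mono) auto
      then have "singular_simplex 2 (top_of_set (\<Inter>l\<in>{a..<b}. U l)) \<sigma>"
        using s singular_simplex_mono by blast
      then have "A a b (singular_face 2 1 \<sigma>) = A a b (singular_face 2 2 \<sigma>) + A a b (singular_face 2 0 \<sigma>)
       + (\<Sum>c\<in>{a<..<b}. A a c (singular_face 2 2 \<sigma>) * A c b (singular_face 2 0 \<sigma>))"
        using assms(1) True ab unfolding flat_def by blast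
      moreover have "(\<Sum>c\<in>{a<..<b}. A a c (singular_face 2 2 \<sigma>) * A c b (singular_face 2 0 \<sigma>))
        = (\<Sum>c\<in>{a<..<b}. entry (hol_simplex A i k (singular_face 2 2 \<sigma>)) a c
             * entry (hol_simplex A i k (singular_face 2 0 \<sigma>)) c b)"
        using True by (intro sum.cong) (auto simp: entry_hol_simplex)
      ultimately show ?thesis
        unfolding entry_times_strict[OF ab] using True ab by (simp add: entry_hol_simplex[of _ _ _ _ a b] entry_hol_simplex[of _ _ _ _ a a] entry_hol_simplex[of _ _ _ _ b b])
    next
      case False
      have "entry (hol_simplex A i k (singular_face 2 2 \<sigma>)) a c
             * entry (hol_simplex A i k (singular_face 2 0 \<sigma>)) c b = 0" if "c \<in> {a<..<b}" for c
        using False that by (simp add: entry_hol_simplex)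
      then have "(\<Sum>c\<in>{a<..<b}. entry (hol_simplex A i k (singular_face 2 2 \<sigma>)) a c
             * entry (hol_simplex A i k (singular_face 2 0 \<sigma>)) c b) = 0"
        by (intro sum.neutral) blast
      moreover have "entry (hol_simplex A i k \<tau>) a b = 0" for \<tau>
        using False ab by (auto simp: entry_hol_simplex)
      ultimately show ?thesis
        unfolding entry_times_strict[OF ab] by simp
    qed
  qed
qed

section \<open>Parallel transport along edges and polygons\<close>

definition edge :: "('b::real_vector \<Rightarrow> 'a) \<Rightarrow> 'b \<Rightarrow> 'b \<Rightarrow> (nat \<Rightarrow> real) \<Rightarrow> 'a" where
  "edge G P Q = (\<lambda>x\<in>standard_simplex 1. G (x 0 *\<^sub>R P + x 1 *\<^sub>R Q))"

lemma edge_cong: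
  assumes "\<And>s. 0 \<le> s \<Longrightarrow> s \<le> 1 \<Longrightarrow> G ((1 - s) *\<^sub>R P + s *\<^sub>R Q) = G' ((1 - s) *\<^sub>R P' + s *\<^sub>R Q')"
  shows "edge G P Q = edge G' P' Q'"
proof -
  have "G (x 0 *\<^sub>R P + x 1 *\<^sub>R Q) = G' (x 0 *\<^sub>R P' + x 1 *\<^sub>R Q')" if "x \<in> standard_simplex 1" for x
  proof -
    have "x 0 = 1 - x 1" "0 \<le> x 1" "x 1 \<le> 1"
      using that by (auto simp: standard_simplex_def)
    then show ?thesis using assms[of "x 1"] by simp
  qed
  then show ?thesis unfolding edge_def by (auto simp: restrict_def)
qed

lemma singular_simplex_affine:
  fixes G :: "'b::real_normed_vector \<Rightarrow> 'a::topological_space"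
  assumes "continuous_on (convex hull {P,Q,R}) G" "G ` (convex hull {P,Q,R}) \<subseteq> W"
  shows "singular_simplex 2 (top_of_set W) (\<lambda>x\<in>standard_simplex 2. G (x 0 *\<^sub>R P + x 1 *\<^sub>R Q + x 2 *\<^sub>R R))"
proof -
  let ?f = "\<lambda>x::nat\<Rightarrow>real. x 0 *\<^sub>R P + x 1 *\<^sub>R Q + x 2 *\<^sub>R R"
  have "continuous_on (standard_simplex 2) ?f"
    by (intro continuous_intros continuous_on_product_coordinates[THEN continuous_on_subset]) auto
  moreover have "?f ` standard_simplex 2 \<subseteq> convex hull {P,Q,R}"
  proof clarify
    fix x :: "nat \<Rightarrow> real" assume "x \<in> standard_simplex 2"
    then have "0 \<le> x 0" "0 \<le> x 1" "0 \<le> x 2" "x 0 + x 1 + x 2 = 1"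
      by (auto simp: standard_simplex_def numeral_2_eq_2)
    then show "?f x \<in> convex hull {P,Q,R}"
      unfolding convex_hull_3 by blast
  qed
  ultimately have "continuous_on (standard_simplex 2) (\<lambda>x. G (?f x))"
    using assms(1) continuous_on_compose2 by blast
  moreover have "(\<lambda>x. G (?f x)) ` standard_simplex 2 \<subseteq> W"
    using assms(2) \<open>?f ` standard_simplex 2 \<subseteq> convex hull {P,Q,R}\<close> by blast
  ultimately have "continuous_map (top_of_set (standard_simplex 2)) (top_of_set W) (\<lambda>x. G (?f x))"
    by (auto simp: continuous_map_in_subtopology)
  then have "continuous_map (top_of_set (standard_simplex 2)) (top_of_set W)
      (\<lambda>x\<in>standard_simplex 2. G (?f x))"
    by (rule continuous_map_eq) auto
  then show ?thesis
    by (simp add: singular_simplex_def euclidean_product_topology)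
qed

lemma affine_simplex_faces:
  fixes G :: "'b::real_normed_vector \<Rightarrow> 'a::topological_space" and P Q R :: 'b
  defines "\<sigma> \<equiv> \<lambda>x\<in>standard_simplex 2. G (x 0 *\<^sub>R P + x 1 *\<^sub>R Q + x 2 *\<^sub>R R)"
  shows "singular_face 2 0 \<sigma> = edge G Q R" "singular_face 2 1 \<sigma> = edge G P R" "singular_face 2 2 \<sigma> = edge G P Q"
proof -
  have in2: "simplical_face k x \<in> standard_simplex 2" if "k \<le> 2" "x \<in> standard_simplex 1" for k x
    using simplical_face_in_standard_simplex[of 2 k x] that by simp
  have "singular_face 2 k \<sigma> = (\<lambda>x\<in>standard_simplex 1. G (simplical_face k x 0 *\<^sub>R P
      + simplical_face k x 1 *\<^sub>R Q + simplical_face k x 2 *\<^sub>R R))" if "k \<le> 2" for k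
    using in2[OF that] by (auto simp: singular_face_def \<sigma>_def restrict_def)
  then show "singular_face 2 0 \<sigma> = edge G Q R" "singular_face 2 1 \<sigma> = edge G P R" "singular_face 2 2 \<sigma> = edge G P Q"
    unfolding edge_def by (auto simp: simplical_face_def cong: restrict_cong)
qed

locale flat_block =
  fixes U :: "nat \<Rightarrow> 'a::real_normed_vector set" and A :: "nat \<Rightarrow> nat \<Rightarrow> ((nat \<Rightarrow> real) \<Rightarrow> 'a) \<Rightarrow> real"
    and i k :: nat
  assumes flat: "flat U i k A"
begin

definition W :: "'a set" where "W = (\<Inter>l\<in>{i..<k}. U l)"

definition hol :: "('b::real_vector \<Rightarrow> 'a) \<Rightarrow> 'b \<Rightarrow> 'b \<Rightarrow> utri" where
  "hol G P Q = hol_simplex A i k (edge G P Q)"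

fun phol :: "('b::real_vector \<Rightarrow> 'a) \<Rightarrow> 'b list \<Rightarrow> utri" where
  "phol G (P # Q # Ps) = hol G P Q * phol G (Q # Ps)"
| "phol G Ps = 1"

lemma unipotent_hol [simp]: "unipotent (hol G P Q)"
  by (simp add: hol_def)

lemma hol_trans:
  fixes G :: "'b::real_normed_vector \<Rightarrow> 'a"
  assumes "continuous_on (convex hull {P,Q,R}) G" "G ` (convex hull {P,Q,R}) \<subseteq> W"
  shows "hol G P R = hol G P Q * hol G Q R"
  using hol_simplex_mult[OF flat singular_simplex_affine[OF assms, unfolded W_def]]
  by (simp only: affine_simplex_faces hol_def)

lemma hol_trans_convex:
  fixes G :: "'b::real_normed_vector \<Rightarrow> 'a"
  assumes "continuous_on C G" "G ` C \<subseteq> W" "convex C" "P \<in> C" "Q \<in> C" "R \<in> C"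
  shows "hol G P R = hol G P Q * hol G Q R"
proof -
  have "convex hull {P,Q,R} \<subseteq> C" using assms by (simp add: hull_minimal)
  then show ?thesis using assms by (intro hol_trans) (auto intro: continuous_on_subset)
qed

text \<open>Cochains are not normalised on degenerate simplices; the constant triangle only shows
  that the holonomy of a constant edge is idempotent, and unipotence then makes it 1.\<close>

lemma hol_self:
  fixes G :: "'b::real_normed_vector \<Rightarrow> 'a"
  assumes "G P \<in> W"
  shows "hol G P P = 1"
proof -
  have "hol G P P = hol G P P * hol G P P"
    by (rule hol_trans) (use assms in auto)
  from this[symmetric] show ?thesis
    by (rule unipotent_idempotent[rotated]) simp
qed

text \<open>Holonomy sees only the parametrised singular edge, so the map and the end points may be
  replaced by others that trace the same path.\<close>

lemma hol_cong:
  assumes "\<And>s. 0 \<le> s \<Longrightarrow> s \<le> 1 \<Longrightarrow> G ((1 - s) *\<^sub>R P + s *\<^sub>R Q) = G' ((1 - s) *\<^sub>R P' + s *\<^sub>R Q')"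
  shows "hol G P Q = hol G' P' Q'"
  unfolding hol_def by (subst edge_cong[of G P Q G' P' Q']) (auto simp: assms)

lemma phol_convex:
  fixes G :: "'b::real_normed_vector \<Rightarrow> 'a"
  assumes "continuous_on C G" "G ` C \<subseteq> W" "convex C" "set (P # Ps) \<subseteq> C"
  shows "phol G (P # Ps) = hol G P (last (P # Ps))"
  using assms(4)
proof (induction Ps arbitrary: P)
  case Nil
  then have "G P \<in> W" using assms(2) by auto
  then show ?case by (simp add: hol_self)
next
  case (Cons Q Ps)
  then have "last (Q # Ps) \<in> C" using last_in_set[of "Q # Ps"] by auto
  then show ?case
    using Cons hol_trans_convex[OF assms(1-3), of P Q "last (Q # Ps)"] by simp
qed

lemma hol_slide:
  fixes H :: "real \<times> 'b::real_normed_vector \<Rightarrow> 'a"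
  assumes "continuous_on ({0..1} \<times> closed_segment P Q) H" "H ` ({0..1} \<times> closed_segment P Q) \<subseteq> W"
  shows "hol (\<lambda>x. H (0,x)) P Q * hol (\<lambda>t. H (t,Q)) 0 1 = hol (\<lambda>t. H (t,P)) 0 1 * hol (\<lambda>x. H (1,x)) P Q"
proof -
  define K where "K = (\<lambda>(t,s). H (t, (1 - s) *\<^sub>R P + s *\<^sub>R Q))"
  let ?C = "{0..1::real} \<times> {0..1::real}"
  have seg: "(1 - s) *\<^sub>R P + s *\<^sub>R Q \<in> closed_segment P Q" if "s \<in> {0..1}" for s
    using that by (auto simp: closed_segment_def)
  have "continuous_on ?C K"
    unfolding K_def case_prod_unfold
    by (rule continuous_on_compose2[OF assms(1)]) (use seg in \<open>auto intro!: continuous_intros\<close>)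
  moreover have "K ` ?C \<subseteq> W"
    unfolding K_def case_prod_unfold using assms(2) seg by fastforce
  moreover have "convex ?C" by (intro convex_Times) auto
  ultimately have tr: "hol K a c = hol K a b * hol K b c" if "a \<in> ?C" "b \<in> ?C" "c \<in> ?C" for a b c
    using that hol_trans_convex by metis
  have "hol K (0,0) (0,1) * hol K (0,1) (1,1) = hol K (0,0) (1,0) * hol K (1,0) (1,1)"
    using tr[of "(0,0)" "(0,1)" "(1,1)"] tr[of "(0,0)" "(1,0)" "(1,1)"] by simp
  moreover have "hol K (0,0) (0,1) = hol (\<lambda>x. H (0,x)) P Q" "hol K (1,0) (1,1) = hol (\<lambda>x. H (1,x)) P Q"
     "hol K (0,1) (1,1) = hol (\<lambda>t. H (t,Q)) 0 1" "hol K (0,0) (1,0) = hol (\<lambda>t. H (t,P)) 0 1"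
    by (auto intro!: hol_cong simp: K_def)
  ultimately show ?thesis by simp
qed

text \<open>The squares swept by the sides fit together; the tracks of intermediate vertices cancel,
  and only those of the first and the last vertex remain.\<close>

lemma phol_slide:
  fixes H :: "real \<times> 'b::real_normed_vector \<Rightarrow> 'a"
  assumes "continuous_on ({0..1} \<times> Z) H" "H ` ({0..1} \<times> Z) \<subseteq> W" "Ps \<noteq> []" "hd Ps \<in> Z"
    and "successively (\<lambda>P Q. closed_segment P Q \<subseteq> Z) Ps"
  shows "phol (\<lambda>x. H (0,x)) Ps * hol (\<lambda>t. H (t,last Ps)) 0 1
       = hol (\<lambda>t. H (t,hd Ps)) 0 1 * phol (\<lambda>x. H (1,x)) Ps"
  using assms(3-5)
proof (induction Ps rule: induct_list012)
  case (3 P Q Ps)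
  have "closed_segment P Q \<subseteq> Z" using 3 by simp
  then have 1: "hol (\<lambda>x. H (0,x)) P Q * hol (\<lambda>t. H (t,Q)) 0 1 = hol (\<lambda>t. H (t,P)) 0 1 * hol (\<lambda>x. H (1,x)) P Q"
    using assms(1,2) by (intro hol_slide) (auto intro: continuous_on_subset)
  have "Q \<in> Z" using \<open>closed_segment P Q \<subseteq> Z\<close> by auto
  then have 2: "phol (\<lambda>x. H (0,x)) (Q # Ps) * hol (\<lambda>t. H (t,last (Q # Ps))) 0 1
     = hol (\<lambda>t. H (t,Q)) 0 1 * phol (\<lambda>x. H (1,x)) (Q # Ps)"
    using 3 by simp
  have "phol (\<lambda>x. H (0,x)) (P # Q # Ps) * hol (\<lambda>t. H (t,last (P # Q # Ps))) 0 1
     = hol (\<lambda>x. H (0,x)) P Q * (phol (\<lambda>x. H (0,x)) (Q # Ps) * hol (\<lambda>t. H (t,last (Q # Ps))) 0 1)"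
    by (simp add: mult.assoc)
  also have "\<dots> = hol (\<lambda>x. H (0,x)) P Q * hol (\<lambda>t. H (t,Q)) 0 1 * phol (\<lambda>x. H (1,x)) (Q # Ps)"
    unfolding 2 by (simp only: mult.assoc)
  also have "\<dots> = hol (\<lambda>t. H (t,P)) 0 1 * phol (\<lambda>x. H (1,x)) (P # Q # Ps)"
    unfolding 1 by (simp add: mult.assoc)
  finally show ?case by simp
qed auto

end

section \<open>Trees of spherical doubles\<close>

text \<open>\<open>e0\<close> is the axis along which spheres are folded, \<open>et\<close> the
  normal of the hyperplane that contains the model sphere. The radius and the \<open>et\<close>
  coordinate together are coordinates in the normal planes of the sphere.\<close>

locale sphere_frame =
  fixes e0 et :: "'a::euclidean_space"
  assumes norm_e0 [simp]: "norm e0 = 1" and norm_et [simp]: "norm et = 1" and orth [simp]: "e0 \<bullet> et = 0"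
begin

lemma frame_simps [simp]: "et \<bullet> e0 = 0" "e0 \<bullet> e0 = 1" "et \<bullet> et = 1" "e0 \<noteq> 0" "et \<noteq> 0"
proof -
  show "et \<bullet> e0 = 0" by (metis inner_commute orth)
  show "e0 \<bullet> e0 = 1" "et \<bullet> et = 1" by (metis norm_e0 norm_eq_1, metis norm_et norm_eq_1)
  show "e0 \<noteq> 0" "et \<noteq> 0" by (metis norm_e0 norm_zero zero_neq_one, metis norm_et norm_zero zero_neq_one)
qed

definition bar :: "'a \<Rightarrow> 'a" where "bar x = x - (x \<bullet> et) *\<^sub>R et"
definition pr :: "'a \<Rightarrow> 'a" where "pr x = x - (x \<bullet> e0) *\<^sub>R e0 - (x \<bullet> et) *\<^sub>R et"
definition S :: "'a set" where "S = {x. x \<bullet> et = 0 \<and> norm x = 1}"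
definition K :: "real \<Rightarrow> 'a set" where "K \<delta> = {x. \<bar>norm (bar x) - 1\<bar> \<le> \<delta> \<and> \<bar>x \<bullet> et\<bar> \<le> \<delta>}"
text \<open>The common domain of all embeddings. It is convex and contains the disc bounded by
  \<open>S\<close>, not just a tube around \<open>S\<close>; this is what makes the homology of leaf
  complements computable. In return, self-maps of \<open>S\<close> have to be extended across
  \<open>bar x = 0\<close>.\<close>

definition Od :: "'a set" where "Od = {x. norm (bar x) < 2 \<and> \<bar>x \<bullet> et\<bar> < 1/2}"

lemma bar_polar [simp]: "v \<in> S \<Longrightarrow> bar (r *\<^sub>R v + t *\<^sub>R et) = r *\<^sub>R v"
  by (simp add: bar_def S_def inner_add_left)

lemma inner_polar [simp]: "v \<in> S \<Longrightarrow> (r *\<^sub>R v + t *\<^sub>R et) \<bullet> et = t"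
  by (simp add: S_def inner_add_left)

lemma norm_S: "v \<in> S \<Longrightarrow> norm v = 1"
  by (simp add: S_def)

lemma polar_unique:
  assumes "r > 0" "r' > 0" "v \<in> S" "v' \<in> S" "r *\<^sub>R v + t *\<^sub>R et = r' *\<^sub>R v' + t' *\<^sub>R et"
  shows "r = r'" "v = v'" "t = t'"
proof -
  show t: "t = t'" using assms by (metis inner_polar)
  have *: "r *\<^sub>R v = r' *\<^sub>R v'" using assms by (metis bar_polar)
  then show r: "r = r'" using assms by (metis abs_of_pos norm_S norm_scaleR mult.right_neutral)
  then show "v = v'" using * assms by simp
qed

lemma e0_in_S [simp]: "e0 \<in> S" "- e0 \<in> S"
  by (auto simp: S_def)

lemma polar_decomposition:
  assumes "bar x \<noteq> 0"
  shows "bar x /\<^sub>R norm (bar x) \<in> S" "x = norm (bar x) *\<^sub>R (bar x /\<^sub>R norm (bar x)) + (x \<bullet> et) *\<^sub>R et"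
proof -
  have "bar x \<bullet> et = 0" by (simp add: bar_def inner_diff_left)
  then show "bar x /\<^sub>R norm (bar x) \<in> S" using assms by (simp add: S_def)
  show "x = norm (bar x) *\<^sub>R (bar x /\<^sub>R norm (bar x)) + (x \<bullet> et) *\<^sub>R et"
  proof -
    have "norm (bar x) *\<^sub>R (bar x /\<^sub>R norm (bar x)) = bar x" using assms by simp
    then show ?thesis unfolding bar_def by (metis diff_add_cancel)
  qed
qed

lemma pr_orth [simp]: "pr x \<bullet> e0 = 0" "pr x \<bullet> et = 0" "e0 \<bullet> pr x = 0" "et \<bullet> pr x = 0"
proof -
  show a: "pr x \<bullet> e0 = 0" "pr x \<bullet> et = 0" by (simp_all add: pr_def inner_diff_left)
  show "e0 \<bullet> pr x = 0" "et \<bullet> pr x = 0" unfolding inner_commute[of _ "pr x"] by (fact a)+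
qed

lemma bar_pr: "bar x = (x \<bullet> e0) *\<^sub>R e0 + pr x"
  by (simp add: bar_def pr_def)

lemma norm_bar: "(norm (bar x))\<^sup>2 = (x \<bullet> e0)\<^sup>2 + (norm (pr x))\<^sup>2"
  unfolding bar_pr power2_norm_eq_inner
  by (simp add: inner_add_left inner_add_right power2_eq_square)

lemma abs_e0_le_bar: "\<bar>x \<bullet> e0\<bar> \<le> norm (bar x)"
  by (rule power2_le_imp_le) (simp_all add: norm_bar)

lemma pr_add: "pr (x + y) = pr x + pr y" and pr_scale: "pr (c *\<^sub>R x) = c *\<^sub>R pr x"
  by (auto simp: pr_def algebra_simps inner_add_left)

lemma pr_diff: "pr (x - y) = pr x - pr y"
  by (simp add: pr_def algebra_simps inner_diff_left)

lemma pr_frame [simp]: "pr e0 = 0" "pr et = 0"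
  by (auto simp: pr_def)

lemma pr_of_orth [simp]: "w \<bullet> e0 = 0 \<Longrightarrow> w \<bullet> et = 0 \<Longrightarrow> pr w = w"
  by (simp add: pr_def)

lemma continuous_on_bar [continuous_intros]: "continuous_on A f \<Longrightarrow> continuous_on A (\<lambda>x. bar (f x))"
  unfolding bar_def by (intro continuous_intros)

lemma continuous_on_pr [continuous_intros]: "continuous_on A f \<Longrightarrow> continuous_on A (\<lambda>x. pr (f x))"
  unfolding pr_def by (intro continuous_intros)

lemma open_Od: "open Od"
proof -
  have "Od = {x. norm (bar x) < 2} \<inter> {x. \<bar>x \<bullet> et\<bar> < 1/2}" by (auto simp: Od_def)
  moreover have "open {x. norm (bar x) < 2}" "open {x::'a. \<bar>x \<bullet> et\<bar> < 1/2}"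
    by (intro open_Collect_less continuous_intros)+
  ultimately show ?thesis by auto
qed

lemma convex_Od: "convex Od"
proof -
  have lin: "linear bar" unfolding bar_def
    by (auto intro!: linearI simp: algebra_simps inner_add_left)
  have "Od = bar -` ball 0 2 \<inter> (\<lambda>x. x \<bullet> et) -` ball 0 (1/2)"
    by (auto simp: Od_def dist_norm)
  moreover have "linear (\<lambda>x. x \<bullet> et)" by (simp add: linear_iff inner_add_left)
  ultimately show ?thesis using lin by (auto intro!: convex_Int convex_linear_vimage)
qed

lemma compact_S: "compact S"
proof -
  have "S = sphere 0 1 \<inter> {x. x \<bullet> et = 0}" by (auto simp: S_def)
  moreover have "closed {x::'a. x \<bullet> et = 0}" by (intro closed_Collect_eq continuous_intros)
  ultimately show ?thesis by (simp add: compact_Int_closed)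
qed

lemma compact_K: "compact (K \<delta>)"
proof -
  have "closed (K \<delta>)" unfolding K_def by (intro closed_Collect_conj closed_Collect_le continuous_intros)
  moreover have "bounded (K \<delta>)"
  proof (rule boundedI)
    fix x assume x: "x \<in> K \<delta>"
    have "norm x \<le> norm (bar x) + norm ((x \<bullet> et) *\<^sub>R et)"
      unfolding bar_def by (metis add_diff_cancel diff_add_cancel norm_triangle_ineq)
    then show "norm x \<le> 1 + 2 * \<delta>" using x by (auto simp: K_def)
  qed
  ultimately show ?thesis by (simp add: compact_eq_bounded_closed)
qed

lemma K_subset_Od: "\<delta> < 1/2 \<Longrightarrow> K \<delta> \<subseteq> Od"
  by (auto simp: K_def Od_def abs_le_iff)

lemma S_subset_K: "0 \<le> \<delta> \<Longrightarrow> S \<subseteq> K \<delta>"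
  by (auto simp: K_def S_def bar_def)

lemma S_subset_Od: "S \<subseteq> Od"
  using S_subset_K[of 0] K_subset_Od[of 0] by auto

lemma polar_in_Od: "v \<in> S \<Longrightarrow> \<bar>s\<bar> < 1 \<Longrightarrow> \<bar>t\<bar> < 1/2 \<Longrightarrow> (1 + s) *\<^sub>R v + t *\<^sub>R et \<in> Od"
  by (simp add: Od_def norm_S)

lemma polar_in_K_iff: "v \<in> S \<Longrightarrow> \<bar>s\<bar> < 1 \<Longrightarrow> (1 + s) *\<^sub>R v + t *\<^sub>R et \<in> K \<delta> \<longleftrightarrow> \<bar>s\<bar> \<le> \<delta> \<and> \<bar>t\<bar> \<le> \<delta>"
  by (simp add: K_def norm_S)

text \<open>\<open>cap\<close> wraps the equatorial hyperplane around the sphere: the unit ball covers the hemisphere of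
  \<open>e0\<close>, and the inversion in the unit sphere covers the other one, except for its pole. Thus for
  \<open>a\<close> near 1 and small \<open>h\<close>, \<open>chip a h\<close> and \<open>chim a h\<close> below squash the sphere to doubled caps that
  are slightly larger than hemispheres and cross near the equator, one thin in the radial direction and
  the other thin in the direction of \<open>et\<close>.\<close>

definition cap :: "'a \<Rightarrow> 'a" where
  "cap w = (if norm w \<le> 1 then sqrt (1 - (norm w)\<^sup>2) *\<^sub>R e0 + w
            else - sqrt (1 - 1 / (norm w)\<^sup>2) *\<^sub>R e0 + w /\<^sub>R (norm w)\<^sup>2)"

lemma cap_0 [simp]: "cap 0 = e0"
  by (simp add: cap_def)

lemma continuous_on_cap: "continuous_on UNIV cap"
proof -
  have "continuous_on UNIV (\<lambda>w. if norm w \<le> 1 then sqrt (1 - (norm w)\<^sup>2) *\<^sub>R e0 + w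
            else - sqrt (1 - 1 / (norm w)\<^sup>2) *\<^sub>R e0 + w /\<^sub>R (norm w)\<^sup>2)"
    by (rule continuous_on_cases_le) (auto intro!: continuous_intros)
  then show ?thesis by (simp add: cap_def[abs_def])
qed

lemma cap_in_S:
  assumes "w \<bullet> e0 = 0" "w \<bullet> et = 0"
  shows "cap w \<in> S"
proof -
  have *: "norm (c *\<^sub>R e0 + d *\<^sub>R w) = 1" if "c\<^sup>2 + d\<^sup>2 * (norm w)\<^sup>2 = 1" for c d
  proof -
    have "(norm (c *\<^sub>R e0 + d *\<^sub>R w))\<^sup>2 = c\<^sup>2 + d\<^sup>2 * (norm w)\<^sup>2"
      unfolding power2_norm_eq_inner using assms
      by (simp add: inner_add_left inner_add_right inner_commute power2_eq_square)
    then show ?thesis using that by (intro power2_eq_imp_eq[of _ 1]) auto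
  qed
  show ?thesis
  proof (cases "norm w \<le> 1")
    case True
    then have "(norm w)\<^sup>2 \<le> 1" by (simp add: power_le_one)
    then show ?thesis using True assms *[of "sqrt (1 - (norm w)\<^sup>2)" 1]
      by (simp add: cap_def S_def inner_add_left)
  next
    case False
    then have "1 < (norm w)\<^sup>2" by (simp add: one_less_power)
    then have "1 / (norm w)\<^sup>2 \<le> 1" by (simp add: divide_le_eq)
    moreover have "(inverse ((norm w)\<^sup>2))\<^sup>2 * (norm w)\<^sup>2 = 1 / (norm w)\<^sup>2"
      using False by (simp add: power2_eq_square field_simps)
    ultimately show ?thesis using False assms *[of "- sqrt (1 - 1 / (norm w)\<^sup>2)" "inverse ((norm w)\<^sup>2)"]
      by (simp add: cap_def S_def inner_add_left inner_diff_left)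
  qed
qed

lemma cap_e0_nonneg_iff:
  assumes "w \<bullet> e0 = 0"
  shows "cap w \<bullet> e0 \<ge> 0 \<longleftrightarrow> norm w \<le> 1"
proof (cases "norm w \<le> 1")
  case True
  then show ?thesis using assms by (simp add: cap_def inner_add_left power_le_one)
next
  case False
  then have "1 < (norm w)\<^sup>2" by (simp add: one_less_power)
  then have "\<not> 1 \<le> 1 / (norm w)\<^sup>2" by (simp add: le_divide_eq)
  then show ?thesis using False assms by (simp add: cap_def inner_add_left inner_diff_left)
qed

lemma pr_cap:
  assumes "w \<bullet> e0 = 0" "w \<bullet> et = 0"
  shows "pr (cap w) = (if norm w \<le> 1 then w else w /\<^sub>R (norm w)\<^sup>2)"
  using assms by (simp add: cap_def pr_add pr_diff pr_scale)

lemma cap_inject: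
  assumes "w \<bullet> e0 = 0" "w \<bullet> et = 0" "w' \<bullet> e0 = 0" "w' \<bullet> et = 0" "cap w = cap w'"
  shows "w = w'"
proof -
  have iff: "norm w \<le> 1 \<longleftrightarrow> norm w' \<le> 1" using assms cap_e0_nonneg_iff by metis
  show ?thesis
  proof (cases "norm w \<le> 1")
    case True
    then show ?thesis using assms iff pr_cap by metis
  next
    case False
    then have *: "w /\<^sub>R (norm w)\<^sup>2 = w' /\<^sub>R (norm w')\<^sup>2" using assms iff pr_cap by metis
    have n: "norm (x /\<^sub>R (norm x)\<^sup>2) = 1 / norm x" for x :: 'a
      by (simp add: power2_eq_square divide_simps)
    then have "norm w = norm w'" using * by (metis div_by_1 divide_divide_eq_right mult_1)
    then show ?thesis using * False by auto
  qed
qed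

lemma cap_neq: "w \<bullet> e0 = 0 \<Longrightarrow> cap w \<noteq> - e0"
proof
  assume w: "w \<bullet> e0 = 0" and eq: "cap w = - e0"
  then have "cap w \<bullet> e0 = -1" by simp
  then have "\<not> norm w \<le> 1" using cap_e0_nonneg_iff[OF w] by simp
  then have "cap w \<bullet> e0 = - sqrt (1 - 1 / (norm w)\<^sup>2)" using w by (simp add: cap_def inner_add_left inner_diff_left)
  then have "sqrt (1 - 1 / (norm w)\<^sup>2) = 1" using \<open>cap w \<bullet> e0 = -1\<close> by simp
  then have "1 / (norm w)\<^sup>2 = 0" by simp
  then show False using \<open>\<not> norm w \<le> 1\<close> by auto
qed

section \<open>The two children of a double\<close>

definition refl :: "'a \<Rightarrow> 'a" where "refl v = v - (2 * (v \<bullet> e0)) *\<^sub>R e0"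

lemma refl_e0 [simp]: "refl v \<bullet> e0 = - (v \<bullet> e0)" "refl v \<bullet> et = v \<bullet> et" "refl (refl v) = v" "refl e0 = - e0"
  by (auto simp: refl_def inner_diff_left algebra_simps scaleR_2)

lemma norm_refl [simp]: "norm (refl v) = norm v"
proof -
  have "(norm (refl v))\<^sup>2 = (norm v)\<^sup>2"
    unfolding power2_norm_eq_inner refl_def by (simp add: inner_diff_left inner_diff_right inner_commute algebra_simps)
  then show ?thesis by simp
qed

lemma refl_in_S [simp]: "refl v \<in> S \<longleftrightarrow> v \<in> S"
  by (simp add: S_def)

lemma continuous_on_refl [continuous_intros]: "continuous_on A f \<Longrightarrow> continuous_on A (\<lambda>x. refl (f x))"
  unfolding refl_def by (intro continuous_intros)

text \<open>Two points of \<open>S\<close> with the same \<open>pr\<close> land on the same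
  direction at radii \<open>1 + h * t\<close> and \<open>1 - h * t\<close>: the sphere becomes a
  double sheet over the hemisphere of \<open>e0\<close>. Its equator becomes the rim, which lies
  beyond the equator of the parent as soon as \<open>1 < a\<close>.\<close>

definition chip :: "real \<Rightarrow> real \<Rightarrow> 'a \<Rightarrow> 'a" where
  "chip a h x = (1 + h * (x \<bullet> e0)) *\<^sub>R cap (a *\<^sub>R pr x) + (x \<bullet> et) *\<^sub>R et"

text \<open>Compared with \<open>chip\<close>, the hemisphere is reflected and the normal plane is
  turned by a right angle: the role of the radius is taken by \<open>et\<close>, and that of
  \<open>et\<close> by minus the radius. The sign makes it a rotation, so meridians keep their
  sense.\<close>

definition chim :: "real \<Rightarrow> real \<Rightarrow> 'a \<Rightarrow> 'a" where
  "chim a h x = (1 + - (x \<bullet> et)) *\<^sub>R refl (cap (a *\<^sub>R pr x)) + (h * (x \<bullet> e0)) *\<^sub>R et"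

lemma cap_pr_in_S [simp]: "cap (a *\<^sub>R pr x) \<in> S"
  by (rule cap_in_S) auto

lemma h_e0_bound:
  assumes "x \<in> Od" "0 < h" "h < 1/4"
  shows "\<bar>h * (x \<bullet> e0)\<bar> < 1/2"
proof -
  have "\<bar>x \<bullet> e0\<bar> < 2" using assms abs_e0_le_bar[of x] by (auto simp: Od_def)
  then have "h * \<bar>x \<bullet> e0\<bar> < (1/4) * 2" using assms by (intro mult_strict_mono) auto
  then show ?thesis using assms by (simp add: abs_mult)
qed

lemma child_in_Od:
  assumes "x \<in> Od" "0 < h" "h < 1/4"
  shows "chip a h x \<in> Od" "chim a h x \<in> Od"
  using assms h_e0_bound[OF assms] unfolding chip_def chim_def
  by (intro polar_in_Od; simp add: Od_def)+

lemma decompose_eq: "x \<bullet> e0 = y \<bullet> e0 \<Longrightarrow> x \<bullet> et = y \<bullet> et \<Longrightarrow> pr x = pr y \<Longrightarrow> x = y"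
  unfolding pr_def by (metis diff_add_cancel)

lemma child_inj:
  assumes "0 < h" "h < 1/4" "0 < a"
  shows "inj_on (chip a h) Od" "inj_on (chim a h) Od"
proof -
  show "inj_on (chip a h) Od"
  proof (rule inj_onI)
    fix x y assume xy: "x \<in> Od" "y \<in> Od" "chip a h x = chip a h y"
    have p: "0 < 1 + h * (x \<bullet> e0)" "0 < 1 + h * (y \<bullet> e0)"
      using h_e0_bound[OF xy(1) assms(1,2)] h_e0_bound[OF xy(2) assms(1,2)] by auto
    note u = polar_unique[OF p cap_pr_in_S cap_pr_in_S xy(3)[unfolded chip_def]]
    have "a *\<^sub>R pr x = a *\<^sub>R pr y" by (rule cap_inject[OF _ _ _ _ u(2)]) simp_all
    then have "pr x = pr y" using assms(3) by simp
    moreover have "x \<bullet> e0 = y \<bullet> e0" using u(1) assms(1) by simp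
    ultimately show "x = y" using u(3) decompose_eq by blast
  qed
  show "inj_on (chim a h) Od"
  proof (rule inj_onI)
    fix x y assume xy: "x \<in> Od" "y \<in> Od" "chim a h x = chim a h y"
    have p: "0 < 1 + - (x \<bullet> et)" "0 < 1 + - (y \<bullet> et)" using xy by (auto simp: Od_def)
    have r: "refl (cap (a *\<^sub>R pr z)) \<in> S" for z by simp
    note u = polar_unique[OF p r r xy(3)[unfolded chim_def]]
    have "cap (a *\<^sub>R pr x) = cap (a *\<^sub>R pr y)" using u(2) by (metis refl_e0(3))
    from cap_inject[OF _ _ _ _ this] have "a *\<^sub>R pr x = a *\<^sub>R pr y" by simp
    then have "pr x = pr y" using assms(3) by simp
    moreover have "x \<bullet> e0 = y \<bullet> e0" "x \<bullet> et = y \<bullet> et" using u(1,3) assms(1) by simp_all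
    ultimately show "x = y" using decompose_eq by blast
  qed
qed

lemma child_cont: "continuous_on A (chip a h)" "continuous_on A (chim a h)"
  unfolding chip_def chim_def
  by (intro continuous_intros continuous_on_compose2[OF continuous_on_cap]; simp)+

section \<open>Self-maps of the sphere and embeddings of its neighbourhood\<close>

definition rot :: "('a \<Rightarrow> 'a) \<Rightarrow> bool" where
  "rot \<rho> \<longleftrightarrow> continuous_on S \<rho> \<and> inj_on \<rho> S \<and> \<rho> ` S \<subseteq> S"

text \<open>The radial extension of \<open>\<rho>\<close>, constant in the \<open>et\<close>
  direction. At \<open>bar x = 0\<close> the junk direction is multiplied by zero, so it is the
  identity there and continuity survives.\<close>

definition hat :: "('a \<Rightarrow> 'a) \<Rightarrow> 'a \<Rightarrow> 'a" where
  "hat \<rho> x = norm (bar x) *\<^sub>R \<rho> (bar x /\<^sub>R norm (bar x)) + (x \<bullet> et) *\<^sub>R et"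

lemma hat_polar: "v \<in> S \<Longrightarrow> 0 < r \<Longrightarrow> hat \<rho> (r *\<^sub>R v + t *\<^sub>R et) = r *\<^sub>R \<rho> v + t *\<^sub>R et"
  by (simp add: hat_def norm_S)

lemma hat_degenerate: "bar x = 0 \<Longrightarrow> hat \<rho> x = x"
  by (simp add: hat_def) (simp add: bar_def)

lemma rot_S: "rot \<rho> \<Longrightarrow> v \<in> S \<Longrightarrow> \<rho> v \<in> S"
  by (auto simp: rot_def)

lemma bar_hat:
  assumes "rot \<rho>"
  shows "norm (bar (hat \<rho> x)) = norm (bar x)" "hat \<rho> x \<bullet> et = x \<bullet> et"
proof -
  have "norm (bar (hat \<rho> x)) = norm (bar x) \<and> hat \<rho> x \<bullet> et = x \<bullet> et"
  proof (cases "bar x = 0")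
    case True
    then show ?thesis by (simp add: hat_degenerate)
  next
    case False
    then have "\<rho> (bar x /\<^sub>R norm (bar x)) \<in> S" using rot_S[OF assms] polar_decomposition(1) by blast
    then show ?thesis by (simp add: hat_def norm_S)
  qed
  then show "norm (bar (hat \<rho> x)) = norm (bar x)" "hat \<rho> x \<bullet> et = x \<bullet> et" by auto
qed

lemma hat_Od: "rot \<rho> \<Longrightarrow> x \<in> Od \<Longrightarrow> hat \<rho> x \<in> Od"
  by (simp add: Od_def bar_hat)

lemma hat_K: "rot \<rho> \<Longrightarrow> x \<in> K \<delta> \<Longrightarrow> hat \<rho> x \<in> K \<delta>"
  by (simp add: K_def bar_hat)

lemma hat_inj:
  assumes "rot \<rho>"
  shows "inj (hat \<rho>)"
proof (rule injI)
  fix x y assume eq: "hat \<rho> x = hat \<rho> y"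
  have n: "norm (bar x) = norm (bar y)" "x \<bullet> et = y \<bullet> et"
    using bar_hat[OF assms, of x] bar_hat[OF assms, of y] eq by auto
  show "x = y"
  proof (cases "bar x = 0")
    case True
    then have "bar y = 0" using n by simp
    then show ?thesis using True eq by (simp add: hat_degenerate)
  next
    case False
    then have ny: "bar y \<noteq> 0" using n by auto
    have "\<rho> (bar x /\<^sub>R norm (bar x)) = \<rho> (bar y /\<^sub>R norm (bar y))"
      using eq n False ny by (simp add: hat_def)
    then have "bar x /\<^sub>R norm (bar x) = bar y /\<^sub>R norm (bar y)"
      using assms polar_decomposition(1)[OF False] polar_decomposition(1)[OF ny]
      unfolding rot_def inj_on_def by blast
    then show ?thesis using polar_decomposition(2)[OF False] polar_decomposition(2)[OF ny] n by metis
  qed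
qed

lemma hat_cont:
  assumes "rot \<rho>"
  shows "continuous_on UNIV (hat \<rho>)"
proof -
  have "isCont (hat \<rho>) x" for x
  proof (cases "bar x = 0")
    case False
    have "continuous_on {x. bar x \<noteq> 0} (\<lambda>x. \<rho> (bar x /\<^sub>R norm (bar x)))"
    proof (rule continuous_on_compose2[of S \<rho>])
      show "continuous_on S \<rho>" using assms by (simp add: rot_def)
      show "continuous_on {x. bar x \<noteq> 0} (\<lambda>x. bar x /\<^sub>R norm (bar x))"
        by (intro continuous_intros) simp
      show "(\<lambda>x. bar x /\<^sub>R norm (bar x)) ` {x. bar x \<noteq> 0} \<subseteq> S"
        using polar_decomposition(1) by blast
    qed
    then have "continuous_on {x. bar x \<noteq> 0} (hat \<rho>)"
      unfolding hat_def[abs_def] by (intro continuous_intros) auto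
    moreover have "open {x. bar x \<noteq> 0}" by (intro open_Collect_neq continuous_intros)
    ultimately show ?thesis using False by (simp add: continuous_on_eq_continuous_at)
  next
    case True
    have cb: "isCont bar x" using continuous_on_bar[OF continuous_on_id, of UNIV] by (simp add: continuous_on_eq_continuous_at)
    have "((\<lambda>y. norm (bar y) *\<^sub>R \<rho> (bar y /\<^sub>R norm (bar y))) \<longlongrightarrow> 0) (at x)"
    proof (rule Lim_null_comparison)
      show "((\<lambda>y. norm (bar y)) \<longlongrightarrow> 0) (at x)"
        using cb True unfolding isCont_def by (metis tendsto_norm_zero)
      have "norm (norm (bar y) *\<^sub>R \<rho> (bar y /\<^sub>R norm (bar y))) \<le> norm (bar y)" for y
      proof (cases "bar y = 0")
        case False
        then show ?thesis using rot_S[OF assms polar_decomposition(1)[OF False]] by (simp add: norm_S)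
      qed simp
      then show "\<forall>\<^sub>F y in at x. norm (norm (bar y) *\<^sub>R \<rho> (bar y /\<^sub>R norm (bar y))) \<le> norm (bar y)"
        by simp
    qed
    then have "isCont (\<lambda>y. norm (bar y) *\<^sub>R \<rho> (bar y /\<^sub>R norm (bar y))) x"
      using True by (simp add: isCont_def)
    then show ?thesis unfolding hat_def[abs_def] by (rule continuous_add) (intro continuous_intros)
  qed
  then show ?thesis by (simp add: continuous_at_imp_continuous_on)
qed

text \<open>By invariance of domain this already makes \<open>\<Theta>\<close> an open embedding of
  \<open>Od\<close>.\<close>

definition good :: "('a \<Rightarrow> 'a) \<Rightarrow> bool" where
  "good \<Theta> \<longleftrightarrow> continuous_on Od \<Theta> \<and> inj_on \<Theta> Od"

lemma good_child:
  assumes "good \<Theta>" "rot \<rho>" "0 < h" "h < 1/4" "0 < a"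
  shows "good (\<Theta> \<circ> hat \<rho> \<circ> chip a h)" "good (\<Theta> \<circ> hat \<rho> \<circ> chim a h)"
proof -
  have *: "good (\<Theta> \<circ> hat \<rho> \<circ> f)" if "continuous_on Od f" "inj_on f Od" "f ` Od \<subseteq> Od" for f
  proof -
    have "continuous_on Od (hat \<rho> \<circ> f)"
      using that hat_cont[OF assms(2)] by (intro continuous_on_compose) (auto intro: continuous_on_subset)
    moreover have sub: "(hat \<rho> \<circ> f) ` Od \<subseteq> Od" using that hat_Od[OF assms(2)] by auto
    ultimately have "continuous_on Od (\<Theta> \<circ> (hat \<rho> \<circ> f))"
      using assms(1) unfolding good_def by (intro continuous_on_compose[of Od "hat \<rho> \<circ> f" \<Theta>]) (auto intro: continuous_on_subset)
    moreover have "inj_on (hat \<rho> \<circ> f) Od"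
      using that(2) hat_inj[OF assms(2)] by (auto intro: comp_inj_on inj_on_subset)
    then have "inj_on (\<Theta> \<circ> (hat \<rho> \<circ> f)) Od"
      by (rule comp_inj_on) (use assms(1) sub in \<open>auto simp: good_def intro: inj_on_subset\<close>)
    ultimately show ?thesis by (simp add: good_def comp_assoc)
  qed
  show "good (\<Theta> \<circ> hat \<rho> \<circ> chip a h)" "good (\<Theta> \<circ> hat \<rho> \<circ> chim a h)"
    using child_in_Od assms by (auto intro!: * child_cont child_inj)
qed

text \<open>\<open>\<delta>\<close> and \<open>\<delta>'\<close> are the tube radii of parent and
  child, \<open>h\<close> is half the distance of the two sheets, \<open>a\<close> the overshoot of
  the caps. \<open>s\<close> is a clearance: over its own hemisphere a child keeps more than
  \<open>s\<close> away from the core, which leaves room for the sheets of the other child, since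
  these are only \<open>\<delta>'\<close> thick. The last inequality is what
  \<open>K_e0_lower\<close> needs for this.\<close>

definition params :: "real \<Rightarrow> real \<Rightarrow> real \<Rightarrow> real \<Rightarrow> real \<Rightarrow> bool" where
  "params a h s \<delta> \<delta>' \<longleftrightarrow> 1 < a \<and> 0 < h \<and> h < 1/4 \<and> 0 < \<delta>' \<and> \<delta>' < 1/2 \<and> \<delta>' \<le> \<delta> \<and> h * (1 + \<delta>') \<le> \<delta>
     \<and> \<delta>' < s \<and> s\<^sup>2 < h\<^sup>2 * ((1 - \<delta>')\<^sup>2 - 1 / a\<^sup>2)"

lemma K_e0_bound: "x \<in> K \<delta> \<Longrightarrow> \<bar>x \<bullet> e0\<bar> \<le> 1 + \<delta>"
  using abs_e0_le_bar[of x] by (auto simp: K_def)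

text \<open>Over the own hemisphere \<open>pr x\<close> has norm at most \<open>1 / a\<close>, so
  nearly all of the norm of \<open>bar x\<close> must come from the \<open>e0\<close> coordinate,
  which is the one that separates the sheets.\<close>

lemma K_e0_lower:
  assumes "params a h s \<delta> \<delta>'" "x \<in> K \<delta>'" "norm (a *\<^sub>R pr x) \<le> 1"
  shows "h\<^sup>2 * ((1 - \<delta>')\<^sup>2 - 1 / a\<^sup>2) \<le> (h * (x \<bullet> e0))\<^sup>2"
proof -
  have "1 - \<delta>' \<le> norm (bar x)" "0 \<le> 1 - \<delta>'" using assms by (auto simp: K_def params_def)
  then have "(1 - \<delta>')\<^sup>2 \<le> (norm (bar x))\<^sup>2" by (intro power_mono) auto
  moreover have "a > 0" using assms(1) by (simp add: params_def)
  then have "norm (pr x) \<le> 1 / a" using assms(3) by (simp add: field_simps)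
  then have "(norm (pr x))\<^sup>2 \<le> 1 / a\<^sup>2"
    using power_mono[of "norm (pr x)" "1 / a" 2] by (simp add: power_divide)
  ultimately have "(1 - \<delta>')\<^sup>2 - 1 / a\<^sup>2 \<le> (x \<bullet> e0)\<^sup>2" using norm_bar[of x] by linarith
  then show ?thesis by (simp add: power_mult_distrib mult_left_mono)
qed

lemma chip_image:
  assumes p: "params a h s \<delta> \<delta>'" and "v \<in> S" "\<bar>\<sigma>\<bar> < 1" "x \<in> K \<delta>'" "(1 + \<sigma>) *\<^sub>R v + \<tau> *\<^sub>R et = chip a h x"
  shows "\<bar>\<sigma>\<bar> \<le> h * (1 + \<delta>')" "\<bar>\<tau>\<bar> \<le> \<delta>'" "v \<bullet> e0 \<ge> 0 \<Longrightarrow> s < \<bar>\<sigma>\<bar>" "v \<noteq> - e0"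
proof -
  have h: "0 < h" "h < 1/4" "0 < a" "\<delta>' < 1/2" "0 < s" using p by (auto simp: params_def)
  have "x \<in> Od" using assms K_subset_Od h by blast
  then have b: "\<bar>h * (x \<bullet> e0)\<bar> < 1/2" using h_e0_bound h by blast
  have q: "0 < 1 + \<sigma>" "0 < 1 + h * (x \<bullet> e0)" using assms b by auto
  note u = polar_unique[OF q assms(2) cap_pr_in_S assms(5)[unfolded chip_def]]
  have "h * \<bar>x \<bullet> e0\<bar> \<le> h * (1 + \<delta>')" using h K_e0_bound[OF assms(4)] by (intro mult_left_mono) auto
  then show "\<bar>\<sigma>\<bar> \<le> h * (1 + \<delta>')" using u(1) h by (simp add: abs_mult)
  show "\<bar>\<tau>\<bar> \<le> \<delta>'" using u(3) assms(4) by (simp add: K_def)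
  show "v \<noteq> - e0" using u(2) cap_neq by simp
  assume "v \<bullet> e0 \<ge> 0"
  then have "norm (a *\<^sub>R pr x) \<le> 1" using u(2) cap_e0_nonneg_iff[of "a *\<^sub>R pr x"] by simp
  then have "h\<^sup>2 * ((1 - \<delta>')\<^sup>2 - 1 / a\<^sup>2) \<le> \<sigma>\<^sup>2" using K_e0_lower[OF p assms(4)] u(1) by simp
  then have "s\<^sup>2 < \<sigma>\<^sup>2" using p by (simp add: params_def)
  then show "s < \<bar>\<sigma>\<bar>" using h by (metis abs_le_square_iff abs_of_pos not_less)
qed

lemma chim_image:
  assumes p: "params a h s \<delta> \<delta>'" and "v \<in> S" "\<bar>\<sigma>\<bar> < 1" "x \<in> K \<delta>'" "(1 + \<sigma>) *\<^sub>R v + \<tau> *\<^sub>R et = chim a h x"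
  shows "\<bar>\<tau>\<bar> \<le> h * (1 + \<delta>')" "\<bar>\<sigma>\<bar> \<le> \<delta>'" "v \<bullet> e0 \<le> 0 \<Longrightarrow> s < \<bar>\<tau>\<bar>" "v \<noteq> e0"
proof -
  have h: "0 < h" "h < 1/4" "0 < a" "\<delta>' < 1/2" "0 < s" using p by (auto simp: params_def)
  have "x \<in> Od" using assms K_subset_Od h by blast
  then have b: "\<bar>x \<bullet> et\<bar> < 1/2" by (simp add: Od_def)
  have q: "0 < 1 + \<sigma>" "0 < 1 + - (x \<bullet> et)" using assms b by auto
  have r: "refl (cap (a *\<^sub>R pr x)) \<in> S" by simp
  note u = polar_unique[OF q assms(2) r assms(5)[unfolded chim_def]]
  have "h * \<bar>x \<bullet> e0\<bar> \<le> h * (1 + \<delta>')" using h K_e0_bound[OF assms(4)] by (intro mult_left_mono) auto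
  then show "\<bar>\<tau>\<bar> \<le> h * (1 + \<delta>')" using u(3) h by (simp add: abs_mult)
  show "\<bar>\<sigma>\<bar> \<le> \<delta>'" using u(1) assms(4) by (simp add: K_def)
  show "v \<noteq> e0"
    using u(2) cap_neq[of "a *\<^sub>R pr x"] by (metis inner_commute inner_zero_right pr_orth(1) refl_e0(3) refl_e0(4) inner_scaleR_left mult_zero_right)
  assume "v \<bullet> e0 \<le> 0"
  then have "norm (a *\<^sub>R pr x) \<le> 1" using u(2) cap_e0_nonneg_iff[of "a *\<^sub>R pr x"] by simp
  then have "h\<^sup>2 * ((1 - \<delta>')\<^sup>2 - 1 / a\<^sup>2) \<le> \<tau>\<^sup>2" using K_e0_lower[OF p assms(4)] u(3) by simp
  then have "s\<^sup>2 < \<tau>\<^sup>2" using p by (simp add: params_def)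
  then show "s < \<bar>\<tau>\<bar>" using h by (metis abs_le_square_iff abs_of_pos not_less)
qed

lemma K_child:
  assumes p: "params a h s \<delta> \<delta>'" and "x \<in> K \<delta>'"
  shows "chip a h x \<in> K \<delta>" "chim a h x \<in> K \<delta>"
proof -
  have h: "0 < h" "h < 1/4" "\<delta>' < 1/2" "\<delta>' \<le> \<delta>" "h * (1 + \<delta>') \<le> \<delta>" using p by (auto simp: params_def)
  have "x \<in> Od" using assms K_subset_Od h by blast
  then have b: "\<bar>h * (x \<bullet> e0)\<bar> < 1/2" "\<bar>x \<bullet> et\<bar> < 1/2" using h_e0_bound h by (auto simp: Od_def)
  have "h * \<bar>x \<bullet> e0\<bar> \<le> h * (1 + \<delta>')" using h K_e0_bound[OF assms(2)] by (intro mult_left_mono) auto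
  moreover have "\<bar>h * (x \<bullet> e0)\<bar> = h * \<bar>x \<bullet> e0\<bar>" using h(1) by (simp add: abs_mult)
  ultimately have c: "\<bar>h * (x \<bullet> e0)\<bar> \<le> \<delta>" using h(5) by linarith
  have d: "\<bar>x \<bullet> et\<bar> \<le> \<delta>" using assms(2) h by (simp add: K_def)
  show "chip a h x \<in> K \<delta>" unfolding chip_def using b c d by (subst polar_in_K_iff) auto
  show "chim a h x \<in> K \<delta>" unfolding chim_def using b c d by (subst polar_in_K_iff) auto
qed

text \<open>Over the hemisphere of \<open>e0\<close> the radial offset exceeds \<open>s\<close> on
  one child and is at most \<open>\<delta>'\<close> on the other; over the opposite hemisphere the
  \<open>et\<close> coordinate separates them in the same way, with the children exchanged.\<close>

lemma children_disjoint:
  assumes p: "params a h s \<delta> \<delta>'" and x: "x \<in> K \<delta>'" "y \<in> K \<delta>'"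
  shows "chip a h x \<noteq> chim a h y"
proof
  assume eq: "chip a h x = chim a h y"
  have h: "0 < h" "h < 1/4" "\<delta>' < 1/2" "\<delta>' < s" using p by (auto simp: params_def)
  have xy: "x \<in> Od" "y \<in> Od" using assms K_subset_Od h by blast+
  have b: "\<bar>h * (x \<bullet> e0)\<bar> < 1" using h_e0_bound[OF xy(1)] h by force
  have b': "\<bar>- (y \<bullet> et)\<bar> < 1" using xy by (auto simp: Od_def)
  have q: "0 < 1 + h * (x \<bullet> e0)" "0 < 1 + - (y \<bullet> et)" using b b' by auto
  let ?v = "cap (a *\<^sub>R pr x)"
  note m = chim_image[OF p cap_pr_in_S b x(2) eq[unfolded chip_def[of a h x]]]
  note c = chip_image[OF p cap_pr_in_S b x(1) chip_def[of a h x, symmetric]]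
  show False using m(2) c(2,3) m(3) h by linarith
qed

text \<open>Only the leaves are recorded, from left to right; their order will be the order of
  matrix indices. The two halves of a double share their radius, but rotations and parameters may
  differ from node to node.\<close>

inductive tree :: "('a \<Rightarrow> 'a) \<Rightarrow> real \<Rightarrow> (('a \<Rightarrow> 'a) \<times> real) list \<Rightarrow> bool" where
  leaf: "tree \<Theta> \<delta> [(\<Theta>,\<delta>)]"
| node: "rot \<rho> \<Longrightarrow> params a h s \<delta> \<delta>' \<Longrightarrow> tree (\<Theta> \<circ> hat \<rho> \<circ> chip a h) \<delta>' L1
    \<Longrightarrow> tree (\<Theta> \<circ> hat \<rho> \<circ> chim a h) \<delta>' L2 \<Longrightarrow> tree \<Theta> \<delta> (L1 @ L2)"

lemma tree_leaf_facts:
  assumes "tree \<Theta> \<delta> L" "good \<Theta>" "0 < \<delta>" "\<delta> < 1/2" "(\<Theta>',\<delta>') \<in> set L"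
  shows "good \<Theta>' \<and> 0 < \<delta>' \<and> \<delta>' < 1/2 \<and> \<Theta>' ` K \<delta>' \<subseteq> \<Theta> ` K \<delta>"
  using assms
proof (induction arbitrary: \<Theta>' \<delta>' rule: tree.induct)
  case (node \<rho> a h s \<delta> \<delta>'' \<Theta> L1 L2)
  have h: "0 < h" "h < 1/4" "0 < a" "0 < \<delta>''" "\<delta>'' < 1/2"
    using node.hyps(2) by (auto simp: params_def)
  have sub: "(\<Theta> \<circ> hat \<rho> \<circ> chip a h) ` K \<delta>'' \<subseteq> \<Theta> ` K \<delta>" "(\<Theta> \<circ> hat \<rho> \<circ> chim a h) ` K \<delta>'' \<subseteq> \<Theta> ` K \<delta>"
    using K_child[OF node.hyps(2)] hat_K[OF node.hyps(1)] by (simp_all add: image_subset_iff)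
  note g = good_child[OF node.prems(1) node.hyps(1) h(1-3)]
  consider "(\<Theta>',\<delta>') \<in> set L1" | "(\<Theta>',\<delta>') \<in> set L2" using node.prems(4) by auto
  then show ?case
  proof cases
    case 1
    then show ?thesis using node.IH(1)[OF g(1) h(4,5) 1] sub(1) by (metis order_trans)
  next
    case 2
    then show ?thesis using node.IH(2)[OF g(2) h(4,5) 2] sub(2) by (metis order_trans)
  qed
qed auto

lemma tree_leaves_disjoint:
  assumes "tree \<Theta> \<delta> L" "good \<Theta>" "0 < \<delta>" "\<delta> < 1/2" "i < j" "j < length L"
  shows "fst (L!i) ` K (snd (L!i)) \<inter> fst (L!j) ` K (snd (L!j)) = {}"
  using assms
proof (induction arbitrary: i j rule: tree.induct)
  case (node \<rho> a h s \<delta> \<delta>' \<Theta> L1 L2)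
  have h: "0 < h" "h < 1/4" "0 < a" "0 < \<delta>'" "\<delta>' < 1/2"
    using node.hyps(2) by (auto simp: params_def)
  note g = good_child[OF node.prems(1) node.hyps(1) h(1-3)]
  consider "j < length L1" | "i < length L1" "length L1 \<le> j" | "length L1 \<le> i"
    by linarith
  then show ?case
  proof cases
    case 1
    then show ?thesis using node.IH(1)[OF g(1) h(4,5), of i j] node.prems by (simp add: nth_append)
  next
    case 3
    then show ?thesis
      using node.IH(2)[OF g(2) h(4,5), of "i - length L1" "j - length L1"] node.prems by (simp add: nth_append)
  next
    case 2
    then have L1: "(L1 @ L2) ! i \<in> set L1" and L2: "(L1 @ L2) ! j \<in> set L2"
      using node.prems by (auto simp: nth_append)
    have 1: "fst ((L1 @ L2) ! i) ` K (snd ((L1 @ L2) ! i)) \<subseteq> (\<Theta> \<circ> hat \<rho> \<circ> chip a h) ` K \<delta>'"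
      using tree_leaf_facts[OF node.hyps(3) g(1) h(4,5), of "fst ((L1 @ L2) ! i)" "snd ((L1 @ L2) ! i)"] L1 by simp
    have 2: "fst ((L1 @ L2) ! j) ` K (snd ((L1 @ L2) ! j)) \<subseteq> (\<Theta> \<circ> hat \<rho> \<circ> chim a h) ` K \<delta>'"
      using tree_leaf_facts[OF node.hyps(4) g(2) h(4,5), of "fst ((L1 @ L2) ! j)" "snd ((L1 @ L2) ! j)"] L2 by simp
    have "(\<Theta> \<circ> hat \<rho> \<circ> chip a h) ` K \<delta>' \<inter> (\<Theta> \<circ> hat \<rho> \<circ> chim a h) ` K \<delta>' = {}"
    proof (rule ccontr)
      assume "\<not> ?thesis"
      then obtain x y where xy: "x \<in> K \<delta>'" "y \<in> K \<delta>'" "\<Theta> (hat \<rho> (chip a h x)) = \<Theta> (hat \<rho> (chim a h y))" by auto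
      then have Od: "x \<in> Od" "y \<in> Od" using K_subset_Od h(5) by auto
      then have "hat \<rho> (chip a h x) \<in> Od" "hat \<rho> (chim a h y) \<in> Od"
        using child_in_Od h(1,2) hat_Od[OF node.hyps(1)] by auto
      then have "hat \<rho> (chip a h x) = hat \<rho> (chim a h y)"
        using node.prems(1) xy(3) by (auto simp: good_def inj_on_def)
      then have "chip a h x = chim a h y" using hat_inj[OF node.hyps(1)] by (simp add: inj_def)
      then show False using children_disjoint[OF node.hyps(2) xy(1,2)] by simp
    qed
    then show ?thesis using 1 2 by blast
  qed
qed auto

text \<open>All modifications happen on the source side, so a tree may be followed by any map; this
  is how the homeomorphism is applied to a whole tree.\<close>

lemma tree_compose:
  "tree \<Theta> \<delta> L \<Longrightarrow> tree (f \<circ> \<Theta>) \<delta> (map (\<lambda>(\<Theta>',\<delta>'). (f \<circ> \<Theta>', \<delta>')) L)"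
proof (induction rule: tree.induct)
  case (leaf \<Theta> \<delta>)
  then show ?case by (simp add: tree.leaf)
next
  case (node \<rho> a h s \<delta> \<delta>' \<Theta> L1 L2)
  show ?case
    using tree.node[OF node.hyps(1,2), of "f \<circ> \<Theta>", unfolded comp_assoc, OF node.IH[unfolded comp_assoc]]
    by (simp only: map_append)
qed

end

section \<open>Complements of embedded spheres\<close>

lemma acyc_starlike:
  fixes U :: "'a::real_normed_vector set"
  assumes "a \<in> U" "\<And>x. x \<in> U \<Longrightarrow> closed_segment a x \<subseteq> U"
  shows "acyc (Suc p) U"
  using assms by (intro acyc_contractible starlike_imp_contractible) (auto simp: starlike_def)

lemma acyc_convex: "convex (U::'a::real_normed_vector set) \<Longrightarrow> acyc (Suc p) U"
  by (simp add: acyc_contractible convex_imp_contractible)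

lemma acyc_disjoint_Un:
  fixes U V :: "'a::topological_space set"
  assumes "open U" "open V" "U \<inter> V = {}" "acyc (Suc 0) U" "acyc (Suc 0) V"
  shows "acyc (Suc 0) (U \<union> V)"
proof (rule acyc_Un[OF assms(1,2,4,5)])
  fix y assume "singular_chain 0 (top_of_set (U \<inter> V)) y"
  then have "y = 0" using assms(3) by (simp add: singular_chain_empty)
  then show "bounds 0 (U \<inter> V) y" by (auto intro!: boundsI[of _ _ 0])
qed

text \<open>The identity of \<open>U\<close> factors through \<open>V\<close> up to homotopy, so
  each cycle of \<open>U\<close> is homologous to the image of a cycle of \<open>V\<close>.\<close>

lemma acyc_homotopy_retract:
  fixes f :: "'a::topological_space \<Rightarrow> 'b::topological_space"
  assumes f: "continuous_on U f" "f ` U \<subseteq> V" and g: "continuous_on V g" "g ` V \<subseteq> U"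
    and hom: "homotopic_with_canon (\<lambda>x. True) U U id (g \<circ> f)" and V: "acyc (Suc p) V"
  shows "acyc (Suc p) U"
  unfolding acyc_def
proof (intro allI impI)
  fix z assume z: "singular_chain (Suc p) (top_of_set U) z" "chain_boundary (Suc p) z = 0"
  have cf: "continuous_map (top_of_set U) (top_of_set V) f" using f by auto
  have "bounds (Suc p) V (chain_map (Suc p) f z)"
    using V singular_chain_chain_map[OF z(1) cf] chain_boundary_chain_map[OF z(1), of f] z(2)
    unfolding acyc_def by (metis chain_map_0)
  then have b: "bounds (Suc p) U (chain_map (Suc p) (g \<circ> f) z)"
    using bounds_image[OF g] by (simp add: chain_map_compose)
  have "homotopic_with (\<lambda>h. h \<in> {} \<rightarrow> {}) (top_of_set U) (top_of_set U) id (g \<circ> f)"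
    using hom by (simp add: homotopic_with_mono)
  moreover have "singular_relcycle (Suc p) (top_of_set U) {} z" using z by (simp add: singular_cycle)
  ultimately have "homologous_rel (Suc p) (top_of_set U) {} (chain_map (Suc p) id z) (chain_map (Suc p) (g \<circ> f) z)"
    by (rule homotopic_imp_homologous_rel_chain_maps)
  moreover have "chain_map (Suc p) id z = z" using chain_map_id_gen[OF z(1)] by simp
  ultimately obtain c where c: "singular_chain (Suc (Suc p)) (top_of_set U) c"
      "chain_boundary (Suc (Suc p)) c = z - chain_map (Suc p) (g \<circ> f) z"
    by (auto simp: homologous_rel_def singular_boundary)
  obtain d where d: "singular_chain (Suc (Suc p)) (top_of_set U) d"
      "chain_boundary (Suc (Suc p)) d = chain_map (Suc p) (g \<circ> f) z"
    using b by (auto simp: bounds_def)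
  show "bounds (Suc p) U z"
    using c d by (intro boundsI[of _ _ "c + d"]) (auto simp: chain_boundary_add singular_chain_add)
qed

locale sphere_frame4 = sphere_frame +
  fixes b1 b2 :: 'a
  assumes norm_b [simp]: "norm b1 = 1" "norm b2 = 1"
    and orth_b [simp]: "b1 \<bullet> e0 = 0" "b1 \<bullet> et = 0" "b2 \<bullet> e0 = 0" "b2 \<bullet> et = 0" "b1 \<bullet> b2 = 0"
begin

text \<open>The set omits the span of \<open>e0\<close> and \<open>et\<close>, which has codimension
  at least 2 thanks to \<open>b1\<close> and \<open>b2\<close>. Segments avoid it unless the
  projections are parallel; then a detour over \<open>b1\<close> or \<open>b2\<close> helps.\<close>

lemma path_connected_pr_nonzero: "path_connected {x. pr x \<noteq> 0}"
proof -
  let ?A = "{x. pr x \<noteq> 0}"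
  have lin: "pr ((1 - s) *\<^sub>R x + s *\<^sub>R y) = (1 - s) *\<^sub>R pr x + s *\<^sub>R pr y" for s x y
    by (simp add: pr_add pr_scale)
  have seg: "closed_segment x y \<subseteq> ?A" if "x \<in> ?A" "y \<in> ?A" "\<forall>c. pr y \<noteq> c *\<^sub>R pr x" for x y
  proof
    fix p assume "p \<in> closed_segment x y"
    then obtain s where s: "p = (1 - s) *\<^sub>R x + s *\<^sub>R y" by (auto simp: closed_segment_def)
    have "pr p \<noteq> 0"
    proof
      assume "pr p = 0"
      then have *: "(1 - s) *\<^sub>R pr x + s *\<^sub>R pr y = 0" by (simp add: s lin)
      have "s \<noteq> 0" using * that by auto
      then have "pr y = (- (1 - s) / s) *\<^sub>R pr x"
        using * by (metis (no_types, lifting) add.commute add_eq_0_iff divideR_right divide_inverse_commute eq_vector_fraction_iff scaleR_minus_left scaleR_scaleR)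
      then show False using that(3) by blast
    qed
    then show "p \<in> ?A" by simp
  qed
  have pc: "path_component ?A x y" if "x \<in> ?A" "y \<in> ?A" "\<forall>c. pr y \<noteq> c *\<^sub>R pr x" for x y
    using path_component_of_subset[OF seg[OF that]] convex_imp_path_connected[OF convex_closed_segment, of x y]
    by (meson ends_in_segment path_connected_component)
  have b: "pr b1 = b1" "pr b2 = b2" "b1 \<noteq> 0" "b2 \<noteq> 0" using norm_b by (auto simp del: norm_b)
  have notboth: "\<not> (\<exists>c. x = c *\<^sub>R b1) \<or> \<not> (\<exists>c. x = c *\<^sub>R b2)" if "x \<noteq> 0" for x
  proof (rule ccontr)
    assume "\<not> ?thesis"
    then obtain c d where "x = c *\<^sub>R b1" "x = d *\<^sub>R b2" by blast
    then have "x \<bullet> x = (c * d) * (b1 \<bullet> b2)" by (metis inner_scaleR_left inner_scaleR_right mult.assoc)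
    then show False using that by simp
  qed
  have "path_component ?A x y" if xy: "x \<in> ?A" "y \<in> ?A" for x y
  proof (cases "\<exists>c. pr y = c *\<^sub>R pr x")
    case False
    then show ?thesis using pc xy by blast
  next
    case True
    then obtain c where c: "pr y = c *\<^sub>R pr x" by blast
    then have c0: "c \<noteq> 0" using xy by auto
    have "(b1 \<in> ?A \<and> \<not> (\<exists>c. pr x = c *\<^sub>R pr b1)) \<or> (b2 \<in> ?A \<and> \<not> (\<exists>c. pr x = c *\<^sub>R pr b2))"
      using notboth[of "pr x"] xy(1) unfolding b(1,2) mem_Collect_eq using b(3,4) by blast
    then obtain u where u: "u \<in> ?A" "\<not> (\<exists>c. pr x = c *\<^sub>R pr u)" by blast
    have "\<not> (\<exists>c. pr y = c *\<^sub>R pr u)"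
    proof
      assume "\<exists>d. pr y = d *\<^sub>R pr u"
      then obtain d where "c *\<^sub>R pr x = d *\<^sub>R pr u" using c by metis
      then have "pr x = (d / c) *\<^sub>R pr u" using c0 by (metis divideR_right divide_inverse_commute scaleR_scaleR)
      then show False using u(2) by blast
    qed
    then have "path_component ?A u x" "path_component ?A u y" using pc u xy by blast+
    then show ?thesis by (meson path_component_sym path_component_trans)
  qed
  then show ?thesis by (simp add: path_connected_component)
qed

text \<open>The complement of the line spanned by \<open>e0\<close>, covered by two starlike sets
  whose intersection is the connected complement of a plane. Each such covering gains one
  codimension and one degree.\<close>

lemma acyc_1_pr_bar: "acyc 1 {x. bar x \<noteq> (x \<bullet> e0) *\<^sub>R e0 \<or> x \<bullet> et \<noteq> 0}"
proof -
  let ?U = "{x. pr x \<noteq> 0 \<or> x \<bullet> et < 0}" and ?V = "{x. pr x \<noteq> 0 \<or> x \<bullet> et > 0}"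
  have op: "open {x. pr x \<noteq> 0}" "open {x::'a. x \<bullet> et < 0}" "open {x::'a. x \<bullet> et > 0}"
    by (intro open_Collect_neq open_Collect_less continuous_intros)+
  have oU: "open ?U" "open ?V" unfolding Collect_disj_eq by (intro open_Un op)+
  have "acyc (Suc 0) ?U"
  proof (rule acyc_starlike[of "- et"])
    show "- et \<in> ?U" by simp
    fix x assume x: "x \<in> ?U"
    show "closed_segment (- et) x \<subseteq> ?U"
    proof
      fix p assume "p \<in> closed_segment (- et) x"
      then obtain s where s: "p = (1 - s) *\<^sub>R (- et) + s *\<^sub>R x" "0 \<le> s" "s \<le> 1" by (auto simp: closed_segment_def)
      have "pr p = s *\<^sub>R pr x" by (simp add: s pr_add pr_diff pr_scale)
      moreover have "p \<bullet> et = - (1 - s) + s * (x \<bullet> et)" by (simp add: s inner_add_left inner_diff_left)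
      ultimately show "p \<in> ?U" using x s
        by (cases "s = 0"; cases "pr x = 0") (auto simp: mult_pos_neg add_nonpos_neg)
    qed
  qed
  moreover have "acyc (Suc 0) ?V"
  proof (rule acyc_starlike[of et])
    show "et \<in> ?V" by simp
    fix x assume x: "x \<in> ?V"
    show "closed_segment et x \<subseteq> ?V"
    proof
      fix p assume "p \<in> closed_segment et x"
      then obtain s where s: "p = (1 - s) *\<^sub>R et + s *\<^sub>R x" "0 \<le> s" "s \<le> 1" by (auto simp: closed_segment_def)
      have "pr p = s *\<^sub>R pr x" by (simp add: s pr_add pr_scale)
      moreover have "p \<bullet> et = (1 - s) + s * (x \<bullet> et)" by (simp add: s inner_add_left inner_diff_left)
      ultimately show "p \<in> ?V" using x s
        by (cases "s = 0"; cases "pr x = 0") (auto simp: add_nonneg_pos)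
    qed
  qed
  moreover have UV: "?U \<inter> ?V = {x. pr x \<noteq> 0}" by auto
  ultimately have "acyc (Suc 0) (?U \<union> ?V)"
    using acyc_Un[OF oU, of 0] path_connected_pr_nonzero bounds_zero_path_connected by metis
  moreover have "?U \<union> ?V = {x. bar x \<noteq> (x \<bullet> e0) *\<^sub>R e0 \<or> x \<bullet> et \<noteq> 0}"
    by (auto simp: bar_pr)
  ultimately show ?thesis by simp
qed

text \<open>The same covering argument once more, from the complement of a line to that of a
  point.\<close>

lemma acyc_2_punctured: "acyc 2 (- {0::'a})"
proof -
  have zero_iff: "x = 0 \<longleftrightarrow> pr x = 0 \<and> x \<bullet> et = 0 \<and> x \<bullet> e0 = 0" for x
    using decompose_eq[of x 0] by (auto simp: pr_def)
  let ?L = "\<lambda>x. pr x \<noteq> 0 \<or> x \<bullet> et \<noteq> 0"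
  let ?U = "{x. ?L x \<or> x \<bullet> e0 < 0}" and ?V = "{x. ?L x \<or> x \<bullet> e0 > 0}"
  have op: "open {x. pr x \<noteq> 0}" "open {x::'a. x \<bullet> et \<noteq> 0}" "open {x::'a. x \<bullet> e0 < 0}" "open {x::'a. x \<bullet> e0 > 0}"
    by (intro open_Collect_neq open_Collect_less continuous_intros)+
  have oU: "open ?U" "open ?V" unfolding Collect_disj_eq by (intro open_Un op)+
  have "acyc (Suc 1) ?U"
  proof (rule acyc_starlike[of "- e0"])
    show "- e0 \<in> ?U" by simp
    fix x assume x: "x \<in> ?U"
    show "closed_segment (- e0) x \<subseteq> ?U"
    proof
      fix p assume "p \<in> closed_segment (- e0) x"
      then obtain s where s: "p = (1 - s) *\<^sub>R (- e0) + s *\<^sub>R x" "0 \<le> s" "s \<le> 1" by (auto simp: closed_segment_def)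
      have "pr p = s *\<^sub>R pr x" by (simp add: s pr_add pr_diff pr_scale)
      moreover have "p \<bullet> e0 = - (1 - s) + s * (x \<bullet> e0)" "p \<bullet> et = s * (x \<bullet> et)" by (auto simp: s inner_add_left inner_diff_left)
      ultimately show "p \<in> ?U" using x s
        by (cases "s = 0"; cases "?L x") (auto simp: mult_pos_neg add_nonpos_neg)
    qed
  qed
  moreover have "acyc (Suc 1) ?V"
  proof (rule acyc_starlike[of e0])
    show "e0 \<in> ?V" by simp
    fix x assume x: "x \<in> ?V"
    show "closed_segment e0 x \<subseteq> ?V"
    proof
      fix p assume "p \<in> closed_segment e0 x"
      then obtain s where s: "p = (1 - s) *\<^sub>R e0 + s *\<^sub>R x" "0 \<le> s" "s \<le> 1" by (auto simp: closed_segment_def)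
      have "pr p = s *\<^sub>R pr x" by (simp add: s pr_add pr_scale)
      moreover have "p \<bullet> e0 = (1 - s) + s * (x \<bullet> e0)" "p \<bullet> et = s * (x \<bullet> et)" by (auto simp: s inner_add_left inner_diff_left)
      ultimately show "p \<in> ?V" using x s
        by (cases "s = 0"; cases "?L x") (auto simp: add_nonneg_pos)
    qed
  qed
  moreover have "?U \<inter> ?V = {x. bar x \<noteq> (x \<bullet> e0) *\<^sub>R e0 \<or> x \<bullet> et \<noteq> 0}" by (auto simp: bar_pr)
  then have "acyc 1 (?U \<inter> ?V)" using acyc_1_pr_bar by simp
  ultimately have "acyc (Suc 1) (?U \<union> ?V)" using oU by (intro acyc_Un_acyc)
  moreover have "?U \<union> ?V = - {0}"
  proof -
    have "x \<in> ?U \<union> ?V \<longleftrightarrow> x \<in> - {0}" for x using zero_iff[of x] by auto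
    then show ?thesis by blast
  qed
  ultimately show ?thesis by (simp add: numeral_2_eq_2)
qed

section \<open>The complement of the sphere inside its neighbourhood\<close>

definition disc :: "'a set" where "disc = {x. x \<bullet> et = 0 \<and> norm (bar x) \<le> 1}"
definition antidisc :: "'a set" where "antidisc = {x. x \<bullet> et = 0 \<and> norm (bar x) \<ge> 1}"

lemma closed_disc: "closed disc" "closed antidisc"
  unfolding disc_def antidisc_def
  by (intro closed_Collect_conj closed_Collect_eq closed_Collect_le continuous_intros)+

lemma disc_simps: "disc \<inter> antidisc = S" "disc \<union> antidisc = {x. x \<bullet> et = 0}"
  by (auto simp: disc_def antidisc_def S_def bar_def)

lemma bar_scale: "bar (c *\<^sub>R x) = c *\<^sub>R bar x"
  by (simp add: bar_def algebra_simps)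

lemma zero_bar: "bar x = 0 \<Longrightarrow> x \<bullet> et = 0 \<Longrightarrow> x = 0"
  by (simp add: bar_def)

lemma acyc_2_Od_disc: "acyc 2 (Od - disc)"
proof -
  \<comment> \<open>The gauge of a box with half-widths 3/2 and 1/4: the box lies inside
    \<open>Od\<close> and has the disc in its interior, on which \<open>N\<close> is at most 2/3.
    Moving radially onto its surface compares \<open>Od - disc\<close> with punctured space.\<close>
  define N where "N x = max (norm (bar x) / (3/2)) (\<bar>x \<bullet> et\<bar> / (1/4))" for x :: 'a
  have N0: "N x > 0" if "x \<noteq> 0" for x
    using that zero_bar[of x] by (auto simp: N_def less_max_iff_disj)
  have N0': "N x \<noteq> 0" if "x \<noteq> 0" for x using N0[OF that] by simp
  have Ncont: "continuous_on A N" for A unfolding N_def by (intro continuous_intros) auto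
  have cone: "c *\<^sub>R x \<in> Od - disc"
    if x: "x \<in> Od - disc" and c: "c > 0" "c = (1 - s) + s / N x" "0 \<le> s" "s \<le> 1" for x c s
  proof -
    have x0: "x \<noteq> 0" using x by (auto simp: disc_def bar_def)
    have n: "N x > 0" using N0 x0 by blast
    have "norm (bar x) \<le> (3/2) * N x" "\<bar>x \<bullet> et\<bar> \<le> (1/4) * N x" by (auto simp: N_def max_def)
    then have *: "norm (bar x) / N x \<le> 3/2" "\<bar>x \<bullet> et\<bar> / N x \<le> 1/4" using n by (auto simp: field_simps)
    have lt: "norm (bar x) / N x < 2" "\<bar>x \<bullet> et\<bar> / N x < 1/2" using * by linarith+
    have xl: "norm (bar x) < 2" "\<bar>x \<bullet> et\<bar> < 1/2" using x by (auto simp: Od_def)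
    have "c * norm (bar x) = (1 - s) * norm (bar x) + s * (norm (bar x) / N x)"
      "c * \<bar>x \<bullet> et\<bar> = (1 - s) * \<bar>x \<bullet> et\<bar> + s * (\<bar>x \<bullet> et\<bar> / N x)"
      by (auto simp: c algebra_simps)
    moreover have "(1 - s) * norm (bar x) + s * (norm (bar x) / N x) < 2"
      using lt xl c(3,4) by (intro convex_bound_lt) simp_all
    moreover have "(1 - s) * \<bar>x \<bullet> et\<bar> + s * (\<bar>x \<bullet> et\<bar> / N x) < 1/2"
      using lt xl c(3,4) by (intro convex_bound_lt) simp_all
    ultimately have Od: "c *\<^sub>R x \<in> Od" using c(1) by (simp add: Od_def bar_scale abs_mult)
    have "c *\<^sub>R x \<notin> disc"
    proof (cases "x \<bullet> et = 0")
      case False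
      then show ?thesis using c(1) by (simp add: disc_def)
    next
      case True
      then have g: "norm (bar x) > 1" using x by (auto simp: disc_def)
      then have "N x = norm (bar x) / (3/2)" using True by (simp add: N_def max_def)
      then have q: "norm (bar x) / N x = 3/2" using g by (simp add: field_simps)
      have "c * norm (bar x) = (1 - s) * norm (bar x) + s * (norm (bar x) / N x)"
        by (auto simp: c algebra_simps)
      also have "\<dots> > 1" unfolding q
        using convex_bound_lt[of "- norm (bar x)" "-1" "-(3/2)" "1 - s" s] g c by simp
      finally show ?thesis using c(1) by (simp add: disc_def bar_scale)
    qed
    then show ?thesis using Od by blast
  qed
  have Nscale: "N (x /\<^sub>R N x) = 1" if "x \<noteq> 0" for x
  proof -
    have "N (c *\<^sub>R x) = c * N x" if "c > 0" for c
      using that by (simp add: N_def bar_scale abs_mult max_mult_distrib_left)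
    then show ?thesis using N0[OF that] by simp
  qed
  have "acyc (Suc 1) (Od - disc)"
  proof (rule acyc_homotopy_retract[where V = "- {0}" and f = id and g = "\<lambda>x. x /\<^sub>R N x"])
    show "id ` (Od - disc) \<subseteq> - {0}" by (auto simp: disc_def bar_def)
    show "continuous_on (- {0}) (\<lambda>x. x /\<^sub>R N x)"
      by (intro continuous_intros Ncont) (simp add: N0')
    show "(\<lambda>x. x /\<^sub>R N x) ` (- {0}) \<subseteq> Od - disc"
    proof (rule image_subsetI)
      fix x :: 'a assume "x \<in> - {0}"
      then have "x \<noteq> 0" by simp
      let ?y = "x /\<^sub>R N x"
      have N1: "N ?y = 1" using Nscale \<open>x \<noteq> 0\<close> by blast
      define y where "y = ?y"
      have N1: "N y = 1" using N1 by (simp add: y_def)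
      have b: "norm (bar y) / (3/2) \<le> 1" "\<bar>y \<bullet> et\<bar> / (1/4) \<le> 1"
        using N1 unfolding N_def by (metis max.cobounded1, metis max.cobounded2)
      have "\<not> (y \<bullet> et = 0 \<and> norm (bar y) \<le> 1)"
      proof
        assume "y \<bullet> et = 0 \<and> norm (bar y) \<le> 1"
        then have "N y \<le> 2/3" by (simp add: N_def)
        then show False using N1 by simp
      qed
      then have "y \<in> Od - disc" using b by (simp add: Od_def disc_def)
      then show "?y \<in> Od - disc" by (simp add: y_def)
    qed
    show "homotopic_with_canon (\<lambda>x. True) (Od - disc) (Od - disc) id ((\<lambda>x. x /\<^sub>R N x) \<circ> id)"
    proof (rule homotopic_with_linear)
      fix x assume x: "x \<in> Od - disc"
      show "closed_segment (id x) (((\<lambda>x. x /\<^sub>R N x) \<circ> id) x) \<subseteq> Od - disc"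
      proof
        fix p assume "p \<in> closed_segment (id x) (((\<lambda>x. x /\<^sub>R N x) \<circ> id) x)"
        then obtain s where s: "p = (1 - s) *\<^sub>R x + s *\<^sub>R (x /\<^sub>R N x)" "0 \<le> s" "s \<le> 1"
          by (auto simp: closed_segment_def)
        have "x \<noteq> 0" using x by (auto simp: disc_def bar_def)
        then have n: "N x > 0" using N0 by blast
        have "p = ((1 - s) + s / N x) *\<^sub>R x" by (simp add: s algebra_simps divide_inverse)
        moreover have "(1 - s) + s / N x > 0"
        proof (cases "s = 1")
          case False
          then have "1 - s > 0" "s / N x \<ge> 0" using s n by auto
          then show ?thesis by linarith
        qed (use n in simp)
        ultimately show "p \<in> Od - disc" using cone[OF x _ HOL.refl s(2,3)] by simp
      qed
    next
      have "x \<noteq> 0" if "x \<in> Od - disc" for x using that by (auto simp: disc_def bar_def)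
      then show "continuous_on (Od - disc) ((\<lambda>x. x /\<^sub>R N x) \<circ> id)"
        unfolding comp_id by (intro continuous_intros Ncont) (simp add: N0')
    qed (simp_all add: continuous_on_id')
  qed (simp_all add: acyc_2_punctured[unfolded numeral_2_eq_2] continuous_on_id')
  then show ?thesis by (simp add: numeral_2_eq_2)
qed

lemma bar_0 [simp]: "bar 0 = 0"
  by (simp add: bar_def)

lemma acyc_Od_antidisc: "acyc (Suc p) (Od - antidisc)"
proof (rule acyc_starlike[of 0])
  show "0 \<in> Od - antidisc" by (simp add: Od_def antidisc_def)
  fix x assume x: "x \<in> Od - antidisc"
  show "closed_segment 0 x \<subseteq> Od - antidisc"
  proof
    fix p assume "p \<in> closed_segment 0 x"
    then obtain s where s: "p = s *\<^sub>R x" "0 \<le> s" "s \<le> 1" by (auto simp: closed_segment_def)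
    have "s * norm (bar x) \<le> norm (bar x)" "s * \<bar>x \<bullet> et\<bar> \<le> \<bar>x \<bullet> et\<bar>"
      using s by (auto intro: mult_left_le_one_le)
    then show "p \<in> Od - antidisc"
      using x s by (cases "s = 0") (auto simp: Od_def antidisc_def bar_scale abs_mult)
  qed
qed

lemma Od_split:
  "open (Od - disc)" "open (Od - antidisc)" "(Od - disc) \<union> (Od - antidisc) = Od - S"
  "(Od - disc) \<inter> (Od - antidisc) = (Od \<inter> {x. x \<bullet> et < 0}) \<union> (Od \<inter> {x. x \<bullet> et > 0})"
proof -
  show "open (Od - disc)" "open (Od - antidisc)" using open_Od closed_disc by auto
  show "(Od - disc) \<union> (Od - antidisc) = Od - S" using disc_simps(1) by blast
  have "(Od - disc) \<inter> (Od - antidisc) = Od - {x. x \<bullet> et = 0}" using disc_simps(2) by blast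
  also have "\<dots> = (Od \<inter> {x. x \<bullet> et < 0}) \<union> (Od \<inter> {x. x \<bullet> et > 0})"
    by (auto simp: neq_iff)
  finally show "(Od - disc) \<inter> (Od - antidisc) = (Od \<inter> {x. x \<bullet> et < 0}) \<union> (Od \<inter> {x. x \<bullet> et > 0})" .
qed

text \<open>Removing the disc or its exterior in the hyperplane covers the complement of the sphere;
  the two pieces meet in two convex halves, on either side of the hyperplane.\<close>

lemma acyc_2_Od_S: "acyc 2 (Od - S)"
proof -
  have "acyc (Suc 0) ((Od \<inter> {x. x \<bullet> et < 0}) \<union> (Od \<inter> {x. x \<bullet> et > 0}))"
  proof (rule acyc_disjoint_Un)
    show "open (Od \<inter> {x. x \<bullet> et < 0})" "open (Od \<inter> {x. x \<bullet> et > 0})"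
      by (intro open_Int open_Od open_Collect_less continuous_intros)+
    show "acyc (Suc 0) (Od \<inter> {x. x \<bullet> et < 0})" "acyc (Suc 0) (Od \<inter> {x. x \<bullet> et > 0})"
      using convex_halfspace_lt[of et 0] convex_halfspace_gt[of 0 et]
      by (auto intro!: acyc_convex convex_Int convex_Od simp: inner_commute)
  qed auto
  then have "acyc (Suc 1) ((Od - disc) \<union> (Od - antidisc))"
    using acyc_2_Od_disc acyc_Od_antidisc[of 1] Od_split
    by (intro acyc_Un_acyc) (auto simp: numeral_2_eq_2)
  then show ?thesis by (simp add: Od_split numeral_2_eq_2)
qed

lemma good_homeomorphism:
  assumes "good \<Theta>"
  obtains g where "homeomorphism Od (\<Theta> ` Od) \<Theta> g" "open (\<Theta> ` Od)"
proof -
  have c: "continuous_on Od \<Theta>" "inj_on \<Theta> Od" using assms by (auto simp: good_def)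
  obtain g where "homeomorphism Od (\<Theta> ` Od) \<Theta> g"
    by (rule invariance_of_domain_homeomorphism[OF open_Od c(1) _ c(2)]) simp_all
  then show thesis using that invariance_of_domain[OF c(1) open_Od c(2)] by blast
qed

lemma good_diff:
  assumes "good \<Theta>"
  shows "- (\<Theta> ` S) \<inter> \<Theta> ` Od = \<Theta> ` (Od - S)"
proof -
  have "\<Theta> ` (Od - S) = \<Theta> ` Od - \<Theta> ` S"
    using assms S_subset_Od by (intro inj_on_image_set_diff[of \<Theta> Od]) (auto simp: good_def)
  then show ?thesis by blast
qed

lemma closed_good_S: "good \<Theta> \<Longrightarrow> closed (\<Theta> ` S)"
  using compact_S S_subset_Od unfolding good_def
  by (meson compact_continuous_image compact_imp_closed continuous_on_subset)

text \<open>The image of \<open>Od\<close> is an open neighbourhood, and together with the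
  complement it covers the whole space, so only the model computation in \<open>Od - S\<close> is
  needed.\<close>

theorem acyc_2_sphere_complement:
  assumes "good \<Theta>"
  shows "acyc 2 (- (\<Theta> ` S))"
proof -
  obtain g where g: "homeomorphism Od (\<Theta> ` Od) \<Theta> g" "open (\<Theta> ` Od)"
    using good_homeomorphism[OF assms] .
  have "homeomorphism (Od - S) (\<Theta> ` (Od - S)) \<Theta> g"
    using g(1) by (rule homeomorphism_of_subsets) auto
  then have "acyc 2 (- (\<Theta> ` S) \<inter> \<Theta> ` Od)"
    using acyc_homeomorphic acyc_2_Od_S good_diff[OF assms] by metis
  moreover have "- (\<Theta> ` S) \<union> \<Theta> ` Od = UNIV" using S_subset_Od by auto
  moreover have "acyc 2 (UNIV :: 'a set)"
    using acyc_convex[of UNIV 1] by (simp add: numeral_2_eq_2)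
  ultimately show ?thesis
    using acyc_excision[of "- (\<Theta> ` S)" "\<Theta> ` Od" 2] closed_good_S[OF assms] g(2) by (simp add: open_Compl)
qed

end

section \<open>Holonomy of polygons\<close>

lemma singular_simplex_edge:
  fixes G :: "'b::real_normed_vector \<Rightarrow> 'a::topological_space"
  assumes "continuous_on (closed_segment P Q) G" "G ` closed_segment P Q \<subseteq> W"
  shows "singular_simplex 1 (top_of_set W) (edge G P Q)"
proof -
  let ?f = "\<lambda>x::nat\<Rightarrow>real. x 0 *\<^sub>R P + x 1 *\<^sub>R Q"
  have c: "continuous_on (standard_simplex 1) ?f"
    by (intro continuous_intros continuous_on_product_coordinates[THEN continuous_on_subset]) auto
  have sub: "?f ` standard_simplex 1 \<subseteq> closed_segment P Q"
  proof (rule image_subsetI)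
    fix x :: "nat \<Rightarrow> real" assume "x \<in> standard_simplex 1"
    then have "0 \<le> x 1" "x 1 \<le> 1" "x 0 = 1 - x 1" by (auto simp: standard_simplex_def)
    then show "?f x \<in> closed_segment P Q" unfolding closed_segment_def by auto
  qed
  have "continuous_on (standard_simplex 1) (\<lambda>x. G (?f x))"
    by (rule continuous_on_compose2[OF assms(1) c sub])
  moreover have "(\<lambda>x. G (?f x)) ` standard_simplex 1 \<subseteq> W" using assms(2) sub by blast
  ultimately have "continuous_map (top_of_set (standard_simplex 1)) (top_of_set W) (\<lambda>x. G (?f x))"
    by (auto simp: continuous_map_in_subtopology)
  then have "continuous_map (top_of_set (standard_simplex 1)) (top_of_set W) (edge G P Q)"
    unfolding edge_def by (rule continuous_map_eq) auto
  then show ?thesis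
    by (simp add: singular_simplex_def euclidean_product_topology edge_def)
qed

definition point_simplex :: "'a \<Rightarrow> (nat \<Rightarrow> real) \<Rightarrow> 'a" where
  "point_simplex x = (\<lambda>_\<in>standard_simplex 0. x)"

lemma edge_faces:
  "singular_face 1 0 (edge G P Q) = point_simplex (G Q)"
  "singular_face 1 1 (edge G P Q) = point_simplex (G P)"
proof -
  have in1: "simplical_face k x \<in> standard_simplex 1" if "k \<le> 1" "x \<in> standard_simplex 0" for k x
    using simplical_face_in_standard_simplex[of 1 k x] that by simp
  have x0: "x 0 = 1" if "x \<in> standard_simplex 0" for x
    using that by (auto simp: standard_simplex_0)
  have f: "singular_face 1 k (edge G P Q) = (\<lambda>x\<in>standard_simplex 0. G (simplical_face k x 0 *\<^sub>R P
      + simplical_face k x 1 *\<^sub>R Q))" if "k \<le> 1" for k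
    using in1[OF that] by (auto simp: singular_face_def edge_def restrict_def)
  have v: "simplical_face 0 x 0 = 0" "simplical_face 0 x 1 = x 0" "simplical_face 1 x 0 = x 0" "simplical_face 1 x 1 = 0" for x :: "nat \<Rightarrow> real"
    by (auto simp: simplical_face_def)
  show "singular_face 1 0 (edge G P Q) = point_simplex (G Q)"
    unfolding f[OF zero_le_one] point_simplex_def v by (rule restrict_ext) (simp add: x0)
  show "singular_face 1 1 (edge G P Q) = point_simplex (G P)"
    unfolding f[OF order_refl] point_simplex_def v by (rule restrict_ext) (simp add: x0)
qed

lemma edge_boundary:
  "chain_boundary 1 (frag_of (edge G P Q)) = frag_of (point_simplex (G Q)) - frag_of (point_simplex (G P))"
  using edge_faces[of G P Q] by (simp add: chain_boundary_of)

lemma edge_compose: "edge (f \<circ> G) P Q = simplex_map 1 f (edge G P Q)"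
  by (auto simp: edge_def simplex_map_def restrict_def)

fun polygon :: "('b::real_vector \<Rightarrow> 'a) \<Rightarrow> 'b list \<Rightarrow> 'a chain" where
  "polygon G (P # Q # Ps) = frag_of (edge G P Q) + polygon G (Q # Ps)"
| "polygon G Ps = 0"

definition unit_square :: "(real \<times> real) list" where
  "unit_square = [(-1,-1),(1,-1),(1,1),(-1,1),(-1,-1)]"

definition square_boundary :: "(real \<times> real) set" where
  "square_boundary = {(x,y). max \<bar>x\<bar> \<bar>y\<bar> = 1}"

lemma unit_square_segments:
  "successively (\<lambda>P Q. closed_segment P Q \<subseteq> square_boundary) unit_square"
proof -
  have *: "max \<bar>1 - u - u\<bar> (1::real) = 1" "max \<bar>u - (1 - u)\<bar> (1::real) = 1"
     "max 1 \<bar>1 - u - u\<bar> = (1::real)" "max 1 \<bar>u - (1 - u)\<bar> = (1::real)" if "0 \<le> u" "u \<le> 1" for u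
    using that by (auto simp: max_def abs_if)
  show ?thesis
    unfolding unit_square_def square_boundary_def
    by (auto simp: closed_segment_def algebra_simps)
qed

lemma unit_square_in: "hd unit_square \<in> square_boundary" "unit_square \<noteq> []" "last unit_square = hd unit_square"
  by (auto simp: unit_square_def square_boundary_def)

section \<open>Corner matrices and block matrices\<close>

definition corner :: "nat \<Rightarrow> nat \<Rightarrow> real \<Rightarrow> utri" where
  "corner i k c = Abs_utri (\<lambda>a b. if a = i \<and> b = k \<and> i \<le> k then c else 0)"

lemma entry_corner: "entry (corner i k c) a b = (if a = i \<and> b = k \<and> i \<le> k then c else 0)"
  unfolding corner_def by (subst Abs_utri_inverse) auto

definition blocked :: "nat \<Rightarrow> nat \<Rightarrow> utri \<Rightarrow> bool" where
  "blocked i k M \<longleftrightarrow> (\<forall>a b. a \<le> b \<longrightarrow> \<not> (i \<le> a \<and> b \<le> k) \<longrightarrow> entry M a b = (if a = b then 1 else 0))"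

lemma blocked_mult:
  assumes "blocked i k M" "blocked i k N"
  shows "blocked i k (M * N)"
  unfolding blocked_def
proof (intro allI impI)
  fix a b :: nat assume ab: "a \<le> b" "\<not> (i \<le> a \<and> b \<le> k)"
  show "entry (M * N) a b = (if a = b then 1 else 0)"
  proof (cases "a = b")
    case True
    then show ?thesis using assms ab by (simp add: entry_times_diag blocked_def)
  next
    case False
    then have "a < b" using ab by simp
    have z: "entry M a c * entry N c b = 0" if "c \<in> {a<..<b}" for c
    proof (cases "i \<le> a")
      case True
      then have "\<not> b \<le> k" using ab by simp
      then show ?thesis using assms(2) that by (simp add: blocked_def)
    next
      case False
      then show ?thesis using assms(1) that by (simp add: blocked_def)
    qed
    have "entry M a b = 0" "entry N a b = 0" using assms ab \<open>a < b\<close> by (auto simp: blocked_def)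
    moreover have "(\<Sum>c\<in>{a<..<b}. entry M a c * entry N c b) = 0" by (rule sum.neutral) (use z in blast)
    ultimately show ?thesis using \<open>a < b\<close> by (simp add: entry_times_strict)
  qed
qed

lemma blocked_1: "blocked i k 1"
  by (simp add: blocked_def one_utri.rep_eq)

text \<open>The corner is the top right entry of its block, so strictly upper triangular parts
  inside the block annihilate it. Hence \<open>1 + corner i k c\<close> commutes with every blocked
  unipotent matrix.\<close>

lemma corner_mult:
  assumes "blocked i k M" "unipotent M" "i \<le> k"
  shows "M * corner i k c = corner i k c" "corner i k c * M = corner i k c"
proof -
  show "M * corner i k c = corner i k c"
  proof (rule utri_eqI)
    fix a b :: nat assume ab: "a \<le> b"
    have "entry (M * corner i k c) a b = (\<Sum>j\<in>{a..b}. if j = i then entry M a i * (if b = k then c else 0) else 0)"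
      unfolding times_utri.rep_eq using assms(3) by (intro sum.cong) (auto simp: entry_corner)
    also have "\<dots> = (if i \<in> {a..b} then entry M a i * (if b = k then c else 0) else 0)"
      by (simp add: sum.delta)
    also have "\<dots> = entry (corner i k c) a b"
      using assms ab by (auto simp: entry_corner blocked_def unipotent_def)
    finally show "entry (M * corner i k c) a b = entry (corner i k c) a b" .
  qed
  show "corner i k c * M = corner i k c"
  proof (rule utri_eqI)
    fix a b :: nat assume ab: "a \<le> b"
    have "entry (corner i k c * M) a b = (\<Sum>j\<in>{a..b}. if j = k then (if a = i then c else 0) * entry M k b else 0)"
      unfolding times_utri.rep_eq using assms(3) by (intro sum.cong) (auto simp: entry_corner)
    also have "\<dots> = (if k \<in> {a..b} then (if a = i then c else 0) * entry M k b else 0)"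
      by (simp add: sum.delta)
    also have "\<dots> = entry (corner i k c) a b"
      using assms ab by (auto simp: entry_corner blocked_def unipotent_def)
    finally show "entry (corner i k c * M) a b = entry (corner i k c) a b" .
  qed
qed

lemma blocked_hol_simplex: "blocked i k (hol_simplex A i k \<tau>)"
  by (auto simp: blocked_def entry_hol_simplex)

text \<open>The entries \<open>(a, b)\<close> with \<open>a < j < b\<close> stay unknown. They enter
  both products linearly and alike; the only product of off-diagonal entries that survives is the
  one of \<open>(i, j)\<close> with \<open>(j, k)\<close>.\<close>

lemma commutator_corner:
  assumes ij: "i < j" "j < k" and b: "blocked i k e" "blocked i k n" "unipotent e" "unipotent n"
    and e: "\<And>a b. i \<le> a \<Longrightarrow> a < b \<Longrightarrow> b \<le> j \<Longrightarrow> entry e a b = (if a = i \<and> b = j then c else 0)"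
           "\<And>a b. j \<le> a \<Longrightarrow> a < b \<Longrightarrow> b \<le> k \<Longrightarrow> entry e a b = 0"
    and n: "\<And>a b. i \<le> a \<Longrightarrow> a < b \<Longrightarrow> b \<le> j \<Longrightarrow> entry n a b = 0"
           "\<And>a b. j \<le> a \<Longrightarrow> a < b \<Longrightarrow> b \<le> k \<Longrightarrow> entry n a b = (if a = j \<and> b = k then c' else 0)"
  shows "e * n = n * e + corner i k (c * c')"
proof (rule utri_eqI)
  fix a b :: nat assume "a \<le> b"
  have diag: "entry e x x = 1" "entry n x x = 1" for x using b by (auto simp: unipotent_def)
  show "entry (e * n) a b = entry (n * e + corner i k (c * c')) a b"
  proof (cases "a = b")
    case True
    then show ?thesis using ij by (simp add: plus_utri.rep_eq entry_times_diag entry_corner diag)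
  next
    case False
    then have ab: "a < b" using \<open>a \<le> b\<close> by simp
    have en: "entry e a x * entry n x b = (if x = j then (if a = i \<and> b = k then c * c' else 0) else 0)"
      if x: "x \<in> {a<..<b}" for x
    proof (cases "i \<le> a \<and> b \<le> k")
      case False
      then have "entry e a x * entry n x b = 0" using b(1,2) x by (auto simp: blocked_def)
      then show ?thesis using False ij by auto
    next
      case True
      consider "x < j" | "x = j" | "x > j" by linarith
      then show ?thesis
      proof cases
        case 1 then show ?thesis using e(1)[of a x] True x by simp
      next
        case 2 then show ?thesis using e(1)[of a x] n(2)[of x b] True x by simp
      next
        case 3 then show ?thesis using n(2)[of x b] True x by simp
      qed
    qed
    have ne: "entry n a x * entry e x b = 0" if x: "x \<in> {a<..<b}" for x
    proof (cases "i \<le> a \<and> b \<le> k")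
      case False
      then show ?thesis using b(1,2) x by (auto simp: blocked_def)
    next
      case True
      then show ?thesis using n(1)[of a x] e(2)[of x b] x by (cases "x \<le> j") auto
    qed
    have "entry (e * n) a b = entry n a b + entry e a b
        + (\<Sum>x\<in>{a<..<b}. if x = j then (if a = i \<and> b = k then c * c' else 0) else 0)"
      using ab en by (simp add: entry_times_strict diag)
    moreover have "(\<Sum>x\<in>{a<..<b}. if x = j then (if a = i \<and> b = k then c * c' else 0) else 0)
        = entry (corner i k (c * c')) a b"
      using ij ab by (auto simp: sum.delta entry_corner)
    moreover have "(\<Sum>x\<in>{a<..<b}. entry n a x * entry e x b) = 0" by (rule sum.neutral) (use ne in blast)
    ultimately show ?thesis using ab by (simp add: plus_utri.rep_eq entry_times_strict diag)
  qed
qed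

lemma (in flat_block) blocked_hol: "blocked i k (hol G P Q)"
  by (simp add: hol_def blocked_hol_simplex)

lemma (in flat_block) blocked_phol: "blocked i k (phol G Ps)"
  by (induction G Ps rule: phol.induct) (auto intro: blocked_mult blocked_hol blocked_1)

lemma unipotent_1: "unipotent 1"
  by (simp add: unipotent_def one_utri.rep_eq)

lemma (in flat_block) unipotent_phol: "unipotent (phol G Ps)"
  by (induction G Ps rule: phol.induct) (auto intro: unipotent_mult unipotent_1)

text \<open>By triangularity the entries of a subblock depend only on the cochains of that subblock.
  They may thus be computed in the larger region where only the leaves of the subblock are removed,
  and homotopies may cross all other leaves.\<close>

lemma entry_phol_subblock:
  assumes "flat U i k A" "i \<le> i'" "k' \<le> k" "i' \<le> a" "a \<le> b" "b \<le> k'"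
  shows "entry (flat_block.phol A i k G Ps) a b = entry (flat_block.phol A i' k' G Ps) a b"
proof -
  interpret F: flat_block U A i k by unfold_locales (fact assms(1))
  interpret F': flat_block U A i' k' by unfold_locales (rule flat_subinterval[OF assms(1-3)])
  have h: "entry (F.hol G P Q) a b = entry (F'.hol G P Q) a b" if "i' \<le> a" "a \<le> b" "b \<le> k'" for a b P Q
    using that assms(2,3) by (simp add: F.hol_def F'.hol_def entry_hol_simplex)
  have "\<forall>a b. i' \<le> a \<longrightarrow> a \<le> b \<longrightarrow> b \<le> k' \<longrightarrow> entry (F.phol G Ps) a b = entry (F'.phol G Ps) a b"
  proof (induction Ps rule: induct_list012)
    case (3 P Q Ps)
    show ?case
    proof (intro allI impI)
      fix a b assume ab: "i' \<le> a" "a \<le> b" "b \<le> k'"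
      have "(\<Sum>c\<in>{a..b}. entry (F.hol G P Q) a c * entry (F.phol G (Q # Ps)) c b)
        = (\<Sum>c\<in>{a..b}. entry (F'.hol G P Q) a c * entry (F'.phol G (Q # Ps)) c b)"
        using ab 3(2) h by (intro sum.cong) auto
      then show "entry (F.phol G (P # Q # Ps)) a b = entry (F'.phol G (P # Q # Ps)) a b"
        by (simp add: times_utri.rep_eq)
    qed
  qed simp_all
  then show ?thesis using assms by blast
qed

lemma (in flat_block) entry_phol_leaf:
  assumes "k = Suc i"
  shows "entry (phol G Ps) i k = cochain_eval (A i k) (polygon G Ps)"
proof (induction Ps rule: induct_list012)
  case (3 P Q Ps)
  have e: "{i<..<k} = {}" and ik: "i < k" using assms by auto
  have u: "entry (phol G (Q # Ps)) k k = 1" "entry (hol G P Q) i i = 1"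
    using unipotent_phol unipotent_hol unfolding unipotent_def by blast+
  have "entry (hol G P Q) i k = A i k (edge G P Q)" using ik by (simp add: hol_def entry_hol_simplex)
  then show ?case
    using 3(2) unfolding phol.simps polygon.simps entry_times_strict[OF ik] u e
    by (simp only: cochain_eval_add cochain_eval_of) simp
qed (simp_all only: phol.simps polygon.simps, simp_all add: assms one_utri.rep_eq)

lemma (in flat_block) phol_leaf:
  assumes "k = Suc i"
  shows "phol G Ps = 1 + corner i k (cochain_eval (A i k) (polygon G Ps))"
proof (rule utri_eqI)
  fix a b :: nat assume ab: "a \<le> b"
  consider "a = b" | "a < b" "a = i" "b = k" | "a < b" "\<not> (i \<le> a \<and> b \<le> k)" using ab assms by linarith
  then show "entry (phol G Ps) a b = entry (1 + corner i k (cochain_eval (A i k) (polygon G Ps))) a b"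
  proof cases
    case 1
    then show ?thesis using unipotent_phol[of G Ps] assms
      by (simp add: unipotent_def plus_utri.rep_eq one_utri.rep_eq entry_corner)
  next
    case 2
    then show ?thesis using entry_phol_leaf[OF assms] by (simp add: plus_utri.rep_eq one_utri.rep_eq entry_corner)
  next
    case 3
    then show ?thesis using blocked_phol[of G Ps] by (auto simp: blocked_def plus_utri.rep_eq one_utri.rep_eq entry_corner)
  qed
qed

text \<open>The rectangle may be off centre in the first coordinate, because the meridian box of a
  child is prescribed by the position of its sheet in the normal plane of the parent.\<close>

definition rect :: "real \<Rightarrow> real \<Rightarrow> real \<Rightarrow> real \<times> real \<Rightarrow> real \<times> real" where
  "rect p q \<gamma> = (\<lambda>(x,y). ((p + q) / 2 + x * (q - p) / 2, y * \<gamma>))"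

lemma polygon_compose: "polygon (f \<circ> G) Ps = chain_map 1 f (polygon G Ps)"
  by (induction G Ps rule: polygon.induct)
    (simp_all only: polygon.simps chain_map_add chain_map_of chain_map_0 edge_compose)

lemma chain_boundary_polygon:
  "Ps \<noteq> [] \<Longrightarrow> chain_boundary 1 (polygon G Ps) = frag_of (point_simplex (G (last Ps))) - frag_of (point_simplex (G (hd Ps)))"
  by (induction G Ps rule: polygon.induct) (auto simp: chain_boundary_add edge_boundary[unfolded One_nat_def])

lemma singular_chain_polygon:
  fixes G :: "'b::real_normed_vector \<Rightarrow> 'a::topological_space"
  assumes "continuous_on Z G" "G ` Z \<subseteq> W" "successively (\<lambda>P Q. closed_segment P Q \<subseteq> Z) Ps"
  shows "singular_chain 1 (top_of_set W) (polygon G Ps)"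
  using assms(3)
proof (induction Ps rule: induct_list012)
  case (3 P Q Ps)
  have "closed_segment P Q \<subseteq> Z" using 3 by simp
  then have "singular_simplex 1 (top_of_set W) (edge G P Q)"
    using assms(1,2) by (intro singular_simplex_edge) (auto intro: continuous_on_subset)
  then have "singular_chain 1 (top_of_set W) (frag_of (edge G P Q))" by (simp add: singular_chain_of)
  then show ?case using 3 by (simp add: singular_chain_add)
qed auto

text \<open>A 0-simplex is evaluated at the only point of the standard 0-simplex. The sign of a
  continuous function without zeros is constant along each path.\<close>

lemma sign_cocycle:
  fixes f :: "'a::topological_space \<Rightarrow> real"
  assumes f: "continuous_on U f" "\<And>x. x \<in> U \<Longrightarrow> f x \<noteq> 0"
  shows "cocycle 0 U (\<lambda>\<sigma>. if f (\<sigma> (\<lambda>j. if j = 0 then 1 else 0)) > 0 then 1 else 0)"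
  unfolding cocycle_def
proof (intro allI impI)
  fix \<sigma> :: "(nat \<Rightarrow> real) \<Rightarrow> 'a"
  assume s: "singular_simplex (Suc 0) (top_of_set U) \<sigma>"
  let ?v = "\<lambda>j::nat. if j = 0 then 1 else 0 :: real"
  let ?X = "subtopology (powertop_real UNIV) (standard_simplex 1)"
  have cm: "continuous_map ?X (top_of_set U) \<sigma>" using s by (simp add: singular_simplex_def)
  have "continuous_map (top_of_set U) euclideanreal f" using f by simp
  from continuous_map_compose[OF cm this] have "continuous_map ?X euclideanreal (f \<circ> \<sigma>)" .
  moreover have "connectedin ?X (standard_simplex 1)" by (simp add: connectedin_standard_simplex)
  ultimately have con: "connected ((f \<circ> \<sigma>) ` standard_simplex 1)"
    using connectedin_continuous_map_image by fastforce
  have im: "\<sigma> x \<in> U" if "x \<in> standard_simplex 1" for x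
    using cm that by (auto simp: continuous_map_def Pi_iff)
  have v0: "?v \<in> standard_simplex 0" by (simp add: standard_simplex_0)
  have in1: "simplical_face k ?v \<in> standard_simplex 1" if "k \<le> 1" for k
    using simplical_face_in_standard_simplex[of 1 k ?v] that v0 by simp
  let ?a = "simplical_face 0 ?v" and ?b = "simplical_face 1 ?v"
  have "f (\<sigma> ?a) > 0 \<longleftrightarrow> f (\<sigma> ?b) > 0"
  proof (rule ccontr)
    assume ne: "\<not> ?thesis"
    have m: "f (\<sigma> ?a) \<in> (f \<circ> \<sigma>) ` standard_simplex 1" "f (\<sigma> ?b) \<in> (f \<circ> \<sigma>) ` standard_simplex 1"
      using in1 by auto
    have "0 \<in> (f \<circ> \<sigma>) ` standard_simplex 1"
    proof (cases "f (\<sigma> ?a) > 0")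
      case True
      then show ?thesis using ne by (intro connectedD_interval[OF con m(2,1)]) auto
    next
      case False
      then show ?thesis using ne by (intro connectedD_interval[OF con m]) auto
    qed
    then show False using f(2) im by auto
  qed
  moreover have "singular_face (Suc 0) k \<sigma> ?v = \<sigma> (simplical_face k ?v)" for k
    using v0 by (simp add: singular_face_def)
  ultimately show "(\<Sum>k\<le>Suc 0. (- 1) ^ k * (if f (singular_face (Suc 0) k \<sigma> ?v) > 0 then 1 else 0)) = (0::real)"
    by simp
qed

section \<open>The cocycle dual to a sphere\<close>

context sphere_frame4
begin

definition fib :: "('a \<Rightarrow> 'a) \<Rightarrow> 'a \<Rightarrow> real \<times> real \<Rightarrow> 'a" where
  "fib \<Theta> v = (\<lambda>(\<sigma>,\<tau>). \<Theta> ((1 + \<sigma>) *\<^sub>R v + \<tau> *\<^sub>R et))"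

lemma fib_id: "fib \<Theta> v = \<Theta> \<circ> fib id v"
  by (auto simp: fib_def)

abbreviation meridian :: "real \<times> real \<Rightarrow> 'a" where
  "meridian \<equiv> fib id e0 \<circ> rect (-1/4) (1/4) (1/4)"

lemma meridian_eq: "meridian = (\<lambda>(x,y). (1 + x / 4) *\<^sub>R e0 + (y / 4) *\<^sub>R et)"
  by (auto simp: fib_def rect_def)

lemma meridian_cont: "continuous_on Z meridian"
  unfolding meridian_eq case_prod_unfold by (intro continuous_intros) auto

lemma meridian_in_Od: "\<bar>x\<bar> \<le> 1 \<Longrightarrow> \<bar>y\<bar> \<le> 1 \<Longrightarrow> meridian (x,y) \<in> Od"
  unfolding meridian_eq using polar_in_Od[of e0 "x/4" "y/4"] by simp

lemma meridian_bar: "\<bar>x\<bar> \<le> 1 \<Longrightarrow> norm (bar (meridian (x,y))) = 1 + x / 4" "meridian (x,y) \<bullet> et = y / 4"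
  unfolding meridian_eq using inner_polar[of e0 "1 + x/4" "y/4"] by simp_all

text \<open>The connecting map of Mayer-Vietoris: the side of the square at radius 3/4 crosses the
  disc, the other three avoid it. A filling of \<open>k\<close> times the square yields a chain
  \<open>q\<close> off the hyperplane joining two points on opposite sides \<open>k\<close> times,
  so \<open>k\<close> vanishes.\<close>

lemma meridian_not_bounding:
  assumes b: "bounds 1 (Od - S) (frag_cmul k (polygon meridian unit_square))"
  shows "k = 0"
proof -
  define Ps :: "(real \<times> real) list" where "Ps = [(-1,-1),(1,-1),(1,1),(-1,1)]"
  define Qs :: "(real \<times> real) list" where "Qs = [(-1,1),(-1,-1)]"
  let ?z = "polygon meridian unit_square" and ?z1 = "polygon meridian Ps" and ?z2 = "polygon meridian Qs"
  have z: "?z = ?z1 + ?z2" by (simp add: unit_square_def Ps_def Qs_def)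
  define Z1 :: "(real \<times> real) set" where "Z1 = {(x,y). \<bar>x\<bar> \<le> 1 \<and> \<bar>y\<bar> \<le> 1 \<and> (x = 1 \<or> y \<noteq> 0)}"
  define Z2 :: "(real \<times> real) set" where "Z2 = {(x,y). x = -1 \<and> \<bar>y\<bar> \<le> 1}"
  have s1: "successively (\<lambda>P Q. closed_segment P Q \<subseteq> Z1) Ps"
    unfolding Ps_def Z1_def by (auto simp: closed_segment_def algebra_simps)
  have s2: "successively (\<lambda>P Q. closed_segment P Q \<subseteq> Z2) Qs"
    unfolding Qs_def Z2_def by (auto simp: closed_segment_def algebra_simps)
  let ?U = "Od - disc" and ?V = "Od - antidisc"
  have "meridian P \<in> ?U" if PZ: "P \<in> Z1" for P
  proof -
    obtain x y where P: "P = (x,y)" "\<bar>x\<bar> \<le> 1" "\<bar>y\<bar> \<le> 1" "x = 1 \<or> y \<noteq> 0" using PZ unfolding Z1_def by blast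
    show ?thesis using P(4) meridian_in_Od[OF P(2,3)] meridian_bar(1)[OF P(2), of y] meridian_bar(2)[of x y]
      unfolding P(1) disc_def by auto
  qed
  then have c1: "singular_chain 1 (top_of_set ?U) ?z1"
    by (intro singular_chain_polygon[OF meridian_cont _ s1] image_subsetI)
  have "meridian P \<in> ?V" if PZ: "P \<in> Z2" for P
  proof -
    obtain y where P: "P = (-1,y)" "\<bar>y\<bar> \<le> 1" using PZ unfolding Z2_def by blast
    show ?thesis using meridian_in_Od[of "-1" y] P(2) meridian_bar(1)[of "-1" y]
      unfolding P(1) antidisc_def by auto
  qed
  then have c2: "singular_chain 1 (top_of_set ?V) ?z2"
    by (intro singular_chain_polygon[OF meridian_cont _ s2] image_subsetI)
  obtain w where w: "singular_chain (Suc 1) (top_of_set (?U \<union> ?V)) w" "chain_boundary (Suc 1) w = frag_cmul k ?z"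
    using b unfolding bounds_def Od_split(3) by blast
  obtain d e h where d: "singular_chain (Suc 1) (top_of_set ?U) d" and e: "singular_chain (Suc 1) (top_of_set ?V) e"
    and h: "\<And>X c. singular_chain 1 X c \<Longrightarrow> singular_chain (Suc 1) X (h c)" "\<And>c c'. h (c - c') = h c - h c'"
    and eq: "chain_boundary (Suc 1) d + chain_boundary (Suc 1) e
       = chain_boundary (Suc 1) w + chain_boundary (Suc 1) (h (chain_boundary (Suc 1) w))"
    by (rule subdivision_filling[OF Od_split(1,2) w(1)]) (rule that)
  let ?k1 = "frag_cmul k ?z1" and ?k2 = "frag_cmul k ?z2"
  have kz: "frag_cmul k ?z = ?k1 + ?k2" unfolding z by (simp add: frag_cmul_distrib2)
  have "frag_cmul k ?z - ?k2 = ?k1" unfolding kz by simp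
  then have "h ?k1 = h (frag_cmul k ?z) - h ?k2" using h(2)[of "frag_cmul k ?z" ?k2] by (simp only:)
  then have hk: "h (frag_cmul k ?z) = h ?k1 + h ?k2" by (simp only: diff_add_cancel)
  define q where "q = ?k1 + chain_boundary (Suc 1) (h ?k1) - chain_boundary (Suc 1) d"
  have q': "q = chain_boundary (Suc 1) e - ?k2 - chain_boundary (Suc 1) (h ?k2)"
  proof -
    have "chain_boundary (Suc 1) d + chain_boundary (Suc 1) e
      = ?k1 + ?k2 + (chain_boundary (Suc 1) (h ?k1) + chain_boundary (Suc 1) (h ?k2))"
      using eq unfolding w(2) hk chain_boundary_add by (simp only: kz)
    then show ?thesis unfolding q_def by (simp only: algebra_simps)
  qed
  have k1: "singular_chain 1 (top_of_set ?U) ?k1" and k2: "singular_chain 1 (top_of_set ?V) ?k2"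
    using c1 c2 by (auto intro: singular_chain_cmul)
  have bd: "singular_chain 1 X (chain_boundary (Suc 1) c)" if "singular_chain (Suc 1) X c" for X and c :: "'a chain"
    using singular_chain_boundary[OF that] by simp
  have "singular_chain 1 (top_of_set ?U) q"
    unfolding q_def by (intro singular_chain_diff singular_chain_add k1 bd h d)
  moreover have "singular_chain 1 (top_of_set ?V) q"
    unfolding q' by (intro singular_chain_diff k2 bd h e)
  ultimately have q: "singular_chain (Suc 0) (top_of_set (?U \<inter> ?V)) q" by (simp add: singular_chain_Int)
  have bb: "chain_boundary 1 (chain_boundary (Suc 1) c) = 0" if "singular_chain (Suc 1) X c" for X and c :: "'a chain"
    using chain_boundary_boundary_Suc[of 0 X c] that by simp
  have "chain_boundary 1 q = frag_cmul k (chain_boundary 1 ?z1)"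
    unfolding q_def using bb[OF h(1)[OF k1]] bb[OF d]
    by (simp add: chain_boundary_diff chain_boundary_add chain_boundary_cmul)
  also have "chain_boundary 1 ?z1 = frag_of (point_simplex (meridian (-1,1))) - frag_of (point_simplex (meridian (-1,-1)))"
    by (subst chain_boundary_polygon) (simp_all add: Ps_def)
  finally have bq: "chain_boundary (Suc 0) q = frag_cmul k (frag_of (point_simplex (meridian (-1,1))) - frag_of (point_simplex (meridian (-1,-1))))"
    by simp
  let ?c = "\<lambda>\<sigma>::(nat \<Rightarrow> real) \<Rightarrow> 'a. if \<sigma> (\<lambda>j. if j = 0 then 1 else 0) \<bullet> et > 0 then 1 else 0 :: real"
  have "cocycle 0 (?U \<inter> ?V) ?c"
    by (rule sign_cocycle[where f = "\<lambda>x. x \<bullet> et"]) (auto simp: Od_split(4) intro!: continuous_intros)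
  from cocycle_eval_boundary[OF this q]
  have "of_int k * (?c (point_simplex (meridian (-1,1))) - ?c (point_simplex (meridian (-1,-1)))) = 0"
    unfolding bq cochain_eval_cmul cochain_eval_diff cochain_eval_of .
  moreover have "point_simplex x (\<lambda>j. if j = 0 then 1 else 0) = x" for x :: 'a
    by (simp add: point_simplex_def standard_simplex_0)
  moreover have "meridian (-1,1) \<bullet> et > 0" "\<not> meridian (-1,-1) \<bullet> et > 0" unfolding meridian_bar(2) by auto
  ultimately have "(of_int k :: real) = 0" by (simp only: if_True if_False diff_0_right mult_1_right)
  then show ?thesis by simp
qed

text \<open>A multiple of the meridian that bounds in the complement also bounds in the contractible
  image of \<open>Od\<close>, hence in their intersection, which is a copy of the model
  \<open>Od - S\<close>.\<close>

theorem sphere_cocycle: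
  assumes "good \<Theta>"
  obtains \<alpha> where "cocycle 1 (- (\<Theta> ` S)) \<alpha>"
    "cochain_eval \<alpha> (polygon (fib \<Theta> e0 \<circ> rect (-1/4) (1/4) (1/4)) unit_square) = 1"
proof -
  let ?m = "polygon meridian unit_square"
  let ?z = "polygon (fib \<Theta> e0 \<circ> rect (-1/4) (1/4) (1/4)) unit_square"
  have z: "?z = chain_map 1 \<Theta> ?m"
    unfolding polygon_compose[symmetric] fib_id[of \<Theta>] comp_assoc ..
  obtain g where g: "homeomorphism Od (\<Theta> ` Od) \<Theta> g" "open (\<Theta> ` Od)"
    using good_homeomorphism[OF assms] .
  have "meridian P \<in> Od" if "P \<in> square_boundary" for P
  proof -
    obtain x y where P: "P = (x,y)" by fastforce
    then have "\<bar>x\<bar> \<le> 1" "\<bar>y\<bar> \<le> 1" using that by (auto simp: square_boundary_def max_def split: if_splits)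
    then show ?thesis unfolding P by (rule meridian_in_Od)
  qed
  then have c0: "singular_chain 1 (top_of_set Od) ?m"
    by (intro singular_chain_polygon[OF meridian_cont _ unit_square_segments] image_subsetI)
  have b0: "chain_boundary 1 ?m = 0"
    by (subst chain_boundary_polygon) (simp_all add: unit_square_in)
  have nb: "k = 0" if k: "bounds 1 (- (\<Theta> ` S)) (frag_cmul k ?z)" for k
  proof (rule meridian_not_bounding)
    have "acyc 1 Od" using acyc_convex[OF convex_Od, of 0] by simp
    moreover have "singular_chain 1 (top_of_set Od) (frag_cmul k ?m)" using c0 by (rule singular_chain_cmul)
    moreover have "chain_boundary 1 (frag_cmul k ?m) = 0" unfolding chain_boundary_cmul b0 by simp
    ultimately have "bounds 1 Od (frag_cmul k ?m)" unfolding acyc_def by blast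
    then have "bounds 1 (\<Theta> ` Od) (chain_map 1 \<Theta> (frag_cmul k ?m))"
      using assms by (intro bounds_image[of Od]) (auto simp: good_def)
    then have "bounds 1 (\<Theta> ` Od) (frag_cmul k ?z)" unfolding z chain_map_cmul .
    moreover have "- (\<Theta> ` S) \<union> \<Theta> ` Od = UNIV" using S_subset_Od by auto
    moreover have "acyc (Suc 1) (UNIV :: 'a set)" using acyc_convex[of UNIV 1] by simp
    ultimately have "bounds 1 (- (\<Theta> ` S) \<inter> \<Theta> ` Od) (frag_cmul k ?z)"
      using closed_good_S[OF assms] g(2) k by (intro bounds_Int) (auto simp: open_Compl)
    then have "bounds 1 (\<Theta> ` (Od - S)) (frag_cmul k ?z)" by (simp add: good_diff[OF assms])
    moreover have "homeomorphism (Od - S) (\<Theta> ` (Od - S)) \<Theta> g"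
      using g(1) by (rule homeomorphism_of_subsets) auto
    then have "continuous_on (\<Theta> ` (Od - S)) g" "g ` \<Theta> ` (Od - S) \<subseteq> Od - S" by (auto simp: homeomorphism_def)
    ultimately have "bounds 1 (Od - S) (chain_map 1 g (frag_cmul k ?z))" by (intro bounds_image)
    moreover have "chain_map 1 g (frag_cmul k ?z) = frag_cmul k (chain_map 1 (g \<circ> \<Theta>) ?m)"
      unfolding z chain_map_compose comp_apply chain_map_cmul ..
    moreover have "chain_map 1 (g \<circ> \<Theta>) ?m = ?m"
      using g(1) by (intro chain_map_id_gen[OF c0]) (auto simp: homeomorphism_def)
    ultimately show "bounds 1 (Od - S) (frag_cmul k ?m)" by (simp only:)
  qed
  show thesis
    by (rule cocycle_detecting_cycle[OF zero_less_one], erule nb, rule that)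
qed

end

section \<open>Essential meridians\<close>

text \<open>This replaces inverses of unipotent matrices, which are never constructed; later
  identities of conjugates are all stated as equations of products.\<close>

lemma unipotent_cancel_right:
  assumes "unipotent X" "M * X = N * X"
  shows "M = N"
proof (rule utri_eqI)
  fix a b :: nat assume "a \<le> b"
  have x: "entry X a a = 1" for a using assms(1) by (simp add: unipotent_def)
  have "a \<le> b \<longrightarrow> entry M a b = entry N a b" for a b
  proof (induction b arbitrary: a rule: less_induct)
    case (less b)
    have s: "entry (Y * X) a b = (\<Sum>c\<in>{a..<b}. entry Y a c * entry X c b) + entry Y a b" if "a \<le> b" for Y
    proof -
      have "{a..b} = insert b {a..<b}" using that by auto
      then show ?thesis by (simp add: times_utri.rep_eq x)
    qed
    have "(\<Sum>c\<in>{a..<b}. entry M a c * entry X c b) = (\<Sum>c\<in>{a..<b}. entry N a c * entry X c b)"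
      using less by (intro sum.cong) auto
    then show ?case using s[of M] s[of N] assms(2) by auto
  qed
  then show "entry M a b = entry N a b" using \<open>a \<le> b\<close> by blast
qed

text \<open>As \<open>1 + corner i k c\<close> is central, changing the base point or the path to it
  does not alter such a holonomy. This is why meridians may be moved freely.\<close>

lemma corner_conjugate:
  assumes X: "blocked i k X" "unipotent X" and "i \<le> k" and eq: "P * X = X * (1 + corner i k c)"
  shows "P = 1 + corner i k c"
proof (rule unipotent_cancel_right[OF X(2)])
  show "P * X = (1 + corner i k c) * X"
    unfolding eq by (simp add: distrib_left distrib_right corner_mult[OF X(1,2) assms(3)])
qed

lemma corner_zero [simp]: "corner i k 0 = 0"
  by (rule utri_eqI) (simp add: entry_corner zero_utri.rep_eq)

lemma closed_segment_vertical: "closed_segment (x,y) (x,y') = {x} \<times> closed_segment y (y'::real)"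
  for x :: real
proof -
  have "(1 - u) * x + u * x = x" for u by (simp add: algebra_simps)
  then show ?thesis by (auto simp: closed_segment_def)
qed

lemma closed_segment_horizontal: "closed_segment (x,y) (x',y) = closed_segment x x' \<times> {y::real}"
  for x :: real
proof -
  have "(1 - u) * y + u * y = y" for u by (simp add: algebra_simps)
  then show ?thesis by (auto simp: closed_segment_def)
qed

lemmas closed_segment_axis = closed_segment_vertical closed_segment_horizontal closed_segment_eq_real_ivl

context flat_block
begin

lemma loop_slide:
  fixes H :: "real \<times> 'b::real_normed_vector \<Rightarrow> 'a"
  assumes "continuous_on ({0..1} \<times> Z) H" "H ` ({0..1} \<times> Z) \<subseteq> W" "Ps \<noteq> []" "hd Ps \<in> Z"
    and "successively (\<lambda>P Q. closed_segment P Q \<subseteq> Z) Ps" "last Ps = hd Ps"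
    and "phol (\<lambda>x. H (1,x)) Ps = 1 + corner i k c" "i \<le> k"
  shows "phol (\<lambda>x. H (0,x)) Ps = 1 + corner i k c"
proof (rule corner_conjugate[OF blocked_hol unipotent_hol \<open>i \<le> k\<close>])
  show "phol (\<lambda>x. H (0,x)) Ps * hol (\<lambda>t. H (t,hd Ps)) 0 1 = hol (\<lambda>t. H (t,hd Ps)) 0 1 * (1 + corner i k c)"
    using phol_slide[OF assms(1-5)] assms(6,7) by simp
qed

lemma phol_affine:
  assumes "\<And>s P Q. f ((1 - s) *\<^sub>R P + s *\<^sub>R Q) = (1 - s) *\<^sub>R f P + s *\<^sub>R f Q"
  shows "phol (G \<circ> f) Ps = phol G (map f Ps)"
proof (induction Ps rule: induct_list012)
  case (3 P Q Ps)
  have "hol (G \<circ> f) P Q = hol G (f P) (f Q)" by (rule hol_cong) (simp add: assms)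
  then show ?case using 3 by (simp only: phol.simps list.map)
qed simp_all

end

lemma rect_affine: "rect p q \<gamma> ((1 - s) *\<^sub>R P + s *\<^sub>R Q) = (1 - s) *\<^sub>R rect p q \<gamma> P + s *\<^sub>R rect p q \<gamma> Q"
  by (cases P; cases Q) (simp add: rect_def field_simps)

lemma map_rect_unit_square:
  "map (rect p q \<gamma>) unit_square = [(p,-\<gamma>),(q,-\<gamma>),(q,\<gamma>),(p,\<gamma>),(p,-\<gamma>)]"
  by (simp add: unit_square_def rect_def field_simps)

context sphere_frame4
begin

lemma fib_continuous:
  assumes "good \<Theta>" "continuous_on T V" "continuous_on T g" "\<And>t. t \<in> T \<Longrightarrow> V t \<in> S"
    "\<And>t. t \<in> T \<Longrightarrow> g t \<in> {-1<..<1} \<times> {-1/2<..<1/2}"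
  shows "continuous_on T (\<lambda>t. fib \<Theta> (V t) (g t))"
proof -
  have "continuous_on T (\<lambda>t. \<Theta> ((1 + fst (g t)) *\<^sub>R V t + snd (g t) *\<^sub>R et))"
  proof (rule continuous_on_compose2[of Od \<Theta>])
    show "continuous_on Od \<Theta>" using assms(1) by (simp add: good_def)
    show "continuous_on T (\<lambda>t. (1 + fst (g t)) *\<^sub>R V t + snd (g t) *\<^sub>R et)"
      using assms(2,3) by (intro continuous_intros)
    show "(\<lambda>t. (1 + fst (g t)) *\<^sub>R V t + snd (g t) *\<^sub>R et) ` T \<subseteq> Od"
    proof (intro image_subsetI polar_in_Od)
      fix t assume t: "t \<in> T"
      show "V t \<in> S" "\<bar>fst (g t)\<bar> < 1" "\<bar>snd (g t)\<bar> < 1/2"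
        using assms(4)[OF t] assms(5)[OF t] unfolding mem_Times_iff by (auto simp: abs_less_iff)
    qed
  qed
  then show ?thesis by (simp add: fib_def case_prod_unfold)
qed

text \<open>The polygon is kept fixed in normal coordinates while its foot point moves along the
  path \<open>V\<close> in the sphere.\<close>

lemma direction_slide:
  fixes V :: "real \<Rightarrow> 'a"
  assumes fl: "flat U i k A" "i \<le> k" and g: "good \<Theta>"
    and V: "continuous_on {0..1} V" "\<And>t. t \<in> {0..1} \<Longrightarrow> V t \<in> S"
    and Z: "Z \<subseteq> {-1<..<1} \<times> {-1/2<..<1/2}" "\<And>t z. t \<in> {0..1} \<Longrightarrow> z \<in> Z \<Longrightarrow> fib \<Theta> (V t) z \<in> (\<Inter>l\<in>{i..<k}. U l)"
    and Ps: "Ps \<noteq> []" "hd Ps \<in> Z" "successively (\<lambda>P Q. closed_segment P Q \<subseteq> Z) Ps" "last Ps = hd Ps"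
    and 1: "flat_block.phol A i k (fib \<Theta> (V 1)) Ps = 1 + corner i k c"
  shows "flat_block.phol A i k (fib \<Theta> (V 0)) Ps = 1 + corner i k c"
proof -
  interpret flat_block U A i k by unfold_locales (fact fl)
  let ?H = "\<lambda>tz::real \<times> real \<times> real. fib \<Theta> (V (fst tz)) (snd tz)"
  have "continuous_on ({0..1} \<times> Z) ?H"
  proof (rule fib_continuous[OF g])
    show "continuous_on ({0..1} \<times> Z) (\<lambda>tz. V (fst tz))"
      by (rule continuous_on_compose2[OF V(1)]) (auto intro!: continuous_intros)
  qed (use V Z in \<open>auto intro!: continuous_intros\<close>)
  moreover have "?H ` ({0..1} \<times> Z) \<subseteq> W" using Z(2) unfolding W_def by auto
  moreover have "phol (\<lambda>x. ?H (1,x)) Ps = 1 + corner i k c" using 1 by simp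
  ultimately have "phol (\<lambda>x. ?H (0,x)) Ps = 1 + corner i k c" using Ps fl(2) by (intro loop_slide)
  then show ?thesis by simp
qed

lemma rect_slide:
  assumes fl: "flat U i k A" "i \<le> k" and g: "good \<Theta>" and v: "v \<in> S"
    and b: "-1 < p" "p < 0" "0 < q" "q < 1" "0 < \<gamma>" "\<gamma> < 1/2" "-1 < p'" "p' < 0" "0 < q'" "q' < 1" "0 < \<gamma>'" "\<gamma>' < 1/2"
    and d: "p < -d" "d < q" "d < \<gamma>" "p' < -d" "d < q'" "d < \<gamma>'"
    and Z: "\<And>\<sigma> \<tau>. \<bar>\<sigma>\<bar> < 1 \<Longrightarrow> \<bar>\<tau>\<bar> < 1/2 \<Longrightarrow> d < \<bar>\<sigma>\<bar> \<or> d < \<bar>\<tau>\<bar> \<Longrightarrow> fib \<Theta> v (\<sigma>,\<tau>) \<in> (\<Inter>l\<in>{i..<k}. U l)"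
    and 1: "flat_block.phol A i k (fib \<Theta> v \<circ> rect p' q' \<gamma>') unit_square = 1 + corner i k c"
  shows "flat_block.phol A i k (fib \<Theta> v \<circ> rect p q \<gamma>) unit_square = 1 + corner i k c"
proof -
  interpret flat_block U A i k by unfold_locales (fact fl)
  define R where "R t = rect ((1 - t) * p + t * p') ((1 - t) * q + t * q') ((1 - t) * \<gamma> + t * \<gamma>')" for t
  have conv: "(1 - t) * x + t * x' < y" if "x < y" "x' < y" "t \<in> {0..1}" for t x x' y :: real
    using that convex_bound_lt[of x y x' "1 - t" t] by simp
  have conv': "y < (1 - t) * x + t * x'" if "y < x" "y < x'" "t \<in> {0..1}" for t x x' y :: real
    using that convex_bound_lt[of "-x" "-y" "-x'" "1 - t" t] by simp
  have in1: "\<bar>fst (R t z)\<bar> < 1 \<and> \<bar>snd (R t z)\<bar> < 1/2 \<and> (d < \<bar>fst (R t z)\<bar> \<or> d < \<bar>snd (R t z)\<bar>)"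
    if tz: "t \<in> {0..1}" "z \<in> square_boundary" for t z
  proof -
    obtain x y where z: "z = (x,y)" by fastforce
    define P Q G where "P = (1 - t) * p + t * p'" and "Q = (1 - t) * q + t * q'" and "G = (1 - t) * \<gamma> + t * \<gamma>'"
    have PQ: "-1 < P" "P < 0" "0 < Q" "Q < 1" "0 < G" "G < 1/2" "P < -d" "d < Q" "d < G"
      unfolding P_def Q_def G_def using b d tz(1) conv conv' by blast+
    have Rz: "R t z = ((P + Q) / 2 + x * (Q - P) / 2, y * G)" by (simp add: R_def z rect_def P_def Q_def G_def)
    have xy: "\<bar>x\<bar> \<le> 1" "\<bar>y\<bar> \<le> 1" "\<bar>x\<bar> = 1 \<or> \<bar>y\<bar> = 1"
      using tz(2) by (auto simp: z square_boundary_def max_def split: if_splits)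
    have "\<bar>x * (Q - P)\<bar> \<le> 1 * (Q - P)" unfolding abs_mult using xy PQ by (intro mult_mono) auto
    then have "P \<le> (P + Q) / 2 + x * (Q - P) / 2" "(P + Q) / 2 + x * (Q - P) / 2 \<le> Q"
      unfolding abs_le_iff by (auto simp: field_simps)
    then have f: "\<bar>fst (R t z)\<bar> < 1" unfolding Rz fst_conv using PQ by linarith
    have "\<bar>y * G\<bar> \<le> 1 * G" unfolding abs_mult using xy PQ by (intro mult_mono) auto
    then have s: "\<bar>snd (R t z)\<bar> < 1/2" unfolding Rz snd_conv using PQ by linarith
    have "\<bar>x\<bar> = 1 \<Longrightarrow> fst (R t z) = P \<or> fst (R t z) = Q" unfolding Rz fst_conv by (auto simp: abs_if field_simps split: if_splits)
    moreover have "\<bar>y\<bar> = 1 \<Longrightarrow> \<bar>snd (R t z)\<bar> = G" unfolding Rz snd_conv abs_mult using PQ by simp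
    ultimately show ?thesis using f s xy(3) PQ by linarith
  qed
  let ?H = "\<lambda>tz::real \<times> real \<times> real. fib \<Theta> v (R (fst tz) (snd tz))"
  have "continuous_on ({0..1} \<times> square_boundary) ?H"
  proof (rule fib_continuous[OF g])
    show "continuous_on ({0..1} \<times> square_boundary) (\<lambda>tz. R (fst tz) (snd tz))"
      unfolding R_def rect_def case_prod_unfold by (intro continuous_intros) auto
    show "R (fst t) (snd t) \<in> {-1<..<1} \<times> {-1/2<..<1/2}" if "t \<in> {0..1} \<times> square_boundary" for t
      using in1[of "fst t" "snd t"] that by (auto simp: mem_Times_iff abs_less_iff)
  qed (use v in \<open>auto intro!: continuous_intros\<close>)
  moreover have "?H ` ({0..1} \<times> square_boundary) \<subseteq> W"
    unfolding W_def using Z[of "fst (R t z)" "snd (R t z)" for t z] in1 by auto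
  moreover have "phol (\<lambda>x. ?H (1,x)) unit_square = 1 + corner i k c" using 1 by (simp add: R_def comp_def)
  ultimately have "phol (\<lambda>x. ?H (0,x)) unit_square = 1 + corner i k c"
    using fl(2) unit_square_in unit_square_segments by (intro loop_slide)
  then show ?thesis by (simp add: R_def comp_def)
qed

section \<open>The crossing of the two children over the equator\<close>

definition turn :: "'a \<Rightarrow> real \<Rightarrow> 'a" where
  "turn w t = cos (pi / 2 * t) *\<^sub>R b1 + sin (pi / 2 * t) *\<^sub>R w"

lemma turn_simps:
  assumes "w = e0 \<or> w = - e0"
  shows "turn w t \<in> S" "turn w t \<bullet> e0 = sin (pi / 2 * t) * (w \<bullet> e0)" "turn w 0 = b1" "turn w 1 = w"
    "continuous_on {0..1} (turn w)"
proof -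
  have w: "w \<bullet> w = 1" "b1 \<bullet> w = 0" "w \<bullet> b1 = 0" "w \<bullet> et = 0" "b1 \<bullet> b1 = 1"
    using assms norm_eq_1[of b1] by (auto simp: inner_commute[of e0 b1])
  have "(norm (turn w t))\<^sup>2 = 1"
    unfolding power2_norm_eq_inner turn_def using w sin_cos_squared_add[of "pi / 2 * t"]
    by (simp add: inner_add_left inner_add_right power2_eq_square)
  then have "norm (turn w t) = 1" by (metis norm_ge_zero power2_eq_1_iff norm_minus_cancel abs_norm_cancel abs_1 abs_neg_one)
  then show "turn w t \<in> S" using w by (simp add: S_def turn_def inner_add_left)
  show "turn w t \<bullet> e0 = sin (pi / 2 * t) * (w \<bullet> e0)" by (simp add: turn_def inner_add_left)
  show "turn w 0 = b1" "turn w 1 = w" by (simp_all add: turn_def)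
  show "continuous_on {0..1} (turn w)" unfolding turn_def by (intro continuous_intros)
qed

lemma turn_e0: "t \<in> {0..1} \<Longrightarrow> turn e0 t \<bullet> e0 \<ge> 0" "t \<in> {0..1} \<Longrightarrow> turn (- e0) t \<bullet> e0 \<le> 0"
proof -
  have "sin (pi / 2 * t) \<ge> 0" if "t \<in> {0..1}"
  proof (rule sin_ge_zero)
    have "pi / 2 * t \<le> pi / 2 * 1" using that by (intro mult_left_mono) auto
    then show "pi / 2 * t \<le> pi" using pi_gt_zero by linarith
  qed (use that in simp)
  then show "t \<in> {0..1} \<Longrightarrow> turn e0 t \<bullet> e0 \<ge> 0" "t \<in> {0..1} \<Longrightarrow> turn (- e0) t \<bullet> e0 \<le> 0"
    by (simp_all add: turn_simps(2))
qed

lemma b1_in_S [simp]: "b1 \<in> S"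
  by (simp add: S_def)

end

text \<open>The normal plane over the equatorial point \<open>b1\<close> meets the first child in an
  eastern and a western sheet and the second child in a northern and a southern one. The boxes in
  the last two assumptions are chosen so that the child maps carry them to the rectangle between
  distances \<open>s\<close> and \<open>3 * h / 2\<close> from the core, once over \<open>e0\<close>
  and once over \<open>- e0\<close>.\<close>

locale crossing = sphere_frame4 e0 et b1 b2 for e0 et b1 b2 :: "'a::euclidean_space" +
  fixes U :: "nat \<Rightarrow> 'a set" and A :: "nat \<Rightarrow> nat \<Rightarrow> ((nat \<Rightarrow> real) \<Rightarrow> 'a) \<Rightarrow> real" and i j k :: nat
    and \<Theta> :: "'a \<Rightarrow> 'a" and a h s \<delta> \<delta>' c c' :: real
  assumes flat_ik: "flat U i k A" and ij: "i < j" and jk: "j < k"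
    and good_\<Theta>: "good \<Theta>" and par: "params a h s \<delta> \<delta>'"
    and Up: "\<And>x. x \<notin> (\<Theta> \<circ> chip a h) ` K \<delta>' \<Longrightarrow> x \<in> (\<Inter>l\<in>{i..<j}. U l)"
    and Um: "\<And>x. x \<notin> (\<Theta> \<circ> chim a h) ` K \<delta>' \<Longrightarrow> x \<in> (\<Inter>l\<in>{j..<k}. U l)"
    and child_p: "flat_block.phol A i j (fib (\<Theta> \<circ> chip a h) e0 \<circ> rect (s / h - 1) (1/2) s) unit_square = 1 + corner i j c"
    and child_m: "flat_block.phol A j k (fib (\<Theta> \<circ> chim a h) e0 \<circ> rect (s / h - 1) (1/2) s) unit_square = 1 + corner j k c'"
begin

sublocale F: flat_block U A i k by unfold_locales (fact flat_ik)
sublocale F1: flat_block U A i j using flat_subinterval[OF flat_ik order_refl] jk by unfold_locales simp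
sublocale F2: flat_block U A j k using flat_subinterval[OF flat_ik _ order_refl] ij by unfold_locales simp

text \<open>The value of \<open>h * (1 + t)\<close> at the right side \<open>t = 1/2\<close> of the
  boxes of the children; it lies beyond the outermost points of the sheets, whose distance is at
  most \<open>h * (1 + \<delta>')\<close>.\<close>

definition r :: real where "r = 3 * h / 2"

lemma sizes: "0 < h" "0 < s" "s < r" "r < 1/2" "h * (1 + \<delta>') < r" "\<delta>' < s" "s < h" "\<delta>' < h * (1 + \<delta>')"
proof -
  have p: "0 < h" "h < 1/4" "0 < \<delta>'" "\<delta>' < 1/2" "\<delta>' < s" "s\<^sup>2 < h\<^sup>2 * ((1 - \<delta>')\<^sup>2 - 1 / a\<^sup>2)"
    using par by (auto simp: params_def)
  show "0 < h" "\<delta>' < s" "0 < s" using p by auto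
  have "(1 - \<delta>')\<^sup>2 \<le> 1" using p by (intro power_le_one) auto
  then have "(1 - \<delta>')\<^sup>2 - 1 / a\<^sup>2 \<le> 1" using zero_le_power2[of a] by (simp add: algebra_simps add_increasing2)
  then have "h\<^sup>2 * ((1 - \<delta>')\<^sup>2 - 1 / a\<^sup>2) \<le> h\<^sup>2 * 1" by (intro mult_left_mono) auto
  then have "s\<^sup>2 < h\<^sup>2" using p by linarith
  then show sh: "s < h" using p(1) by (intro power_less_imp_less_base[of s 2 h]) auto
  show "s < r" "r < 1/2" unfolding r_def using sh p by auto
  have "h * (1 + \<delta>') < h * (3/2)" using p by (intro mult_strict_left_mono) auto
  then show "h * (1 + \<delta>') < r" by (simp add: r_def)
  have "0 < h * \<delta>'" using p by simp
  moreover have "h * (1 + \<delta>') = h + h * \<delta>'" by (simp add: algebra_simps)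
  ultimately show "\<delta>' < h * (1 + \<delta>')" using sh p by linarith
qed

text \<open>The four alternatives: too far in the direction of \<open>et\<close>, too far radially,
  inside the clearance over the own hemisphere, or over the opposite pole, which the child never
  reaches.\<close>

lemma avoid_p:
  assumes "v \<in> S" "\<bar>\<sigma>\<bar> < 1" "\<bar>\<tau>\<bar> < 1/2"
    "\<delta>' < \<bar>\<tau>\<bar> \<or> h * (1 + \<delta>') < \<bar>\<sigma>\<bar> \<or> (0 \<le> v \<bullet> e0 \<and> \<bar>\<sigma>\<bar> \<le> s) \<or> v = - e0"
  shows "fib \<Theta> v (\<sigma>,\<tau>) \<in> (\<Inter>l\<in>{i..<j}. U l)"
proof (rule Up, rule notI)
  assume "fib \<Theta> v (\<sigma>,\<tau>) \<in> (\<Theta> \<circ> chip a h) ` K \<delta>'"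
  then obtain x where x: "x \<in> K \<delta>'" "\<Theta> ((1 + \<sigma>) *\<^sub>R v + \<tau> *\<^sub>R et) = \<Theta> (chip a h x)" by (auto simp: fib_def)
  have "x \<in> Od" using K_subset_Od x(1) par by (auto simp: params_def)
  then have "chip a h x \<in> Od" using par by (intro child_in_Od) (auto simp: params_def)
  then have "(1 + \<sigma>) *\<^sub>R v + \<tau> *\<^sub>R et = chip a h x"
    using good_\<Theta> x(2) polar_in_Od[OF assms(1-3)] by (auto simp: good_def inj_on_def)
  from chip_image[OF par assms(1,2) x(1) this] show False using assms(4) by auto
qed

lemma avoid_m:
  assumes "v \<in> S" "\<bar>\<sigma>\<bar> < 1" "\<bar>\<tau>\<bar> < 1/2"
    "\<delta>' < \<bar>\<sigma>\<bar> \<or> h * (1 + \<delta>') < \<bar>\<tau>\<bar> \<or> (v \<bullet> e0 \<le> 0 \<and> \<bar>\<tau>\<bar> \<le> s) \<or> v = e0"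
  shows "fib \<Theta> v (\<sigma>,\<tau>) \<in> (\<Inter>l\<in>{j..<k}. U l)"
proof (rule Um, rule notI)
  assume "fib \<Theta> v (\<sigma>,\<tau>) \<in> (\<Theta> \<circ> chim a h) ` K \<delta>'"
  then obtain x where x: "x \<in> K \<delta>'" "\<Theta> ((1 + \<sigma>) *\<^sub>R v + \<tau> *\<^sub>R et) = \<Theta> (chim a h x)" by (auto simp: fib_def)
  have "x \<in> Od" using K_subset_Od x(1) par by (auto simp: params_def)
  then have "chim a h x \<in> Od" using par by (intro child_in_Od) (auto simp: params_def)
  then have "(1 + \<sigma>) *\<^sub>R v + \<tau> *\<^sub>R et = chim a h x"
    using good_\<Theta> x(2) polar_in_Od[OF assms(1-3)] by (auto simp: good_def inj_on_def)
  from chim_image[OF par assms(1,2) x(1) this] show False using assms(4) by auto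
qed

lemma avoid_both:
  "x \<in> (\<Inter>l\<in>{i..<j}. U l) \<Longrightarrow> x \<in> (\<Inter>l\<in>{j..<k}. U l) \<Longrightarrow> x \<in> (\<Inter>l\<in>{i..<k}. U l)"
  by (auto simp: not_le[symmetric])

abbreviation "G \<equiv> fib \<Theta> b1"

text \<open>The square of radius \<open>r\<close> without four open holes, one around each sheet.
  What remains includes the central square, the four corner squares and the outer boundary.\<close>

definition free :: "(real \<times> real) set" where
  "free = {(\<sigma>,\<tau>). \<bar>\<sigma>\<bar> \<le> r \<and> \<bar>\<tau>\<bar> \<le> r \<and> (s \<le> \<bar>\<tau>\<bar> \<or> r \<le> \<bar>\<sigma>\<bar> \<or> \<bar>\<sigma>\<bar> \<le> s) \<and> (s \<le> \<bar>\<sigma>\<bar> \<or> r \<le> \<bar>\<tau>\<bar> \<or> \<bar>\<tau>\<bar> \<le> s)}"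

lemma G_continuous: "continuous_on ({-r..r} \<times> {-r..r}) G"
proof -
  have "continuous_on ({-r..r} \<times> {-r..r}) (\<lambda>z. fib \<Theta> b1 z)"
    by (rule fib_continuous[OF good_\<Theta>]) (use sizes in \<open>auto intro!: continuous_intros\<close>)
  then show ?thesis by simp
qed

lemma G_free: "z \<in> free \<Longrightarrow> G z \<in> F.W"
proof -
  assume z: "z \<in> free"
  obtain \<sigma> \<tau> where e: "z = (\<sigma>,\<tau>)" by fastforce
  show "G z \<in> F.W"
    unfolding e F.W_def using z sizes by (intro avoid_both avoid_p avoid_m) (auto simp: e free_def)
qed

lemma free_trans:
  assumes "{x..x'} \<times> {y..y'} \<subseteq> free" "P \<in> {x..x'} \<times> {y..y'}" "Q \<in> {x..x'} \<times> {y..y'}" "R \<in> {x..x'} \<times> {y..y'}"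
  shows "F.hol G P R = F.hol G P Q * F.hol G Q R"
proof (rule F.hol_trans_convex[OF _ _ _ assms(2-4)])
  have "free \<subseteq> {-r..r} \<times> {-r..r}" by (auto simp: free_def)
  then show "continuous_on ({x..x'} \<times> {y..y'}) G"
    using assms(1) G_continuous continuous_on_subset order_trans by metis
  show "G ` ({x..x'} \<times> {y..y'}) \<subseteq> F.W" using assms(1) G_free by blast
qed (auto intro: convex_Times)

lemma free_inverse:
  assumes "{x..x'} \<times> {y..y'} \<subseteq> free" "P \<in> {x..x'} \<times> {y..y'}" "Q \<in> {x..x'} \<times> {y..y'}"
  shows "F.hol G P Q * F.hol G Q P = 1"
proof -
  have "F.hol G P P = 1" using assms(1,2) G_free by (intro F.hol_self) blast
  then show ?thesis using free_trans[OF assms(1,2,3,2)] by simp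
qed

text \<open>Over \<open>e0\<close> this is exactly the meridian of the first child. Turning from
  there to \<open>b1\<close> stays in the closed hemisphere where the loop misses that child;
  finally the base point moves to \<open>(s,s)\<close>.\<close>

lemma east_loop: "F1.phol G [(s,s),(s,-s),(r,-s),(r,s),(s,s)] = 1 + corner i j c"
proof -
  have eq: "fib (\<Theta> \<circ> chip a h) e0 \<circ> rect (s / h - 1) (1/2) s = fib \<Theta> e0 \<circ> (\<lambda>(x,y). ((r + s) / 2 + x * (r - s) / 2, y * s))"
  proof (rule ext)
    fix z :: "real \<times> real"
    obtain x y where z: "z = (x,y)" by fastforce
    have "h * (1 + ((s / h - 1 + 1/2) / 2 + x * (1/2 - (s / h - 1)) / 2)) = (r + s) / 2 + x * (r - s) / 2"
      using sizes(1) by (simp add: r_def field_simps)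
    then show "(fib (\<Theta> \<circ> chip a h) e0 \<circ> rect (s / h - 1) (1/2) s) z = (fib \<Theta> e0 \<circ> (\<lambda>(x,y). ((r + s) / 2 + x * (r - s) / 2, y * s))) z"
      by (simp add: z fib_def rect_def chip_def pr_add pr_scale inner_add_left)
  qed
  let ?f = "\<lambda>(x::real,y). ((r + s) / 2 + x * (r - s) / 2, y * s)"
  let ?Ps = "[(s,-s),(r,-s),(r,s),(s,s),(s,-s)]"
  have "F1.phol (fib \<Theta> e0 \<circ> ?f) unit_square = F1.phol (fib \<Theta> e0) (map ?f unit_square)"
    by (rule F1.phol_affine) (auto simp: field_simps)
  also have "map ?f unit_square = ?Ps"
    by (simp add: unit_square_def field_simps)
  finally have st: "F1.phol (fib \<Theta> e0 \<circ> ?f) unit_square = F1.phol (fib \<Theta> e0) ?Ps" .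
  have 1: "F1.phol (fib \<Theta> (turn e0 1)) ?Ps = 1 + corner i j c"
    using child_p unfolding eq st turn_simps(4)[OF disjI1[OF HOL.refl]] .
  define Z :: "(real \<times> real) set" where "Z = {(\<sigma>,\<tau>). s \<le> \<sigma> \<and> \<sigma> \<le> r \<and> \<bar>\<tau>\<bar> \<le> s \<and> (\<sigma> = s \<or> \<sigma> = r \<or> \<bar>\<tau>\<bar> = s)}"
  have "F1.phol (fib \<Theta> (turn e0 0)) ?Ps = 1 + corner i j c"
  proof (rule direction_slide[where Z = Z and V = "turn e0", OF F1.flat _ good_\<Theta> _ _ _ _ _ _ _ _ 1])
    show "Z \<subseteq> {-1<..<1} \<times> {-1/2<..<1/2}" using sizes by (auto simp: Z_def)
    fix t z assume t: "t \<in> {0..1::real}" and z: "z \<in> Z"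
    obtain \<sigma> \<tau> where e: "z = (\<sigma>,\<tau>)" by fastforce
    show "fib \<Theta> (turn e0 t) z \<in> (\<Inter>l\<in>{i..<j}. U l)"
      unfolding e using z sizes turn_e0(1)[OF t] by (intro avoid_p) (auto simp: e Z_def turn_simps)
  qed (use ij sizes in \<open>auto simp: turn_simps Z_def closed_segment_axis\<close>)
  then have "F1.phol G ((s,-s) # [(r,-s),(r,s)] @ [(s,s),(s,-s)]) = 1 + corner i j c" by (simp add: turn_simps)
  moreover have "F1.phol G [(s,s),(s,-s),(r,-s),(r,s),(s,s)] * F1.hol G (s,s) (s,-s)
     = F1.hol G (s,s) (s,-s) * F1.phol G [(s,-s),(r,-s),(r,s),(s,s),(s,-s)]"
    by (simp add: mult.assoc)
  ultimately show ?thesis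
    using ij by (intro corner_conjugate[OF F1.blocked_hol F1.unipotent_hol]) auto
qed

text \<open>The second child occupies only radial offsets up to \<open>\<delta>' < s\<close>, so for
  its block the whole eastern rectangle is free and the loop contracts in it.\<close>

lemma east_loop_trivial: "F2.phol G [(s,s),(s,-s),(r,-s),(r,s),(s,s)] = 1"
proof -
  have "F2.phol G [(s,s),(s,-s),(r,-s),(r,s),(s,s)] = F2.hol G (s,s) (last [(s,s),(s,-s),(r,-s),(r,s),(s,s)])"
  proof (rule F2.phol_convex)
    show "continuous_on ({s..r} \<times> {-s..s}) G"
      by (rule continuous_on_subset[OF G_continuous]) (use sizes in auto)
    show im: "G ` ({s..r} \<times> {-s..s}) \<subseteq> F2.W"
      unfolding F2.W_def by (rule image_subsetI, erule SigmaE, hypsubst, rule avoid_m) (use sizes in auto)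
  qed (use sizes in \<open>auto intro: convex_Times\<close>)
  moreover have "G (s,s) \<in> F2.W"
    unfolding F2.W_def using sizes by (intro avoid_m) auto
  ultimately show ?thesis by (simp only: last.simps F2.hol_self) (simp add: F2.hol_self)
qed

lemma north_loop: "F2.phol G [(s,s),(s,r),(-s,r),(-s,s),(s,s)] = 1 + corner j k c'"
proof -
  let ?f = "\<lambda>(x::real,y). (- y * s, (r + s) / 2 + x * (r - s) / 2)"
  have eq: "fib (\<Theta> \<circ> chim a h) e0 \<circ> rect (s / h - 1) (1/2) s = fib \<Theta> (- e0) \<circ> ?f"
  proof (rule ext)
    fix z :: "real \<times> real"
    obtain x y where z: "z = (x,y)" by fastforce
    have "h * (1 + ((s / h - 1 + 1/2) / 2 + x * (1/2 - (s / h - 1)) / 2)) = (r + s) / 2 + x * (r - s) / 2"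
      using sizes(1) by (simp add: r_def field_simps)
    then show "(fib (\<Theta> \<circ> chim a h) e0 \<circ> rect (s / h - 1) (1/2) s) z = (fib \<Theta> (- e0) \<circ> ?f) z"
      by (simp add: z fib_def rect_def chim_def pr_add pr_scale inner_add_left)
  qed
  let ?Ps = "[(s,s),(s,r),(-s,r),(-s,s),(s,s)]"
  have "F2.phol (fib \<Theta> (- e0) \<circ> ?f) unit_square = F2.phol (fib \<Theta> (- e0)) (map ?f unit_square)"
    by (rule F2.phol_affine) (auto simp: field_simps)
  also have "map ?f unit_square = ?Ps"
    by (simp add: unit_square_def field_simps)
  finally have st: "F2.phol (fib \<Theta> (- e0) \<circ> ?f) unit_square = F2.phol (fib \<Theta> (- e0)) ?Ps" .
  have 1: "F2.phol (fib \<Theta> (turn (- e0) 1)) ?Ps = 1 + corner j k c'"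
    using child_m unfolding eq st turn_simps(4)[OF disjI2[OF HOL.refl]] .
  define Z :: "(real \<times> real) set" where "Z = {(\<sigma>,\<tau>). s \<le> \<tau> \<and> \<tau> \<le> r \<and> \<bar>\<sigma>\<bar> \<le> s \<and> (\<tau> = s \<or> \<tau> = r \<or> \<bar>\<sigma>\<bar> = s)}"
  have "F2.phol (fib \<Theta> (turn (- e0) 0)) ?Ps = 1 + corner j k c'"
  proof (rule direction_slide[where Z = Z and V = "turn (- e0)", OF F2.flat _ good_\<Theta> _ _ _ _ _ _ _ _ 1])
    show "Z \<subseteq> {-1<..<1} \<times> {-1/2<..<1/2}" using sizes by (auto simp: Z_def)
    fix t z assume t: "t \<in> {0..1::real}" and z: "z \<in> Z"
    obtain \<sigma> \<tau> where e: "z = (\<sigma>,\<tau>)" by fastforce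
    show "fib \<Theta> (turn (- e0) t) z \<in> (\<Inter>l\<in>{j..<k}. U l)"
      unfolding e using z sizes turn_e0(2)[OF t] by (intro avoid_m) (auto simp: e Z_def turn_simps)
  qed (use jk sizes in \<open>auto simp: turn_simps Z_def closed_segment_axis\<close>)
  then show ?thesis by (simp add: turn_simps)
qed

lemma north_loop_trivial: "F1.phol G [(s,s),(s,r),(-s,r),(-s,s),(s,s)] = 1"
proof -
  have "F1.phol G [(s,s),(s,r),(-s,r),(-s,s),(s,s)] = F1.hol G (s,s) (last [(s,s),(s,r),(-s,r),(-s,s),(s,s)])"
  proof (rule F1.phol_convex)
    show "continuous_on ({-s..s} \<times> {s..r}) G"
      by (rule continuous_on_subset[OF G_continuous]) (use sizes in auto)
    show im: "G ` ({-s..s} \<times> {s..r}) \<subseteq> F1.W"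
      unfolding F1.W_def by (rule image_subsetI, erule SigmaE, hypsubst, rule avoid_p) (use sizes in auto)
  qed (use sizes in \<open>auto intro: convex_Times\<close>)
  moreover have "G (s,s) \<in> F1.W"
    unfolding F1.W_def using sizes by (intro avoid_p) auto
  ultimately show ?thesis by (simp only: last.simps F1.hol_self) (simp add: F1.hol_self)
qed

text \<open>Over \<open>e0\<close> the second child is absent and the first one avoids the central
  strip, so the boundary of the strip contracts there; it is then carried over to \<open>b1\<close>.
  This relates the southern to the northern hole.\<close>

lemma vertical_strip: "F.phol G [(-s,-s),(-s,-r),(s,-r),(s,-s),(s,s),(s,r),(-s,r),(-s,s),(-s,-s)] = 1"
proof -
  let ?Ps = "[(-s,-s),(-s,-r),(s,-r),(s,-s),(s,s),(s,r),(-s,r),(-s,s),(-s,-s)]"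
  have av: "fib \<Theta> v (\<sigma>,\<tau>) \<in> (\<Inter>l\<in>{i..<k}. U l)"
    if "v \<in> S" "v \<bullet> e0 \<ge> 0" "\<bar>\<sigma>\<bar> \<le> s" "\<bar>\<tau>\<bar> \<le> r" "v = e0 \<or> \<bar>\<sigma>\<bar> = s \<or> \<bar>\<tau>\<bar> = r" for v \<sigma> \<tau>
    using that sizes by (intro avoid_both avoid_p avoid_m) auto
  have "F.phol (fib \<Theta> e0) ?Ps = F.hol (fib \<Theta> e0) (-s,-s) (last ?Ps)"
  proof (rule F.phol_convex)
    show "continuous_on ({-s..s} \<times> {-r..r}) (fib \<Theta> e0)"
      using fib_continuous[OF good_\<Theta>, of "{-s..s} \<times> {-r..r}" "\<lambda>_. e0" "\<lambda>z. z"] sizes by (auto simp: continuous_on_id)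
    show "fib \<Theta> e0 ` ({-s..s} \<times> {-r..r}) \<subseteq> F.W"
      unfolding F.W_def by (rule image_subsetI, erule SigmaE, hypsubst, rule av) auto
  qed (use sizes in \<open>auto intro: convex_Times\<close>)
  moreover have "fib \<Theta> e0 (-s,-s) \<in> F.W"
    unfolding F.W_def using sizes by (intro av) auto
  ultimately have 1: "F.phol (fib \<Theta> (turn e0 1)) ?Ps = 1 + corner i k 0"
    unfolding turn_simps(4)[OF disjI1[OF HOL.refl]] by (simp only: last.simps) (simp add: F.hol_self)
  define Z :: "(real \<times> real) set" where "Z = {(\<sigma>,\<tau>). \<bar>\<sigma>\<bar> \<le> s \<and> \<bar>\<tau>\<bar> \<le> r \<and> (\<bar>\<sigma>\<bar> = s \<or> \<bar>\<tau>\<bar> = r)}"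
  have "F.phol (fib \<Theta> (turn e0 0)) ?Ps = 1 + corner i k 0"
  proof (rule direction_slide[where Z = Z and V = "turn e0", OF F.flat _ good_\<Theta> _ _ _ _ _ _ _ _ 1])
    show "Z \<subseteq> {-1<..<1} \<times> {-1/2<..<1/2}" using sizes by (auto simp: Z_def)
    fix t z assume t: "t \<in> {0..1::real}" and z: "z \<in> Z"
    obtain \<sigma> \<tau> where e: "z = (\<sigma>,\<tau>)" by fastforce
    show "fib \<Theta> (turn e0 t) z \<in> (\<Inter>l\<in>{i..<k}. U l)"
      unfolding e using z turn_e0(1)[OF t] by (intro av) (auto simp: e Z_def turn_simps)
  qed (use ij jk sizes in \<open>auto simp: turn_simps Z_def closed_segment_axis\<close>)
  then show ?thesis by (simp add: turn_simps)
qed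

lemma horizontal_strip: "F.phol G [(-s,s),(-r,s),(-r,-s),(-s,-s),(s,-s),(r,-s),(r,s),(s,s),(-s,s)] = 1"
proof -
  let ?Ps = "[(-s,s),(-r,s),(-r,-s),(-s,-s),(s,-s),(r,-s),(r,s),(s,s),(-s,s)]"
  have av: "fib \<Theta> v (\<sigma>,\<tau>) \<in> (\<Inter>l\<in>{i..<k}. U l)"
    if "v \<in> S" "v \<bullet> e0 \<le> 0" "\<bar>\<tau>\<bar> \<le> s" "\<bar>\<sigma>\<bar> \<le> r" "v = - e0 \<or> \<bar>\<tau>\<bar> = s \<or> \<bar>\<sigma>\<bar> = r" for v \<sigma> \<tau>
    using that sizes by (intro avoid_both avoid_p avoid_m) auto
  have "F.phol (fib \<Theta> (- e0)) ?Ps = F.hol (fib \<Theta> (- e0)) (-s,s) (last ?Ps)"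
  proof (rule F.phol_convex)
    show "continuous_on ({-r..r} \<times> {-s..s}) (fib \<Theta> (- e0))"
      using fib_continuous[OF good_\<Theta>, of "{-r..r} \<times> {-s..s}" "\<lambda>_. - e0" "\<lambda>z. z"] sizes by (auto simp: continuous_on_id)
    show "fib \<Theta> (- e0) ` ({-r..r} \<times> {-s..s}) \<subseteq> F.W"
      unfolding F.W_def by (rule image_subsetI, erule SigmaE, hypsubst, rule av) auto
  qed (use sizes in \<open>auto intro: convex_Times\<close>)
  moreover have "fib \<Theta> (- e0) (-s,s) \<in> F.W"
    unfolding F.W_def using sizes by (intro av) auto
  ultimately have 1: "F.phol (fib \<Theta> (turn (- e0) 1)) ?Ps = 1 + corner i k 0"
    unfolding turn_simps(4)[OF disjI2[OF HOL.refl]] by (simp only: last.simps) (simp add: F.hol_self)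
  define Z :: "(real \<times> real) set" where "Z = {(\<sigma>,\<tau>). \<bar>\<tau>\<bar> \<le> s \<and> \<bar>\<sigma>\<bar> \<le> r \<and> (\<bar>\<tau>\<bar> = s \<or> \<bar>\<sigma>\<bar> = r)}"
  have "F.phol (fib \<Theta> (turn (- e0) 0)) ?Ps = 1 + corner i k 0"
  proof (rule direction_slide[where Z = Z and V = "turn (- e0)", OF F.flat _ good_\<Theta> _ _ _ _ _ _ _ _ 1])
    show "Z \<subseteq> {-1<..<1} \<times> {-1/2<..<1/2}" using sizes by (auto simp: Z_def)
    fix t z assume t: "t \<in> {0..1::real}" and z: "z \<in> Z"
    obtain \<sigma> \<tau> where e: "z = (\<sigma>,\<tau>)" by fastforce
    show "fib \<Theta> (turn (- e0) t) z \<in> (\<Inter>l\<in>{i..<k}. U l)"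
      unfolding e using z turn_e0(2)[OF t] by (intro av) (auto simp: e Z_def turn_simps)
  qed (use ij jk sizes in \<open>auto simp: turn_simps Z_def closed_segment_axis\<close>)
  then show ?thesis by (simp add: turn_simps)
qed

text \<open>The two strip relations make the western arm conjugate to the inverse of the eastern one
  and the southern arm to that of the northern one. The boundary of the whole square thereby becomes
  a commutator of \<open>e1\<close> and \<open>n0\<close>.\<close>

lemma cross_box: "F.phol (G \<circ> rect (-r) r r) unit_square = 1 + corner i k (c * c')"
proof -
  let ?C1 = "(s,s)" and ?C2 = "(-s,s)" and ?C3 = "(-s,-s)" and ?C4 = "(s,-s)"
  let ?A1 = "(r,-s)" and ?A2 = "(r,s)" and ?A3 = "(s,r)" and ?A4 = "(-s,r)"
  let ?A5 = "(-r,s)" and ?A6 = "(-r,-s)" and ?A7 = "(-s,-r)" and ?A8 = "(s,-r)"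
  let ?D1 = "(r,r)" and ?D2 = "(-r,r)" and ?D3 = "(-r,-r)" and ?D4 = "(r,-r)"
  define hh where "hh = F.hol G"
  have c0: "{-s..s} \<times> {-s..s} \<subseteq> free" and c1: "{s..r} \<times> {s..r} \<subseteq> free" and c2: "{-r..-s} \<times> {s..r} \<subseteq> free"
    and c3: "{-r..-s} \<times> {-r..-s} \<subseteq> free" and c4: "{s..r} \<times> {-r..-s} \<subseteq> free"
    and dE: "{r..r} \<times> {-r..r} \<subseteq> free" and dW: "{-r..-r} \<times> {-r..r} \<subseteq> free"
    and dN: "{-r..r} \<times> {r..r} \<subseteq> free" and dS: "{-r..r} \<times> {-r..-r} \<subseteq> free"
    using sizes by (auto simp: free_def)
  define e1 where "e1 = F.phol G [?C1,?C4,?A1,?A2,?C1]"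
  define n0 where "n0 = F.phol G [?C1,?A3,?A4,?C2,?C1]"
  \<comment> \<open>The four outer arms: \<open>R\<close>, \<open>T\<close>, \<open>L\<close>,
    \<open>B\<close> lead around the eastern, northern, western and southern hole, each from one
    inner corner to the next, counterclockwise.\<close>
  define R where "R = hh ?C4 ?A1 * hh ?A1 ?A2 * hh ?A2 ?C1"
  define T where "T = hh ?C1 ?A3 * hh ?A3 ?A4 * hh ?A4 ?C2"
  define L where "L = hh ?C2 ?A5 * hh ?A5 ?A6 * hh ?A6 ?C3"
  define B where "B = hh ?C3 ?A7 * hh ?A7 ?A8 * hh ?A8 ?C4"
  have e1: "e1 = hh ?C1 ?C4 * R" by (simp add: e1_def R_def hh_def mult.assoc)
  have n0: "n0 = T * hh ?C2 ?C1" by (simp add: n0_def T_def hh_def mult.assoc)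
  have E1: "entry e1 a b = (if a = i \<and> b = j then c else 0)" if "i \<le> a" "a < b" "b \<le> j" for a b
    using entry_phol_subblock[OF flat_ik order_refl less_imp_le[OF jk], of a b G "[?C1,?C4,?A1,?A2,?C1]"] that
    unfolding e1_def east_loop by (simp add: plus_utri.rep_eq one_utri.rep_eq entry_corner)
  have E2: "entry e1 a b = 0" if "j \<le> a" "a < b" "b \<le> k" for a b
    using entry_phol_subblock[OF flat_ik less_imp_le[OF ij] order_refl, of a b G "[?C1,?C4,?A1,?A2,?C1]"] that
    unfolding e1_def east_loop_trivial by (simp add: one_utri.rep_eq)
  have N1: "entry n0 a b = 0" if "i \<le> a" "a < b" "b \<le> j" for a b
    using entry_phol_subblock[OF flat_ik order_refl less_imp_le[OF jk], of a b G "[?C1,?A3,?A4,?C2,?C1]"] that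
    unfolding n0_def north_loop_trivial by (simp add: one_utri.rep_eq)
  have N2: "entry n0 a b = (if a = j \<and> b = k then c' else 0)" if "j \<le> a" "a < b" "b \<le> k" for a b
    using entry_phol_subblock[OF flat_ik less_imp_le[OF ij] order_refl, of a b G "[?C1,?A3,?A4,?C2,?C1]"] that
    unfolding n0_def north_loop by (simp add: plus_utri.rep_eq one_utri.rep_eq entry_corner)
  have bl: "blocked i k e1" "blocked i k n0" "unipotent e1" "unipotent n0"
    unfolding e1_def n0_def by (rule F.blocked_phol F.unipotent_phol)+
  have comm: "e1 * n0 = n0 * e1 + corner i k (c * c')"
    by (rule commutator_corner[OF ij jk bl E1 E2 N1 N2])
  have u11: "hh ?C4 ?C1 * hh ?C1 ?C4 = 1" and u22: "hh ?C1 ?C2 * hh ?C2 ?C1 = 1" and u33: "hh ?C2 ?C3 * hh ?C3 ?C2 = 1"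
    unfolding hh_def by (rule free_inverse[OF c0]; use sizes in simp)+
  have u4: "hh ?C3 ?C4 = hh ?C3 ?C2 * (hh ?C2 ?C1 * hh ?C1 ?C4)"
    unfolding hh_def using free_trans[OF c0, of ?C3 ?C2 ?C4] free_trans[OF c0, of ?C2 ?C1 ?C4] sizes by simp
  have "B * hh ?C4 ?C1 * T * hh ?C2 ?C3 = 1"
    using vertical_strip by (simp add: B_def T_def hh_def mult.assoc)
  then have "B * hh ?C4 ?C1 * T * (hh ?C2 ?C3 * hh ?C3 ?C2) = hh ?C3 ?C2"
    unfolding mult.assoc[symmetric] by simp
  then have i1: "B * hh ?C4 ?C1 * T = hh ?C3 ?C2" unfolding u33 by simp
  have "L * hh ?C3 ?C4 * R * hh ?C1 ?C2 = 1"
    using horizontal_strip by (simp add: L_def R_def hh_def mult.assoc)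
  then have "L * hh ?C3 ?C4 * R * (hh ?C1 ?C2 * hh ?C2 ?C1) = hh ?C2 ?C1"
    unfolding mult.assoc[symmetric] by simp
  then have i2: "L * hh ?C3 ?C4 * R = hh ?C2 ?C1" unfolding u22 by simp
  \<comment> \<open>\<open>X\<close> takes the place of the inverses in the commutator: the relation
    is proved after multiplication by \<open>X\<close> and cancelled by centrality of the
    corner.\<close>
  define X where "X = B * hh ?C4 ?C1 * n0 * e1"
  have "R * T * L * X = R * T * L * (B * hh ?C4 ?C1 * T) * (hh ?C2 ?C1 * hh ?C1 ?C4) * R"
    unfolding X_def n0 e1 by (simp only: mult.assoc)
  also have "\<dots> = R * T * (L * (hh ?C3 ?C2 * (hh ?C2 ?C1 * hh ?C1 ?C4)) * R)"
    unfolding i1 by (simp only: mult.assoc)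
  also have "\<dots> = R * T * hh ?C2 ?C1" unfolding u4[symmetric] i2 ..
  also have "\<dots> = (hh ?C4 ?C1 * hh ?C1 ?C4) * R * T * hh ?C2 ?C1" by (simp add: u11)
  also have "\<dots> = hh ?C4 ?C1 * (e1 * n0)" unfolding e1 n0 by (simp only: mult.assoc)
  finally have "B * R * T * L * X = B * hh ?C4 ?C1 * (n0 * e1 + corner i k (c * c'))"
    unfolding comm by (simp only: mult.assoc)
  also have "\<dots> = X + B * (hh ?C4 ?C1 * corner i k (c * c'))"
    unfolding X_def by (simp only: mult.assoc distrib_left)
  finally have BX: "B * R * T * L * X = X + B * (hh ?C4 ?C1 * corner i k (c * c'))" .
  have blB: "blocked i k B" "unipotent B" and blh: "blocked i k (hh P Q)" "unipotent (hh P Q)" for P Q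
    unfolding B_def hh_def by (intro blocked_mult F.blocked_hol unipotent_mult F.unipotent_hol)+
  have blX: "blocked i k X" "unipotent X"
    unfolding X_def by (intro blocked_mult unipotent_mult blB blh bl)+
  have ik: "i \<le> k" using ij jk by simp
  have Q: "B * R * T * L = 1 + corner i k (c * c')"
  proof (rule corner_conjugate[OF blX ik])
    show "B * R * T * L * X = X * (1 + corner i k (c * c'))"
      unfolding BX by (simp add: corner_mult[OF blB ik] corner_mult[OF blh ik] corner_mult[OF blX ik] distrib_left)
  qed
  have t: "hh P R = hh P Q * hh Q R" if "{x..x'} \<times> {y..y'} \<subseteq> free" "P \<in> {x..x'} \<times> {y..y'}"
      "Q \<in> {x..x'} \<times> {y..y'}" "R \<in> {x..x'} \<times> {y..y'}" for P Q R x x' y y'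
    unfolding hh_def using that by (rule free_trans)
  have sS: "hh ?D3 ?D4 = hh ?D3 ?A7 * (hh ?A7 ?A8 * hh ?A8 ?D4)"
    using t[OF dS, of ?D3 ?A7 ?D4] t[OF dS, of ?A7 ?A8 ?D4] sizes by simp
  have sE: "hh ?D4 ?D1 = hh ?D4 ?A1 * (hh ?A1 ?A2 * hh ?A2 ?D1)"
    using t[OF dE, of ?D4 ?A1 ?D1] t[OF dE, of ?A1 ?A2 ?D1] sizes by simp
  have sN: "hh ?D1 ?D2 = hh ?D1 ?A3 * (hh ?A3 ?A4 * hh ?A4 ?D2)"
    using t[OF dN, of ?D1 ?A3 ?D2] t[OF dN, of ?A3 ?A4 ?D2] sizes by simp
  have sW: "hh ?D2 ?D3 = hh ?D2 ?A5 * (hh ?A5 ?A6 * hh ?A6 ?D3)"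
    using t[OF dW, of ?D2 ?A5 ?D3] t[OF dW, of ?A5 ?A6 ?D3] sizes by simp
  \<comment> \<open>At an outer corner the path is pushed through the free corner square to the
    inner corner, which turns the outer boundary into the product of the arms.\<close>
  have k4: "hh ?A8 ?D4 * (hh ?D4 ?A1 * Y) = hh ?A8 ?C4 * (hh ?C4 ?A1 * Y)" for Y
    using t[OF c4, of ?A8 ?D4 ?A1] t[OF c4, of ?A8 ?C4 ?A1] sizes by (simp flip: mult.assoc)
  have k1: "hh ?A2 ?D1 * (hh ?D1 ?A3 * Y) = hh ?A2 ?C1 * (hh ?C1 ?A3 * Y)" for Y
    using t[OF c1, of ?A2 ?D1 ?A3] t[OF c1, of ?A2 ?C1 ?A3] sizes by (simp flip: mult.assoc)
  have k2: "hh ?A4 ?D2 * (hh ?D2 ?A5 * Y) = hh ?A4 ?C2 * (hh ?C2 ?A5 * Y)" for Y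
    using t[OF c2, of ?A4 ?D2 ?A5] t[OF c2, of ?A4 ?C2 ?A5] sizes by (simp flip: mult.assoc)
  have k3: "hh ?A6 ?D3 * hh ?D3 ?C3 = hh ?A6 ?C3"
    using t[OF c3, of ?A6 ?D3 ?C3] sizes by simp
  have k3': "hh ?D3 ?A7 * Y = hh ?D3 ?C3 * (hh ?C3 ?A7 * Y)" for Y
    using t[OF c3, of ?D3 ?C3 ?A7] sizes by (simp add: mult.assoc)
  have "hh ?D3 ?D4 * (hh ?D4 ?D1 * (hh ?D1 ?D2 * hh ?D2 ?D3)) * hh ?D3 ?C3 = hh ?D3 ?C3 * (B * R * T * L)"
    unfolding sS sE sN sW B_def R_def T_def L_def mult.assoc k4 k1 k2 k3 k3' ..
  then have box: "hh ?D3 ?D4 * (hh ?D4 ?D1 * (hh ?D1 ?D2 * hh ?D2 ?D3)) = 1 + corner i k (c * c')"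
    unfolding Q by (rule corner_conjugate[OF blh ik])
  have "F.phol (G \<circ> rect (-r) r r) unit_square = F.phol G (map (rect (-r) r r) unit_square)"
    by (rule F.phol_affine) (rule rect_affine)
  also have "\<dots> = hh ?D3 ?D4 * (hh ?D4 ?D1 * (hh ?D1 ?D2 * hh ?D2 ?D3))"
    unfolding map_rect_unit_square hh_def by simp
  finally show ?thesis unfolding box .
qed

end

lemma (in flat_block) phol_cong:
  assumes "successively (\<lambda>P Q. closed_segment P Q \<subseteq> Z) Ps" "\<And>z. z \<in> Z \<Longrightarrow> G z = G' z"
  shows "phol G Ps = phol G' Ps"
  using assms(1)
proof (induction Ps rule: induct_list012)
  case (3 P Q Ps)
  have "closed_segment P Q \<subseteq> Z" using 3 by simp
  then have "hol G P Q = hol G' P Q"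
    by (intro hol_cong assms(2)) (auto simp: closed_segment_def)
  then show ?case using 3 by simp
qed simp_all

section \<open>Induction over the tree\<close>

context sphere_frame4
begin

text \<open>The path is the normalised segment from \<open>v\<close> to \<open>w\<close>, which
  fails only for antipodal points; these are joined through a third point of the sphere.\<close>

lemma sphere_slide:
  assumes fl: "flat U i k A" "i \<le> k" and g: "good \<Theta>" and vw: "v \<in> S" "w \<in> S"
    and b: "-1 < p" "p < -d" "d < q" "q < 1" "d < \<gamma>" "\<gamma> < 1/2" "0 < d"
    and Z: "\<And>u \<sigma> \<tau>. u \<in> S \<Longrightarrow> \<bar>\<sigma>\<bar> < 1 \<Longrightarrow> \<bar>\<tau>\<bar> < 1/2 \<Longrightarrow> d < \<bar>\<sigma>\<bar> \<or> d < \<bar>\<tau>\<bar>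
              \<Longrightarrow> fib \<Theta> u (\<sigma>,\<tau>) \<in> (\<Inter>l\<in>{i..<k}. U l)"
    and 1: "flat_block.phol A i k (fib \<Theta> w \<circ> rect p q \<gamma>) unit_square = 1 + corner i k c"
  shows "flat_block.phol A i k (fib \<Theta> v \<circ> rect p q \<gamma>) unit_square = 1 + corner i k c"
proof -
  interpret flat_block U A i k by unfold_locales (fact fl)
  let ?Ps = "[(p,-\<gamma>),(q,-\<gamma>),(q,\<gamma>),(p,\<gamma>),(p,-\<gamma>)]"
  have af: "phol (fib \<Theta> u \<circ> rect p q \<gamma>) unit_square = phol (fib \<Theta> u) ?Ps" for u
    unfolding map_rect_unit_square[symmetric] by (rule phol_affine) (rule rect_affine)
  have step: "phol (fib \<Theta> v) ?Ps = 1 + corner i k c"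
    if S: "v \<in> S" "w \<in> S" "v \<noteq> - w" and 1: "phol (fib \<Theta> w) ?Ps = 1 + corner i k c" for v w
  proof -
    define N where "N t = (1 - t) *\<^sub>R v + t *\<^sub>R w" for t
    define V where "V t = N t /\<^sub>R norm (N t)" for t
    have vw1: "norm v = 1" "norm w = 1" "v \<bullet> et = 0" "w \<bullet> et = 0" using S by (auto simp: S_def)
    have N0: "N t \<noteq> 0" if t: "t \<in> {0..1}" for t
    proof
      assume "N t = 0"
      then have eq: "(1 - t) *\<^sub>R v = - (t *\<^sub>R w)" by (simp add: N_def eq_neg_iff_add_eq_0)
      then have "norm ((1 - t) *\<^sub>R v) = norm (t *\<^sub>R w)" by simp
      then have "1 - t = t" using t vw1 by simp
      then have "t = 1/2" by simp
      with eq show False using S(3) by (simp add: scaleR_right.minus[symmetric] del: scaleR_minus_right)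
    qed
    have "N t \<bullet> et = 0" for t by (simp add: N_def inner_add_left vw1)
    then have VS: "V t \<in> S" if "t \<in> {0..1}" for t using N0[OF that] by (simp add: V_def S_def)
    have V01: "V 0 = v" "V 1 = w" by (auto simp: V_def N_def vw1)
    define Z :: "(real \<times> real) set" where "Z = {(\<sigma>,\<tau>). p \<le> \<sigma> \<and> \<sigma> \<le> q \<and> \<bar>\<tau>\<bar> \<le> \<gamma> \<and> (\<sigma> = p \<or> \<sigma> = q \<or> \<bar>\<tau>\<bar> = \<gamma>)}"
    have "phol (fib \<Theta> (V 0)) ?Ps = 1 + corner i k c"
    proof (rule direction_slide[where Z = Z and V = V, OF fl g])
      show "continuous_on {0..1} V" unfolding V_def
        by (intro continuous_intros) (use N0 in \<open>auto simp: N_def intro!: continuous_intros\<close>)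
      show "Z \<subseteq> {-1<..<1} \<times> {-1/2<..<1/2}" using b by (auto simp: Z_def)
      fix t z assume t: "t \<in> {0..1::real}" and z: "z \<in> Z"
      obtain \<sigma> \<tau> where e: "z = (\<sigma>,\<tau>)" by fastforce
      show "fib \<Theta> (V t) z \<in> (\<Inter>l\<in>{i..<k}. U l)"
        unfolding e using z b by (intro assms(13) VS t) (auto simp: e Z_def)
    next
      show "successively (\<lambda>P Q. closed_segment P Q \<subseteq> Z) ?Ps"
        using b by (auto simp: Z_def closed_segment_axis)
    qed (use b VS 1 V01 in \<open>auto simp: Z_def\<close>)
    then show ?thesis by (simp only: V01)
  qed
  have "phol (fib \<Theta> v) ?Ps = 1 + corner i k c"
  proof (cases "v = - w")
    case False
    then show ?thesis using step[OF vw False] 1 af by simp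
  next
    case True
    obtain b where b: "b \<in> S" "b \<noteq> - w" "v \<noteq> - b"
    proof (cases "w = b1 \<or> w = - b1")
      case True
      have "e0 \<noteq> b1" "e0 \<noteq> - b1" using frame_simps(2) orth_b(1) by (metis zero_neq_one, metis inner_minus_left neg_0_equal_iff_equal zero_neq_one)
      then show thesis using True that[of e0] \<open>v = - w\<close> by auto
    next
      case False
      then have "b1 \<noteq> - w" "v \<noteq> - b1" using \<open>v = - w\<close> by (metis minus_minus, metis neg_equal_iff_equal)
      then show thesis by (rule that[OF b1_in_S])
    qed
    have "phol (fib \<Theta> b) ?Ps = 1 + corner i k c" using step[OF b(1) vw(2) b(2)] 1 af by simp
    then show ?thesis using step[OF vw(1) b(1) b(3)] by blast
  qed
  then show ?thesis using af by simp
qed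

lemma tree_nonempty: "tree \<Theta> \<delta> L \<Longrightarrow> L \<noteq> []"
  by (induction rule: tree.induct) auto

lemma tree_complement:
  assumes "tree \<Theta> \<delta> L" "good \<Theta>" "0 < \<delta>" "\<delta> < 1/2"
    and U: "\<And>l. l < length L \<Longrightarrow> U (i + l) = - (fst (L!l) ` S)" and x: "x \<notin> \<Theta> ` K \<delta>"
  shows "x \<in> (\<Inter>l\<in>{i..<i + length L}. U l)"
proof
  fix l assume "l \<in> {i..<i + length L}"
  then obtain m where m: "l = i + m" "m < length L" by (auto simp: le_iff_add)
  then have "(fst (L!m), snd (L!m)) \<in> set L" by simp
  from tree_leaf_facts[OF assms(1-4) this]
  have "fst (L!m) ` S \<subseteq> \<Theta> ` K \<delta>" using S_subset_K[of "snd (L!m)"] by (meson image_mono less_imp_le order_trans)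
  then show "x \<in> U l" using U[OF m(2)] x m(1) by auto
qed

lemma fib_notin_K:
  assumes "good \<Theta>" "v \<in> S" "\<bar>\<sigma>\<bar> < 1" "\<bar>\<tau>\<bar> < 1/2" "\<delta> < \<bar>\<sigma>\<bar> \<or> \<delta> < \<bar>\<tau>\<bar>" "\<delta> < 1/2"
  shows "fib \<Theta> v (\<sigma>,\<tau>) \<notin> \<Theta> ` K \<delta>"
proof
  assume "fib \<Theta> v (\<sigma>,\<tau>) \<in> \<Theta> ` K \<delta>"
  then obtain x where x: "x \<in> K \<delta>" "\<Theta> ((1 + \<sigma>) *\<^sub>R v + \<tau> *\<^sub>R et) = \<Theta> x" by (auto simp: fib_def)
  then have "(1 + \<sigma>) *\<^sub>R v + \<tau> *\<^sub>R et = x"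
    using assms(1) polar_in_Od[OF assms(2-4)] K_subset_Od[OF assms(6)] by (auto simp: good_def inj_on_def)
  then show False using x(1) polar_in_K_iff[OF assms(2,3), of \<tau> \<delta>] assms(5) by auto
qed

lemma good_hat:
  assumes "good \<Theta>" "rot \<rho>"
  shows "good (\<Theta> \<circ> hat \<rho>)"
proof -
  have sub: "hat \<rho> ` Od \<subseteq> Od" using hat_Od[OF assms(2)] by auto
  have "continuous_on Od (\<Theta> \<circ> hat \<rho>)"
    using assms(1) sub hat_cont[OF assms(2)] unfolding good_def
    by (intro continuous_on_compose) (auto intro: continuous_on_subset)
  moreover have "inj_on (\<Theta> \<circ> hat \<rho>) Od"
    using assms(1) sub hat_inj[OF assms(2)] unfolding good_def
    by (intro comp_inj_on) (auto intro: inj_on_subset)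
  ultimately show ?thesis by (simp add: good_def)
qed

theorem tree_essential:
  assumes "tree \<Theta> \<delta> L" "good \<Theta>" "0 < \<delta>" "\<delta> < 1/2"
    and "flat U i (i + length L) A" "\<And>l. l < length L \<Longrightarrow> U (i + l) = - (fst (L!l) ` S)"
    and "\<And>l. l < length L \<Longrightarrow>
        cochain_eval (A (i + l) (Suc (i + l))) (polygon (fib (fst (L!l)) e0 \<circ> rect (-1/4) (1/4) (1/4)) unit_square) = 1"
  shows "\<exists>c. c \<noteq> 0 \<and> (\<forall>p q \<gamma>. -1 < p \<longrightarrow> p < -\<delta> \<longrightarrow> \<delta> < q \<longrightarrow> q < 1 \<longrightarrow> \<delta> < \<gamma> \<longrightarrow> \<gamma> < 1/2 \<longrightarrow>
     flat_block.phol A i (i + length L) (fib \<Theta> e0 \<circ> rect p q \<gamma>) unit_square = 1 + corner i (i + length L) c)"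
  using assms
proof (induction arbitrary: i rule: tree.induct)
  case (leaf \<Theta> \<delta>)
  have fl: "flat U i (Suc i) A" using leaf.prems(4) by simp
  interpret flat_block U A i "Suc i" by unfold_locales (fact fl)
  have 1: "phol (fib \<Theta> e0 \<circ> rect (-1/4) (1/4) (1/4)) unit_square = 1 + corner i (Suc i) 1"
    using leaf.prems(6)[of 0] phol_leaf[OF HOL.refl, of "fib \<Theta> e0 \<circ> rect (-1/4) (1/4) (1/4)" unit_square]
    by (simp add: comp_def)
  have "phol (fib \<Theta> e0 \<circ> rect p q \<gamma>) unit_square = 1 + corner i (Suc i) 1"
    if "-1 < p" "p < -\<delta>" "\<delta> < q" "q < 1" "\<delta> < \<gamma>" "\<gamma> < 1/2" for p q \<gamma>
  \<comment> \<open>For a leaf only the core sphere is removed, not its tube, so the rectangle may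
    be deformed as long as it surrounds the origin; hence \<open>d = 0\<close>.\<close>
  proof (rule rect_slide[OF fl _ leaf.prems(1) e0_in_S(1), where d = 0 and p' = "-1/4" and q' = "1/4" and \<gamma>' = "1/4"])
    fix \<sigma> \<tau> :: real assume b: "\<bar>\<sigma>\<bar> < 1" "\<bar>\<tau>\<bar> < 1/2" "0 < \<bar>\<sigma>\<bar> \<or> 0 < \<bar>\<tau>\<bar>"
    have "fib \<Theta> e0 (\<sigma>,\<tau>) \<notin> \<Theta> ` K 0" by (rule fib_notin_K[OF leaf.prems(1) e0_in_S(1) b]) simp
    then have "fib \<Theta> e0 (\<sigma>,\<tau>) \<notin> \<Theta> ` S" using S_subset_K[of 0] by auto
    then show "fib \<Theta> e0 (\<sigma>,\<tau>) \<in> (\<Inter>l\<in>{i..<Suc i}. U l)" using leaf.prems(5)[of 0] by simp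
  qed (use that 1 leaf.prems(2) in auto)
  moreover have len: "i + length [(\<Theta>,\<delta>)] = Suc i" by simp
  ultimately show ?case unfolding len using one_neq_zero by blast
next
  case (node \<rho> a h s \<delta> \<delta>' \<Theta> L1 L2)
  note par = node.hyps(2)
  have h: "0 < h" "h < 1/4" "0 < a" "0 < \<delta>'" "\<delta>' < 1/2" "\<delta>' < s" "h * (1 + \<delta>') \<le> \<delta>"
    using par by (auto simp: params_def)
  note gc = good_child[OF node.prems(1) node.hyps(1) h(1-3)]
  define j k where "j = i + length L1" and "k = i + length (L1 @ L2)"
  have k: "k = j + length L2" by (simp add: j_def k_def)
  have ij: "i < j" "j < k" using node.hyps(3,4) tree_nonempty by (auto simp: j_def k)
  have fl: "flat U i k A" using node.prems(4) by (simp add: k_def)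
  have U1: "U (i + l) = - (fst (L1!l) ` S)" if "l < length L1" for l
    using node.prems(5)[of l] that by (simp add: nth_append)
  have U2: "U (j + l) = - (fst (L2!l) ` S)" if "l < length L2" for l
    using node.prems(5)[of "length L1 + l"] that by (simp add: nth_append j_def add.assoc)
  have A1: "cochain_eval (A (i + l) (Suc (i + l))) (polygon (fib (fst (L1!l)) e0 \<circ> rect (-1/4) (1/4) (1/4)) unit_square) = 1"
    if "l < length L1" for l using node.prems(6)[of l] that by (simp add: nth_append comp_def)
  have A2: "cochain_eval (A (j + l) (Suc (j + l))) (polygon (fib (fst (L2!l)) e0 \<circ> rect (-1/4) (1/4) (1/4)) unit_square) = 1"
    if "l < length L2" for l using node.prems(6)[of "length L1 + l"] that by (simp add: nth_append j_def add.assoc comp_def)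
  have fl1: "flat U i (i + length L1) A" and fl2: "flat U j (j + length L2) A"
    using flat_subinterval[OF fl order_refl] flat_subinterval[OF fl _ order_refl] ij by (auto simp: j_def k)
  obtain c where c: "c \<noteq> 0" "\<And>p q \<gamma>. -1 < p \<Longrightarrow> p < -\<delta>' \<Longrightarrow> \<delta>' < q \<Longrightarrow> q < 1 \<Longrightarrow> \<delta>' < \<gamma> \<Longrightarrow> \<gamma> < 1/2 \<Longrightarrow>
     flat_block.phol A i j (fib (\<Theta> \<circ> hat \<rho> \<circ> chip a h) e0 \<circ> rect p q \<gamma>) unit_square = 1 + corner i j c"
    using node.IH(1)[OF gc(1) h(4,5) fl1 U1 A1] unfolding j_def by blast
  obtain c' where c': "c' \<noteq> 0" "\<And>p q \<gamma>. -1 < p \<Longrightarrow> p < -\<delta>' \<Longrightarrow> \<delta>' < q \<Longrightarrow> q < 1 \<Longrightarrow> \<delta>' < \<gamma> \<Longrightarrow> \<gamma> < 1/2 \<Longrightarrow>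
     flat_block.phol A j k (fib (\<Theta> \<circ> hat \<rho> \<circ> chim a h) e0 \<circ> rect p q \<gamma>) unit_square = 1 + corner j k c'"
    using node.IH(2)[OF gc(2) h(4,5) fl2 U2 A2] unfolding k by blast
  note gh = good_hat[OF node.prems(1) node.hyps(1)]
  \<comment> \<open>The last condition in \<open>params\<close> gives
    \<open>s < h * (1 - \<delta>')\<close>, so the left side of the box of a child lies outside the
    tube of the child.\<close>
  have sh: "-1 < s / h - 1 \<and> s / h - 1 < - \<delta>' \<and> s < 1/2"
  proof -
    have p: "0 < h" "h < 1/4" "0 < s" "\<delta>' < 1/2" "s\<^sup>2 < h\<^sup>2 * ((1 - \<delta>')\<^sup>2 - 1 / a\<^sup>2)"
      using par by (auto simp: params_def)
    have "h\<^sup>2 * ((1 - \<delta>')\<^sup>2 - 1 / a\<^sup>2) \<le> h\<^sup>2 * (1 - \<delta>')\<^sup>2" by (intro mult_left_mono) auto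
    then have "s\<^sup>2 < (h * (1 - \<delta>'))\<^sup>2" using p(5) by (simp add: power_mult_distrib)
    then have l: "s < h * (1 - \<delta>')" using p by (intro power_less_imp_less_base[of s 2]) auto
    have "h * (1 - \<delta>') \<le> h * 1" using p h(4) by (intro mult_left_mono) auto
    then show ?thesis using l p by (simp add: field_simps)
  qed
  interpret X: crossing e0 et b1 b2 U A i j k "\<Theta> \<circ> hat \<rho>" a h s \<delta> \<delta>' c c'
  proof unfold_locales
    show "x \<in> (\<Inter>l\<in>{i..<j}. U l)" if "x \<notin> (\<Theta> \<circ> hat \<rho> \<circ> chip a h) ` K \<delta>'" for x
      using tree_complement[where U = U, OF node.hyps(3) gc(1) h(4,5) U1 that] unfolding j_def .
    show "x \<in> (\<Inter>l\<in>{j..<k}. U l)" if "x \<notin> (\<Theta> \<circ> hat \<rho> \<circ> chim a h) ` K \<delta>'" for x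
      using tree_complement[where U = U, OF node.hyps(4) gc(2) h(4,5) U2 that] unfolding k .
  qed (use fl ij gh par c(2) c'(2) h sh in auto)
  have ik: "i \<le> k" using ij by simp
  have "X.F.phol (fib \<Theta> e0 \<circ> rect p q \<gamma>) unit_square = 1 + corner i k (c * c')"
    if b: "-1 < p" "p < -\<delta>" "\<delta> < q" "q < 1" "\<delta> < \<gamma>" "\<gamma> < 1/2" for p q \<gamma>
  proof (rule sphere_slide[where d = \<delta> and w = "\<rho> b1", OF fl ik node.prems(1) e0_in_S(1) _ b])
    show "\<rho> b1 \<in> S" by (rule rot_S[OF node.hyps(1) b1_in_S])
    show "fib \<Theta> u (\<sigma>,\<tau>) \<in> (\<Inter>l\<in>{i..<k}. U l)"
      if "u \<in> S" "\<bar>\<sigma>\<bar> < 1" "\<bar>\<tau>\<bar> < 1/2" "\<delta> < \<bar>\<sigma>\<bar> \<or> \<delta> < \<bar>\<tau>\<bar>" for u \<sigma> \<tau>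
      using tree_complement[where U = U and i = i, OF tree.node[OF node.hyps] node.prems(1-3,5) fib_notin_K[OF node.prems(1) that node.prems(3)]]
      unfolding k_def .
    have "X.F.phol (fib (\<Theta> \<circ> hat \<rho>) b1 \<circ> rect p q \<gamma>) unit_square = 1 + corner i k (c * c')"
    proof (rule rect_slide[OF fl ik gh b1_in_S, where d = "h * (1 + \<delta>')" and p' = "- X.r" and q' = X.r and \<gamma>' = X.r])
      show "X.F.phol (X.G \<circ> rect (- X.r) X.r X.r) unit_square = 1 + corner i k (c * c')"
        by (rule X.cross_box)
      show "fib (\<Theta> \<circ> hat \<rho>) b1 (\<sigma>,\<tau>) \<in> (\<Inter>l\<in>{i..<k}. U l)"
        if "\<bar>\<sigma>\<bar> < 1" "\<bar>\<tau>\<bar> < 1/2" "h * (1 + \<delta>') < \<bar>\<sigma>\<bar> \<or> h * (1 + \<delta>') < \<bar>\<tau>\<bar>" for \<sigma> \<tau>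
        using that X.sizes by (intro X.avoid_both X.avoid_p X.avoid_m b1_in_S) auto
    qed (insert b h X.sizes node.prems(2), linarith+)
    \<comment> \<open>At positive radius the normal plane of the rotated embedding over
      \<open>b1\<close> is the normal plane of the original one over
      \<open>\<rho> b1\<close>.\<close>
    moreover have "X.F.phol (fib (\<Theta> \<circ> hat \<rho>) b1 \<circ> rect p q \<gamma>) unit_square = X.F.phol (fib \<Theta> (\<rho> b1) \<circ> rect p q \<gamma>) unit_square"
    proof (rule X.F.phol_cong[OF unit_square_segments])
      fix z assume z: "z \<in> square_boundary"
      obtain x y where e: "z = (x,y)" by fastforce
      have x: "\<bar>x\<bar> \<le> 1" using z by (auto simp: e square_boundary_def max_def split: if_splits)
      have pq: "p < q" using b node.prems(2) by linarith
      have "\<bar>x * (q - p)\<bar> \<le> 1 * (q - p)" unfolding abs_mult using x pq by (intro mult_mono) auto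
      then have "0 < 1 + ((p + q) / 2 + x * (q - p) / 2)" using b(1) unfolding abs_le_iff by (simp add: field_simps)
      then show "(fib (\<Theta> \<circ> hat \<rho>) b1 \<circ> rect p q \<gamma>) z = (fib \<Theta> (\<rho> b1) \<circ> rect p q \<gamma>) z"
        by (simp add: e fib_def rect_def hat_polar[OF b1_in_S])
    qed
    ultimately show "X.F.phol (fib \<Theta> (\<rho> b1) \<circ> rect p q \<gamma>) unit_square = 1 + corner i k (c * c')" by simp
  qed (use node.prems(2) in simp)
  moreover have "c * c' \<noteq> 0" using c(1) c'(1) by simp
  ultimately show ?case unfolding k_def[symmetric] by blast
qed

end

section \<open>Folding spheres into small sets\<close>

text \<open>On the circle of radius \<open>r \<le> s\<close> in the \<open>(x,z)\<close>-plane, \<open>push_top c b s\<close> moves the topmost point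
  counterclockwise until its height is \<open>c * s\<close>; on the left half it preserves the level \<open>b * s\<close> and
  on the right half it fixes everything below the level \<open>c * s\<close>.\<close>

definition lower :: "real \<Rightarrow> real \<Rightarrow> real \<Rightarrow> real \<Rightarrow> real \<Rightarrow> real" where
  "lower c b s r z = min z (max (b * s + (c - b) / (1 - b) * (z - b * s)) (z - max 0 (r - c * s)))"

text \<open>The abscissa of the right-hand point at height \<open>c * s\<close> on the circle of
  radius \<open>r\<close>, and 0 if the circle stays below that height. \<open>push_right\<close>
  stretches the abscissae from 0 to this value over the interval symmetric about 0.\<close>

definition slack :: "real \<Rightarrow> real \<Rightarrow> real \<Rightarrow> real" where
  "slack c s r = sqrt (max 0 (r\<^sup>2 - (c * s)\<^sup>2))"

definition push_left :: "real \<Rightarrow> real \<Rightarrow> real \<Rightarrow> real \<times> real \<Rightarrow> real \<times> real" where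
  "push_left c b s = (\<lambda>(x,z). let r = sqrt (x\<^sup>2 + z\<^sup>2); z' = lower c b s r z in (- sqrt (r\<^sup>2 - z'\<^sup>2), z'))"

definition push_right :: "real \<Rightarrow> real \<Rightarrow> real \<times> real \<Rightarrow> real \<times> real" where
  "push_right c s = (\<lambda>(x,z). let r = sqrt (x\<^sup>2 + z\<^sup>2); x' = min x (2 * x - slack c s r) in (x', sqrt (r\<^sup>2 - x'\<^sup>2)))"

definition push_top :: "real \<Rightarrow> real \<Rightarrow> real \<Rightarrow> real \<times> real \<Rightarrow> real \<times> real" where
  "push_top c b s p = (if fst p \<le> 0 then push_left c b s p else if snd p \<le> 0 then p else push_right c s p)"

locale push =
  fixes c b :: real
  assumes b0: "0 \<le> b" and bc: "b < c" and c1: "c < 1"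
begin

lemma slope: "0 < (c - b) / (1 - b)" "(c - b) / (1 - b) < 1"
  using b0 bc c1 by auto

lemma lower_strict:
  assumes "z < w"
  shows "lower c b s r z < lower c b s r w"
proof -
  have "(c - b) / (1 - b) * (z - b * s) < (c - b) / (1 - b) * (w - b * s)"
    using slope assms by (intro mult_strict_left_mono) auto
  then show ?thesis using assms unfolding lower_def by (auto simp: min_def max_def)
qed

lemma lower_inject: "lower c b s r z = lower c b s r w \<Longrightarrow> z = w"
  using lower_strict[of z w s r] lower_strict[of w z s r] by (cases z w rule: linorder_cases) auto

lemma lower_below:
  assumes "z \<le> b * s"
  shows "lower c b s r z = z"
proof -
  have "(c - b) / (1 - b) * (b * s - z) \<le> 1 * (b * s - z)"
    using slope assms by (intro mult_right_mono) auto
  then have "z \<le> b * s + (c - b) / (1 - b) * (z - b * s)"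
    by (simp add: right_diff_distrib)
  then show ?thesis unfolding lower_def by auto
qed

lemma slope_bound:
  assumes "z \<le> s"
  shows "b * s + (c - b) / (1 - b) * (z - b * s) \<le> c * s"
proof -
  have "(c - b) / (1 - b) * (z - b * s) \<le> (c - b) / (1 - b) * (s - b * s)"
    using slope assms by (intro mult_left_mono) auto
  also have "\<dots> = (c - b) * s" using bc c1 by (simp add: field_simps)
  finally show ?thesis by (simp add: algebra_simps)
qed

lemma lower_above:
  assumes "b * s \<le> z" "z \<le> r" "r \<le> s"
  shows "b * s \<le> lower c b s r z" "lower c b s r z \<le> c * s"
proof -
  have "0 \<le> (c - b) / (1 - b) * (z - b * s)" using slope assms by (intro mult_nonneg_nonneg) auto
  then show "b * s \<le> lower c b s r z" using assms unfolding lower_def by auto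
  have "z - max 0 (r - c * s) \<le> c * s" using assms by (auto simp: max_def)
  then show "lower c b s r z \<le> c * s"
    using slope_bound[of z s] assms unfolding lower_def by (auto simp: min_def max_def)
qed

text \<open>The topmost point must go to the same place under both formulas. On the right its height
  becomes \<open>min r (c * s)\<close> by the choice of \<open>slack\<close>; the second argument of
  \<open>max\<close> in \<open>lower\<close> arranges the same on the left.\<close>

lemma lower_top:
  assumes "0 \<le> r" "r \<le> s"
  shows "lower c b s r r = min r (c * s)"
  using slope_bound[of r s] assms unfolding lower_def by (auto simp: min_def max_def)

lemma lower_bounds:
  assumes "\<bar>z\<bar> \<le> r" "r \<le> s"
  shows "- r \<le> lower c b s r z" "lower c b s r z \<le> z" "\<bar>lower c b s r z\<bar> \<le> r"
proof -
  have s: "0 \<le> b * s" using assms b0 by auto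
  show 1: "lower c b s r z \<le> z" by (simp add: lower_def)
  show 2: "- r \<le> lower c b s r z"
  proof (cases "z \<le> b * s")
    case True
    then show ?thesis using lower_below assms by auto
  next
    case False
    then have "b * s \<le> lower c b s r z" using lower_above(1)[of s z r] assms by auto
    then show ?thesis using s assms by auto
  qed
  show "\<bar>lower c b s r z\<bar> \<le> r" using 1 2 assms by auto
qed

lemma lower_bottom: "0 \<le> r \<Longrightarrow> r \<le> s \<Longrightarrow> lower c b s r (- r) = - r"
  using b0 by (intro lower_below) (auto intro: order_trans[of _ 0])

lemma slack_facts:
  assumes "0 \<le> r" "r \<le> s"
  shows "0 \<le> slack c s r" "slack c s r \<le> r" "r\<^sup>2 - (slack c s r)\<^sup>2 = (min r (c * s))\<^sup>2" "r \<noteq> 0 \<Longrightarrow> slack c s r < r"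
proof -
  have cs: "0 \<le> c * s" using assms b0 bc by auto
  show 0: "0 \<le> slack c s r" by (simp add: slack_def)
  have sq: "(slack c s r)\<^sup>2 = max 0 (r\<^sup>2 - (c * s)\<^sup>2)" by (simp add: slack_def)
  show 3: "r\<^sup>2 - (slack c s r)\<^sup>2 = (min r (c * s))\<^sup>2"
  proof (cases "r \<le> c * s")
    case True
    then have "r\<^sup>2 \<le> (c * s)\<^sup>2" using assms by (intro power_mono) auto
    then show ?thesis using True by (simp add: sq)
  next
    case False
    then have "(c * s)\<^sup>2 \<le> r\<^sup>2" using cs by (intro power_mono) auto
    then show ?thesis using False by (simp add: sq)
  qed
  then have "(slack c s r)\<^sup>2 \<le> r\<^sup>2" by (metis diff_ge_0_iff_ge zero_le_power2)
  then show 2: "slack c s r \<le> r" using assms(1) by (rule power2_le_imp_le)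
  assume "r \<noteq> 0"
  then have "0 < s" "0 < r" using assms by auto
  then have "0 < min r (c * s)" using b0 bc by auto
  then have "0 < (min r (c * s))\<^sup>2" by (rule zero_less_power)
  then have "(slack c s r)\<^sup>2 < r\<^sup>2" using 3 by linarith
  then show "slack c s r < r" using assms(1) by (rule power_less_imp_less_base)
qed

lemma right_facts:
  assumes "0 \<le> x" "x \<le> r" "r \<le> s"
  defines "x' \<equiv> min x (2 * x - slack c s r)"
  shows "- slack c s r \<le> x'" "x' \<le> r" "\<bar>x'\<bar> \<le> r" "x \<le> slack c s r \<Longrightarrow> \<bar>x'\<bar> \<le> slack c s r" "slack c s r \<le> x \<Longrightarrow> x' = x"
  using slack_facts[of r s] assms by (auto simp: min_def)

lemma sqrt_norm:
  assumes "\<bar>y\<bar> \<le> sqrt (x\<^sup>2 + z\<^sup>2)"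
  shows "(sqrt ((sqrt (x\<^sup>2 + z\<^sup>2))\<^sup>2 - y\<^sup>2))\<^sup>2 = x\<^sup>2 + z\<^sup>2 - y\<^sup>2"
proof -
  have "y\<^sup>2 \<le> (sqrt (x\<^sup>2 + z\<^sup>2))\<^sup>2" using assms by (rule power2_le_iff_abs_le[THEN iffD2, rotated]) simp
  then show ?thesis by simp
qed

lemma abs_le_radius: "\<bar>x\<bar> \<le> sqrt (x\<^sup>2 + z\<^sup>2)" "\<bar>z\<bar> \<le> sqrt (x\<^sup>2 + z\<^sup>2)"
  by (rule real_le_rsqrt, simp)+

lemma push_top_radius:
  assumes "sqrt (x\<^sup>2 + z\<^sup>2) \<le> s" "push_top c b s (x,z) = (x',z')"
  shows "x'\<^sup>2 + z'\<^sup>2 = x\<^sup>2 + z\<^sup>2"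
proof -
  consider "x \<le> 0" | "0 < x" "z \<le> 0" | "0 < x" "0 < z" by linarith
  then show ?thesis
  proof cases
    case 1
    then show ?thesis using assms sqrt_norm[of "lower c b s (sqrt (x\<^sup>2 + z\<^sup>2)) z" x z]
        lower_bounds(3)[OF abs_le_radius(2) assms(1)]
      by (auto simp: push_top_def push_left_def Let_def)
  next
    case 2
    then show ?thesis using assms by (simp add: push_top_def)
  next
    case 3
    let ?r = "sqrt (x\<^sup>2 + z\<^sup>2)"
    have "\<bar>min x (2 * x - slack c s ?r)\<bar> \<le> ?r"
      using right_facts(3)[of x ?r s] 3 abs_le_radius(1)[of x z] assms(1) by simp
    from sqrt_norm[OF this] show ?thesis using 3 assms
      by (auto simp: push_top_def push_right_def Let_def)
  qed
qed

lemma push_top_left: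
  assumes "x \<le> 0" "sqrt (x\<^sup>2 + z\<^sup>2) \<le> s"
  shows "z \<le> b * s \<Longrightarrow> push_top c b s (x,z) = (x,z)"
    "b * s \<le> z \<Longrightarrow> b * s \<le> snd (push_top c b s (x,z)) \<and> snd (push_top c b s (x,z)) \<le> c * s"
    "fst (push_top c b s (x,z)) \<le> 0"
proof -
  let ?r = "sqrt (x\<^sup>2 + z\<^sup>2)"
  have z: "z \<le> ?r" using abs_le_radius(2)[of z x] by linarith
  show "push_top c b s (x,z) = (x,z)" if "z \<le> b * s"
    using assms(1) lower_below[OF that, of ?r] by (simp add: push_top_def push_left_def Let_def real_sqrt_abs)
  show "b * s \<le> snd (push_top c b s (x,z)) \<and> snd (push_top c b s (x,z)) \<le> c * s" if "b * s \<le> z"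
    using lower_above[OF that z assms(2)] assms(1) by (simp add: push_top_def push_left_def Let_def)
  have "(lower c b s ?r z)\<^sup>2 \<le> ?r\<^sup>2"
    using lower_bounds(3)[OF abs_le_radius(2) assms(2)] by (rule power2_le_iff_abs_le[THEN iffD2, rotated]) simp
  then show "fst (push_top c b s (x,z)) \<le> 0"
    using assms(1) by (simp add: push_top_def push_left_def Let_def)
qed

lemma push_top_right:
  assumes "0 \<le> x" "sqrt (x\<^sup>2 + z\<^sup>2) \<le> s"
  shows "z \<le> c * s \<Longrightarrow> push_top c b s (x,z) = (x,z)" "c * s \<le> z \<Longrightarrow> c * s \<le> snd (push_top c b s (x,z))"
proof -
  let ?r = "sqrt (x\<^sup>2 + z\<^sup>2)"
  have "0 \<le> sqrt (x\<^sup>2 + z\<^sup>2)" by simp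
  then have s: "0 \<le> s" using assms(2) by linarith
  then have cs: "0 \<le> c * s" using b0 bc by simp
  have r: "0 \<le> ?r" "?r \<le> s" using assms by auto
  show fx: "push_top c b s (x,z) = (x,z)" if zc: "z \<le> c * s"
  proof -
    consider "x = 0" "z \<le> b * s" | "x = 0" "b * s < z" | "0 < x" "z \<le> 0" | "0 < x" "0 < z" using assms by linarith
    then show ?thesis
    proof cases
      case 1
      then show ?thesis using push_top_left(1)[of x z s] assms by simp
    next
      case 2
      then have "0 < z" using b0 s by (metis mult_nonneg_nonneg order_le_less_trans)
      then have "lower c b s ?r z = z" using 2 lower_top[OF r] zc by simp
      then show ?thesis using 2 \<open>0 < z\<close> by (simp add: push_top_def push_left_def Let_def)
    next
      case 3
      then show ?thesis by (simp add: push_top_def)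
    next
      case 4
      have "z\<^sup>2 \<le> (min ?r (c * s))\<^sup>2" using 4 zc abs_le_radius(2)[of z x] by (intro power_mono) auto
      then have "(slack c s ?r)\<^sup>2 \<le> x\<^sup>2" using slack_facts(3)[OF r] by simp
      then have "slack c s ?r \<le> x" using assms(1) by (rule power2_le_imp_le)
      then have "min x (2 * x - slack c s ?r) = x" by simp
      then show ?thesis using 4 by (simp add: push_top_def push_right_def Let_def)
    qed
  qed
  show "c * s \<le> snd (push_top c b s (x,z))" if zc: "c * s \<le> z"
  proof (cases "z \<le> c * s")
    case True
    then show ?thesis using fx zc by simp
  next
    case False
    then have z0: "0 < z" using cs by linarith
    have r': "c * s \<le> ?r" using False abs_le_radius(2)[of z x] by linarith
    show ?thesis
    proof (cases "x = 0")
      case True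
      then have "?r = z" using z0 by simp
      then have "lower c b s ?r z = c * s" using lower_top[OF r] r' by simp
      then show ?thesis using True by (simp add: push_top_def push_left_def Let_def)
    next
      case False
      have "(c * s)\<^sup>2 \<le> z\<^sup>2" using zc cs by (intro power_mono) auto
      then have "x\<^sup>2 \<le> (slack c s ?r)\<^sup>2" using slack_facts(3)[OF r] r' by simp
      then have "x \<le> slack c s ?r" using slack_facts(1)[OF r] by (rule power2_le_imp_le)
      then have "\<bar>min x (2 * x - slack c s ?r)\<bar> \<le> slack c s ?r"
        using right_facts(4)[of x ?r s] assms abs_le_radius(1)[of x z] by simp
      then have "(min x (2 * x - slack c s ?r))\<^sup>2 \<le> (slack c s ?r)\<^sup>2"
        by (rule power2_le_iff_abs_le[THEN iffD2, rotated]) (rule slack_facts(1)[OF r])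
      then have "(c * s)\<^sup>2 \<le> ?r\<^sup>2 - (min x (2 * x - slack c s ?r))\<^sup>2" using slack_facts(3)[OF r] r' by simp
      then have "c * s \<le> sqrt (?r\<^sup>2 - (min x (2 * x - slack c s ?r))\<^sup>2)" by (rule real_le_rsqrt)
      then show ?thesis using False assms(1) z0 by (simp add: push_top_def push_right_def Let_def)
    qed
  qed
qed

lemma push_top_continuous:
  "continuous_on {(s,x,z). sqrt (x\<^sup>2 + z\<^sup>2) \<le> s} (\<lambda>(s,p). push_top c b s p)"
proof -
  let ?D = "{q::real \<times> real \<times> real. sqrt ((fst (snd q))\<^sup>2 + (snd (snd q))\<^sup>2) \<le> fst q}"
  have cl: "continuous_on A (\<lambda>q. push_left c b (fst q) (snd q))" for A
    unfolding push_left_def Let_def lower_def case_prod_unfold by (intro continuous_intros)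
  have cr: "continuous_on A (\<lambda>q. push_right c (fst q) (snd q))" for A
    unfolding push_right_def Let_def slack_def case_prod_unfold by (intro continuous_intros)
  have inner: "continuous_on {q\<in>?D. 0 \<le> fst (snd q)} (\<lambda>q. if snd (snd q) \<le> 0 then snd q else push_right c (fst q) (snd q))"
  proof (rule continuous_on_cases_le)
    fix q assume q: "q \<in> {q\<in>?D. 0 \<le> fst (snd q)}" "snd (snd q) = 0"
    obtain s x z where e: "q = (s,x,z)" by (metis prod.exhaust)
    have "0 \<le> x" "x \<le> s" "z = 0" using q by (auto simp: e)
    then have "slack c s x \<le> x" using slack_facts(2)[of x s] by simp
    then have "min x (2 * x - slack c s x) = x" by simp
    then show "snd q = push_right c (fst q) (snd q)" using \<open>0 \<le> x\<close> \<open>z = 0\<close> by (simp add: e push_right_def Let_def)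
  qed (intro continuous_intros cr)+
  have "continuous_on ?D (\<lambda>q. if fst (snd q) \<le> 0 then push_left c b (fst q) (snd q)
      else if snd (snd q) \<le> 0 then snd q else push_right c (fst q) (snd q))"
  proof (rule continuous_on_cases_le)
    fix q assume q: "q \<in> ?D" "fst (snd q) = 0"
    obtain s x z where e: "q = (s,x,z)" by (metis prod.exhaust)
    have x: "x = 0" and r: "\<bar>z\<bar> \<le> s" using q by (auto simp: e)
    show "push_left c b (fst q) (snd q) = (if snd (snd q) \<le> 0 then snd q else push_right c (fst q) (snd q))"
    proof (cases "z \<le> 0")
      case True
      then have "lower c b s (- z) z = z" using lower_bottom[of "- z" s] r by simp
      then show ?thesis using True x by (simp add: e push_left_def Let_def)
    next
      case False
      note sl = slack_facts[of z s]
      have sl': "0 \<le> slack c s z" "(slack c s z)\<^sup>2 = z\<^sup>2 - (min z (c * s))\<^sup>2" using sl(1,3) False r by auto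
      have "0 \<le> c * s" using b0 bc r by auto
      then have m: "0 \<le> min z (c * s)" using False by simp
      have "sqrt (z\<^sup>2 - (min z (c * s))\<^sup>2) = slack c s z" using sl' by (simp flip: sl'(2))
      moreover have "sqrt (z\<^sup>2 - (slack c s z)\<^sup>2) = min z (c * s)" unfolding sl'(2) using m by simp
      moreover have "min 0 (- slack c s z) = - slack c s z" using sl'(1) by simp
      moreover have "lower c b s z z = min z (c * s)" using lower_top[of z s] False r by simp
      ultimately show ?thesis using False x by (simp add: e push_left_def push_right_def Let_def)
    qed
  qed (intro continuous_intros cl inner)+
  then have "continuous_on ?D (\<lambda>q. push_top c b (fst q) (snd q))" by (simp add: push_top_def)
  then show ?thesis by (simp add: case_prod_unfold)
qed

text \<open>Points are sorted into left half, lower right and upper right quarter. Each piece is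
  mapped injectively by monotonicity of one coordinate, and coincidences between different pieces
  are excluded by height or side.\<close>

lemma push_top_inj:
  assumes r: "sqrt (x\<^sup>2 + z\<^sup>2) \<le> s" "x\<^sup>2 + z\<^sup>2 = y\<^sup>2 + w\<^sup>2" and eq: "push_top c b s (x,z) = push_top c b s (y,w)"
  shows "x = y \<and> z = w"
proof -
  define R where "R = sqrt (x\<^sup>2 + z\<^sup>2)"
  have R: "sqrt (x\<^sup>2 + z\<^sup>2) = R" "sqrt (y\<^sup>2 + w\<^sup>2) = R" "0 \<le> R" "R \<le> s" using r by (auto simp: R_def)
  have Rsq: "R\<^sup>2 = x\<^sup>2 + z\<^sup>2" "R\<^sup>2 = y\<^sup>2 + w\<^sup>2" using r by (auto simp: R_def)
  define m where "m = min R (c * s)"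
  have m0: "0 \<le> m" using R b0 bc by (auto simp: m_def)
  have sl: "0 \<le> slack c s R" "slack c s R \<le> R" "(slack c s R)\<^sup>2 = R\<^sup>2 - m\<^sup>2" "R \<noteq> 0 \<Longrightarrow> slack c s R < R"
    using slack_facts[OF R(3,4)] by (auto simp: m_def)
  have main: "x = y \<and> z = w"
    if e: "push_top c b s (x,z) = push_top c b s (y,w)" and q: "R\<^sup>2 = x\<^sup>2 + z\<^sup>2" "R\<^sup>2 = y\<^sup>2 + w\<^sup>2"
      and ord: "x \<le> 0 \<or> 0 < y" "x \<le> 0 \<or> z \<le> 0 \<or> 0 < w" for x z y w
  proof -
    have sq: "sqrt (x\<^sup>2 + z\<^sup>2) = R" "sqrt (y\<^sup>2 + w\<^sup>2) = R"
      unfolding q(1)[symmetric] q(2)[symmetric] using R(3) by (simp_all only: real_sqrt_abs abs_of_nonneg)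
    have bd: "\<bar>x\<bar> \<le> R" "\<bar>z\<bar> \<le> R" "\<bar>y\<bar> \<le> R" "\<bar>w\<bar> \<le> R"
      using abs_le_radius(1)[of x z] abs_le_radius(2)[of z x] abs_le_radius(1)[of y w] abs_le_radius(2)[of w y] unfolding sq by blast+
    have lf: "push_top c b s (x,z) = (- sqrt (R\<^sup>2 - (lower c b s R z)\<^sup>2), lower c b s R z)"
      if "x \<le> 0" "sqrt (x\<^sup>2 + z\<^sup>2) = R" for x z
      using that by (simp only: push_top_def push_left_def Let_def fst_conv snd_conv case_prod_conv if_True)
    have rt: "push_top c b s (y,w) = (min y (2 * y - slack c s R), sqrt (R\<^sup>2 - (min y (2 * y - slack c s R))\<^sup>2))"
      if "0 < y" "0 < w" "sqrt (y\<^sup>2 + w\<^sup>2) = R" for y w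
      using that by (simp only: push_top_def push_right_def Let_def fst_conv snd_conv case_prod_conv if_False not_le[symmetric])
    have md: "push_top c b s (y,w) = (y,w)" if "0 < y" "w \<le> 0" for y w using that by (simp add: push_top_def)
    consider "x \<le> 0" "y \<le> 0" | "x \<le> 0" "0 < y" "w \<le> 0" | "x \<le> 0" "0 < y" "0 < w" | "0 < x" "0 < y" "z \<le> 0" "w \<le> 0"
      | "0 < x" "0 < y" "z \<le> 0" "0 < w" | "0 < x" "0 < y" "0 < z" "0 < w" using ord by linarith
    then show ?thesis
    proof cases
      case 1
      then have "lower c b s R z = lower c b s R w" using e lf sq by simp
      then have zw: "z = w" by (rule lower_inject)
      then have "x\<^sup>2 = y\<^sup>2" using q by simp
      then have "x = y \<or> x = - y" by (simp only: power2_eq_iff)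
      then show ?thesis using 1 zw by linarith
    next
      case 2
      have "(lower c b s R z)\<^sup>2 \<le> R\<^sup>2"
        using lower_bounds(3)[OF bd(2) R(4)] by (rule power2_le_iff_abs_le[THEN iffD2, rotated]) (rule R)
      then have "fst (push_top c b s (x,z)) \<le> 0" using lf 2 sq by simp
      then have False using e md[OF 2(2,3)] 2 by simp
      then show ?thesis ..
    next
      case 3
      let ?y = "min y (2 * y - slack c s R)"
      have "- sqrt (R\<^sup>2 - (lower c b s R z)\<^sup>2) = ?y \<and> lower c b s R z = sqrt (R\<^sup>2 - ?y\<^sup>2)"
        using e unfolding lf[OF 3(1) sq(1)] rt[OF 3(2,3) sq(2)] prod.inject .
      then have eq1: "?y = - sqrt (R\<^sup>2 - (lower c b s R z)\<^sup>2)" and eq2: "sqrt (R\<^sup>2 - ?y\<^sup>2) = lower c b s R z"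
        by (rule conjunct1[THEN sym], rule conjunct2[THEN sym])
      have "(lower c b s R z)\<^sup>2 \<le> R\<^sup>2"
        using lower_bounds(3)[OF bd(2) R(4)] by (rule power2_le_iff_abs_le[THEN iffD2, rotated]) (rule R)
      then have y0: "?y \<le> 0" unfolding eq1 by simp
      then have "y \<le> slack c s R" using 3(2) by (auto simp: min_def split: if_splits)
      then have "- slack c s R < ?y" using 3(2) by (auto simp: min_def)
      then have "(- ?y)\<^sup>2 < (slack c s R)\<^sup>2" using y0 by (intro power_strict_mono) auto
      then have "?y\<^sup>2 < (slack c s R)\<^sup>2" by (simp only: power2_minus)
      then have "m\<^sup>2 < R\<^sup>2 - ?y\<^sup>2" using sl(3) by linarith
      then have "m < lower c b s R z" unfolding eq2[symmetric] using m0 by (intro real_less_rsqrt)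
      moreover have "lower c b s R z \<le> m"
      proof (cases "z = R")
        case False
        then have "z < R" using bd(2) by linarith
        then show ?thesis using lower_strict[of z R s R] lower_top[OF R(3,4)] unfolding m_def by simp
      qed (simp add: lower_top[OF R(3,4)] m_def)
      ultimately show ?thesis by simp
    next
      case 4
      then show ?thesis using e md by simp
    next
      case 5
      let ?y = "min y (2 * y - slack c s R)"
      have "x = ?y \<and> z = sqrt (R\<^sup>2 - ?y\<^sup>2)" using e unfolding md[OF 5(1,3)] rt[OF 5(2,4) sq(2)] prod.inject .
      then have eq1: "?y = x" and eq2: "sqrt (R\<^sup>2 - ?y\<^sup>2) = z"
        by (rule conjunct1[THEN sym], rule conjunct2[THEN sym])
      have "\<bar>?y\<bar> \<le> R" using right_facts(3)[of y R s] 5(2) bd(3) R(4) by linarith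
      then have "?y\<^sup>2 \<le> R\<^sup>2" by (rule power2_le_iff_abs_le[THEN iffD2, rotated]) (rule R(3))
      then have "0 \<le> z" unfolding eq2[symmetric] by simp
      then have "z = 0" using 5(3) by simp
      then have "R\<^sup>2 = x\<^sup>2" using q(1) by simp
      then have "R = x \<or> R = - x" by (simp only: power2_eq_iff)
      then have "x = R" using 5(1) R(3) by linarith
      then have "R \<le> y" using eq1 by linarith
      then have "y = R" using bd(3) by linarith
      then have "w\<^sup>2 = 0" using q(2) by simp
      then show ?thesis using 5(4) by simp
    next
      case 6
      then have "min x (2 * x - slack c s R) = min y (2 * y - slack c s R)" using e rt sq by simp
      then have xy: "x = y" by (auto simp: min_def split: if_splits)
      then have "z\<^sup>2 = w\<^sup>2" using q by simp
      then have "z = w \<or> z = - w" by (simp only: power2_eq_iff)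
      then show ?thesis using 6 xy by linarith
    qed
  qed
  show ?thesis
  proof (cases "(x \<le> 0 \<or> 0 < y) \<and> (x \<le> 0 \<or> z \<le> 0 \<or> 0 < w)")
    case True
    then show ?thesis using main[OF eq Rsq] by blast
  next
    case False
    then have "y = x \<and> w = z" using main[OF eq[symmetric] Rsq(2,1)] by linarith
    then show ?thesis by simp
  qed
qed

end

section \<open>Folding maps of the sphere\<close>

context sphere_frame
begin

text \<open>The foldings of the sphere onto its two hemispheres, to which the children degenerate as
  \<open>a\<close> tends to 1 and \<open>h\<close> to 0.\<close>

definition Fp :: "'a \<Rightarrow> 'a" where "Fp v = v + (\<bar>v \<bullet> e0\<bar> - v \<bullet> e0) *\<^sub>R e0"
definition Fm :: "'a \<Rightarrow> 'a" where "Fm v = v + (- \<bar>v \<bullet> e0\<bar> - v \<bullet> e0) *\<^sub>R e0"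

lemma Fp_cases: "Fp v = (if 0 \<le> v \<bullet> e0 then v else refl v)" and Fm_cases: "Fm v = (if 0 \<le> v \<bullet> e0 then refl v else v)"
proof -
  have "(- a - a) *\<^sub>R e0 = - ((2 * a) *\<^sub>R e0)" for a
  proof -
    have "- a - a = - (2 * a)" by simp
    then show ?thesis by (simp only: scaleR_minus_left)
  qed
  then show "Fp v = (if 0 \<le> v \<bullet> e0 then v else refl v)" "Fm v = (if 0 \<le> v \<bullet> e0 then refl v else v)"
    by (simp_all add: Fp_def Fm_def refl_def abs_if)
qed

lemma F_in_S: "v \<in> S \<Longrightarrow> Fp v \<in> S" "v \<in> S \<Longrightarrow> Fm v \<in> S"
  by (simp_all add: Fp_cases Fm_cases)

lemma F_e0: "Fp v \<bullet> e0 = \<bar>v \<bullet> e0\<bar>" "Fm v \<bullet> e0 = - \<bar>v \<bullet> e0\<bar>"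
  by (simp_all add: Fp_def Fm_def inner_add_left)

lemma F_orth: "e0 \<bullet> b = 0 \<Longrightarrow> Fp v \<bullet> b = v \<bullet> b" "e0 \<bullet> b = 0 \<Longrightarrow> Fm v \<bullet> b = v \<bullet> b"
  by (simp_all add: Fp_def Fm_def inner_add_left)

lemma F_continuous: "continuous_on A Fp" "continuous_on A Fm"
  unfolding Fp_def Fm_def by (intro continuous_intros)+

text \<open>The degenerate counterpart of \<open>tree\<close>: the children are honest foldings, so
  questions of size can be settled before thickness and disjointness come in.\<close>

inductive folds :: "(('a \<Rightarrow> 'a) \<Rightarrow> bool) \<Rightarrow> ('a \<Rightarrow> 'a) \<Rightarrow> bool" for Q where
  leaf: "Q f \<Longrightarrow> folds Q f"
| node: "rot \<rho> \<Longrightarrow> folds Q (f \<circ> \<rho> \<circ> Fp) \<Longrightarrow> folds Q (f \<circ> \<rho> \<circ> Fm) \<Longrightarrow> folds Q f"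

lemma folds_trans: "folds Q f \<Longrightarrow> (\<And>g. Q g \<Longrightarrow> folds Q' g) \<Longrightarrow> folds Q' f"
  by (induction rule: folds.induct) (auto intro: folds.node)

lemma continuous_child:
  assumes "continuous_on S f" "rot \<rho>"
  shows "continuous_on S (f \<circ> \<rho> \<circ> Fp)" "continuous_on S (f \<circ> \<rho> \<circ> Fm)"
proof -
  have *: "continuous_on S (f \<circ> \<rho> \<circ> F)" if "continuous_on S F" "F ` S \<subseteq> S" for F
  proof -
    have "continuous_on S (\<rho> \<circ> F)" "(\<rho> \<circ> F) ` S \<subseteq> S"
      using that assms(2) unfolding rot_def by (blast intro!: continuous_on_compose intro: continuous_on_subset, fastforce)
    then have "continuous_on S (f \<circ> (\<rho> \<circ> F))"
      using assms(1) by (intro continuous_on_compose[of S "\<rho> \<circ> F" f]) (blast intro: continuous_on_subset)+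
    then show ?thesis by (simp only: comp_assoc)
  qed
  show "continuous_on S (f \<circ> \<rho> \<circ> Fp)" "continuous_on S (f \<circ> \<rho> \<circ> Fm)"
    by (rule *; use F_continuous F_in_S in blast)+
qed

lemma rot_comp: "rot \<rho> \<Longrightarrow> rot \<rho>' \<Longrightarrow> rot (\<rho> \<circ> \<rho>')"
  unfolding rot_def
  by (intro conjI continuous_on_compose comp_inj_on) (blast intro: continuous_on_subset inj_on_subset, blast intro: continuous_on_subset inj_on_subset, blast intro: continuous_on_subset inj_on_subset, blast intro: continuous_on_subset inj_on_subset, fastforce)

end

section \<open>Rotations in coordinate planes\<close>

locale basis_frame = sphere_frame +
  assumes e0_Basis: "e0 \<in> Basis" and et_Basis: "et \<in> Basis"
begin

definition part :: "'a set \<Rightarrow> 'a \<Rightarrow> 'a" where "part B v = (\<Sum>b\<in>B. (v \<bullet> b) *\<^sub>R b)"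

lemma inner_part: "B \<subseteq> Basis \<Longrightarrow> b \<in> Basis \<Longrightarrow> part B v \<bullet> b = (if b \<in> B then v \<bullet> b else 0)"
proof -
  assume B: "B \<subseteq> Basis" "b \<in> Basis"
  then have "finite B" using finite_subset finite_Basis by blast
  have "part B v \<bullet> b = (\<Sum>b'\<in>B. if b' = b then v \<bullet> b else 0)"
    unfolding part_def inner_sum_left using B by (intro sum.cong) (auto simp: inner_Basis)
  then show ?thesis using \<open>finite B\<close> by (simp add: sum.delta)
qed

lemma norm_part: "B \<subseteq> Basis \<Longrightarrow> (norm (part B v))\<^sup>2 = (\<Sum>b\<in>B. (v \<bullet> b)\<^sup>2)"
proof -
  assume B: "B \<subseteq> Basis"
  have "(norm (part B v))\<^sup>2 = (\<Sum>b\<in>Basis. (part B v \<bullet> b)\<^sup>2)"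
    by (subst power2_norm_eq_inner, subst euclidean_inner) (simp add: power2_eq_square)
  also have "\<dots> = (\<Sum>b\<in>Basis. if b \<in> B then (v \<bullet> b)\<^sup>2 else 0)"
    using B by (intro sum.cong) (auto simp: inner_part)
  also have "\<dots> = (\<Sum>b\<in>B. (v \<bullet> b)\<^sup>2)" using B by (simp add: sum.If_cases Int_absorb1)
  finally show ?thesis .
qed

lemma norm_split: "B \<subseteq> Basis \<Longrightarrow> (norm v)\<^sup>2 = (norm (part B v))\<^sup>2 + (\<Sum>b\<in>Basis - B. (v \<bullet> b)\<^sup>2)"
proof -
  assume B: "B \<subseteq> Basis"
  have "(norm v)\<^sup>2 = (\<Sum>b\<in>Basis. (v \<bullet> b)\<^sup>2)"
    by (subst power2_norm_eq_inner, subst euclidean_inner) (simp add: power2_eq_square)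
  then show ?thesis unfolding norm_part[OF B] using B by (simp add: sum.subset_diff)
qed

lemma part_same_tail:
  assumes "B \<subseteq> Basis" "norm v = norm w" "\<And>b. b \<in> Basis - B \<Longrightarrow> v \<bullet> b = w \<bullet> b"
  shows "norm (part B v) = norm (part B w)"
proof -
  have "(\<Sum>b\<in>Basis - B. (v \<bullet> b)\<^sup>2) = (\<Sum>b\<in>Basis - B. (w \<bullet> b)\<^sup>2)" using assms(3) by (intro sum.cong) auto
  then have "(norm (part B v))\<^sup>2 = (norm (part B w))\<^sup>2"
    using norm_split[OF assms(1), of v] norm_split[OF assms(1), of w] assms(2) by simp
  then show ?thesis by simp
qed

lemma continuous_on_part [continuous_intros]: "continuous_on A f \<Longrightarrow> continuous_on A (\<lambda>x. part B (f x))"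
  unfolding part_def by (intro continuous_intros)

end

locale plane_frame = basis_frame e0 et for e0 et :: "'a::euclidean_space" +
  fixes B :: "'a set" and e :: 'a
  assumes B: "B \<subseteq> Basis - {et}" "e0 \<in> B" "e \<in> B" "e \<noteq> e0"
begin

abbreviation s :: "'a \<Rightarrow> real" where "s v \<equiv> norm (part B v)"

lemma e_simps [simp]: "e \<bullet> e0 = 0" "e0 \<bullet> e = 0" "e \<bullet> et = 0" "et \<bullet> e = 0" "e \<bullet> e = 1" "e \<in> Basis"
proof -
  show eB: "e \<in> Basis" using B by auto
  have "e \<noteq> et" using B by auto
  then show "e \<bullet> e0 = 0" "e0 \<bullet> e = 0" "e \<bullet> et = 0" "et \<bullet> e = 0" "e \<bullet> e = 1"
    using B eB e0_Basis et_Basis by (simp_all add: inner_not_same_Basis inner_same_Basis)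
qed

lemma BB: "B \<subseteq> Basis" using B by auto

lemma radius_le_s: "sqrt ((v \<bullet> e0)\<^sup>2 + (v \<bullet> e)\<^sup>2) \<le> s v" "\<bar>v \<bullet> e\<bar> \<le> s v"
proof -
  have "finite B" using BB finite_subset finite_Basis by blast
  then have "(\<Sum>b\<in>{e0,e}. (v \<bullet> b)\<^sup>2) \<le> (\<Sum>b\<in>B. (v \<bullet> b)\<^sup>2)" using B by (intro sum_mono2) auto
  then have 1: "(v \<bullet> e0)\<^sup>2 + (v \<bullet> e)\<^sup>2 \<le> (s v)\<^sup>2" using B by (simp add: norm_part[OF BB])
  then show "sqrt ((v \<bullet> e0)\<^sup>2 + (v \<bullet> e)\<^sup>2) \<le> s v" by (rule real_le_lsqrt[rotated]) simp
  have "(v \<bullet> e)\<^sup>2 \<le> (s v)\<^sup>2" using 1 zero_le_power2[of "v \<bullet> e0"] by linarith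
  then show "\<bar>v \<bullet> e\<bar> \<le> s v" using abs_le_square_iff[of "v \<bullet> e" "s v"] by simp
qed

lemma basis_eqI: "(\<And>b. b \<in> Basis \<Longrightarrow> v \<bullet> b = w \<bullet> b) \<Longrightarrow> v = (w::'a)"
  by (rule euclidean_eqI)

lemma same_s:
  assumes "v \<in> S" "w \<in> S" "\<And>b. b \<in> Basis - B \<Longrightarrow> v \<bullet> b = w \<bullet> b"
  shows "s v = s w"
  using assms by (intro part_same_tail[OF BB]) (auto simp: norm_S)

text \<open>Acts on the \<open>e0\<close> and \<open>e\<close> coordinates only, by a map that may
  depend on \<open>s v\<close>. If that map preserves the circles around the origin, both the norm
  and \<open>s v\<close> are preserved.\<close>

definition plane_map :: "(real \<Rightarrow> real \<times> real \<Rightarrow> real \<times> real) \<Rightarrow> 'a \<Rightarrow> 'a" where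
  "plane_map g v = v + (fst (g (s v) (v \<bullet> e0, v \<bullet> e)) - v \<bullet> e0) *\<^sub>R e0 + (snd (g (s v) (v \<bullet> e0, v \<bullet> e)) - v \<bullet> e) *\<^sub>R e"

lemma plane_map_inner:
  "plane_map g v \<bullet> e0 = fst (g (s v) (v \<bullet> e0, v \<bullet> e))" "plane_map g v \<bullet> e = snd (g (s v) (v \<bullet> e0, v \<bullet> e))"
  "b \<in> Basis \<Longrightarrow> b \<noteq> e0 \<Longrightarrow> b \<noteq> e \<Longrightarrow> plane_map g v \<bullet> b = v \<bullet> b"
proof -
  show "plane_map g v \<bullet> e0 = fst (g (s v) (v \<bullet> e0, v \<bullet> e))" "plane_map g v \<bullet> e = snd (g (s v) (v \<bullet> e0, v \<bullet> e))"
    by (simp_all add: plane_map_def inner_add_left)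
  show "b \<in> Basis \<Longrightarrow> b \<noteq> e0 \<Longrightarrow> b \<noteq> e \<Longrightarrow> plane_map g v \<bullet> b = v \<bullet> b"
    using e0_Basis e_simps(6) by (simp add: plane_map_def inner_add_left inner_not_same_Basis)
qed

lemma plane_map_norm:
  assumes "(fst (g (s v) (v \<bullet> e0, v \<bullet> e)))\<^sup>2 + (snd (g (s v) (v \<bullet> e0, v \<bullet> e)))\<^sup>2 = (v \<bullet> e0)\<^sup>2 + (v \<bullet> e)\<^sup>2"
  shows "norm (plane_map g v) = norm v" "s (plane_map g v) = s v"
proof -
  have sp: "(\<Sum>b\<in>C. (w \<bullet> b)\<^sup>2) = (w \<bullet> e0)\<^sup>2 + (w \<bullet> e)\<^sup>2 + (\<Sum>b\<in>C - {e0,e}. (w \<bullet> b)\<^sup>2)"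
    if "finite C" "e0 \<in> C" "e \<in> C" for C and w :: 'a
  proof -
    have "(\<Sum>b\<in>C. (w \<bullet> b)\<^sup>2) = (\<Sum>b\<in>C - {e0,e}. (w \<bullet> b)\<^sup>2) + (\<Sum>b\<in>{e0,e}. (w \<bullet> b)\<^sup>2)"
      using that by (intro sum.subset_diff) auto
    then show ?thesis using B(4) by simp
  qed
  have eq: "(\<Sum>b\<in>C. (plane_map g v \<bullet> b)\<^sup>2) = (\<Sum>b\<in>C. (v \<bullet> b)\<^sup>2)" if "finite C" "e0 \<in> C" "e \<in> C" "C \<subseteq> Basis" for C
  proof -
    have "(\<Sum>b\<in>C - {e0,e}. (plane_map g v \<bullet> b)\<^sup>2) = (\<Sum>b\<in>C - {e0,e}. (v \<bullet> b)\<^sup>2)"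
      using that(4) by (intro sum.cong) (auto simp: plane_map_inner(3))
    then show ?thesis using sp[OF that(1-3)] assms by (simp add: plane_map_inner)
  qed
  have "finite B" using BB finite_subset finite_Basis by blast
  then have "(s (plane_map g v))\<^sup>2 = (s v)\<^sup>2" using eq[of B] B BB by (simp add: norm_part[OF BB])
  then show "s (plane_map g v) = s v" by simp
  have "(norm (part Basis (plane_map g v)))\<^sup>2 = (norm (part Basis v))\<^sup>2"
    using eq[of Basis] e0_Basis by (simp add: norm_part)
  then show "norm (plane_map g v) = norm v" by (simp add: part_def euclidean_representation)
qed

lemma plane_map_rot:
  assumes rad: "\<And>s x z. sqrt (x\<^sup>2 + z\<^sup>2) \<le> s \<Longrightarrow> (fst (g s (x,z)))\<^sup>2 + (snd (g s (x,z)))\<^sup>2 = x\<^sup>2 + z\<^sup>2"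
    and inj: "\<And>s x z y w. sqrt (x\<^sup>2 + z\<^sup>2) \<le> s \<Longrightarrow> x\<^sup>2 + z\<^sup>2 = y\<^sup>2 + w\<^sup>2 \<Longrightarrow> g s (x,z) = g s (y,w) \<Longrightarrow> x = y \<and> z = w"
    and cont: "continuous_on {(s,x,z). sqrt (x\<^sup>2 + z\<^sup>2) \<le> s} (\<lambda>(s,p). g s p)"
  shows "rot (plane_map g)"
  unfolding rot_def
proof (intro conjI)
  note nm = plane_map_norm[of g, OF rad[OF radius_le_s(1)]]
  have "continuous_on S (\<lambda>v. (\<lambda>(s,p). g s p) (s v, (v \<bullet> e0, v \<bullet> e)))"
    by (rule continuous_on_compose2[OF cont]) (auto intro!: continuous_intros simp: radius_le_s)
  then have "continuous_on S (\<lambda>v. g (s v) (v \<bullet> e0, v \<bullet> e))" by simp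
  then show "continuous_on S (plane_map g)" unfolding plane_map_def by (intro continuous_intros)
  have "plane_map g v \<bullet> et = v \<bullet> et" for v
    using et_Basis B by (intro plane_map_inner(3)) auto
  then show "plane_map g ` S \<subseteq> S" using nm(1) by (auto simp: S_def)
  show "inj_on (plane_map g) S"
  proof (rule inj_onI)
    fix v w assume vw: "v \<in> S" "w \<in> S" "plane_map g v = plane_map g w"
    have ss: "s v = s w" using nm(2)[of v] nm(2)[of w] vw(3) by simp
    have "g (s v) (v \<bullet> e0, v \<bullet> e) = g (s v) (w \<bullet> e0, w \<bullet> e)"
      using plane_map_inner(1,2)[of g v] plane_map_inner(1,2)[of g w] vw(3) ss by (simp add: prod_eq_iff)
    moreover have "(v \<bullet> e0)\<^sup>2 + (v \<bullet> e)\<^sup>2 = (w \<bullet> e0)\<^sup>2 + (w \<bullet> e)\<^sup>2"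
      using rad[OF radius_le_s(1), of v] rad[OF radius_le_s(1), of w] calculation ss by simp
    ultimately have xz: "v \<bullet> e0 = w \<bullet> e0" "v \<bullet> e = w \<bullet> e" using inj[OF radius_le_s(1), of v] by blast+
    show "v = w"
    proof (rule basis_eqI)
      fix b :: 'a assume "b \<in> Basis"
      then show "v \<bullet> b = w \<bullet> b" using xz vw(3) plane_map_inner(3)[of b g] by (cases "b = e0 \<or> b = e") metis+
    qed
  qed
qed

text \<open>The top point is pushed into the left half and the bottom point into the right half. So
  the image of the right half omits a bottom slab and the image of the left half omits a top slab,
  while middle heights do not move.\<close>

lemma squeeze_map:
  assumes bc: "0 \<le> b" "b < c" "c < 1" and a: "-1 < a" "a < 0"
  obtains \<rho> where "rot \<rho>" "\<And>v b'. b' \<in> Basis - {e0,e} \<Longrightarrow> \<rho> v \<bullet> b' = v \<bullet> b'"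
    "\<And>v. 0 \<le> v \<bullet> e0 \<Longrightarrow> v \<bullet> e \<le> 0 \<Longrightarrow> a * s v \<le> \<rho> v \<bullet> e \<and> \<rho> v \<bullet> e \<le> 0"
    "\<And>v. 0 \<le> v \<bullet> e0 \<Longrightarrow> 0 \<le> v \<bullet> e \<Longrightarrow> v \<bullet> e \<le> c * s v \<Longrightarrow> \<rho> v = v"
    "\<And>v. 0 \<le> v \<bullet> e0 \<Longrightarrow> c * s v \<le> v \<bullet> e \<Longrightarrow> c * s v \<le> \<rho> v \<bullet> e"
    "\<And>v. v \<bullet> e0 \<le> 0 \<Longrightarrow> v \<bullet> e \<le> a * s v \<Longrightarrow> \<rho> v \<bullet> e \<le> a * s v"
    "\<And>v. v \<bullet> e0 \<le> 0 \<Longrightarrow> a * s v \<le> v \<bullet> e \<Longrightarrow> v \<bullet> e \<le> b * s v \<Longrightarrow> \<rho> v = v"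
    "\<And>v. v \<bullet> e0 \<le> 0 \<Longrightarrow> b * s v \<le> v \<bullet> e \<Longrightarrow> b * s v \<le> \<rho> v \<bullet> e \<and> \<rho> v \<bullet> e \<le> c * s v"
proof -
  interpret P: push c b using bc by unfold_locales
  interpret P0: push "- a" 0 using a by unfold_locales auto
  define N where "N = plane_map (\<lambda>_ (x,z). (- x, - z))"
  define T where "T = plane_map (push_top c b)"
  define T0 where "T0 = plane_map (push_top (- a) 0)"
  have rN: "rot N" unfolding N_def
    by (rule plane_map_rot) (auto simp: case_prod_unfold intro!: continuous_intros)
  have radT: "(fst (push_top c b s (x,z)))\<^sup>2 + (snd (push_top c b s (x,z)))\<^sup>2 = x\<^sup>2 + z\<^sup>2"
    if "sqrt (x\<^sup>2 + z\<^sup>2) \<le> s" for s x z using P.push_top_radius[OF that] by (cases "push_top c b s (x,z)") auto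
  have radT0: "(fst (push_top (- a) 0 s (x,z)))\<^sup>2 + (snd (push_top (- a) 0 s (x,z)))\<^sup>2 = x\<^sup>2 + z\<^sup>2"
    if "sqrt (x\<^sup>2 + z\<^sup>2) \<le> s" for s x z using P0.push_top_radius[OF that] by (cases "push_top (- a) 0 s (x,z)") auto
  have rT: "rot T" unfolding T_def by (rule plane_map_rot[OF radT P.push_top_inj P.push_top_continuous])
  have rT0: "rot T0" unfolding T0_def by (rule plane_map_rot[OF radT0 P0.push_top_inj P0.push_top_continuous])
  have Ni: "N v \<bullet> e0 = - (v \<bullet> e0)" "N v \<bullet> e = - (v \<bullet> e)" "s (N v) = s v" for v
    unfolding N_def by (simp_all add: plane_map_inner plane_map_norm)
  have NN: "N (N v) = v" for v
  proof (rule basis_eqI)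
    fix b' :: 'a assume "b' \<in> Basis"
    then show "N (N v) \<bullet> b' = v \<bullet> b'"
      using Ni plane_map_inner(3)[of b'] unfolding N_def by (cases "b' = e0 \<or> b' = e") auto
  qed
  have fixT: "T v = v" if "push_top c b (s v) (v \<bullet> e0, v \<bullet> e) = (v \<bullet> e0, v \<bullet> e)" for v
    using that by (simp add: T_def plane_map_def)
  have fixT0: "T0 v = v" if "push_top (- a) 0 (s v) (v \<bullet> e0, v \<bullet> e) = (v \<bullet> e0, v \<bullet> e)" for v
    using that by (simp add: T0_def plane_map_def)
  have sT0: "s (T0 v) = s v" for v
    unfolding T0_def by (rule plane_map_norm(2)) (rule radT0[OF radius_le_s(1)])
  \<comment> \<open>Conjugation with the half turn \<open>N\<close> makes the push act at the
    bottom, again counterclockwise and hence towards the right half.\<close>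
  define bot where "bot v = N (T0 (N v))" for v
  have sbot: "s (bot v) = s v" for v by (simp add: bot_def Ni sT0)
  have bot_e: "bot v \<bullet> e = - (T0 (N v) \<bullet> e)" "bot v \<bullet> e0 = - (T0 (N v) \<bullet> e0)" for v by (simp_all add: bot_def Ni)
  have T0i: "T0 v \<bullet> e0 = fst (push_top (- a) 0 (s v) (v \<bullet> e0, v \<bullet> e))" "T0 v \<bullet> e = snd (push_top (- a) 0 (s v) (v \<bullet> e0, v \<bullet> e))" for v
    unfolding T0_def by (simp_all add: plane_map_inner)
  have Ti: "T v \<bullet> e = snd (push_top c b (s v) (v \<bullet> e0, v \<bullet> e))" for v
    unfolding T_def by (simp_all add: plane_map_inner)
  have botL1: "bot v = v" if "v \<bullet> e0 \<le> 0" "a * s v \<le> v \<bullet> e" for v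
  proof -
    have "T0 (N v) = N v" using that by (intro fixT0 P0.push_top_right radius_le_s) (auto simp: Ni)
    then show ?thesis by (simp add: bot_def NN)
  qed
  have botL2: "bot v \<bullet> e \<le> a * s v" if "v \<bullet> e0 \<le> 0" "v \<bullet> e \<le> a * s v" for v
    using P0.push_top_right(2)[OF _ radius_le_s(1), of "N v"] that unfolding bot_e T0i by (simp add: Ni)
  have botR1: "bot v = v" if "0 \<le> v \<bullet> e0" "0 \<le> v \<bullet> e" for v
  proof -
    have "T0 (N v) = N v" using that by (intro fixT0 P0.push_top_left radius_le_s) (auto simp: Ni)
    then show ?thesis by (simp add: bot_def NN)
  qed
  have botR2: "a * s v \<le> bot v \<bullet> e \<and> bot v \<bullet> e \<le> 0 \<and> 0 \<le> bot v \<bullet> e0" if "0 \<le> v \<bullet> e0" "v \<bullet> e \<le> 0" for v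
    using P0.push_top_left(2,3)[OF _ radius_le_s(1), of "N v"] that unfolding bot_e T0i by (simp add: Ni)
  have TL1: "T v = v" if "v \<bullet> e0 \<le> 0" "v \<bullet> e \<le> b * s v" for v
    using that by (intro fixT P.push_top_left radius_le_s)
  have TL2: "b * s v \<le> T v \<bullet> e \<and> T v \<bullet> e \<le> c * s v" if "v \<bullet> e0 \<le> 0" "b * s v \<le> v \<bullet> e" for v
    unfolding Ti using that by (intro P.push_top_left(2) radius_le_s)
  have TR1: "T v = v" if "0 \<le> v \<bullet> e0" "v \<bullet> e \<le> c * s v" for v
    using that by (intro fixT P.push_top_right radius_le_s)
  have TR2: "c * s v \<le> T v \<bullet> e" if "0 \<le> v \<bullet> e0" "c * s v \<le> v \<bullet> e" for v
    unfolding Ti using that by (intro P.push_top_right(2) radius_le_s)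
  have sg: "0 \<le> b * s v" "0 \<le> c * s v" "a * s v \<le> 0" for v using bc a by (auto simp: mult_nonpos_nonneg)
  let ?\<rho> = "T \<circ> bot"
  show thesis
  proof (rule that[of ?\<rho>])
    have "bot = N \<circ> (T0 \<circ> N)" by (auto simp: bot_def)
    then show "rot ?\<rho>" using rot_comp[OF rT] rot_comp[OF rN] rot_comp[OF rT0 rN] by metis
    show "?\<rho> v \<bullet> b' = v \<bullet> b'" if "b' \<in> Basis - {e0,e}" for v b'
      using that plane_map_inner(3)[of b'] by (simp add: bot_def T_def N_def T0_def)
    show "a * s v \<le> ?\<rho> v \<bullet> e \<and> ?\<rho> v \<bullet> e \<le> 0" if "0 \<le> v \<bullet> e0" "v \<bullet> e \<le> 0" for v
    proof -
      note b2 = botR2[OF that]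
      have "bot v \<bullet> e \<le> c * s (bot v)" using b2 sg(2)[of "bot v"] by linarith
      then show ?thesis using TR1[of "bot v"] b2 by simp
    qed
    show "?\<rho> v = v" if "0 \<le> v \<bullet> e0" "0 \<le> v \<bullet> e" "v \<bullet> e \<le> c * s v" for v
      using botR1[OF that(1,2)] TR1[OF that(1,3)] by simp
    show "c * s v \<le> ?\<rho> v \<bullet> e" if "0 \<le> v \<bullet> e0" "c * s v \<le> v \<bullet> e" for v
      using botR1[of v] TR2[of v] that sg(2)[of v] by simp
    show "?\<rho> v \<bullet> e \<le> a * s v" if "v \<bullet> e0 \<le> 0" "v \<bullet> e \<le> a * s v" for v
    proof -
      note b2 = botL2[OF that]
      have "T (bot v) = bot v"
        using TL1[of "bot v"] TR1[of "bot v"] b2 sg(3)[of v] sg(1,2)[of "bot v"] by linarith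
      then show ?thesis using b2 by simp
    qed
    show "?\<rho> v = v" if "v \<bullet> e0 \<le> 0" "a * s v \<le> v \<bullet> e" "v \<bullet> e \<le> b * s v" for v
      using botL1[OF that(1,2)] TL1[OF that(1,3)] by simp
    show "b * s v \<le> ?\<rho> v \<bullet> e \<and> ?\<rho> v \<bullet> e \<le> c * s v" if "v \<bullet> e0 \<le> 0" "b * s v \<le> v \<bullet> e" for v
      using botL1[of v] TL2[of v] that sg(1,3)[of v] by simp
  qed
qed

text \<open>A Lorentz boost along \<open>e\<close>, acting as a Moebius map on the sphere of radius
  \<open>s v\<close> in the span of \<open>B\<close>: relative heights
  \<open>t = (v \<bullet> e) / s v\<close> change to \<open>(t + \<mu>) / (1 + \<mu> * t)\<close>.
  For \<open>s v = 0\<close> division by zero gives the right value 0.\<close>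

definition boost :: "real \<Rightarrow> 'a \<Rightarrow> 'a" where
  "boost \<mu> v = (s v / (s v + \<mu> * (v \<bullet> e))) *\<^sub>R ((v \<bullet> e + \<mu> * s v) *\<^sub>R e + sqrt (1 - \<mu>\<^sup>2) *\<^sub>R (part B v - (v \<bullet> e) *\<^sub>R e))"

definition moebius :: "real \<Rightarrow> 'a \<Rightarrow> 'a" where
  "moebius \<mu> v = v - part B v + boost \<mu> v"

context
  fixes \<mu> :: real
  assumes \<mu>: "\<bar>\<mu>\<bar> < 1"
begin

lemma denom_pos: "s v \<noteq> 0 \<Longrightarrow> 0 < s v + \<mu> * (v \<bullet> e)"
proof -
  assume "s v \<noteq> 0"
  then have "\<bar>\<mu>\<bar> * s v < 1 * s v" using \<mu> by (intro mult_strict_right_mono) auto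
  moreover have "\<bar>\<mu> * (v \<bullet> e)\<bar> \<le> \<bar>\<mu>\<bar> * s v" unfolding abs_mult using radius_le_s(2) by (intro mult_left_mono) auto
  ultimately show ?thesis by linarith
qed

lemma mu_sq: "0 < 1 - \<mu>\<^sup>2" "0 < sqrt (1 - \<mu>\<^sup>2)"
  using \<mu> abs_square_less_1[of \<mu>] by simp_all

lemma part_e: "part B v \<bullet> e = v \<bullet> e" "e \<bullet> part B v = v \<bullet> e"
  using inner_part[OF BB e_simps(6), of v] B by (simp_all add: inner_commute[of e])

lemma norm_boost: "norm (boost \<mu> v) = s v"
proof (cases "s v = 0")
  case False
  let ?z = "v \<bullet> e" and ?y = "part B v - (v \<bullet> e) *\<^sub>R e"
  have ye: "?y \<bullet> e = 0" "e \<bullet> ?y = 0" by (simp_all add: inner_diff_left inner_diff_right part_e)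
  have pp: "part B v \<bullet> part B v = (s v)\<^sup>2" by (simp add: power2_norm_eq_inner)
  have yy: "?y \<bullet> ?y = (s v)\<^sup>2 - ?z\<^sup>2"
    unfolding inner_diff_left inner_diff_right pp by (simp add: part_e power2_eq_square)
  have nn: "(norm (p *\<^sub>R e + q *\<^sub>R y))\<^sup>2 = p\<^sup>2 + q\<^sup>2 * (y \<bullet> y)" if "y \<bullet> e = 0" "e \<bullet> y = 0" for p q and y :: 'a
    unfolding power2_norm_eq_inner using that by (simp add: inner_add_left inner_add_right power2_eq_square)
  have k2: "(sqrt (1 - \<mu>\<^sup>2))\<^sup>2 = 1 - \<mu>\<^sup>2" using mu_sq(1) by (intro real_sqrt_pow2) simp
  have alg: "(z + \<mu> * t)\<^sup>2 + (1 - \<mu>\<^sup>2) * (t\<^sup>2 - z\<^sup>2) = (t + \<mu> * z)\<^sup>2" for z t :: real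
    by (simp add: power2_eq_square algebra_simps)
  have "(norm ((?z + \<mu> * s v) *\<^sub>R e + sqrt (1 - \<mu>\<^sup>2) *\<^sub>R ?y))\<^sup>2 = (s v + \<mu> * ?z)\<^sup>2"
    unfolding nn[OF ye] yy k2 alg ..
  then have "norm ((?z + \<mu> * s v) *\<^sub>R e + sqrt (1 - \<mu>\<^sup>2) *\<^sub>R ?y) = s v + \<mu> * ?z"
    by (rule power2_eq_imp_eq) (use denom_pos[OF False] in auto)
  then show ?thesis unfolding boost_def norm_scaleR using denom_pos[OF False] by simp
qed (simp add: boost_def)

lemma boost_inner: "b \<in> Basis - B \<Longrightarrow> boost \<mu> v \<bullet> b = 0"
proof -
  assume b: "b \<in> Basis - B"
  then have "e \<bullet> b = 0" using B(3) by (intro inner_not_same_Basis) auto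
  then show ?thesis using b by (simp add: boost_def inner_add_left inner_diff_left inner_part[OF BB])
qed

lemma moebius_tail: "b \<in> Basis - B \<Longrightarrow> moebius \<mu> v \<bullet> b = v \<bullet> b"
  by (simp add: moebius_def inner_add_left inner_diff_left inner_part[OF BB] boost_inner)

lemma part_moebius: "part B (moebius \<mu> v) = boost \<mu> v"
proof (rule basis_eqI)
  fix b :: 'a assume "b \<in> Basis"
  then show "part B (moebius \<mu> v) \<bullet> b = boost \<mu> v \<bullet> b"
    using boost_inner[of b v] by (auto simp: inner_part[OF BB] moebius_def inner_add_left inner_diff_left)
qed

lemma s_moebius: "s (moebius \<mu> v) = s v"
  by (simp add: part_moebius norm_boost)

lemma moebius_e: "moebius \<mu> v \<bullet> e = s v * (v \<bullet> e + \<mu> * s v) / (s v + \<mu> * (v \<bullet> e))"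
  using B by (simp add: moebius_def boost_def inner_add_left inner_diff_left part_e)

lemma moebius_height:
  assumes "-1 \<le> c" "c \<le> 1"
  shows "c * s v \<le> v \<bullet> e \<Longrightarrow> (c + \<mu>) / (1 + \<mu> * c) * s v \<le> moebius \<mu> v \<bullet> e"
    "v \<bullet> e \<le> c * s v \<Longrightarrow> moebius \<mu> v \<bullet> e \<le> (c + \<mu>) / (1 + \<mu> * c) * s v"
proof -
  have "\<bar>\<mu> * c\<bar> \<le> \<bar>\<mu>\<bar> * 1" unfolding abs_mult using assms by (intro mult_left_mono) auto
  then have d: "0 < 1 + \<mu> * c" using \<mu> by linarith
  have key: "(v \<bullet> e + \<mu> * s v) * (1 + \<mu> * c) - (c + \<mu>) * (s v + \<mu> * (v \<bullet> e)) = (v \<bullet> e - c * s v) * (1 - \<mu>\<^sup>2)"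
    by (simp add: algebra_simps power2_eq_square)
  show "(c + \<mu>) / (1 + \<mu> * c) * s v \<le> moebius \<mu> v \<bullet> e" if "c * s v \<le> v \<bullet> e"
  proof (cases "s v = 0")
    case False
    have "0 \<le> (v \<bullet> e - c * s v) * (1 - \<mu>\<^sup>2)" using that mu_sq by (intro mult_nonneg_nonneg) auto
    then have "(c + \<mu>) / (1 + \<mu> * c) \<le> (v \<bullet> e + \<mu> * s v) / (s v + \<mu> * (v \<bullet> e))"
      using key d denom_pos[OF False] by (simp add: divide_le_eq le_divide_eq pos_le_divide_eq pos_divide_le_eq mult.commute)
    then have "s v * ((c + \<mu>) / (1 + \<mu> * c)) \<le> s v * ((v \<bullet> e + \<mu> * s v) / (s v + \<mu> * (v \<bullet> e)))" by (intro mult_left_mono) auto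
    then show ?thesis unfolding moebius_e by (simp add: mult.commute)
  qed (simp add: moebius_e)
  show "moebius \<mu> v \<bullet> e \<le> (c + \<mu>) / (1 + \<mu> * c) * s v" if "v \<bullet> e \<le> c * s v"
  proof (cases "s v = 0")
    case False
    have "(v \<bullet> e - c * s v) * (1 - \<mu>\<^sup>2) \<le> 0" using that mu_sq by (intro mult_nonpos_nonneg) auto
    then have "(v \<bullet> e + \<mu> * s v) / (s v + \<mu> * (v \<bullet> e)) \<le> (c + \<mu>) / (1 + \<mu> * c)"
      using key d denom_pos[OF False] by (simp add: divide_le_eq le_divide_eq pos_le_divide_eq pos_divide_le_eq mult.commute)
    then have "s v * ((v \<bullet> e + \<mu> * s v) / (s v + \<mu> * (v \<bullet> e))) \<le> s v * ((c + \<mu>) / (1 + \<mu> * c))" by (intro mult_left_mono) auto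
    then show ?thesis unfolding moebius_e by (simp add: mult.commute)
  qed (simp add: moebius_e)
qed

lemma moebius_continuous: "continuous_on UNIV (moebius \<mu>)"
proof -
  have "isCont (boost \<mu>) v" for v
  proof (cases "s v = 0")
    case False
    have "continuous_on {v. s v \<noteq> 0} (boost \<mu>)"
      unfolding boost_def using denom_pos by (intro continuous_intros) (auto simp: less_le)
    moreover have "open {v. s v \<noteq> 0}" by (intro open_Collect_neq continuous_intros)
    ultimately show ?thesis using False by (simp add: continuous_on_eq_continuous_at)
  next
    case True
    have "isCont (\<lambda>v. s v) v"
      using continuous_on_norm[OF continuous_on_part[OF continuous_on_id], of UNIV B] by (simp add: continuous_on_eq_continuous_at)
    then have "((\<lambda>w. s w) \<longlongrightarrow> 0) (at v)" using True by (simp add: isCont_def)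
    then have "(boost \<mu> \<longlongrightarrow> 0) (at v)" by (rule Lim_null_comparison[rotated]) (simp add: norm_boost)
    moreover have "boost \<mu> v = 0" using norm_boost[of v] True by simp
    ultimately show ?thesis by (simp add: isCont_def)
  qed
  then have "continuous_on UNIV (boost \<mu>)" by (simp add: continuous_at_imp_continuous_on)
  then show ?thesis unfolding moebius_def by (intro continuous_intros)
qed

lemma rot_moebius: "rot (moebius \<mu>)"
  unfolding rot_def
proof (intro conjI)
  show "continuous_on S (moebius \<mu>)" using moebius_continuous continuous_on_subset by blast
  have "norm (moebius \<mu> v) = norm v" for v
  proof -
    have "(\<Sum>b\<in>Basis - B. (moebius \<mu> v \<bullet> b)\<^sup>2) = (\<Sum>b\<in>Basis - B. (v \<bullet> b)\<^sup>2)" by (intro sum.cong) (auto simp: moebius_tail)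
    then have "(norm (moebius \<mu> v))\<^sup>2 = (norm v)\<^sup>2"
      using norm_split[OF BB, of v] norm_split[OF BB, of "moebius \<mu> v"] s_moebius[of v] by simp
    then show ?thesis by simp
  qed
  moreover have "moebius \<mu> v \<bullet> et = v \<bullet> et" for v using et_Basis B by (intro moebius_tail) auto
  ultimately show "moebius \<mu> ` S \<subseteq> S" by (auto simp: S_def)
  show "inj_on (moebius \<mu>) S"
  proof (rule inj_onI)
    fix v w assume vw: "v \<in> S" "w \<in> S" "moebius \<mu> v = moebius \<mu> w"
    have tail: "v \<bullet> b = w \<bullet> b" if "b \<in> Basis - B" for b using moebius_tail[OF that, of v] moebius_tail[OF that, of w] vw(3) by simp
    have ss: "s v = s w" using s_moebius[of v] s_moebius[of w] vw(3) by simp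
    have bb: "boost \<mu> v = boost \<mu> w" using part_moebius[of v] part_moebius[of w] vw(3) by simp
    have "part B v = part B w"
    proof (cases "s v = 0")
      case False
      have d: "0 < s v + \<mu> * (v \<bullet> e)" "0 < s v + \<mu> * (w \<bullet> e)" using denom_pos[of v] denom_pos[of w] False ss by auto
      have "s v * (v \<bullet> e + \<mu> * s v) / (s v + \<mu> * (v \<bullet> e)) = s v * (w \<bullet> e + \<mu> * s v) / (s v + \<mu> * (w \<bullet> e))"
        using moebius_e[of v] moebius_e[of w] vw(3) ss by simp
      then have "(v \<bullet> e + \<mu> * s v) * (s v + \<mu> * (w \<bullet> e)) = (w \<bullet> e + \<mu> * s v) * (s v + \<mu> * (v \<bullet> e))"
        using d False by (simp add: frac_eq_eq)
      then have "s v * (1 - \<mu>\<^sup>2) * (v \<bullet> e - w \<bullet> e) = 0" by (simp add: algebra_simps power2_eq_square)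
      then have z: "v \<bullet> e = w \<bullet> e" using False mu_sq(1) by simp
      have "s v / (s v + \<mu> * (v \<bullet> e)) \<noteq> 0" using False d by simp
      then have "sqrt (1 - \<mu>\<^sup>2) *\<^sub>R (part B v - (v \<bullet> e) *\<^sub>R e) = sqrt (1 - \<mu>\<^sup>2) *\<^sub>R (part B w - (v \<bullet> e) *\<^sub>R e)"
        using bb unfolding boost_def ss[symmetric] z[symmetric] by simp
      then show ?thesis using mu_sq(2) by simp
    qed (use ss in simp)
    then have "v \<bullet> b = w \<bullet> b" if "b \<in> B" for b
      using inner_part[OF BB, of b v] inner_part[OF BB, of b w] that BB by auto
    then show "v = w" using tail by (intro basis_eqI) blast
  qed
qed

end

end

text \<open>The oscillation is measured on the small spheres obtained by freezing all coordinates
  outside \<open>B\<close>; once \<open>B\<close> contains every direction but \<open>et\<close>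
  this is the diameter of the image.\<close>

definition (in basis_frame) steady :: "'a set \<Rightarrow> real \<Rightarrow> ('a \<Rightarrow> 'a) \<Rightarrow> bool" where
  "steady B \<epsilon> f \<longleftrightarrow> continuous_on S f \<and>
     (\<forall>v\<in>S. \<forall>w\<in>S. (\<forall>b\<in>Basis - B. v \<bullet> b = w \<bullet> b) \<longrightarrow> dist (f v) (f w) \<le> \<epsilon>)"

lemma moebius_less:
  fixes x y \<mu> :: real
  assumes "\<bar>\<mu>\<bar> < 1" "-1 \<le> x" "x < y" "y \<le> 1"
  shows "(x - \<mu>) / (1 - \<mu> * x) < (y - \<mu>) / (1 - \<mu> * y)"
proof -
  have d: "0 < 1 - \<mu> * u" if "-1 \<le> u" "u \<le> 1" for u
  proof -
    have "\<bar>\<mu> * u\<bar> \<le> \<bar>\<mu>\<bar> * 1" unfolding abs_mult using that by (intro mult_left_mono) auto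
    then show ?thesis using assms(1) by linarith
  qed
  have "\<mu>\<^sup>2 < 1" using assms(1) abs_square_less_1[of \<mu>] by simp
  then have "0 < (y - x) * (1 - \<mu>\<^sup>2)" using assms by (intro mult_pos_pos) auto
  also have "(y - x) * (1 - \<mu>\<^sup>2) = (y - \<mu>) * (1 - \<mu> * x) - (x - \<mu>) * (1 - \<mu> * y)"
    by (simp add: algebra_simps power2_eq_square)
  finally have "(x - \<mu>) * (1 - \<mu> * y) < (y - \<mu>) * (1 - \<mu> * x)" by simp
  then show ?thesis using d[of x] d[of y] assms by (simp add: divide_less_eq less_divide_eq mult.commute)
qed

lemma moebius_inverse:
  fixes x \<mu> :: real
  assumes "\<bar>\<mu>\<bar> < 1" "-1 \<le> x" "x \<le> 1"
  shows "((x - \<mu>) / (1 - \<mu> * x) + \<mu>) / (1 + \<mu> * ((x - \<mu>) / (1 - \<mu> * x))) = x"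
proof -
  have "\<bar>\<mu> * x\<bar> \<le> \<bar>\<mu>\<bar> * 1" unfolding abs_mult using assms by (intro mult_left_mono) auto
  then have d: "1 - \<mu> * x \<noteq> 0" using assms(1) by linarith
  have m: "1 - \<mu>\<^sup>2 \<noteq> 0" using assms(1) abs_square_less_1[of \<mu>] by simp
  have "(x - \<mu>) / (1 - \<mu> * x) + \<mu> = x * (1 - \<mu>\<^sup>2) / (1 - \<mu> * x)"
    using d by (simp add: field_simps power2_eq_square)
  moreover have "1 + \<mu> * ((x - \<mu>) / (1 - \<mu> * x)) = (1 - \<mu>\<^sup>2) / (1 - \<mu> * x)"
    using d by (simp add: field_simps power2_eq_square)
  ultimately show ?thesis using d m by simp
qed

context plane_frame
begin

definition tl :: "'a \<Rightarrow> 'a \<Rightarrow> bool" where "tl v w \<longleftrightarrow> (\<forall>b\<in>Basis - B. v \<bullet> b = w \<bullet> b)"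

text \<open>Heights are taken relative to \<open>s v\<close>. Thus Moebius maps permute slabs by
  acting on the two bounds alone.\<close>

definition slab :: "real \<Rightarrow> real \<Rightarrow> 'a \<Rightarrow> bool" where
  "slab lo hi v \<longleftrightarrow> lo * s v \<le> v \<bullet> e \<and> v \<bullet> e \<le> hi * s v"

lemma tl_s: "v \<in> S \<Longrightarrow> w \<in> S \<Longrightarrow> tl v w \<Longrightarrow> s v = s w"
  by (rule same_s) (auto simp: tl_def)

text \<open>Each double drops the top slab on one half and the bottom slab on the other, so induction on the
  number of slabs leaves every leaf in a few adjacent ones.\<close>

lemma folds_slabs:
  assumes "2 \<le> k" "continuous_on S f" "c 0 = -1" "c (Suc k) = 1" "\<And>i. i \<le> k \<Longrightarrow> c i < c (Suc i)"
    "\<And>i v w. i + 3 \<le> Suc k \<Longrightarrow> v \<in> S \<Longrightarrow> w \<in> S \<Longrightarrow> tl v w \<Longrightarrow> slab (c i) (c (i + 3)) v \<Longrightarrow> slab (c i) (c (i + 3)) w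
       \<Longrightarrow> dist (f v) (f w) \<le> \<epsilon>"
  shows "folds (steady B \<epsilon>) f"
  using assms
proof (induction k arbitrary: f c rule: dec_induct)
  case base
  \<comment> \<open>With \<open>k = 2\<close> there are three slabs in all, so the hypothesis on
    three adjacent slabs already covers everything.\<close>
  have sl: "slab (c 0) (c (0 + 3)) v" for v
    using radius_le_s(2)[of v] base(2,3) by (simp add: slab_def abs_le_iff numeral_3_eq_3 numeral_2_eq_2)
  have "dist (f v) (f w) \<le> \<epsilon>" if "v \<in> S" "w \<in> S" "tl v w" for v w
    by (rule base(5)[of 0, OF _ that sl sl]) simp
  then have "steady B \<epsilon> f" using base(1) unfolding steady_def tl_def by blast
  then show ?case by (rule folds.leaf[where Q = "steady B \<epsilon>"])
next
  case (step k)
  note c0 = step.prems(2) and c1 = step.prems(3) and cinc = step.prems(4) and osc = step.prems(5)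
  have mono: "c i < c j" if ij: "i < j" "j \<le> Suc (Suc k)" for i j
    using ij
  proof (induction j)
    case (Suc j)
    then show ?case using cinc[of j] by (cases "i = j") auto
  qed simp
  \<comment> \<open>The Moebius map puts the cut \<open>c 2\<close> at height 0. Then the lowest
    inner cut is negative and the two highest inner cuts are nonnegative, as
    \<open>squeeze_map\<close> requires.\<close>
  define \<mu> where "\<mu> = c 2"
  have "c 0 < c 2" "c 2 < c (Suc (Suc k))" using step.hyps by (auto intro!: mono)
  then have \<mu>: "\<bar>\<mu>\<bar> < 1" using c0 c1 by (auto simp: \<mu>_def)
  have cb: "-1 \<le> c i" "c i \<le> 1" if "i \<le> Suc (Suc k)" for i
  proof -
    show "-1 \<le> c i" using mono[of 0 i] that c0 by (cases "i = 0") auto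
    show "c i \<le> 1" using mono[of i "Suc (Suc k)"] that c1 by (cases "i = Suc (Suc k)") auto
  qed
  define d where "d i = (c i - \<mu>) / (1 - \<mu> * c i)" for i
  have dmono: "d i < d j" if "i < j" "j \<le> Suc (Suc k)" for i j
    unfolding d_def using that by (intro moebius_less \<mu> cb mono) auto
  have dle: "d i \<le> d j" if "i \<le> j" "j \<le> Suc (Suc k)" for i j
    using dmono[of i j] that by (cases "i = j") auto
  have dinv: "(d i + \<mu>) / (1 + \<mu> * d i) = c i" if "i \<le> Suc (Suc k)" for i
    unfolding d_def using that by (intro moebius_inverse \<mu> cb)
  have d0: "d 0 = -1" using \<mu> by (simp add: d_def c0 divide_eq_minus_1_iff)
  have d1: "d (Suc (Suc k)) = 1" using \<mu> by (simp add: d_def c1)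
  have d2: "d 2 = 0" by (simp add: d_def \<mu>_def)
  have db: "-1 \<le> d i" "d i \<le> 1" if "i \<le> Suc (Suc k)" for i
    using dle[of 0 i] dle[of i "Suc (Suc k)"] that d0 d1 by auto
  have dk: "0 \<le> d k" "d k < d (Suc k)" "d (Suc k) < 1" "-1 < d 1" "d 1 < 0"
    using dle[of 2 k] dmono[of k "Suc k"] dmono[of "Suc k" "Suc (Suc k)"] dmono[of 0 1] dmono[of 1 2] step.hyps d0 d1 d2 by auto
  obtain P where P: "rot P" "\<And>v b'. b' \<in> Basis - {e0,e} \<Longrightarrow> P v \<bullet> b' = v \<bullet> b'"
    and P1: "\<And>v. 0 \<le> v \<bullet> e0 \<Longrightarrow> v \<bullet> e \<le> 0 \<Longrightarrow> d 1 * s v \<le> P v \<bullet> e \<and> P v \<bullet> e \<le> 0"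
    and P2: "\<And>v. 0 \<le> v \<bullet> e0 \<Longrightarrow> 0 \<le> v \<bullet> e \<Longrightarrow> v \<bullet> e \<le> d (Suc k) * s v \<Longrightarrow> P v = v"
    and P3: "\<And>v. 0 \<le> v \<bullet> e0 \<Longrightarrow> d (Suc k) * s v \<le> v \<bullet> e \<Longrightarrow> d (Suc k) * s v \<le> P v \<bullet> e"
    and P4: "\<And>v. v \<bullet> e0 \<le> 0 \<Longrightarrow> v \<bullet> e \<le> d 1 * s v \<Longrightarrow> P v \<bullet> e \<le> d 1 * s v"
    and P5: "\<And>v. v \<bullet> e0 \<le> 0 \<Longrightarrow> d 1 * s v \<le> v \<bullet> e \<Longrightarrow> v \<bullet> e \<le> d k * s v \<Longrightarrow> P v = v"
    and P6: "\<And>v. v \<bullet> e0 \<le> 0 \<Longrightarrow> d k * s v \<le> v \<bullet> e \<Longrightarrow> d k * s v \<le> P v \<bullet> e \<and> P v \<bullet> e \<le> d (Suc k) * s v"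
    by (rule squeeze_map[OF dk]) (rule that)
  define \<rho> where "\<rho> = moebius \<mu> \<circ> P"
  have r\<rho>: "rot \<rho>" unfolding \<rho>_def by (rule rot_comp[OF rot_moebius[OF \<mu>] P(1)])
  have Pt: "P v \<bullet> b = v \<bullet> b" if "b \<in> Basis - B" for v b using P(2)[of b v] that B by auto
  have PS: "P v \<in> S" "s (P v) = s v" if "v \<in> S" for v
    using rot_S[OF P(1) that] same_s[OF rot_S[OF P(1) that] that Pt] by auto
  have up: "x * s v \<le> y * s v" if "x \<le> y" for x y v using that by (intro mult_right_mono) auto
  have abs: "- s v \<le> v \<bullet> e" "v \<bullet> e \<le> s v" for v using radius_le_s(2)[of v] by (auto simp: abs_le_iff)
  have "folds (steady B \<epsilon>) (f \<circ> \<rho> \<circ> F)"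
    if F: "continuous_on S (f \<circ> \<rho> \<circ> F)" "\<And>v. v \<in> S \<Longrightarrow> F v \<in> S" "\<And>v. F v \<bullet> e = v \<bullet> e" "\<And>v b. b \<in> Basis - {e0} \<Longrightarrow> F v \<bullet> b = v \<bullet> b"
      and d': "d' 0 = -1" "d' (Suc k) = 1" "\<And>i. i \<le> k \<Longrightarrow> d' i < d' (Suc i)"
      and sh: "\<And>i v. i + 3 \<le> Suc k \<Longrightarrow> v \<in> S \<Longrightarrow> slab (d' i) (d' (i + 3)) (F v) \<Longrightarrow> slab (d (i + m)) (d (i + m + 3)) (P (F v))" "m \<le> 1"
    for F d' m
  proof (rule step.IH[OF F(1) d'])
    fix i v w assume i: "i + 3 \<le> Suc k" and vw: "v \<in> S" "w \<in> S" "tl v w"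
      and sv: "slab (d' i) (d' (i + 3)) v" and sw: "slab (d' i) (d' (i + 3)) w"
    have Ft: "F v \<bullet> b = v \<bullet> b" if "b \<in> Basis - B" for v b using F(4)[of b v] that B by auto
    have sF: "s (F v) = s v" if "v \<in> S" for v using same_s[OF F(2)[OF that] that Ft] .
    have gS: "\<rho> (F v) \<in> S" if "v \<in> S" for v using rot_S[OF r\<rho>] F(2) that by blast
    have gt: "\<rho> (F v) \<bullet> b = v \<bullet> b" if "b \<in> Basis - B" for v b
      using that by (simp add: \<rho>_def moebius_tail[OF \<mu>] Pt Ft)
    have "slab (c (i + m)) (c (i + m + 3)) (\<rho> (F v))" if v: "v \<in> S" "slab (d' i) (d' (i + 3)) v" for v
    proof -
      have "slab (d' i) (d' (i + 3)) (F v)" using v by (simp add: slab_def sF F(3))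
      from sh(1)[OF i v(1) this] have "slab (d (i + m)) (d (i + m + 3)) (P (F v))" .
      moreover have im: "i + m \<le> Suc (Suc k)" "i + m + 3 \<le> Suc (Suc k)" using i sh(2) by auto
      ultimately have "(d (i + m) + \<mu>) / (1 + \<mu> * d (i + m)) * s (P (F v)) \<le> moebius \<mu> (P (F v)) \<bullet> e"
        "moebius \<mu> (P (F v)) \<bullet> e \<le> (d (i + m + 3) + \<mu>) / (1 + \<mu> * d (i + m + 3)) * s (P (F v))"
        unfolding slab_def using db by (intro moebius_height[OF \<mu>]; blast)+
      then show ?thesis unfolding dinv[OF im(1)] dinv[OF im(2)] by (simp add: slab_def \<rho>_def s_moebius[OF \<mu>])
    qed
    then have "slab (c (i + m)) (c (i + m + 3)) (\<rho> (F v))" "slab (c (i + m)) (c (i + m + 3)) (\<rho> (F w))"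
      using vw sv sw by auto
    moreover have "tl (\<rho> (F v)) (\<rho> (F w))" using vw(3) by (simp add: tl_def gt)
    moreover have "i + m + 3 \<le> Suc (Suc k)" using i sh(2) by simp
    ultimately show "dist ((f \<circ> \<rho> \<circ> F) v) ((f \<circ> \<rho> \<circ> F) w) \<le> \<epsilon>"
      using osc[of "i + m" "\<rho> (F v)" "\<rho> (F w)"] gS vw by simp
  qed
  note child = this
  show ?case
  proof (rule folds.node[OF r\<rho>])
    show "folds (steady B \<epsilon>) (f \<circ> \<rho> \<circ> Fp)"
    \<comment> \<open>The half at \<open>e0\<close> omits the bottom slab, so the cut
      \<open>d 1\<close> disappears and all later slabs shift by one index:
      \<open>m = 1\<close>.\<close>
    proof (rule child[where d' = "\<lambda>i. if i = 0 then -1 else d (Suc i)" and m = 1])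
      show "continuous_on S (f \<circ> \<rho> \<circ> Fp)" by (rule continuous_child[OF step.prems(1) r\<rho>])
      show "(if i = 0 then -1 else d (Suc i)) < (if Suc i = 0 then -1 else d (Suc (Suc i)))" if "i \<le> k" for i
        using dmono[of "Suc i" "Suc (Suc i)"] dk(4) d2 that by (auto simp: numeral_2_eq_2)
      fix i v assume i: "i + 3 \<le> Suc k" and v: "v \<in> S"
        and sl: "slab (if i = 0 then -1 else d (Suc i)) (if i + 3 = 0 then -1 else d (Suc (i + 3))) (Fp v)"
      let ?u = "Fp v"
      have u: "?u \<in> S" "0 \<le> ?u \<bullet> e0" using F_in_S v by (auto simp: F_e0)
      note su = PS(2)[OF u(1)]
      have lo: "d (Suc i) * s ?u \<le> P ?u \<bullet> e"
      proof (cases "?u \<bullet> e \<le> 0")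
        case True
        then have 1: "d 1 * s ?u \<le> P ?u \<bullet> e" using P1 u(2) by blast
        show ?thesis
        proof (cases "i = 0")
          case False
          then have le: "d (Suc i) * s ?u \<le> ?u \<bullet> e" using sl by (simp add: slab_def)
          have "0 \<le> d (Suc i)" using dle[of 2 "Suc i"] d2 i False by simp
          then have "0 \<le> d (Suc i) * s ?u" by simp
          then have "?u \<bullet> e = 0" using le True by linarith
          moreover have "0 \<le> d (Suc k) * s ?u" using dk by simp
          ultimately have "P ?u = ?u" using P2[OF u(2)] by simp
          then show ?thesis using le by simp
        qed (use 1 in simp)
      next
        case False
        show ?thesis
        proof (cases "?u \<bullet> e \<le> d (Suc k) * s ?u")
          case True
          have Pu: "P ?u = ?u" using P2[OF u(2)] True False by simp
          show ?thesis
          proof (cases "i = 0")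
            case True
            have "d 1 * s ?u \<le> 0" using dk(5) by (simp add: mult_nonpos_nonneg)
            then show ?thesis using Pu True False by simp
          qed (use sl Pu in \<open>simp add: slab_def\<close>)
        next
          case False
          then have "d (Suc k) * s ?u \<le> P ?u \<bullet> e" using P3[OF u(2)] by simp
          moreover have "d (Suc i) * s ?u \<le> d (Suc k) * s ?u" using i by (intro up dle) auto
          ultimately show ?thesis by linarith
        qed
      qed
      have hi: "P ?u \<bullet> e \<le> d (i + 4) * s ?u"
      proof (cases "i + 4 = Suc (Suc k)")
        case True
        then have "d (i + 4) = 1" using d1 by (simp only:)
        then show ?thesis using abs(2)[of "P ?u"] su by simp
      next
        case False
        then have le: "d (i + 4) * s ?u \<le> d (Suc k) * s ?u" using i by (intro up dle) auto
        have z: "?u \<bullet> e \<le> d (i + 4) * s ?u" using sl by (simp add: slab_def numeral_eq_Suc)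
        have "0 \<le> d (i + 4)" using dle[of 2 "i + 4"] d2 i by simp
        then have p: "0 \<le> d (i + 4) * s ?u" by simp
        show ?thesis
        proof (cases "?u \<bullet> e \<le> 0")
          case True
          then show ?thesis using P1[OF u(2)] p by fastforce
        next
          case False
          then have "P ?u = ?u" using P2[OF u(2)] z le by simp
          then show ?thesis using z by simp
        qed
      qed
      show "slab (d (i + 1)) (d (i + 1 + 3)) (P ?u)" using lo hi unfolding slab_def su by (simp add: numeral_eq_Suc)
    qed (use d1 F_in_S F_orth e0_Basis in \<open>auto simp: inner_not_same_Basis\<close>)
    show "folds (steady B \<epsilon>) (f \<circ> \<rho> \<circ> Fm)"
    \<comment> \<open>The other half omits the top slab: the cut \<open>d (Suc k)\<close> disappears
      and nothing shifts.\<close>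
    proof (rule child[where d' = "\<lambda>i. if i = Suc k then 1 else d i" and m = 0])
      show "continuous_on S (f \<circ> \<rho> \<circ> Fm)" by (rule continuous_child[OF step.prems(1) r\<rho>])
      show "(if i = Suc k then 1 else d i) < (if Suc i = Suc k then 1 else d (Suc i))" if "i \<le> k" for i
        using dmono[of i "Suc i"] dk that by (cases "i = k") auto
      fix i v assume i: "i + 3 \<le> Suc k" and v: "v \<in> S"
        and sl: "slab (if i = Suc k then 1 else d i) (if i + 3 = Suc k then 1 else d (i + 3)) (Fm v)"
      let ?u = "Fm v"
      have u: "?u \<in> S" "?u \<bullet> e0 \<le> 0" using F_in_S v by (auto simp: F_e0)
      note su = PS(2)[OF u(1)]
      have zl: "d i * s ?u \<le> ?u \<bullet> e" using sl i by (simp add: slab_def)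
      have lo: "d i * s ?u \<le> P ?u \<bullet> e"
      proof (cases "i = 0")
        case True
        then show ?thesis using abs(1)[of "P ?u"] su d0 by simp
      next
        case False
        then have "d 1 * s ?u \<le> d i * s ?u" using i by (intro up dle) auto
        then have z1: "d 1 * s ?u \<le> ?u \<bullet> e" using zl by linarith
        show ?thesis
        proof (cases "?u \<bullet> e \<le> d k * s ?u")
          case True
          then show ?thesis using P5[OF u(2) z1] zl by simp
        next
          case False
          then have "d k * s ?u \<le> P ?u \<bullet> e" using P6[OF u(2)] by simp
          moreover have "d i * s ?u \<le> d k * s ?u" using i by (intro up dle) auto
          ultimately show ?thesis by linarith
        qed
      qed
      have hi: "P ?u \<bullet> e \<le> d (i + 3) * s ?u"
      proof (cases "?u \<bullet> e \<le> d 1 * s ?u")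
        case True
        have "d 1 * s ?u \<le> d (i + 3) * s ?u" using i by (intro up dle) auto
        then show ?thesis using P4[OF u(2) True] by linarith
      next
        case False
        show ?thesis
        proof (cases "i + 3 = Suc k")
          case True
          show ?thesis
          proof (cases "?u \<bullet> e \<le> d k * s ?u")
            case True
            then have "P ?u = ?u" using P5[OF u(2)] False by simp
            moreover have "d k * s ?u \<le> d (i + 3) * s ?u" using i \<open>i + 3 = Suc k\<close> by (intro up dle) auto
            ultimately show ?thesis using True by simp
          next
            case False
            then have "P ?u \<bullet> e \<le> d (Suc k) * s ?u" using P6[OF u(2)] by simp
            then show ?thesis unfolding \<open>i + 3 = Suc k\<close> .
          qed
        next
          case ne: False
          then have z: "?u \<bullet> e \<le> d (i + 3) * s ?u" using sl by (simp add: slab_def)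
          have "d (i + 3) * s ?u \<le> d k * s ?u" using i ne by (intro up dle) auto
          then have "P ?u = ?u" using P5[OF u(2)] False z by simp
          then show ?thesis using z by simp
        qed
      qed
      show "slab (d (i + 0)) (d (i + 0 + 3)) (P ?u)" using lo hi unfolding slab_def su by simp
    qed (use d0 F_in_S F_orth e0_Basis in \<open>auto simp: inner_not_same_Basis\<close>)
  qed
qed

end

section \<open>Reducing the oscillation one coordinate at a time\<close>

context basis_frame
begin

text \<open>Points of the sphere that agree outside \<open>e0\<close> differ at most in the sign of
  that coordinate, and both foldings forget the sign.\<close>

lemma folds_steady_e0:
  assumes "continuous_on S f" "0 < \<epsilon>"
  shows "folds (steady {e0} \<epsilon>) f"
proof (rule folds.node)
  show r: "rot id" by (auto simp: rot_def)
  have eq: "\<bar>v \<bullet> e0\<bar> = \<bar>w \<bullet> e0\<bar>" if vw: "v \<in> S" "w \<in> S" "\<forall>b\<in>Basis - {e0}. v \<bullet> b = w \<bullet> b" for v w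
  proof -
    have "norm (part {e0} v) = norm (part {e0} w)"
      using vw e0_Basis by (intro part_same_tail) (auto simp: norm_S)
    then show ?thesis by (simp add: part_def)
  qed
  have "Fp v = Fp w \<and> Fm v = Fm w" if vw: "v \<in> S" "w \<in> S" "\<forall>b\<in>Basis - {e0}. v \<bullet> b = w \<bullet> b" for v w
  proof -
    have F: "F v = F w" if F: "F v \<bullet> e0 = F w \<bullet> e0" "\<And>b u. e0 \<bullet> b = 0 \<Longrightarrow> F u \<bullet> b = u \<bullet> b" for F :: "'a \<Rightarrow> 'a"
    proof (rule euclidean_eqI)
      fix b :: 'a assume b: "b \<in> Basis"
      show "F v \<bullet> b = F w \<bullet> b"
      proof (cases "b = e0")
        case False
        then have "e0 \<bullet> b = 0" using b e0_Basis by (intro inner_not_same_Basis) auto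
        then show ?thesis using F(2) vw(3) b False by simp
      qed (use F(1) in simp)
    qed
    show ?thesis
      by (intro conjI F) (simp_all add: F_e0 F_orth eq[OF vw])
  qed
  note FF = this
  have "dist ((f \<circ> id \<circ> Fp) v) ((f \<circ> id \<circ> Fp) w) \<le> \<epsilon>" "dist ((f \<circ> id \<circ> Fm) v) ((f \<circ> id \<circ> Fm) w) \<le> \<epsilon>"
    if "v \<in> S" "w \<in> S" "\<forall>b\<in>Basis - {e0}. v \<bullet> b = w \<bullet> b" for v w
    using FF[OF that] assms(2) by simp_all
  then have "steady {e0} \<epsilon> (f \<circ> id \<circ> Fp)" "steady {e0} \<epsilon> (f \<circ> id \<circ> Fm)"
    using continuous_child[OF assms(1) r] unfolding steady_def by blast+
  then show "folds (steady {e0} \<epsilon>) (f \<circ> id \<circ> Fp)" "folds (steady {e0} \<epsilon>) (f \<circ> id \<circ> Fm)"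
    by (auto intro: folds.leaf)
qed

text \<open>Steadiness lets \<open>v\<close> be replaced by \<open>q v\<close>, in which the
  \<open>B\<close> part is turned into the direction of \<open>e0\<close>. Within a thin slab the
  coordinate along \<open>e\<close> and therefore the norm of the \<open>B\<close> part hardly vary,
  so \<open>q v\<close> does not either. The three terms are the two replacements and uniform
  continuity.\<close>

lemma folds_steady_insert:
  assumes BA: "B \<subseteq> Basis - {et}" "e0 \<in> B" "e \<in> Basis - {et}" "e \<notin> B" and f: "steady B \<epsilon> f" and "0 < \<epsilon>"
  shows "folds (steady (insert e B) (3 * \<epsilon>)) f"
proof -
  interpret plane_frame e0 et "insert e B" e
    using BA by unfold_locales auto
  note B = BA
  have cf: "continuous_on S f" and st: "\<And>v w. v \<in> S \<Longrightarrow> w \<in> S \<Longrightarrow> \<forall>b\<in>Basis - B. v \<bullet> b = w \<bullet> b \<Longrightarrow> dist (f v) (f w) \<le> \<epsilon>"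
    using f by (auto simp: steady_def)
  have "uniformly_continuous_on S f" using compact_uniformly_continuous[OF cf compact_S] .
  then obtain \<delta> where \<delta>: "0 < \<delta>" "\<And>v w. v \<in> S \<Longrightarrow> w \<in> S \<Longrightarrow> dist w v < \<delta> \<Longrightarrow> dist (f w) (f v) < \<epsilon>"
    unfolding uniformly_continuous_on_def using \<open>0 < \<epsilon>\<close> by metis
  \<comment> \<open>Ensures that both \<open>\<eta>\<close> and \<open>sqrt (2 * \<eta>)\<close> are
    at most a third of \<open>\<delta>\<close>. The number 6 below is three slabs of width
    \<open>2 / (k + 1)\<close>.\<close>
  define \<eta>0 where "\<eta>0 = min (\<delta> / 3) (\<delta>\<^sup>2 / 18)"
  have \<eta>0: "0 < \<eta>0" using \<delta>(1) by (simp add: \<eta>0_def)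
  obtain k0 :: nat where k0: "6 / \<eta>0 \<le> real k0" using real_arch_simple by blast
  define k where "k = max 2 k0"
  define \<eta> where "\<eta> = 6 / (real k + 1)"
  have \<eta>1: "0 < \<eta>" by (simp add: \<eta>_def)
  have "6 / \<eta>0 \<le> real k + 1" using k0 by (simp add: k_def)
  then have le: "\<eta> \<le> \<eta>0" using \<eta>0 by (simp add: \<eta>_def field_simps)
  then have "2 * \<eta> \<le> (\<delta> / 3)\<^sup>2" by (simp add: \<eta>0_def power2_eq_square)
  then have "sqrt (2 * \<eta>) \<le> \<delta> / 3" using \<delta>(1) by (intro real_le_lsqrt) auto
  then have \<eta>: "0 < \<eta>" "\<eta> + sqrt (2 * \<eta>) < \<delta>" using \<eta>1 le \<delta>(1) by (auto simp: \<eta>0_def)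
  define c where "c i = -1 + 2 * real i / (real k + 1)" for i
  define q where "q v = v - part B v + norm (part B v) *\<^sub>R e0" for v
  have BB': "B \<subseteq> Basis" using B by auto
  have qb: "q v \<bullet> b = v \<bullet> b" if "b \<in> Basis - B" for v b
  proof -
    have "e0 \<bullet> b = 0" using that B e0_Basis by (intro inner_not_same_Basis) auto
    then show ?thesis using that by (simp add: q_def inner_add_left inner_diff_left inner_part[OF BB'])
  qed
  have pq: "part B (q v) = norm (part B v) *\<^sub>R e0" for v
  proof (rule euclidean_eqI)
    fix b :: 'a assume b: "b \<in> Basis"
    show "part B (q v) \<bullet> b = (norm (part B v) *\<^sub>R e0) \<bullet> b"
    proof (cases "b \<in> B")
      case False
      then have "e0 \<bullet> b = 0" using b B(2) e0_Basis by (intro inner_not_same_Basis) auto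
      then show ?thesis using b False by (simp add: inner_part[OF BB'])
    qed (use b in \<open>simp add: inner_part[OF BB'] q_def inner_add_left inner_diff_left\<close>)
  qed
  have qS: "q v \<in> S" if "v \<in> S" for v
  proof -
    have "(\<Sum>b\<in>Basis - B. (q v \<bullet> b)\<^sup>2) = (\<Sum>b\<in>Basis - B. (v \<bullet> b)\<^sup>2)" by (intro sum.cong) (auto simp: qb)
    then have "(norm (q v))\<^sup>2 = (norm v)\<^sup>2"
      using norm_split[OF BB', of v] norm_split[OF BB', of "q v"] by (simp add: pq)
    moreover have "q v \<bullet> et = v \<bullet> et" using et_Basis B by (intro qb) auto
    ultimately show ?thesis using that by (simp add: S_def)
  qed
  have s2: "(s v)\<^sup>2 = (norm (part B v))\<^sup>2 + (v \<bullet> e)\<^sup>2" for v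
  proof -
    have "finite B" using BB' finite_subset finite_Basis by blast
    then show ?thesis using B by (simp add: norm_part[OF BB] norm_part[OF BB'])
  qed
  show ?thesis
  proof (rule folds_slabs[where k = k and c = c])
    show "2 \<le> k" by (simp add: k_def)
    show "c 0 = -1" "c (Suc k) = 1" by (auto simp: c_def field_simps)
    show "c i < c (Suc i)" for i by (simp add: c_def divide_strict_right_mono)
    fix i v w assume vw: "v \<in> S" "w \<in> S" "tl v w" "slab (c i) (c (i + 3)) v" "slab (c i) (c (i + 3)) w"
    have s1: "s v \<le> 1"
    proof -
      have "(s v)\<^sup>2 \<le> (norm v)\<^sup>2" using norm_split[OF BB, of v] by (simp add: sum_nonneg)
      then show ?thesis using vw(1) norm_S power2_le_imp_le[of "s v" 1] by simp
    qed
    have ss: "s w = s v" using tl_s[OF vw(1-3)] by simp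
    have ci: "c (i + 3) - c i = \<eta>" by (simp add: c_def \<eta>_def add_divide_distrib distrib_left)
    have "\<bar>v \<bullet> e - w \<bullet> e\<bar> \<le> (c (i + 3) - c i) * s v"
      using vw(4,5) unfolding slab_def ss left_diff_distrib by linarith
    also have "\<dots> \<le> \<eta> * 1" unfolding ci using s1 \<eta>(1) by (intro mult_left_mono) auto
    finally have z: "\<bar>v \<bullet> e - w \<bullet> e\<bar> \<le> \<eta>" by simp
    have ze: "\<bar>v \<bullet> e\<bar> \<le> 1" "\<bar>w \<bullet> e\<bar> \<le> 1" using radius_le_s(2)[of v] radius_le_s(2)[of w] ss s1 by linarith+
    have "(norm (part B v))\<^sup>2 - (norm (part B w))\<^sup>2 = (w \<bullet> e + v \<bullet> e) * (w \<bullet> e - v \<bullet> e)"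
      using s2[of v] s2[of w] ss by (simp add: power2_eq_square algebra_simps)
    then have "\<bar>(norm (part B v))\<^sup>2 - (norm (part B w))\<^sup>2\<bar> \<le> 2 * \<eta>"
      unfolding abs_mult[symmetric] using z ze by (simp add: abs_mult) (intro mult_mono, auto)
    moreover have "\<bar>x - y\<bar>\<^sup>2 \<le> \<bar>x\<^sup>2 - y\<^sup>2\<bar>" if "0 \<le> x" "0 \<le> y" for x y :: real
    proof -
      have "\<bar>x - y\<bar> * \<bar>x - y\<bar> \<le> \<bar>x - y\<bar> * (x + y)" using that by (intro mult_left_mono) auto
      also have "\<dots> = \<bar>x\<^sup>2 - y\<^sup>2\<bar>" using that by (simp add: power2_eq_square square_diff_square_factored abs_mult)
      finally show ?thesis by (simp add: power2_eq_square)
    qed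
    ultimately have "\<bar>norm (part B v) - norm (part B w)\<bar>\<^sup>2 \<le> 2 * \<eta>" by (meson norm_ge_zero order_trans)
    then have n: "\<bar>norm (part B v) - norm (part B w)\<bar> \<le> sqrt (2 * \<eta>)" by (rule real_le_rsqrt)
    have "q v - q w = (v \<bullet> e - w \<bullet> e) *\<^sub>R e + (norm (part B v) - norm (part B w)) *\<^sub>R e0"
    proof (rule euclidean_eqI)
      fix b :: 'a assume b: "b \<in> Basis"
      consider "b = e" | "b \<in> B" | "b \<in> Basis - insert e B" using b by blast
      then show "(q v - q w) \<bullet> b = ((v \<bullet> e - w \<bullet> e) *\<^sub>R e + (norm (part B v) - norm (part B w)) *\<^sub>R e0) \<bullet> b"
      proof cases
        case 1
        then show ?thesis using qb[of e] B by (simp add: inner_diff_left inner_add_left)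
      next
        case 2
        have qB: "q u \<bullet> b = norm (part B u) * (e0 \<bullet> b)" for u
          using inner_part[OF BB' b, of "q u"] 2 pq[of u] by simp
        have "e \<bullet> b = 0" using 2 B b by (intro inner_not_same_Basis) auto
        then show ?thesis by (simp add: inner_diff_left inner_add_left qB algebra_simps)
      next
        case 3
        then have "q u \<bullet> b = u \<bullet> b" for u by (intro qb) auto
        moreover have "v \<bullet> b = w \<bullet> b" using vw(3) 3 by (simp add: tl_def)
        moreover have "e \<bullet> b = 0" "e0 \<bullet> b = 0" using 3 B e0_Basis by (auto intro!: inner_not_same_Basis)
        ultimately show ?thesis by (simp add: inner_diff_left inner_add_left)
      qed
    qed
    then have "dist (q v) (q w) \<le> \<bar>v \<bullet> e - w \<bullet> e\<bar> * norm e + \<bar>norm (part B v) - norm (part B w)\<bar> * norm e0"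
      unfolding dist_norm by (metis norm_triangle_ineq norm_scaleR)
    also have "\<dots> \<le> \<eta> + sqrt (2 * \<eta>)" using z n by simp
    finally have "dist (q v) (q w) < \<delta>" using \<eta>(2) by simp
    then have 1: "dist (f (q v)) (f (q w)) < \<epsilon>" using \<delta>(2) qS vw by blast
    have 2: "dist (f v) (f (q v)) \<le> \<epsilon>" "dist (f w) (f (q w)) \<le> \<epsilon>" using st qS vw qb by auto
    show "dist (f v) (f w) \<le> 3 * \<epsilon>"
      using 1 2 dist_triangle[of "f v" "f w" "f (q v)"] dist_triangle2[of "f (q v)" "f w" "f (q w)"] by linarith
  qed (rule cf)
qed

theorem folds_shrink:
  assumes "continuous_on S f" "0 < \<epsilon>"
  shows "folds (\<lambda>g. \<forall>v\<in>S. \<forall>w\<in>S. dist (g v) (g w) \<le> \<epsilon>) f"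
proof -
  have ne: "e0 \<noteq> et" by (metis frame_simps(2) orth zero_neq_one)
  have "\<forall>\<epsilon>>0. folds (steady (insert e0 C) \<epsilon>) f" if "finite C" "C \<subseteq> Basis - {et,e0}" for C
    using that
  proof (induction C rule: finite_induct)
    case empty
    then show ?case using folds_steady_e0[OF assms(1)] by simp
  next
    case (insert e C)
    show ?case
    proof (intro allI impI)
      fix \<epsilon> :: real assume \<epsilon>: "0 < \<epsilon>"
      have "folds (steady (insert e0 C) (\<epsilon> / 3)) f" using insert \<epsilon> by auto
      then have "folds (steady (insert e (insert e0 C)) (3 * (\<epsilon> / 3))) f"
      proof (rule folds_trans)
        fix g assume "steady (insert e0 C) (\<epsilon> / 3) g"
        then show "folds (steady (insert e (insert e0 C)) (3 * (\<epsilon> / 3))) g"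
          using insert.prems insert.hyps(2) e0_Basis et_Basis \<epsilon> ne by (intro folds_steady_insert) auto
      qed
      then show "folds (steady (insert e0 (insert e C)) \<epsilon>) f" by (simp add: insert_commute)
    qed
  qed
  then have "folds (steady (insert e0 (Basis - {et,e0})) \<epsilon>) f" using assms(2) by auto
  then show ?thesis
  proof (rule folds_trans)
    fix g assume g: "steady (insert e0 (Basis - {et,e0})) \<epsilon> g"
    have "v \<bullet> b = w \<bullet> b" if "v \<in> S" "w \<in> S" "b \<in> Basis - insert e0 (Basis - {et,e0})" for v w b
      using that by (auto simp: S_def)
    then show "folds (\<lambda>g. \<forall>v\<in>S. \<forall>w\<in>S. dist (g v) (g w) \<le> \<epsilon>) g"
      using g unfolding steady_def by (intro folds.leaf) blast
  qed
qed

end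

section \<open>Realising folds by trees\<close>

context sphere_frame
begin

lemma cap_pr:
  assumes "v \<in> S"
  shows "cap (pr v) = Fp v"
proof -
  have "bar v = v" using assms by (simp add: S_def bar_def)
  then have "1 = (v \<bullet> e0)\<^sup>2 + (norm (pr v))\<^sup>2" using norm_bar[of v] assms by (simp add: norm_S)
  then have n: "(norm (pr v))\<^sup>2 = 1 - (v \<bullet> e0)\<^sup>2" by simp
  then have "norm (pr v) \<le> 1" using power2_le_imp_le[of "norm (pr v)" 1] by simp
  then have "cap (pr v) = \<bar>v \<bullet> e0\<bar> *\<^sub>R e0 + pr v" by (simp add: cap_def n)
  also have "\<dots> = Fp v" using assms by (simp add: Fp_def pr_def S_def algebra_simps)
  finally show ?thesis .
qed

lemma refl_Fp: "refl (Fp v) = Fm v"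
  by (simp add: Fp_cases Fm_cases)

text \<open>For \<open>a = 1\<close> the cap of \<open>pr v\<close> is exactly the folded point, so
  uniform continuity of \<open>cap\<close> handles \<open>a\<close> near 1, and \<open>h\<close>
  contributes at most itself.\<close>

lemma children_converge:
  assumes "0 < \<gamma>" "0 < h0"
  obtains a h where "1 < a" "0 < h" "h < h0" "\<And>v. v \<in> S \<Longrightarrow> dist (chip a h v) (Fp v) < \<gamma>"
    "\<And>v. v \<in> S \<Longrightarrow> dist (chim a h v) (Fm v) < \<gamma>"
proof -
  have "uniformly_continuous_on (cball 0 2) cap"
    by (rule compact_uniformly_continuous[OF continuous_on_subset[OF continuous_on_cap]]) auto
  then obtain \<kappa> where \<kappa>: "0 < \<kappa>" "\<And>x y. x \<in> cball 0 2 \<Longrightarrow> y \<in> cball 0 2 \<Longrightarrow> dist y x < \<kappa> \<Longrightarrow> dist (cap y) (cap x) < \<gamma> / 2"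
    unfolding uniformly_continuous_on_def using assms(1) by (metis half_gt_zero)
  define a where "a = 1 + min 1 (\<kappa> / 2)"
  define h where "h = min (h0 / 2) (\<gamma> / 2)"
  have a: "1 < a" "a \<le> 2" "a - 1 < \<kappa>" using \<kappa>(1) by (auto simp: a_def)
  have h: "0 < h" "h < h0" "h \<le> \<gamma> / 2" using assms by (auto simp: h_def)
  have c: "dist (cap (a *\<^sub>R pr v)) (Fp v) < \<gamma> / 2" and e: "\<bar>v \<bullet> e0\<bar> \<le> 1" if v: "v \<in> S" for v
  proof -
    have bv: "bar v = v" using v by (simp add: S_def bar_def)
    show "\<bar>v \<bullet> e0\<bar> \<le> 1" using abs_e0_le_bar[of v] bv v by (simp add: norm_S)
    have "1 = (v \<bullet> e0)\<^sup>2 + (norm (pr v))\<^sup>2" using norm_bar[of v] bv v by (simp add: norm_S)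
    then have "(norm (pr v))\<^sup>2 \<le> 1\<^sup>2" unfolding one_power2 using zero_le_power2[of "v \<bullet> e0"] by linarith
    then have n: "norm (pr v) \<le> 1" by (rule power2_le_imp_le) simp
    have 3: "a * norm (pr v) \<le> 2 * 1" using a n by (intro mult_mono) auto
    have d: "dist (a *\<^sub>R pr v) (pr v) = (a - 1) * norm (pr v)"
    proof -
      have "a *\<^sub>R pr v - pr v = (a - 1) *\<^sub>R pr v" by (simp add: algebra_simps)
      then show ?thesis using a by (simp add: dist_norm)
    qed
    have "(a - 1) * norm (pr v) \<le> (a - 1) * 1" using a n by (intro mult_left_mono) auto
    then have "dist (a *\<^sub>R pr v) (pr v) \<le> a - 1" unfolding d by simp
    then have 2: "dist (a *\<^sub>R pr v) (pr v) < \<kappa>" using a(3) by simp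
    have 1: "norm (a *\<^sub>R pr v) \<le> 2" using a(1) 3 by simp
    have "dist (cap (a *\<^sub>R pr v)) (cap (pr v)) < \<gamma> / 2"
      by (rule \<kappa>(2)) (use 1 2 n in auto)
    then show "dist (cap (a *\<^sub>R pr v)) (Fp v) < \<gamma> / 2"
      unfolding cap_pr[OF v] .
  qed
  show thesis
  proof (rule that[OF a(1) h(1,2)])
    fix v assume v: "v \<in> S"
    have vt: "v \<bullet> et = 0" using v by (simp add: S_def)
    have nc: "norm (cap (a *\<^sub>R pr v)) = 1" by (rule norm_S) simp
    have "\<bar>h * (v \<bullet> e0)\<bar> \<le> h * 1" unfolding abs_mult using h e[OF v] by (intro mult_mono) auto
    then have hv: "\<bar>h * (v \<bullet> e0)\<bar> \<le> h" by simp
    have "chip a h v = cap (a *\<^sub>R pr v) + (h * (v \<bullet> e0)) *\<^sub>R cap (a *\<^sub>R pr v)"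
      by (simp add: chip_def vt algebra_simps)
    then have "dist (chip a h v) (cap (a *\<^sub>R pr v)) \<le> h" using hv nc by (simp add: dist_norm)
    then show "dist (chip a h v) (Fp v) < \<gamma>"
      using c[OF v] h(3) dist_triangle[of "chip a h v" "Fp v" "cap (a *\<^sub>R pr v)"] by linarith
    have "chim a h v = refl (cap (a *\<^sub>R pr v)) + (h * (v \<bullet> e0)) *\<^sub>R et" by (simp add: chim_def vt)
    then have "dist (chim a h v) (refl (cap (a *\<^sub>R pr v))) \<le> h" using hv by (simp add: dist_norm)
    moreover have "dist (refl x) (refl y) = dist x y" for x y
    proof -
      have "refl x - refl y = refl (x - y)" by (simp add: refl_def inner_diff_left algebra_simps)
      then show ?thesis by (simp add: dist_norm)
    qed
    ultimately show "dist (chim a h v) (Fm v) < \<gamma>"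
      using c[OF v] h(3) dist_triangle[of "chim a h v" "Fm v" "refl (cap (a *\<^sub>R pr v))"]
      unfolding refl_Fp[symmetric] by simp
  qed
qed

definition small :: "real \<Rightarrow> (('a \<Rightarrow> 'a) \<times> real) list \<Rightarrow> bool" where
  "small \<epsilon> L \<longleftrightarrow> (\<forall>(\<Theta>,\<delta>)\<in>set L. \<forall>x\<in>K \<delta>. \<forall>y\<in>K \<delta>. dist (\<Theta> x) (\<Theta> y) \<le> \<epsilon>)"

text \<open>The tolerance \<open>\<eta>\<close> depends on \<open>f\<close> alone, while the bound
  \<open>\<delta>0\<close> on the tube may depend on the embedding. This order lets a node choose
  its parameters after the embedding is known.\<close>

definition realisable :: "real \<Rightarrow> ('a \<Rightarrow> 'a) \<Rightarrow> bool" where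
  "realisable \<epsilon> f \<longleftrightarrow> (\<exists>\<eta>>0. \<forall>\<Theta>. good \<Theta> \<longrightarrow> (\<forall>v\<in>S. dist (\<Theta> v) (f v) < \<eta>) \<longrightarrow>
     (\<exists>\<delta>0>0. \<forall>\<delta>. 0 < \<delta> \<longrightarrow> \<delta> < \<delta>0 \<longrightarrow> (\<exists>L. tree \<Theta> \<delta> L \<and> small \<epsilon> L)))"

lemma good_uniform:
  assumes "good \<Theta>" "0 < \<epsilon>"
  obtains \<gamma> where "0 < \<gamma>" "\<And>x y. x \<in> K (1/4) \<Longrightarrow> y \<in> K (1/4) \<Longrightarrow> dist x y < \<gamma> \<Longrightarrow> dist (\<Theta> x) (\<Theta> y) < \<epsilon>"
proof -
  have "continuous_on (K (1/4)) \<Theta>" using assms(1) K_subset_Od[of "1/4"] unfolding good_def by (auto intro: continuous_on_subset)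
  then have "uniformly_continuous_on (K (1/4)) \<Theta>" by (rule compact_uniformly_continuous) (rule compact_K)
  then obtain \<gamma> where "0 < \<gamma>" "\<forall>x\<in>K (1/4). \<forall>x'\<in>K (1/4). dist x' x < \<gamma> \<longrightarrow> dist (\<Theta> x') (\<Theta> x) < \<epsilon>"
    unfolding uniformly_continuous_on_def using assms(2) by metis
  then show thesis using that[of \<gamma>] by blast
qed

text \<open>Five steps of size \<open>\<epsilon>\<close>: two from the tube to the sphere, two from
  \<open>\<Theta>\<close> to \<open>f\<close>, and the oscillation of \<open>f\<close>.\<close>

lemma realisable_leaf:
  assumes "0 < \<epsilon>" "\<forall>v\<in>S. \<forall>w\<in>S. dist (f v) (f w) \<le> \<epsilon>"
  shows "realisable (5 * \<epsilon>) f"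
  unfolding realisable_def
proof (rule exI[of _ \<epsilon>], intro conjI allI impI)
  fix \<Theta> assume g: "good \<Theta>" and cl: "\<forall>v\<in>S. dist (\<Theta> v) (f v) < \<epsilon>"
  obtain \<gamma> where \<gamma>: "0 < \<gamma>" "\<And>x y. x \<in> K (1/4) \<Longrightarrow> y \<in> K (1/4) \<Longrightarrow> dist x y < \<gamma> \<Longrightarrow> dist (\<Theta> x) (\<Theta> y) < \<epsilon>"
    by (rule good_uniform[OF g assms(1)]) (rule that)
  have "small (5 * \<epsilon>) [(\<Theta>,\<delta>)]" if \<delta>: "0 < \<delta>" "\<delta> < min (1/4) (\<gamma> / 2)" for \<delta>
  proof -
    have near: "\<exists>v\<in>S. dist (\<Theta> x) (\<Theta> v) < \<epsilon>" if x: "x \<in> K \<delta>" for x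
    proof -
      have nb: "\<bar>norm (bar x) - 1\<bar> \<le> \<delta>" "\<bar>x \<bullet> et\<bar> \<le> \<delta>" using x by (auto simp: K_def)
      then have b0: "bar x \<noteq> 0" using \<delta> by auto
      let ?v = "bar x /\<^sub>R norm (bar x)"
      note pd = polar_decomposition[OF b0]
      have eq: "x - ?v = (norm (bar x) - 1) *\<^sub>R ?v + (x \<bullet> et) *\<^sub>R et"
        using pd(2) by (simp add: algebra_simps)
      have "norm (x - ?v) \<le> \<bar>norm (bar x) - 1\<bar> * norm ?v + \<bar>x \<bullet> et\<bar> * norm et"
        unfolding eq by (metis norm_scaleR norm_triangle_ineq)
      then have "dist x ?v < \<gamma>" using nb \<delta> norm_S[OF pd(1)] unfolding dist_norm by simp
      moreover have "x \<in> K (1/4)" using x \<delta> by (auto simp: K_def)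
      moreover have "?v \<in> K (1/4)" using pd(1) S_subset_K[of "1/4"] by auto
      ultimately show ?thesis using \<gamma>(2) pd(1) by blast
    qed
    have "dist (\<Theta> x) (\<Theta> y) \<le> 5 * \<epsilon>" if xy: "x \<in> K \<delta>" "y \<in> K \<delta>" for x y
    proof -
      obtain v w where vw: "v \<in> S" "w \<in> S" "dist (\<Theta> x) (\<Theta> v) < \<epsilon>" "dist (\<Theta> y) (\<Theta> w) < \<epsilon>"
        using near xy by metis
      have "dist (\<Theta> v) (f v) < \<epsilon>" "dist (\<Theta> w) (f w) < \<epsilon>" "dist (f v) (f w) \<le> \<epsilon>" using cl assms(2) vw by auto
      then show ?thesis
        using vw(3,4) dist_triangle[of "\<Theta> x" "\<Theta> y" "\<Theta> v"] dist_triangle[of "\<Theta> v" "\<Theta> y" "f v"]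
          dist_triangle[of "f v" "\<Theta> y" "f w"] dist_triangle[of "f w" "\<Theta> y" "\<Theta> w"]
        by (simp add: dist_commute)
    qed
    then show ?thesis by (simp add: small_def)
  qed
  then show "\<exists>\<delta>0>0. \<forall>\<delta>>0. \<delta> < \<delta>0 \<longrightarrow> (\<exists>L. tree \<Theta> \<delta> L \<and> small (5 * \<epsilon>) L)"
    using \<gamma>(1) by (intro exI[of _ "min (1/4) (\<gamma> / 2)"]) (auto intro!: exI[of _ "[(\<Theta>,_)]"] tree.leaf)
qed (use assms in auto)

text \<open>At a genuine double the radius \<open>\<delta>\<close> of the parent is arbitrary below
  1/2, since \<open>h\<close> can be chosen small against it. First \<open>a\<close> and
  \<open>h\<close> are fixed so that the children follow the foldings; only then the common radius
  of the children is chosen.\<close>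

lemma realise_node:
  assumes r: "rot \<rho>" and p: "realisable \<epsilon> (f \<circ> \<rho> \<circ> Fp)" and m: "realisable \<epsilon> (f \<circ> \<rho> \<circ> Fm)"
  obtains \<eta> where "0 < \<eta>" "\<And>\<Theta> \<delta>. good \<Theta> \<Longrightarrow> \<forall>v\<in>S. dist (\<Theta> v) (f v) < \<eta> \<Longrightarrow> 0 < \<delta> \<Longrightarrow> \<delta> < 1/2
     \<Longrightarrow> \<exists>L. tree \<Theta> \<delta> L \<and> small \<epsilon> L \<and> 2 \<le> length L"
proof -
  obtain \<eta>p where \<eta>p: "0 < \<eta>p" and hp: "\<And>\<Theta>. good \<Theta> \<Longrightarrow> \<forall>v\<in>S. dist (\<Theta> v) ((f \<circ> \<rho> \<circ> Fp) v) < \<eta>p \<Longrightarrow>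
     (\<exists>\<delta>0>0. \<forall>\<delta>. 0 < \<delta> \<longrightarrow> \<delta> < \<delta>0 \<longrightarrow> (\<exists>L. tree \<Theta> \<delta> L \<and> small \<epsilon> L))"
    using p unfolding realisable_def by blast
  obtain \<eta>m where \<eta>m: "0 < \<eta>m" and hm: "\<And>\<Theta>. good \<Theta> \<Longrightarrow> \<forall>v\<in>S. dist (\<Theta> v) ((f \<circ> \<rho> \<circ> Fm) v) < \<eta>m \<Longrightarrow>
     (\<exists>\<delta>0>0. \<forall>\<delta>. 0 < \<delta> \<longrightarrow> \<delta> < \<delta>0 \<longrightarrow> (\<exists>L. tree \<Theta> \<delta> L \<and> small \<epsilon> L))"
    using m unfolding realisable_def by blast
  define \<eta> where "\<eta> = min \<eta>p \<eta>m / 2"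
  have \<eta>: "0 < \<eta>" "\<eta> + \<eta> \<le> \<eta>p" "\<eta> + \<eta> \<le> \<eta>m" using \<eta>p \<eta>m by (auto simp: \<eta>_def)
  have "\<exists>L. tree \<Theta> \<delta> L \<and> small \<epsilon> L \<and> 2 \<le> length L"
    if g: "good \<Theta>" and cl: "\<forall>v\<in>S. dist (\<Theta> v) (f v) < \<eta>" and \<delta>: "0 < \<delta>" "\<delta> < 1/2" for \<Theta> \<delta>
  proof -
    have gh: "good (\<Theta> \<circ> hat \<rho>)"
    proof -
      have sub: "hat \<rho> ` Od \<subseteq> Od" using hat_Od[OF r] by auto
      have "continuous_on Od (\<Theta> \<circ> hat \<rho>)"
        using g sub hat_cont[OF r] unfolding good_def by (intro continuous_on_compose) (auto intro: continuous_on_subset)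
      moreover have "inj_on (\<Theta> \<circ> hat \<rho>) Od"
        using g sub hat_inj[OF r] unfolding good_def by (intro comp_inj_on) (auto intro: inj_on_subset)
      ultimately show ?thesis by (simp add: good_def)
    qed
    obtain \<gamma> where \<gamma>: "0 < \<gamma>" "\<And>x y. x \<in> K (1/4) \<Longrightarrow> y \<in> K (1/4) \<Longrightarrow> dist x y < \<gamma> \<Longrightarrow> dist ((\<Theta> \<circ> hat \<rho>) x) ((\<Theta> \<circ> hat \<rho>) y) < \<eta>"
      by (rule good_uniform[OF gh \<eta>(1)]) (rule that)
    have h0: "0 < min (1/4) (\<delta> / 2)" using \<delta> by simp
    obtain a h where a: "1 < a" and h: "0 < h" "h < min (1/4) (\<delta> / 2)"
      and cp: "\<And>v. v \<in> S \<Longrightarrow> dist (chip a h v) (Fp v) < \<gamma>" and cm: "\<And>v. v \<in> S \<Longrightarrow> dist (chim a h v) (Fm v) < \<gamma>"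
      by (rule children_converge[OF \<gamma>(1) h0]) (rule that)
    have h4: "h < 1/4" "0 < a" using h a by auto
    have K4: "chip a h v \<in> K (1/4)" "chim a h v \<in> K (1/4)" if v: "v \<in> S" for v
    proof -
      have "bar v = v" using v by (simp add: S_def bar_def)
      then have "\<bar>v \<bullet> e0\<bar> \<le> 1" using abs_e0_le_bar[of v] v by (simp add: norm_S)
      then have "\<bar>h * (v \<bullet> e0)\<bar> \<le> h * 1" unfolding abs_mult using h by (intro mult_mono) auto
      then have "\<bar>h * (v \<bullet> e0)\<bar> \<le> 1/4" using h4 by linarith
      moreover have "v \<bullet> et = 0" using v by (simp add: S_def)
      ultimately show "chip a h v \<in> K (1/4)" "chim a h v \<in> K (1/4)"
        unfolding chip_def chim_def by (subst polar_in_K_iff; simp)+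
    qed
    have S4: "v \<in> K (1/4)" if "v \<in> S" for v using S_subset_K[of "1/4"] that by auto
    have hS: "hat \<rho> v = \<rho> v" if "v \<in> S" for v
      using hat_polar[of v 1 \<rho> 0] that by simp
    have close: "dist ((\<Theta> \<circ> hat \<rho> \<circ> X) v) ((f \<circ> \<rho> \<circ> F) v) < \<eta> + \<eta>"
      if v: "v \<in> S" and X: "X v \<in> K (1/4)" "F v \<in> S" "dist (X v) (F v) < \<gamma>" for X F v
    proof -
      have "dist ((\<Theta> \<circ> hat \<rho>) (X v)) ((\<Theta> \<circ> hat \<rho>) (F v)) < \<eta>" using \<gamma>(2)[OF X(1) S4[OF X(2)] X(3)] .
      moreover have "dist (\<Theta> (\<rho> (F v))) (f (\<rho> (F v))) < \<eta>" using cl rot_S[OF r X(2)] by blast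
      ultimately show ?thesis using dist_triangle[of "\<Theta> (hat \<rho> (X v))" "f (\<rho> (F v))" "\<Theta> (\<rho> (F v))"] hS[OF X(2)] by simp
    qed
    note gc = good_child[OF g r h(1) h4]
    have "\<forall>v\<in>S. dist ((\<Theta> \<circ> hat \<rho> \<circ> chip a h) v) ((f \<circ> \<rho> \<circ> Fp) v) < \<eta>p"
      using close[of _ "chip a h" Fp] K4 F_in_S cp \<eta>(2) by fastforce
    then obtain \<delta>p where \<delta>p: "0 < \<delta>p" "\<And>\<delta>. 0 < \<delta> \<Longrightarrow> \<delta> < \<delta>p \<Longrightarrow> \<exists>L. tree (\<Theta> \<circ> hat \<rho> \<circ> chip a h) \<delta> L \<and> small \<epsilon> L"
      using hp[OF gc(1)] by blast
    have "\<forall>v\<in>S. dist ((\<Theta> \<circ> hat \<rho> \<circ> chim a h) v) ((f \<circ> \<rho> \<circ> Fm) v) < \<eta>m"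
      using close[of _ "chim a h" Fm] K4 F_in_S cm \<eta>(3) by fastforce
    then obtain \<delta>m where \<delta>m: "0 < \<delta>m" "\<And>\<delta>. 0 < \<delta> \<Longrightarrow> \<delta> < \<delta>m \<Longrightarrow> \<exists>L. tree (\<Theta> \<circ> hat \<rho> \<circ> chim a h) \<delta> L \<and> small \<epsilon> L"
      using hm[OF gc(2)] by blast
    \<comment> \<open>The clearance condition in \<open>params\<close> compares \<open>s\<close>
      with \<open>h\<close> times the root of roughly \<open>\<kappa>\<close>. Half of that root is
      taken for \<open>s\<close>, and \<open>\<delta>' \<le> \<kappa> / 8\<close> loses at most a
      quarter of \<open>\<kappa>\<close>.\<close>
    define \<kappa> where "\<kappa> = 1 - 1 / a\<^sup>2"
    have "1 < a\<^sup>2" using a by (simp add: one_less_power)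
    then have \<kappa>: "0 < \<kappa>" by (simp add: \<kappa>_def divide_less_eq)
    define s where "s = h * sqrt \<kappa> / 2"
    have s: "0 < s" "s\<^sup>2 = h\<^sup>2 * (\<kappa> / 4)" using h \<kappa> by (auto simp: s_def power_mult_distrib power_divide)
    define m where "m = Min {\<delta>p, \<delta>m, s, \<kappa> / 4, \<delta>}"
    have m: "0 < m" "m \<le> \<delta>p" "m \<le> \<delta>m" "m \<le> s" "m \<le> \<kappa> / 4" "m \<le> \<delta>"
      using \<delta>p(1) \<delta>m(1) s(1) \<kappa> \<delta> by (auto simp: m_def)
    define \<delta>' where "\<delta>' = m / 2"
    have \<delta>': "0 < \<delta>'" "\<delta>' < \<delta>p" "\<delta>' < \<delta>m" "\<delta>' < s" "\<delta>' \<le> \<kappa> / 8" "\<delta>' \<le> \<delta>" "\<delta>' < 1/2" using m \<delta> by (auto simp: \<delta>'_def)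
    have "s\<^sup>2 < h\<^sup>2 * ((1 - \<delta>')\<^sup>2 - 1 / a\<^sup>2)"
    proof -
      have "(1 - \<delta>')\<^sup>2 - 1 / a\<^sup>2 = \<kappa> - 2 * \<delta>' + \<delta>'\<^sup>2" by (simp add: \<kappa>_def power2_eq_square algebra_simps)
      then have "\<kappa> / 4 < (1 - \<delta>')\<^sup>2 - 1 / a\<^sup>2" using \<delta>'(5) \<kappa> zero_le_power2[of \<delta>'] by linarith
      then show ?thesis unfolding s(2) using h by (intro mult_strict_left_mono) auto
    qed
    moreover have "h * (1 + \<delta>') \<le> \<delta>"
    proof -
      have "h * (1 + \<delta>') \<le> (\<delta> / 2) * 2" using h \<delta>' \<delta> by (intro mult_mono) auto
      then show ?thesis by simp
    qed
    ultimately have par: "params a h s \<delta> \<delta>'" using a h h4 \<delta>' by (simp add: params_def)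
    obtain L1 where L1: "tree (\<Theta> \<circ> hat \<rho> \<circ> chip a h) \<delta>' L1" "small \<epsilon> L1" using \<delta>p(2) \<delta>' by blast
    obtain L2 where L2: "tree (\<Theta> \<circ> hat \<rho> \<circ> chim a h) \<delta>' L2" "small \<epsilon> L2" using \<delta>m(2) \<delta>' by blast
    have ne: "L \<noteq> []" if "tree \<Theta> \<delta> L" for \<Theta> \<delta> L using that by (induction rule: tree.induct) auto
    have "tree \<Theta> \<delta> (L1 @ L2)" by (rule tree.node[OF r par L1(1) L2(1)])
    moreover have "small \<epsilon> (L1 @ L2)" using L1(2) L2(2) unfolding small_def by (simp add: ball_Un)
    moreover have "2 \<le> length (L1 @ L2)" using ne[OF L1(1)] ne[OF L2(1)] by (cases L1; cases L2) auto
    ultimately show ?thesis by blast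
  qed
  then show thesis by (rule that[OF \<eta>(1)])
qed

lemma realisable_folds:
  assumes "folds (\<lambda>g. \<forall>v\<in>S. \<forall>w\<in>S. dist (g v) (g w) \<le> \<epsilon>) f" "0 < \<epsilon>"
  shows "realisable (5 * \<epsilon>) f"
  using assms
proof (induction rule: folds.induct)
  case (leaf f)
  then show ?case by (intro realisable_leaf)
next
  case (node \<rho> f)
  obtain \<eta> where \<eta>: "0 < \<eta>" "\<And>\<Theta> \<delta>. good \<Theta> \<Longrightarrow> \<forall>v\<in>S. dist (\<Theta> v) (f v) < \<eta> \<Longrightarrow> 0 < \<delta> \<Longrightarrow> \<delta> < 1/2
     \<Longrightarrow> \<exists>L. tree \<Theta> \<delta> L \<and> small (5 * \<epsilon>) L \<and> 2 \<le> length L"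
    by (rule realise_node[OF node.hyps(1) node.IH(1)[OF node.prems] node.IH(2)[OF node.prems]]) (rule that)
  show ?case unfolding realisable_def
  proof (rule exI[of _ \<eta>], intro conjI allI impI)
    fix \<Theta> assume "good \<Theta>" "\<forall>v\<in>S. dist (\<Theta> v) (f v) < \<eta>"
    then show "\<exists>\<delta>0>0. \<forall>\<delta>>0. \<delta> < \<delta>0 \<longrightarrow> (\<exists>L. tree \<Theta> \<delta> L \<and> small (5 * \<epsilon>) L)"
      using \<eta>(2) by (intro exI[of _ "1/2"]) fastforce
  qed (fact \<eta>(1))
qed

end

text \<open>The root is doubled once with the identity before the folds are realised, which frees
  the radius \<open>\<delta>\<close> and guarantees at least two leaves.\<close>

theorem (in basis_frame) small_tree:
  assumes "good \<Theta>" "0 < \<delta>" "\<delta> < 1/2" "0 < \<epsilon>"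
  obtains L where "tree \<Theta> \<delta> L" "small \<epsilon> L" "2 \<le> length L"
proof -
  have cont: "continuous_on S \<Theta>" using assms(1) S_subset_Od by (auto simp: good_def intro: continuous_on_subset)
  have r: "rot id" by (auto simp: rot_def)
  have "realisable (5 * (\<epsilon> / 5)) (\<Theta> \<circ> id \<circ> Fp)" "realisable (5 * (\<epsilon> / 5)) (\<Theta> \<circ> id \<circ> Fm)"
    by (rule realisable_folds[OF folds_shrink]; use assms(4) continuous_child[OF cont r] in simp)+
  then obtain \<eta> where \<eta>: "0 < \<eta>" "\<And>\<Theta>' \<delta>. good \<Theta>' \<Longrightarrow> \<forall>v\<in>S. dist (\<Theta>' v) (\<Theta> v) < \<eta> \<Longrightarrow> 0 < \<delta> \<Longrightarrow> \<delta> < 1/2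
     \<Longrightarrow> \<exists>L. tree \<Theta>' \<delta> L \<and> small (5 * (\<epsilon> / 5)) L \<and> 2 \<le> length L"
    by (rule realise_node[OF r]) (rule that)
  have "\<exists>L. tree \<Theta> \<delta> L \<and> small \<epsilon> L \<and> 2 \<le> length L" using \<eta>(2)[OF assms(1) _ assms(2,3)] \<eta>(1) by simp
  then show thesis using that by blast
qed

section \<open>Cantor sets\<close>

definition binary_scheme :: "'a::metric_space set \<Rightarrow> (bool list \<Rightarrow> 'a set) \<Rightarrow> bool" where
  "binary_scheme X T \<longleftrightarrow> T [] = X \<and>
     (\<forall>w. compact (T w) \<and> T w \<noteq> {} \<and> T (w @ [True]) \<union> T (w @ [False]) = T w \<and> T (w @ [True]) \<inter> T (w @ [False]) = {}) \<and>
     (\<forall>\<epsilon>>0. \<exists>N. \<forall>w. length w = N \<longrightarrow> (\<forall>x\<in>T w. \<forall>y\<in>T w. dist x y < \<epsilon>))"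

primrec addr :: "(bool list \<Rightarrow> 'a set) \<Rightarrow> 'a \<Rightarrow> nat \<Rightarrow> bool list" where
  "addr T x 0 = []"
| "addr T x (Suc n) = addr T x n @ [x \<in> T (addr T x n @ [True])]"

lemma length_addr [simp]: "length (addr T x n) = n"
  by (induction n) auto

lemma addr_in: "binary_scheme X T \<Longrightarrow> x \<in> X \<Longrightarrow> x \<in> T (addr T x n)"
proof (induction n)
  case (Suc n)
  then have x: "x \<in> T (addr T x n)" by simp
  have "T (addr T x n @ [True]) \<union> T (addr T x n @ [False]) = T (addr T x n)"
    using Suc.prems(1) unfolding binary_scheme_def by blast
  then show ?case using x by (cases "x \<in> T (addr T x n @ [True])") auto
qed (simp add: binary_scheme_def)

lemma addr_unique:
  assumes "binary_scheme X T" "x \<in> T w"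
  shows "w = addr T x (length w)"
  using assms(2)
proof (induction w rule: rev_induct)
  case (snoc b w)
  have s: "T (w @ [True]) \<union> T (w @ [False]) = T w" "T (w @ [True]) \<inter> T (w @ [False]) = {}"
    using assms(1) unfolding binary_scheme_def by blast+
  then have w: "w = addr T x (length w)" using snoc by (cases b) auto
  have "b \<longleftrightarrow> x \<in> T (w @ [True])" using snoc.prems s(2) by (cases b) auto
  then show ?case using w by simp
qed simp

lemma scheme_continuous:
  assumes T: "binary_scheme X T" and T': "binary_scheme Y T'" and f: "\<And>x n. x \<in> X \<Longrightarrow> f x \<in> T' (addr T x n)"
  shows "continuous_on X f"
  unfolding continuous_on_iff
proof (intro ballI allI impI)
  fix x and \<epsilon> :: real assume x: "x \<in> X" and \<epsilon>: "0 < \<epsilon>"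
  obtain N where N: "\<And>w y z. length w = N \<Longrightarrow> y \<in> T' w \<Longrightarrow> z \<in> T' w \<Longrightarrow> dist y z < \<epsilon>"
  proof -
    have "\<exists>N. \<forall>w. length w = N \<longrightarrow> (\<forall>x\<in>T' w. \<forall>y\<in>T' w. dist x y < \<epsilon>)"
      using T' \<epsilon> unfolding binary_scheme_def by blast
    then show thesis using that by blast
  qed
  define Z where "Z = \<Union> (T ` {w. length w = N \<and> w \<noteq> addr T x N})"
  have "finite {w::bool list. length w = N}" using finite_lists_length_eq[of "UNIV::bool set" N] by simp
  then have "closed Z" unfolding Z_def using T
    by (intro closed_Union) (auto simp: binary_scheme_def intro: compact_imp_closed)
  moreover have "x \<notin> Z" using addr_unique[OF T] by (auto simp: Z_def)
  ultimately have "open (- Z)" "x \<in> - Z" by auto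
  then obtain r where "0 < r" "ball x r \<subseteq> - Z" unfolding open_contains_ball by blast
  then have r: "0 < r" "ball x r \<inter> Z = {}" by auto
  show "\<exists>d>0. \<forall>x'\<in>X. dist x' x < d \<longrightarrow> dist (f x') (f x) < \<epsilon>"
  proof (intro exI[of _ r] conjI ballI impI)
    fix x' assume x': "x' \<in> X" "dist x' x < r"
    then have "x' \<in> ball x r" by (simp add: dist_commute)
    then have "x' \<notin> Z" using r(2) by blast
    then have "addr T x' N = addr T x N"
      using addr_in[OF T x'(1), of N] length_addr[of T x' N] unfolding Z_def by blast
    then show "dist (f x') (f x) < \<epsilon>" using N[of "addr T x N"] f[OF x, of N] f[OF x'(1), of N] by simp
  qed (rule r)
qed

text \<open>The pieces of the other scheme along the address of \<open>x\<close> are nested nonempty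
  compact sets.\<close>

lemma scheme_match:
  fixes Y :: "'a::heine_borel set"
  assumes T': "binary_scheme Y T'"
  obtains y where "\<And>n. y \<in> T' (addr T x n)"
proof -
  have "\<Inter> (range (\<lambda>n. T' (addr T x n))) \<noteq> {}"
  proof (rule compact_nest)
    show "compact (T' (addr T x n))" "T' (addr T x n) \<noteq> {}" for n
      using T' by (auto simp: binary_scheme_def)
    have "T' (w @ [b]) \<subseteq> T' w" for w b
    proof -
      have "T' (w @ [True]) \<union> T' (w @ [False]) = T' w" using T' unfolding binary_scheme_def by blast
      then show ?thesis by (cases b) auto
    qed
    then have "T' (addr T x (Suc n)) \<subseteq> T' (addr T x n)" for n by simp
    then show "T' (addr T x n) \<subseteq> T' (addr T x m)" if "m \<le> n" for m n
      by (rule lift_Suc_antimono_le[of "\<lambda>n. T' (addr T x n)", OF _ that])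
  qed
  then show thesis using that by auto
qed

lemma scheme_point_unique:
  assumes S: "binary_scheme X T" and xy: "\<And>n. x \<in> T (v n)" "\<And>n. y \<in> T (v n)" "\<And>n. length (v n) = n"
  shows "x = y"
proof (rule ccontr)
  assume "x \<noteq> y"
  then have "0 < dist x y" by simp
  then obtain N where "\<forall>w. length w = N \<longrightarrow> (\<forall>x'\<in>T w. \<forall>y'\<in>T w. dist x' y' < dist x y)"
    using S unfolding binary_scheme_def by blast
  then have "dist x y < dist x y" using xy(1)[of N] xy(2)[of N] xy(3)[of N] by blast
  then show False by simp
qed

theorem scheme_homeomorphic:
  fixes X :: "'a::heine_borel set" and Y :: "'b::heine_borel set"
  assumes T: "binary_scheme X T" and T': "binary_scheme Y T'"
  shows "X homeomorphic Y"
proof -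
  define f where "f x = (SOME y. \<forall>n. y \<in> T' (addr T x n))" for x
  define g where "g y = (SOME x. \<forall>n. x \<in> T (addr T' y n))" for y
  have f: "f x \<in> T' (addr T x n)" for x n
  proof -
    obtain y where "\<And>n. y \<in> T' (addr T x n)" by (rule scheme_match[OF T']) (rule that)
    then have "\<exists>y. \<forall>n. y \<in> T' (addr T x n)" by blast
    from someI_ex[OF this] show ?thesis unfolding f_def by blast
  qed
  have g: "g y \<in> T (addr T' y n)" for y n
  proof -
    obtain x where "\<And>n. x \<in> T (addr T' y n)" by (rule scheme_match[OF T]) (rule that)
    then have "\<exists>x. \<forall>n. x \<in> T (addr T' y n)" by blast
    from someI_ex[OF this] show ?thesis unfolding g_def by blast
  qed
  have fa: "addr T' (f x) n = addr T x n" for x n using addr_unique[OF T' f[of x n]] by simp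
  have ga: "addr T (g y) n = addr T' y n" for y n using addr_unique[OF T g[of y n]] by simp
  have gf: "g (f x) = x" if "x \<in> X" for x
    by (rule scheme_point_unique[where v = "addr T x", OF T]) (use g[of "f x"] fa addr_in[OF T that] in auto)
  have fg: "f (g y) = y" if "y \<in> Y" for y
    by (rule scheme_point_unique[where v = "addr T' y", OF T']) (use f[of "g y"] ga addr_in[OF T' that] in auto)
  have "f x \<in> Y" for x using f[of x 0] T' by (simp add: binary_scheme_def)
  moreover have "g y \<in> X" for y using g[of y 0] T by (simp add: binary_scheme_def)
  moreover have "continuous_on X f" by (rule scheme_continuous[OF T T' f])
  moreover have "continuous_on Y g" by (rule scheme_continuous[OF T' T g])
  ultimately have "homeomorphism X Y f g" using gf fg by (intro homeomorphismI) auto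
  then show ?thesis unfolding homeomorphic_def by blast
qed

section \<open>The middle-thirds set and its characterisation\<close>

definition cantor_map :: "bool \<Rightarrow> real \<Rightarrow> real" where
  "cantor_map b x = (if b then 2/3 + x / 3 else x / 3)"

lemma cantor_stage_bounds: "cantor_stage n \<subseteq> {0..1}"
proof (induction n)
  case (Suc n)
  then show ?case by (auto simp: subset_iff)
qed simp

lemma cantor_set_split: "cantor_map True ` cantor_set \<union> cantor_map False ` cantor_set = cantor_set"
proof -
  have "x \<in> cantor_set \<longleftrightarrow> x \<in> cantor_map True ` cantor_set \<union> cantor_map False ` cantor_set" for x
  proof
    assume x: "x \<in> cantor_set"
    then have st: "x \<in> (\<lambda>x. x / 3) ` cantor_stage n \<union> (\<lambda>x. 2/3 + x / 3) ` cantor_stage n" for n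
      unfolding cantor_set_def using cantor_stage.simps(2)[of n] by blast
    show "x \<in> cantor_map True ` cantor_set \<union> cantor_map False ` cantor_set"
    proof (cases "x \<le> 1/2")
      case True
      have "3 * x \<in> cantor_stage n" for n
        using st[of n] True cantor_stage_bounds[of n] by (auto simp: subset_iff)
      then have "3 * x \<in> cantor_set" by (simp add: cantor_set_def)
      moreover have "x = cantor_map False (3 * x)" by (simp add: cantor_map_def)
      ultimately show ?thesis by blast
    next
      case False
      have "3 * x - 2 \<in> cantor_stage n" for n
        using st[of n] False cantor_stage_bounds[of n] by (auto simp: subset_iff)
      then have "3 * x - 2 \<in> cantor_set" by (simp add: cantor_set_def)
      moreover have "x = cantor_map True (3 * x - 2)" by (simp add: cantor_map_def field_simps)
      ultimately show ?thesis by blast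
    qed
  next
    assume "x \<in> cantor_map True ` cantor_set \<union> cantor_map False ` cantor_set"
    then obtain y b where y: "x = cantor_map b y" "y \<in> cantor_set" by blast
    then have "y \<in> cantor_stage n" for n by (simp add: cantor_set_def)
    then have s: "x \<in> cantor_stage (Suc n)" for n using y(1) by (cases b) (auto simp: cantor_map_def)
    then have "x \<in> cantor_stage n" for n
      using s[of 0] cantor_stage_bounds[of 1] by (cases n) auto
    then show "x \<in> cantor_set" by (simp add: cantor_set_def)
  qed
  then show ?thesis by blast
qed

lemma cantor_set_compact: "compact cantor_set" and cantor_set_nonempty: "cantor_set \<noteq> {}"
proof -
  have "compact (cantor_stage n)" for n
    by (induction n) (auto intro!: compact_Un compact_continuous_image continuous_intros)
  then show "compact cantor_set" unfolding cantor_set_def by (intro compact_Inter) auto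
  have "0 \<in> cantor_stage n" for n by (induction n) (auto simp: image_iff)
  then show "cantor_set \<noteq> {}" unfolding cantor_set_def by blast
qed

lemma cantor_scheme: "binary_scheme cantor_set (\<lambda>w. foldr cantor_map w ` cantor_set)"
  unfolding binary_scheme_def
proof (intro conjI allI impI)
  have aff: "\<exists>c. \<forall>x. foldr cantor_map w x = c + x / 3 ^ length w" for w
  proof (induction w)
    case (Cons b w)
    then obtain c where "\<And>x. foldr cantor_map w x = c + x / 3 ^ length w" by blast
    then have "foldr cantor_map (b # w) x = cantor_map b c + x / 3 ^ length (b # w)" for x
      by (simp add: cantor_map_def add_divide_distrib)
    then show ?case by blast
  qed simp
  have inj: "inj (foldr cantor_map w)" for w
  proof -
    obtain c where "\<And>x. foldr cantor_map w x = c + x / 3 ^ length w" using aff by blast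
    then show ?thesis by (auto simp: inj_def)
  qed
  show "foldr cantor_map [] ` cantor_set = cantor_set" by simp
  fix w
  show "compact (foldr cantor_map w ` cantor_set)"
  proof -
    obtain c where "\<And>x. foldr cantor_map w x = c + x / 3 ^ length w" using aff by blast
    then show ?thesis using cantor_set_compact by (intro compact_continuous_image) (auto intro!: continuous_intros)
  qed
  show "foldr cantor_map w ` cantor_set \<noteq> {}" using cantor_set_nonempty by simp
  have snoc: "foldr cantor_map (w @ [b]) ` cantor_set = foldr cantor_map w ` (cantor_map b ` cantor_set)" for b
    by (auto simp: image_image)
  show "foldr cantor_map (w @ [True]) ` cantor_set \<union> foldr cantor_map (w @ [False]) ` cantor_set = foldr cantor_map w ` cantor_set"
    unfolding snoc image_Un[symmetric] cantor_set_split ..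
  have "cantor_set \<subseteq> {0..1}" using cantor_stage_bounds[of 0] unfolding cantor_set_def by blast
  then have "cantor_map True x \<noteq> cantor_map False y" if "x \<in> cantor_set" "y \<in> cantor_set" for x y
  proof -
    have "x \<in> {0..1}" "y \<in> {0..1}" using \<open>cantor_set \<subseteq> {0..1}\<close> that by blast+
    then show ?thesis by (simp add: cantor_map_def)
  qed
  then have "cantor_map True ` cantor_set \<inter> cantor_map False ` cantor_set = {}" by blast
  then show "foldr cantor_map (w @ [True]) ` cantor_set \<inter> foldr cantor_map (w @ [False]) ` cantor_set = {}"
    unfolding snoc image_Int[OF inj, symmetric] by simp
next
  fix \<epsilon> :: real assume \<epsilon>: "0 < \<epsilon>"
  have aff: "\<exists>c. \<forall>x. foldr cantor_map w x = c + x / 3 ^ length w" for w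
  proof (induction w)
    case (Cons b w)
    then obtain c where "\<And>x. foldr cantor_map w x = c + x / 3 ^ length w" by blast
    then have "foldr cantor_map (b # w) x = cantor_map b c + x / 3 ^ length (b # w)" for x
      by (simp add: cantor_map_def add_divide_distrib)
    then show ?case by blast
  qed simp
  obtain N where N: "(1/3::real) ^ N < \<epsilon>" using real_arch_pow_inv[OF \<epsilon>, of "1/3"] by auto
  have b: "cantor_set \<subseteq> {0..1}" using cantor_stage_bounds[of 0] unfolding cantor_set_def by blast
  have "dist x y < \<epsilon>" if w: "length w = N" and xy: "x \<in> foldr cantor_map w ` cantor_set" "y \<in> foldr cantor_map w ` cantor_set" for w x y
  proof -
    obtain c where c: "\<And>x. foldr cantor_map w x = c + x / 3 ^ N" using aff[of w] w by auto
    obtain u v where uv: "u \<in> cantor_set" "v \<in> cantor_set" "x = c + u / 3 ^ N" "y = c + v / 3 ^ N" using xy c by auto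
    have "u \<in> {0..1}" "v \<in> {0..1}" using uv(1,2) b by blast+
    then have "\<bar>u - v\<bar> \<le> 1" by (simp add: abs_le_iff)
    then have "\<bar>u - v\<bar> / 3 ^ N \<le> 1 / 3 ^ N" by (intro divide_right_mono) auto
    moreover have "dist x y = \<bar>u - v\<bar> / 3 ^ N" by (simp add: uv dist_real_def flip: diff_divide_distrib)
    ultimately show ?thesis using N by (simp add: power_divide)
  qed
  then show "\<exists>N. \<forall>w. length w = N \<longrightarrow> (\<forall>x\<in>foldr cantor_map w ` cantor_set. \<forall>y\<in>foldr cantor_map w ` cantor_set. dist x y < \<epsilon>)"
    by blast
qed

text \<open>Brouwer's characterisation. Clopen sets from finite covers of mesh tending to 0 are used
  one after another as cuts, so that all pieces of a late level are small.\<close>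

theorem homeomorphic_cantor_set:
  fixes C :: "'a::heine_borel set"
  assumes C: "compact C" "C \<noteq> {}" and perfect: "\<And>x r. x \<in> C \<Longrightarrow> 0 < r \<Longrightarrow> \<exists>y\<in>C. y \<noteq> x \<and> dist x y < r"
    and zero_dim: "\<And>x r. x \<in> C \<Longrightarrow> 0 < r \<Longrightarrow> \<exists>K. openin (top_of_set C) K \<and> closed K \<and> x \<in> K \<and> K \<subseteq> ball x r"
  shows "C homeomorphic cantor_set"
proof -
  define clo where "clo K \<longleftrightarrow> openin (top_of_set C) K \<and> closed K" for K
  have "\<forall>k. \<exists>\<K>. finite \<K> \<and> (\<forall>K\<in>\<K>. clo K \<and> (\<forall>x\<in>K. \<forall>y\<in>K. dist x y < 1 / (real k + 1))) \<and> C \<subseteq> \<Union>\<K>"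
  proof
    fix k
    define r where "r = 1 / (2 * (real k + 1))"
    have r: "0 < r" by (simp add: r_def)
    have "\<forall>x\<in>C. \<exists>K. clo K \<and> x \<in> K \<and> K \<subseteq> ball x r" 
    proof
      fix x assume "x \<in> C"
      from zero_dim[OF this r] show "\<exists>K. clo K \<and> x \<in> K \<and> K \<subseteq> ball x r" unfolding clo_def by blast
    qed
    from bchoice[OF this] obtain K where K: "\<forall>x\<in>C. clo (K x) \<and> x \<in> K x \<and> K x \<subseteq> ball x r" by blast
    have "(\<forall>c\<in>K ` C. openin (top_of_set C) c) \<and> C \<subseteq> \<Union> (K ` C)" using K unfolding clo_def by blast
    from C(1)[unfolded compact_eq_openin_cover, rule_format, OF this]
    obtain \<F> where \<F>: "\<F> \<subseteq> K ` C" "finite \<F>" "C \<subseteq> \<Union>\<F>" by blast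
    have sm: "dist y z < 1 / (real k + 1)" if "x \<in> C" "y \<in> K x" "z \<in> K x" for x y z
    proof -
      have "y \<in> ball x r" "z \<in> ball x r" using K that by blast+
      then have "dist x y < r" "dist x z < r" by auto
      moreover have "r + r = 1 / (real k + 1)" by (simp add: r_def field_simps)
      ultimately show ?thesis using dist_triangle3[of y z x] by linarith
    qed
    have "clo K' \<and> (\<forall>x\<in>K'. \<forall>y\<in>K'. dist x y < 1 / (real k + 1))" if K': "K' \<in> \<F>" for K'
    proof -
      obtain x where x: "x \<in> C" "K' = K x" using K' \<F>(1) by blast
      then show ?thesis using K sm[OF x(1)] by simp
    qed
    then show "\<exists>\<K>. finite \<K> \<and> (\<forall>K\<in>\<K>. clo K \<and> (\<forall>x\<in>K. \<forall>y\<in>K. dist x y < 1 / (real k + 1))) \<and> C \<subseteq> \<Union>\<K>"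
      using \<F>(2,3) by (intro exI[of _ \<F>]) simp
  qed
  from choice[OF this] obtain \<K> where \<K>0: "\<forall>k. finite (\<K> k) \<and>
     (\<forall>K\<in>\<K> k. clo K \<and> (\<forall>x\<in>K. \<forall>y\<in>K. dist x y < 1 / (real k + 1))) \<and> C \<subseteq> \<Union> (\<K> k)" by blast
  have \<K>: "finite (\<K> k)" "K \<in> \<K> k \<Longrightarrow> clo K"
    "K \<in> \<K> k \<Longrightarrow> x \<in> K \<Longrightarrow> y \<in> K \<Longrightarrow> dist x y < 1 / (real k + 1)" "C \<subseteq> \<Union> (\<K> k)" for k K x y
    using \<K>0 by blast+
  define E where "E = from_nat_into (\<Union>k. \<K> k)"
  have cnt: "countable (\<Union>k. \<K> k)" using \<K>(1) by (auto intro: countable_finite)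
  have ne: "(\<Union>k. \<K> k) \<noteq> {}" using \<K>(4)[of 0] C(2) by blast
  have Eclo: "clo (E n)" for n
    using from_nat_into[OF ne, of n] \<K>(2) unfolding E_def by blast
  have Esmall: "\<exists>N. \<forall>Y. Y \<noteq> {} \<longrightarrow> Y \<subseteq> C \<longrightarrow> (\<forall>n<N. Y \<subseteq> E n \<or> Y \<inter> E n = {}) \<longrightarrow> (\<forall>x\<in>Y. \<forall>y\<in>Y. dist x y < \<epsilon>)"
    if \<epsilon>: "0 < \<epsilon>" for \<epsilon>
  proof -
    obtain k where k: "1 / (real k + 1) < \<epsilon>" using reals_Archimedean[OF \<epsilon>] by (auto simp: inverse_eq_divide add.commute)
    define N where "N = Suc (Max (to_nat_on (\<Union>k. \<K> k) ` \<K> k))"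
    have "dist x y < \<epsilon>" if Y: "Y \<subseteq> C" "\<forall>n<N. Y \<subseteq> E n \<or> Y \<inter> E n = {}" "x \<in> Y" "y \<in> Y" for Y x y
    proof -
      obtain K where K: "K \<in> \<K> k" "x \<in> K" using \<K>(4)[of k] Y by blast
      let ?n = "to_nat_on (\<Union>k. \<K> k) K"
      have "?n \<le> Max (to_nat_on (\<Union>k. \<K> k) ` \<K> k)" using K(1) \<K>(1) by (intro Max_ge) auto
      then have "?n < N" by (simp add: N_def)
      moreover have "E ?n = K" unfolding E_def using cnt K(1) by (intro from_nat_into_to_nat_on) auto
      ultimately have "Y \<subseteq> K" using Y(2,3) K(2) by blast
      then show ?thesis using \<K>(3)[OF K(1), of x y] Y(3,4) k by force
    qed
    then show ?thesis by (intro exI[of _ N]) simp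
  qed
  \<comment> \<open>If \<open>E n\<close> cuts \<open>Y\<close> properly it is used; otherwise
    another cut serves, so that both halves are nonempty in any case. Either way no piece of the
    next level is cut by \<open>E n\<close> any more.\<close>
  define sp where "sp n Y = (if Y \<inter> E n \<noteq> {} \<and> Y - E n \<noteq> {} then E n else E (SOME m. Y \<inter> E m \<noteq> {} \<and> Y - E m \<noteq> {}))" for n Y
  have spclo: "clo (sp n Y)" for n Y unfolding sp_def using Eclo by simp
  have split: "Y \<inter> sp n Y \<noteq> {} \<and> Y - sp n Y \<noteq> {}" if Y: "openin (top_of_set C) Y" "Y \<noteq> {}" for n Y
  proof -
    obtain x where x: "x \<in> Y" using Y(2) by blast
    have YC: "Y \<subseteq> C" using Y(1) openin_imp_subset by blast
    obtain r where r: "0 < r" "ball x r \<inter> C \<subseteq> Y"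
      using Y(1) x unfolding openin_contains_ball by blast
    obtain y where y: "y \<in> C" "y \<noteq> x" "dist x y < r" using perfect[of x r] x YC r(1) by blast
    then have yY: "y \<in> Y" using r(2) by auto
    have "\<exists>m. Y \<inter> E m \<noteq> {} \<and> Y - E m \<noteq> {}"
    proof (rule ccontr)
      assume "\<not> ?thesis"
      then have all: "Y \<subseteq> E n \<or> Y \<inter> E n = {}" for n by blast
      have "0 < dist x y" using y(2) by simp
      from Esmall[OF this] obtain N where "\<And>Y. Y \<noteq> {} \<Longrightarrow> Y \<subseteq> C \<Longrightarrow> (\<forall>n<N. Y \<subseteq> E n \<or> Y \<inter> E n = {}) \<Longrightarrow> (\<forall>u\<in>Y. \<forall>v\<in>Y. dist u v < dist x y)"
        by blast
      from this[OF Y(2) YC] all x yY show False by blast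
    qed
    from someI_ex[OF this] show ?thesis unfolding sp_def by auto
  qed
  define T' where "T' = rec_list C (\<lambda>b w Y. if b then Y \<inter> sp (length w) Y else Y - sp (length w) Y)"
  have T'0: "T' [] = C" and T'1: "T' (b # w) = (if b then T' w \<inter> sp (length w) (T' w) else T' w - sp (length w) (T' w))" for b w
    by (simp_all add: T'_def)
  have inv: "openin (top_of_set C) (T' w) \<and> closed (T' w) \<and> T' w \<noteq> {}" for w
  proof (induction w)
    case Nil
    then show ?case using C by (auto simp: T'0 compact_imp_closed)
  next
    case (Cons b w)
    let ?Z = "sp (length w) (T' w)"
    have Z: "openin (top_of_set C) ?Z" "closed ?Z" using spclo by (auto simp: clo_def)
    have "closedin (top_of_set C) ?Z" "closedin (top_of_set C) (T' w)"
      using Z Cons.IH openin_imp_subset by (auto intro!: closed_subset)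
    then have "openin (top_of_set C) (T' w - ?Z)" using Cons.IH by (intro openin_diff) auto
    moreover have "closed (T' w - ?Z)"
    proof -
      have "T' w - ?Z = T' w \<inter> (C - ?Z)" using Cons.IH openin_imp_subset by blast
      moreover have "closedin (top_of_set C) (C - ?Z)" using Z(1) by (intro closedin_diff) auto
      then have "closed (C - ?Z)" using closedin_closed_trans compact_imp_closed C(1) by blast
      ultimately show ?thesis using Cons.IH by (simp add: closed_Int)
    qed
    ultimately show ?case using Cons.IH Z split[of "T' w" "length w"] by (auto simp: T'1 openin_Int closed_Int)
  qed
  \<comment> \<open>The recursion adds letters at the front of a word, whereas a binary scheme
    extends words at the end.\<close>
  define T where "T w = T' (rev w)" for w
  have sub: "T (w @ u) \<subseteq> T w" for w u
    by (induction u rule: rev_induct) (auto simp: T_def T'1 split: if_splits)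
  have "binary_scheme C T"
    unfolding binary_scheme_def
  proof (intro conjI allI impI)
    show "T [] = C" by (simp add: T_def T'0)
    fix w
    have "T w \<subseteq> C" using inv[of "rev w"] openin_imp_subset unfolding T_def by blast
    then have "T w = C \<inter> T w" by blast
    moreover have "compact (C \<inter> T w)" using C(1) inv[of "rev w"] unfolding T_def by (intro compact_Int_closed) auto
    ultimately show "compact (T w)" by simp
    show "T w \<noteq> {}" using inv[of "rev w"] by (simp add: T_def)
    show "T (w @ [True]) \<union> T (w @ [False]) = T w" "T (w @ [True]) \<inter> T (w @ [False]) = {}"
      by (auto simp: T_def T'1)
  next
    fix \<epsilon> :: real assume "0 < \<epsilon>"
    from Esmall[OF this] obtain N where N: "\<And>Y. Y \<noteq> {} \<Longrightarrow> Y \<subseteq> C \<Longrightarrow> (\<forall>n<N. Y \<subseteq> E n \<or> Y \<inter> E n = {}) \<Longrightarrow> (\<forall>x\<in>Y. \<forall>y\<in>Y. dist x y < \<epsilon>)"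
      by blast
    have "\<forall>x\<in>T w. \<forall>y\<in>T w. dist x y < \<epsilon>" if w: "length w = N" for w
    proof (rule N)
      show "T w \<noteq> {}" "T w \<subseteq> C" using inv[of "rev w"] openin_imp_subset unfolding T_def by blast+
      show "\<forall>n<N. T w \<subseteq> E n \<or> T w \<inter> E n = {}"
      proof (intro allI impI)
        fix n assume n: "n < N"
        define u where "u = take n w"
        have wu: "w = (u @ [w ! n]) @ drop (Suc n) w" using n w by (simp add: u_def id_take_nth_drop)
        have "T w \<subseteq> T (u @ [w ! n])" by (subst wu) (rule sub)
        moreover have "length u = n" using n w by (simp add: u_def)
        then have "T (u @ [w ! n]) \<subseteq> E n \<or> T (u @ [w ! n]) \<inter> E n = {}"
          unfolding T_def by (auto simp: T'1 sp_def)
        ultimately show "T w \<subseteq> E n \<or> T w \<inter> E n = {}" by blast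
      qed
    qed
    then show "\<exists>N. \<forall>w. length w = N \<longrightarrow> (\<forall>x\<in>T w. \<forall>y\<in>T w. dist x y < \<epsilon>)" by blast
  qed
  then show ?thesis using cantor_scheme by (rule scheme_homeomorphic)
qed

section \<open>Unions of totally disconnected compact sets\<close>

definition totally_disconnected :: "'a::topological_space set \<Rightarrow> bool" where
  "totally_disconnected X \<longleftrightarrow> (\<forall>T. T \<subseteq> X \<longrightarrow> connected T \<longrightarrow> (\<forall>x\<in>T. \<forall>y\<in>T. x = y))"

lemma totally_disconnected_clopen:
  fixes X :: "'a::euclidean_space set"
  assumes "compact X" "totally_disconnected X" "x \<in> X" "0 < r"
  obtains K where "openin (top_of_set X) K" "closed K" "x \<in> K" "K \<subseteq> ball x r"
proof -
  have "connected_component_set X x = {x}"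
  proof -
    have "y = x" if "y \<in> connected_component_set X x" for y
      using assms(2) that connected_component_subset[of X x] connected_connected_component[of X x]
        connected_component_refl[OF assms(3)] unfolding totally_disconnected_def by blast
    then show ?thesis using connected_component_refl[OF assms(3)] by blast
  qed
  then have "{x} \<in> components X" unfolding components_def using assms(3) by blast
  moreover have "locally compact X" using assms(1) by (simp add: closed_imp_locally_compact compact_imp_closed)
  moreover have "openin (top_of_set X) (X \<inter> ball x r)" by (simp add: openin_open_Int)
  ultimately obtain K where "openin (top_of_set X) K" "compact K" "{x} \<subseteq> K" "K \<subseteq> ball x r"
    using Sura_Bura_clopen_subset[of X "{x}" "ball x r"] assms(4) by auto
  then show thesis using that[of K] compact_imp_closed by blast
qed

text \<open>A point of a connected set off \<open>X\<close> has a neighbourhood in which the set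
  lies in \<open>Y\<close> and has small clopen pieces; such a piece inside the neighbourhood is
  clopen in the whole set, which is thus contained in \<open>Y\<close>.\<close>

lemma totally_disconnected_Un:
  fixes X Y :: "'a::euclidean_space set"
  assumes X: "compact X" "totally_disconnected X" and Y: "compact Y" "totally_disconnected Y"
  shows "totally_disconnected (X \<union> Y)"
  unfolding totally_disconnected_def
proof (intro allI impI)
  fix T0 assume T0: "T0 \<subseteq> X \<union> Y" "connected T0"
  define T where "T = closure T0"
  have cXY: "compact (X \<union> Y)" using X(1) Y(1) by (rule compact_Un)
  have T: "T \<subseteq> X \<union> Y" "connected T" "closed T"
    unfolding T_def using closure_minimal[OF T0(1)] cXY compact_imp_closed T0(2) connected_imp_connected_closure by auto
  have "compact ((X \<union> Y) \<inter> T)" using cXY T(3) by (rule compact_Int_closed)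
  then have cT: "compact T" using T(1) by (simp add: Int_absorb1)
  have "T \<subseteq> X \<or> T \<subseteq> Y"
  proof (rule ccontr)
    assume no: "\<not> ?thesis"
    then obtain x where x: "x \<in> T" "x \<notin> X" by blast
    have "open (- X)" using X(1) compact_imp_closed by auto
    then obtain r where r: "0 < r" "cball x r \<subseteq> - X" using x(2) open_contains_cball by blast
    let ?N = "T \<inter> cball x r"
    have "?N \<subseteq> Y" using T(1) r(2) by blast
    then have tN: "totally_disconnected ?N" using Y(2) unfolding totally_disconnected_def by blast
    have cN: "compact ?N" using cT by (simp add: compact_Int_closed)
    have xN: "x \<in> ?N" using x r by simp
    obtain K where K: "openin (top_of_set ?N) K" "closed K" "x \<in> K" "K \<subseteq> ball x r"
      by (rule totally_disconnected_clopen[OF cN tN xN r(1)]) (rule that)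
    obtain V where V: "open V" "K = ?N \<inter> V" using K(1) by (auto simp: openin_open)
    have "K = T \<inter> (ball x r \<inter> V)" using V(2) K(4) by auto
    moreover have "open (ball x r \<inter> V)" using V(1) by auto
    ultimately have "openin (top_of_set T) K" unfolding openin_open by blast
    moreover have "closedin (top_of_set T) K" using K(2) V(2) by (intro closed_subset) auto
    ultimately have "K = T" using T(2) K(3) unfolding connected_clopen by blast
    then show False using V(2) \<open>?N \<subseteq> Y\<close> no by blast
  qed
  then have "x = y" if "x \<in> T" "y \<in> T" for x y
    using X(2)[unfolded totally_disconnected_def, rule_format, OF _ T(2) that]
      Y(2)[unfolded totally_disconnected_def, rule_format, OF _ T(2) that] by blast
  moreover have "T0 \<subseteq> T" unfolding T_def by (rule closure_subset)
  ultimately show "\<forall>x\<in>T0. \<forall>y\<in>T0. x = y" by blast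
qed

text \<open>The two sets may meet. In the application they do, as \<open>limit_sets_linked\<close>
  shows for the identity.\<close>

theorem is_cantor_set_Un:
  fixes X Y :: "'a::euclidean_space set"
  assumes X: "compact X" "X \<noteq> {}" "totally_disconnected X" "\<And>x r. x \<in> X \<Longrightarrow> 0 < r \<Longrightarrow> \<exists>y\<in>X. y \<noteq> x \<and> dist x y < r"
    and Y: "compact Y" "totally_disconnected Y" "\<And>x r. x \<in> Y \<Longrightarrow> 0 < r \<Longrightarrow> \<exists>y\<in>Y. y \<noteq> x \<and> dist x y < r"
  shows "is_cantor_set (X \<union> Y)"
  unfolding is_cantor_set_def
proof (rule homeomorphic_cantor_set)
  show c: "compact (X \<union> Y)" "X \<union> Y \<noteq> {}" using X Y by auto
  show "\<exists>y\<in>X \<union> Y. y \<noteq> x \<and> dist x y < r" if "x \<in> X \<union> Y" "0 < r" for x r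
    using that X(4) Y(3) by blast
  show "\<exists>K. openin (top_of_set (X \<union> Y)) K \<and> closed K \<and> x \<in> K \<and> K \<subseteq> ball x r" if "x \<in> X \<union> Y" "0 < r" for x r
    by (rule totally_disconnected_clopen[OF c(1) totally_disconnected_Un[OF X(1,3) Y(1,2)] that]) blast
qed

section \<open>Limit sets of iterated refinements\<close>

context sphere_frame
begin

lemma tree_refine:
  assumes "tree \<Theta> \<delta> L" "\<And>l. l \<in> set L \<Longrightarrow> tree (fst l) (snd l) (R l)"
  shows "tree \<Theta> \<delta> (concat (map R L))"
  using assms
proof (induction rule: tree.induct)
  case (leaf \<Theta> \<delta>)
  then show ?case by simp
next
  case (node \<rho> a h s \<delta> \<delta>' \<Theta> L1 L2)
  have 1: "tree (\<Theta> \<circ> hat \<rho> \<circ> chip a h) \<delta>' (concat (map R L1))" by (rule node.IH(1)) (use node.prems in simp)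
  have 2: "tree (\<Theta> \<circ> hat \<rho> \<circ> chim a h) \<delta>' (concat (map R L2))" by (rule node.IH(2)) (use node.prems in simp)
  show ?case unfolding map_append concat_append by (rule tree.node[OF node.hyps(1,2) 1 2])
qed

end

context basis_frame
begin

text \<open>Leaves of refinement \<open>n\<close> have diameter at most \<open>(1/2) ^ n\<close>, so
  this bound holds from stage \<open>Suc n\<close> on. At least two leaves are demanded for the sake
  of perfectness.\<close>

definition refinement :: "nat \<Rightarrow> ('a \<Rightarrow> 'a) \<times> real \<Rightarrow> (('a \<Rightarrow> 'a) \<times> real) list" where
  "refinement n l = (SOME L. tree (fst l) (snd l) L \<and> small ((1/2) ^ n) L \<and> 2 \<le> length L)"

primrec stage :: "('a \<Rightarrow> 'a) \<Rightarrow> nat \<Rightarrow> (('a \<Rightarrow> 'a) \<times> real) list" where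
  "stage \<Theta> 0 = [(\<Theta>, 1/8)]"
| "stage \<Theta> (Suc n) = concat (map (refinement n) (stage \<Theta> n))"

definition piece :: "('a \<Rightarrow> 'a) \<times> real \<Rightarrow> 'a set" where "piece l = fst l ` K (snd l)"

definition level :: "('a \<Rightarrow> 'a) \<Rightarrow> nat \<Rightarrow> 'a set" where "level \<Theta> n = \<Union> (piece ` set (stage \<Theta> n))"

definition limit_set :: "('a \<Rightarrow> 'a) \<Rightarrow> 'a set" where "limit_set \<Theta> = (\<Inter>n. level \<Theta> n)"

lemma refinement:
  assumes "good (fst l)" "0 < snd l" "snd l < 1/2"
  shows "tree (fst l) (snd l) (refinement n l)" "small ((1/2) ^ n) (refinement n l)" "2 \<le> length (refinement n l)"
proof -
  have "\<exists>L. tree (fst l) (snd l) L \<and> small ((1/2) ^ n) L \<and> 2 \<le> length L"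
    by (rule small_tree[OF assms, of "(1/2) ^ n"]) auto
  from someI_ex[OF this]
  show "tree (fst l) (snd l) (refinement n l)" "small ((1/2) ^ n) (refinement n l)" "2 \<le> length (refinement n l)"
    unfolding refinement_def by blast+
qed

context
  fixes \<Theta> :: "'a \<Rightarrow> 'a"
  assumes good: "good \<Theta>"
begin

lemma stage_tree: "tree \<Theta> (1/8) (stage \<Theta> n)"
  and stage_leaf: "l \<in> set (stage \<Theta> n) \<Longrightarrow> good (fst l) \<and> 0 < snd l \<and> snd l < 1/2"
proof -
  have *: "tree \<Theta> (1/8) (stage \<Theta> n) \<and> (\<forall>l\<in>set (stage \<Theta> n). good (fst l) \<and> 0 < snd l \<and> snd l < 1/2)" for n
  proof (induction n)
    case 0
    then show ?case using good by (simp add: tree.leaf)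
  next
    case (Suc n)
    have t: "tree \<Theta> (1/8) (stage \<Theta> (Suc n))"
      unfolding stage.simps by (rule tree_refine) (use Suc refinement in auto)
    have "good (fst l) \<and> 0 < snd l \<and> snd l < 1/2" if "l \<in> set (stage \<Theta> (Suc n))" for l
      using tree_leaf_facts[OF t good, of "fst l" "snd l"] that by simp
    then show ?case using t by blast
  qed
  show "tree \<Theta> (1/8) (stage \<Theta> n)" "l \<in> set (stage \<Theta> n) \<Longrightarrow> good (fst l) \<and> 0 < snd l \<and> snd l < 1/2"
    using * by blast+
qed

lemma refinement_leaf:
  assumes "l \<in> set (stage \<Theta> n)" "l' \<in> set (refinement n l)"
  shows "piece l' \<subseteq> piece l" "l' \<in> set (stage \<Theta> (Suc n))"
proof -
  note g = stage_leaf[OF assms(1)]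
  have r: "tree (fst l) (snd l) (refinement n l)" using refinement g by blast
  show "piece l' \<subseteq> piece l"
    using tree_leaf_facts[OF r, of "fst l'" "snd l'"] g assms(2) by (simp add: piece_def)
  show "l' \<in> set (stage \<Theta> (Suc n))" using assms by auto
qed

lemma compact_piece: "l \<in> set (stage \<Theta> n) \<Longrightarrow> compact (piece l)"
proof -
  assume "l \<in> set (stage \<Theta> n)"
  note g = stage_leaf[OF this]
  then show ?thesis
    unfolding piece_def using K_subset_Od[of "snd l"]
    by (intro compact_continuous_image compact_K) (auto simp: good_def intro: continuous_on_subset)
qed

lemma piece_nonempty: "l \<in> set (stage \<Theta> n) \<Longrightarrow> piece l \<noteq> {}"
proof -
  assume "l \<in> set (stage \<Theta> n)"
  note g = stage_leaf[OF this]
  then have "e0 \<in> K (snd l)" using S_subset_K[of "snd l"] e0_in_S(1) by (meson less_imp_le subsetD)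
  then show ?thesis unfolding piece_def by blast
qed

lemma compact_level: "compact (level \<Theta> n)"
  unfolding level_def by (intro compact_Union) (auto intro: compact_piece)

lemma level_Suc: "level \<Theta> (Suc n) \<subseteq> level \<Theta> n"
proof
  fix x assume "x \<in> level \<Theta> (Suc n)"
  then obtain l' where l': "l' \<in> set (stage \<Theta> (Suc n))" "x \<in> piece l'" unfolding level_def by blast
  then obtain l where "l \<in> set (stage \<Theta> n)" "l' \<in> set (refinement n l)" by auto
  then show "x \<in> level \<Theta> n" using refinement_leaf(1) l'(2) unfolding level_def by blast
qed

lemma level_antimono: "m \<le> n \<Longrightarrow> level \<Theta> n \<subseteq> level \<Theta> m"
  by (rule lift_Suc_antimono_le[of "level \<Theta>"]) (rule level_Suc)

lemma compact_limit: "compact (limit_set \<Theta>)"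
  unfolding limit_set_def by (intro compact_Inter) (auto intro: compact_level)

lemma piece_meets_limit:
  assumes l: "l \<in> set (stage \<Theta> n)"
  shows "piece l \<inter> limit_set \<Theta> \<noteq> {}"
proof -
  have ex: "\<exists>l'\<in>set (stage \<Theta> (n + m)). piece l' \<subseteq> piece l" for m
  proof (induction m)
    case (Suc m)
    then obtain l' where l': "l' \<in> set (stage \<Theta> (n + m))" "piece l' \<subseteq> piece l" by blast
    have "2 \<le> length (refinement (n + m) l')" using stage_leaf[OF l'(1)] refinement(3) by blast
    then have "refinement (n + m) l' \<noteq> []" by auto
    then have hd: "hd (refinement (n + m) l') \<in> set (refinement (n + m) l')" by (rule hd_in_set)
    have "n + Suc m = Suc (n + m)" by simp
    then show ?case using refinement_leaf[OF l'(1) hd] l'(2) by (metis order_trans)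
  qed (use l in auto)
  define F where "F m = piece l \<inter> level \<Theta> (n + m)" for m
  have "\<Inter> (range F) \<noteq> {}"
  proof (rule compact_nest)
    show "compact (F m)" for m unfolding F_def using compact_piece[OF l] compact_level by (rule compact_Int)
    show "F m \<noteq> {}" for m
    proof -
      obtain l' where l': "l' \<in> set (stage \<Theta> (n + m))" "piece l' \<subseteq> piece l" using ex by blast
      then show ?thesis using piece_nonempty[OF l'(1)] unfolding F_def level_def by blast
    qed
    show "F b \<subseteq> F a" if "a \<le> b" for a b unfolding F_def using level_antimono[of "n + a" "n + b"] that by auto
  qed
  then obtain x where x: "\<And>m. x \<in> F m" by blast
  have "x \<in> level \<Theta> m" for m using x[of m] level_antimono[of m "n + m"] by (auto simp: F_def)
  then have "x \<in> limit_set \<Theta>" by (simp add: limit_set_def)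
  then show ?thesis using x[of 0] by (auto simp: F_def)
qed

lemma limit_nonempty: "limit_set \<Theta> \<noteq> {}"
  using piece_meets_limit[of "(\<Theta>, 1/8)" 0] by auto

lemma pieces_disjoint:
  assumes "i < j" "j < length (stage \<Theta> n)"
  shows "piece (stage \<Theta> n ! i) \<inter> piece (stage \<Theta> n ! j) = {}"
  unfolding piece_def by (rule tree_leaves_disjoint[OF stage_tree good _ _ assms]) auto

lemma pieces_disjoint':
  assumes "l \<in> set (stage \<Theta> n)" "l' \<in> set (stage \<Theta> n)" "x \<in> piece l" "x \<in> piece l'"
  shows "l = l'"
proof -
  obtain i j where ij: "i < length (stage \<Theta> n)" "l = stage \<Theta> n ! i" "j < length (stage \<Theta> n)" "l' = stage \<Theta> n ! j"
    using assms(1,2) by (auto simp: in_set_conv_nth)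
  then show ?thesis using pieces_disjoint[of i j n] pieces_disjoint[of j i n] assms(3,4)
    by (cases i j rule: linorder_cases) auto
qed

lemma piece_small:
  assumes "l \<in> set (stage \<Theta> (Suc n))" "x \<in> piece l" "y \<in> piece l"
  shows "dist x y \<le> (1/2) ^ n"
proof -
  obtain k where k: "k \<in> set (stage \<Theta> n)" "l \<in> set (refinement n k)" using assms(1) by auto
  have "small ((1/2) ^ n) (refinement n k)" using stage_leaf[OF k(1)] refinement(2) by blast
  then show ?thesis using k(2) assms(2,3) unfolding small_def piece_def by fastforce
qed

lemma limit_totally_disconnected: "totally_disconnected (limit_set \<Theta>)"
  unfolding totally_disconnected_def
proof (intro allI impI ballI)
  fix T x y assume T: "T \<subseteq> limit_set \<Theta>" "connected T" and xy: "x \<in> T" "y \<in> T"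
  have "dist x y \<le> (1/2) ^ n" for n
  proof -
    have TL: "T \<subseteq> level \<Theta> (Suc n)" using T(1) unfolding limit_set_def by blast
    then obtain l where l: "l \<in> set (stage \<Theta> (Suc n))" "x \<in> piece l" using xy(1) unfolding level_def by blast
    define Z where "Z = \<Union> (piece ` (set (stage \<Theta> (Suc n)) - {l}))"
    have cp: "closed (piece l')" if "l' \<in> set (stage \<Theta> (Suc n))" for l'
      using compact_piece[OF that] compact_imp_closed by blast
    have "closed (piece l)" using cp[OF l(1)] .
    moreover have "closed Z" unfolding Z_def by (rule closed_Union) (use cp in blast)+
    moreover have "T \<subseteq> piece l \<union> Z" using TL unfolding Z_def level_def by blast
    moreover have "piece l \<inter> Z \<inter> T = {}" using pieces_disjoint'[OF l(1)] unfolding Z_def by blast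
    ultimately have "piece l \<inter> T = {} \<or> Z \<inter> T = {}" using T(2) by (intro connected_closedD)
    then have "T \<subseteq> piece l" using l(2) xy(1) \<open>T \<subseteq> piece l \<union> Z\<close> by blast
    then show ?thesis using piece_small[OF l(1)] xy by blast
  qed
  moreover have "(\<lambda>n. (1/2::real) ^ n) \<longlonglongrightarrow> 0" by (intro LIMSEQ_power_zero) auto
  ultimately have "dist x y \<le> 0" by (intro LIMSEQ_le_const[of "\<lambda>n. (1/2) ^ n"]) auto
  then show "x = y" by simp
qed

text \<open>A small piece around \<open>x\<close> contains two disjoint pieces of the next stage,
  each with a limit point; at least one of these differs from \<open>x\<close>.\<close>

lemma limit_perfect:
  assumes "x \<in> limit_set \<Theta>" "0 < r"
  shows "\<exists>y\<in>limit_set \<Theta>. y \<noteq> x \<and> dist x y < r"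
proof -
  obtain n where n: "(1/2::real) ^ n < r" using real_arch_pow_inv[OF assms(2), of "1/2"] by auto
  have "x \<in> level \<Theta> (Suc n)" using assms(1) unfolding limit_set_def by blast
  then obtain l where l: "l \<in> set (stage \<Theta> (Suc n))" "x \<in> piece l" unfolding level_def by blast
  let ?R = "refinement (Suc n) l"
  note g = stage_leaf[OF l(1)]
  have t: "tree (fst l) (snd l) ?R" "2 \<le> length ?R" using refinement g by blast+
  have d: "piece (?R ! 0) \<inter> piece (?R ! 1) = {}"
    unfolding piece_def using tree_leaves_disjoint[OF t(1), of 0 1] g t(2) by simp
  have l1: "1 < length ?R" using t(2) by linarith
  then have l0: "0 < length ?R" by linarith
  from l0 l1 have m: "?R ! 0 \<in> set ?R" "?R ! 1 \<in> set ?R" using nth_mem by blast+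
  obtain y z where y: "y \<in> limit_set \<Theta>" "y \<in> piece (?R ! 0)" and z: "z \<in> limit_set \<Theta>" "z \<in> piece (?R ! 1)"
    using piece_meets_limit[OF refinement_leaf(2)[OF l(1) m(1)]] piece_meets_limit[OF refinement_leaf(2)[OF l(1) m(2)]] by blast
  have "y \<noteq> z" using d y z by blast
  then have "y \<noteq> x \<or> z \<noteq> x" by blast
  moreover have "y \<in> piece l" "z \<in> piece l" using refinement_leaf(1)[OF l(1)] m y z by blast+
  then have "dist x y < r" "dist x z < r" using piece_small[OF l] n by fastforce+
  ultimately show ?thesis using y(1) z(1) by blast
qed

end

end

section \<open>Linked limit sets\<close>

text \<open>One loop is transported along the sides of the other. When both polygons close up, the
  equation says that the two holonomies of a torus commute.\<close>

lemma (in flat_block) torus_slide: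
  fixes \<Phi> :: "'b::real_normed_vector \<times> 'c::real_normed_vector \<Rightarrow> 'a"
  assumes \<Phi>: "continuous_on (Z1 \<times> Z2) \<Phi>" "\<Phi> ` (Z1 \<times> Z2) \<subseteq> W"
    and Ps: "Ps \<noteq> []" "hd Ps \<in> Z1" "successively (\<lambda>P Q. closed_segment P Q \<subseteq> Z1) Ps" "last Ps = hd Ps"
    and Qs: "Qs \<noteq> []" "successively (\<lambda>P Q. closed_segment P Q \<subseteq> Z2) Qs"
  shows "phol (\<lambda>p. \<Phi> (p, hd Qs)) Ps * phol (\<lambda>q. \<Phi> (hd Ps, q)) Qs
     = phol (\<lambda>q. \<Phi> (hd Ps, q)) Qs * phol (\<lambda>p. \<Phi> (p, last Qs)) Ps"
  using Qs
proof (induction Qs rule: induct_list012)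
  case (3 Q Q' Qs)
  have seg: "closed_segment Q Q' \<subseteq> Z2" using 3 by simp
  let ?H = "\<lambda>tp::real \<times> 'b. \<Phi> (snd tp, (1 - fst tp) *\<^sub>R Q + fst tp *\<^sub>R Q')"
  have in2: "(1 - t) *\<^sub>R Q + t *\<^sub>R Q' \<in> Z2" if "t \<in> {0..1}" for t
    using seg that by (auto simp: closed_segment_def)
  have c: "continuous_on ({0..1} \<times> Z1) ?H"
    by (rule continuous_on_compose2[OF \<Phi>(1)]) (use in2 in \<open>auto intro!: continuous_intros\<close>)
  have im: "?H ` ({0..1} \<times> Z1) \<subseteq> W" using \<Phi>(2) in2 by fastforce
  have e: "hol (\<lambda>t. ?H (t, p)) 0 1 = hol (\<lambda>q. \<Phi> (p, q)) Q Q'" for p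
    by (rule hol_cong) simp
  have sl: "phol (\<lambda>p. \<Phi> (p, Q)) Ps * hol (\<lambda>q. \<Phi> (hd Ps, q)) Q Q'
     = hol (\<lambda>q. \<Phi> (hd Ps, q)) Q Q' * phol (\<lambda>p. \<Phi> (p, Q')) Ps"
    using phol_slide[OF c im Ps(1-3)] unfolding Ps(4) e by simp
  have IH: "phol (\<lambda>p. \<Phi> (p, Q')) Ps * phol (\<lambda>q. \<Phi> (hd Ps, q)) (Q' # Qs)
     = phol (\<lambda>q. \<Phi> (hd Ps, q)) (Q' # Qs) * phol (\<lambda>p. \<Phi> (p, last (Q' # Qs))) Ps"
    using 3 by simp
  have "phol (\<lambda>p. \<Phi> (p, Q)) Ps * phol (\<lambda>q. \<Phi> (hd Ps, q)) (Q # Q' # Qs)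
     = phol (\<lambda>p. \<Phi> (p, Q)) Ps * hol (\<lambda>q. \<Phi> (hd Ps, q)) Q Q' * phol (\<lambda>q. \<Phi> (hd Ps, q)) (Q' # Qs)"
    by (simp add: mult.assoc)
  also have "\<dots> = hol (\<lambda>q. \<Phi> (hd Ps, q)) Q Q' * (phol (\<lambda>p. \<Phi> (p, Q')) Ps * phol (\<lambda>q. \<Phi> (hd Ps, q)) (Q' # Qs))"
    unfolding sl by (simp only: mult.assoc)
  also have "\<dots> = phol (\<lambda>q. \<Phi> (hd Ps, q)) (Q # Q' # Qs) * phol (\<lambda>p. \<Phi> (p, last (Q' # Qs))) Ps"
    unfolding IH by (simp add: mult.assoc)
  finally show ?case by simp
qed auto

lemma square_boundary_bounds: "p \<in> square_boundary \<Longrightarrow> \<bar>fst p\<bar> \<le> 1 \<and> \<bar>snd p\<bar> \<le> 1 \<and> (\<bar>fst p\<bar> = 1 \<or> \<bar>snd p\<bar> = 1)"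
  by (auto simp: square_boundary_def max_def split: if_splits)

locale basis_frame4 = sphere_frame4 e0 et b1 b2 + basis_frame e0 et for e0 et b1 b2 :: "'a::euclidean_space"
begin

lemma b_simps [simp]: "b1 \<bullet> b1 = 1" "b2 \<bullet> b2 = 1" "e0 \<bullet> b1 = 0" "et \<bullet> b1 = 0" "e0 \<bullet> b2 = 0" "et \<bullet> b2 = 0" "b2 \<bullet> b1 = 0"
  using norm_eq_1[of b1] norm_eq_1[of b2] inner_commute[of e0 b1] inner_commute[of et b1] inner_commute[of e0 b2]
    inner_commute[of et b2] inner_commute[of b2 b1] by simp_all

text \<open>The product of two orthogonal reflections, exchanging \<open>e0\<close> with
  \<open>b1\<close> and \<open>et\<close> with \<open>b2\<close>; the difference vectors have
  squared length 2, which cancels the usual factor.\<close>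

definition swap :: "'a \<Rightarrow> 'a" where
  "swap x = x - (x \<bullet> (e0 - b1)) *\<^sub>R (e0 - b1) - (x \<bullet> (et - b2)) *\<^sub>R (et - b2)"

text \<open>The translation makes \<open>e0\<close> a fixed point. There the normal plane of
  \<open>S\<close>, spanned by \<open>e0\<close> and \<open>et\<close>, goes to the span of
  \<open>b1\<close> and \<open>b2\<close>, so the two root spheres cross transversally.\<close>

definition dual :: "'a \<Rightarrow> 'a" where "dual x = swap x + (e0 - b1)"

text \<open>A product of two squares about the crossing point, one in the normal plane of each root;
  \<open>dual\<close> exchanges the factors.\<close>

definition torus :: "(real \<times> real) \<times> (real \<times> real) \<Rightarrow> 'a" where
  "torus = (\<lambda>((x,y),(u,v)). (1 + x / 4) *\<^sub>R e0 + (y / 4) *\<^sub>R et + (u / 4) *\<^sub>R b1 + (v / 4) *\<^sub>R b2)"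

lemma norm_swap: "norm (swap x) = norm x"
proof -
  define u w where "u = e0 - b1" and "w = et - b2"
  have uw: "u \<bullet> u = 2" "w \<bullet> w = 2" "u \<bullet> w = 0" "w \<bullet> u = 0" by (simp_all add: u_def w_def inner_diff_left inner_diff_right)
  have sw: "swap x = x - (x \<bullet> u) *\<^sub>R u - (x \<bullet> w) *\<^sub>R w" by (simp add: swap_def u_def w_def)
  have "swap x \<bullet> swap x = x \<bullet> x"
    unfolding sw by (simp add: inner_diff_left inner_diff_right uw inner_commute[of u x] inner_commute[of w x] algebra_simps)
  then show ?thesis by (simp add: norm_eq_sqrt_inner)
qed

lemma dist_dual: "dist (dual x) (dual y) = dist x y"
proof -
  have "dual x - dual y = swap (x - y)"
    by (simp add: dual_def swap_def inner_diff_left algebra_simps)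
  then show ?thesis by (simp add: dist_norm norm_swap)
qed

lemma good_dual: "good dual"
proof -
  have "continuous_on Od dual" unfolding dual_def swap_def by (intro continuous_intros)
  moreover have "inj_on dual Od" by (rule inj_onI) (metis dist_dual dist_eq_0_iff)
  ultimately show ?thesis by (simp add: good_def)
qed

lemma good_id: "good id"
  by (simp add: good_def)

lemma dual_torus: "dual (torus (q,p)) = torus (p,q)"
proof -
  obtain x y u v where e: "p = (x,y)" "q = (u,v)" by fastforce
  show ?thesis
    unfolding e torus_def dual_def swap_def
    by (simp add: inner_add_left inner_diff_right algebra_simps)
qed

lemma torus_continuous: "continuous_on A torus"
  unfolding torus_def case_prod_unfold by (intro continuous_intros) auto

lemma norm_bar_le: "norm (bar z) \<le> norm z"
proof -
  have "bar z + (z \<bullet> et) *\<^sub>R et = z" by (simp add: bar_def)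
  moreover have "bar z \<bullet> et = 0" by (simp add: bar_def inner_diff_left)
  ultimately have "(norm z)\<^sup>2 = (norm (bar z))\<^sup>2 + (z \<bullet> et)\<^sup>2"
    using norm_add_Pythagorean[of "bar z" "(z \<bullet> et) *\<^sub>R et"] by (simp add: orthogonal_def)
  then have "(norm (bar z))\<^sup>2 \<le> (norm z)\<^sup>2" by simp
  then show ?thesis by (rule power2_le_imp_le) simp
qed

text \<open>The narrowest place is the side \<open>a = -1\<close>: there the squared radius is at
  most 11/16, so the radius is at most 27/32, while the tube begins at 28/32.\<close>

lemma torus_far:
  assumes p: "p \<in> square_boundary" and q: "\<bar>fst q\<bar> \<le> 1" "\<bar>snd q\<bar> \<le> 1" and y: "y \<in> K (1/8)"
  shows "1/32 \<le> dist (torus (p,q)) y"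
proof (rule ccontr)
  assume "\<not> ?thesis"
  then have d: "norm (torus (p,q) - y) < 1/32" by (simp add: dist_norm)
  obtain a b u v where e: "p = (a,b)" "q = (u,v)" by fastforce
  have ab: "\<bar>a\<bar> \<le> 1" "\<bar>b\<bar> \<le> 1" "\<bar>a\<bar> = 1 \<or> \<bar>b\<bar> = 1" using square_boundary_bounds[OF p] by (auto simp: e)
  have uv: "u\<^sup>2 \<le> 1" "v\<^sup>2 \<le> 1" using q by (auto simp: e abs_square_le_1)
  let ?x = "torus (p,q)"
  have t: "?x \<bullet> et = b / 4" by (simp add: e torus_def inner_add_left)
  have bx: "bar ?x = (1 + a / 4) *\<^sub>R e0 + (u / 4) *\<^sub>R b1 + (v / 4) *\<^sub>R b2"
    unfolding bar_def t by (simp add: e torus_def)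
  have n: "(norm (bar ?x))\<^sup>2 = (1 + a / 4)\<^sup>2 + u\<^sup>2 / 16 + v\<^sup>2 / 16"
    unfolding bx power2_norm_eq_inner by (simp add: inner_add_left inner_add_right power2_eq_square)
  have yk: "\<bar>norm (bar y) - 1\<bar> \<le> 1/8" "\<bar>y \<bullet> et\<bar> \<le> 1/8" using y by (auto simp: K_def)
  have "\<bar>(?x - y) \<bullet> et\<bar> \<le> norm (?x - y) * norm et" by (rule Cauchy_Schwarz_ineq2)
  then have td: "\<bar>b / 4 - y \<bullet> et\<bar> < 1/32" using d by (simp add: inner_diff_left t)
  have "bar (?x - y) = bar ?x - bar y" by (simp add: bar_def inner_diff_left algebra_simps)
  then have "norm (bar ?x - bar y) < 1/32" using norm_bar_le[of "?x - y"] d by simp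
  then have nd: "\<bar>norm (bar ?x) - norm (bar y)\<bar> < 1/32" using norm_triangle_ineq3[of "bar ?x" "bar y"] by linarith
  consider "\<bar>b\<bar> = 1" | "a = 1" | "a = -1" using ab(3) by linarith
  then show False
  proof cases
    case 1
    then show False using td yk(2) by (auto simp: abs_if split: if_splits)
  next
    case 2
    then have "(5/4)\<^sup>2 \<le> (norm (bar ?x))\<^sup>2" unfolding n by (simp add: power2_eq_square)
    then have "5/4 \<le> norm (bar ?x)" by (rule power2_le_imp_le) simp
    then show False using nd yk(1) by linarith
  next
    case 3
    then have "(norm (bar ?x))\<^sup>2 \<le> (27/32)\<^sup>2" unfolding n using uv by (simp add: power2_eq_square)
    then have "norm (bar ?x) \<le> 27/32" by (rule power2_le_imp_le) simp
    then show False using nd yk(1) by linarith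
  qed
qed

lemma meridian_torus: "fib \<Theta> e0 \<circ> rect (-1/4) (1/4) (1/4) = (\<lambda>p. \<Theta> (torus (p,(0,0))))"
  by (auto simp: fib_def rect_def torus_def)

text \<open>The bound 1/64 is half of the distance in \<open>torus_far\<close>: one half is used up
  by displacing the tube of the second tree, the other by displacing the loop in a straight
  homotopy.\<close>

theorem limit_sets_linked:
  assumes h: "continuous_on UNIV h" "inj h" "\<And>x. norm (h x - x) < 1/64"
  shows "h ` limit_set dual \<inter> limit_set id \<noteq> {}"
proof
  assume empty: "h ` limit_set dual \<inter> limit_set id = {}"
  have ch: "continuous_on X h" for X using h(1) continuous_on_subset by blast
  have "\<exists>n. h ` level dual n \<inter> level id n = {}"
  proof (rule ccontr)
    \<comment> \<open>If no stage separated the sets, nested compactness would produce a common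
      point of all stages, and injectivity of \<open>h\<close> puts it into both limit sets.\<close>
    assume "\<nexists>n. h ` level dual n \<inter> level id n = {}"
    then have ne: "h ` level dual n \<inter> level id n \<noteq> {}" for n by simp
    have "\<Inter> (range (\<lambda>n. h ` level dual n \<inter> level id n)) \<noteq> {}"
    proof (rule compact_nest)
      show "compact (h ` level dual n \<inter> level id n)" for n
        by (intro compact_Int compact_continuous_image ch compact_level good_dual good_id)
      show "h ` level dual b \<inter> level id b \<subseteq> h ` level dual a \<inter> level id a" if "a \<le> b" for a b
        using level_antimono[OF good_dual that] level_antimono[OF good_id that] by blast
    qed (rule ne)
    then obtain x where x0: "x \<in> \<Inter> (range (\<lambda>n. h ` level dual n \<inter> level id n))" by (meson ex_in_conv)
    have x: "x \<in> h ` level dual n" "x \<in> level id n" for n using x0 by simp_all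
    obtain y where y: "x = h y" using x(1)[of 0] by blast
    have "y \<in> level dual n" for n using x(1)[of n] unfolding y by (simp add: inj_image_mem_iff[OF h(2)])
    then have "x \<in> h ` limit_set dual" using y by (auto simp: limit_set_def)
    moreover have "x \<in> limit_set id" using x(2) by (simp add: limit_set_def)
    ultimately show False using empty by blast
  qed
  then obtain n where n: "h ` level dual n \<inter> level id n = {}" by (rule exE)
  \<comment> \<open>The leaves of the first tree get the indices below \<open>a\<close>, those of
    the displaced second tree the indices from \<open>a\<close> to \<open>N\<close>.\<close>
  define LA where "LA = stage id n"
  define LB where "LB = map (\<lambda>(\<Theta>,\<delta>). (h \<circ> \<Theta>, \<delta>)) (stage dual n)"
  define LL where "LL = LA @ LB"
  define a N where "a = length LA" and "N = length LL"
  have N: "N = a + length LB" by (simp add: a_def N_def LL_def)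
  have tA: "tree id (1/8) LA" unfolding LA_def by (rule stage_tree[OF good_id])
  have tB: "tree (h \<circ> dual) (1/8) LB" unfolding LB_def by (rule tree_compose[OF stage_tree[OF good_dual]])
  have aN: "0 < a" "a < N" using tree_nonempty[OF tA] tree_nonempty[OF tB] by (auto simp: a_def N)
  have gB: "good (h \<circ> dual)"
  proof -
    have "continuous_on Od (h \<circ> dual)" using good_dual ch unfolding good_def by (intro continuous_on_compose) auto
    moreover have "inj_on (h \<circ> dual) Od"
      using good_dual h(2) unfolding good_def by (intro comp_inj_on) (auto intro: inj_on_subset)
    ultimately show ?thesis by (simp add: good_def)
  qed
  have eighth: "0 < (1/8::real)" "(1/8::real) < 1/2" by auto
  have nthA: "LL ! l = LA ! l" if "l < a" for l using that by (simp add: LL_def a_def nth_append)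
  have nthB: "LL ! (a + l) = LB ! l" for l by (simp add: LL_def a_def nth_append)
  have splitN: "l < a \<or> (\<exists>m. l = a + m \<and> m < length LB)" if "l < N" for l
    using that unfolding N by (metis add_diff_inverse_nat nat_add_left_cancel_less)
  have gl: "good (fst (LL ! l))" "0 < snd (LL ! l)" if "l < N" for l
  proof -
    have "good (fst (LL ! l)) \<and> 0 < snd (LL ! l)"
      using splitN[OF that]
    proof
      assume l: "l < a"
      then have "(fst (LA ! l), snd (LA ! l)) \<in> set LA" by (simp add: a_def)
      from tree_leaf_facts[OF tA good_id eighth this] show ?thesis using nthA[OF l] by simp
    next
      assume "\<exists>m. l = a + m \<and> m < length LB"
      then obtain m where m: "l = a + m" "m < length LB" by blast
      then have "(fst (LB ! m), snd (LB ! m)) \<in> set LB" by simp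
      from tree_leaf_facts[OF tB gB eighth this] show ?thesis using nthB m by simp
    qed
    then show "good (fst (LL ! l))" "0 < snd (LL ! l)" by auto
  qed
  have SK: "fst (LL ! l) ` S \<subseteq> fst (LL ! l) ` K (snd (LL ! l))" if "l < N" for l
    using S_subset_K[of "snd (LL ! l)"] gl(2)[OF that] by (intro image_mono) simp
  have inA: "fst (LL ! l) ` K (snd (LL ! l)) \<subseteq> level id n" if "l < a" for l
  proof -
    have "LA ! l \<in> set (stage id n)" using that by (simp add: a_def LA_def)
    then show ?thesis unfolding nthA[OF that] level_def piece_def by blast
  qed
  have inB: "fst (LL ! (a + m)) ` K (snd (LL ! (a + m))) \<subseteq> h ` level dual n" if "m < length LB" for m
  proof -
    have m: "m < length (stage dual n)" using that by (simp add: LB_def)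
    then have "LB ! m = (h \<circ> fst (stage dual n ! m), snd (stage dual n ! m))" by (simp add: LB_def case_prod_unfold)
    moreover have "stage dual n ! m \<in> set (stage dual n)" using m by simp
    ultimately show ?thesis unfolding nthB level_def piece_def by (auto simp: image_comp[symmetric])
  qed
  have disj: "fst (LL ! l) ` K (snd (LL ! l)) \<inter> fst (LL ! l') ` K (snd (LL ! l')) = {}" if ll: "l < l'" "l' < N" for l l'
  proof -
    consider "l' < a" | "l < a" "a \<le> l'" | "a \<le> l" by linarith
    then show ?thesis
    proof cases
      case 1
      then show ?thesis using tree_leaves_disjoint[OF tA good_id eighth ll(1)] nthA[of l] nthA[of l'] ll(1) by (simp add: a_def)
    next
      case 2
      then obtain m where m: "l' = a + m" "m < length LB" using splitN[OF ll(2)] by auto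
      then show ?thesis using inA[OF 2(1)] inB[OF m(2)] n by blast
    next
      case 3
      then obtain m m' where m: "l = a + m" "l' = a + m'" using ll by (metis le_Suc_ex less_imp_le order_trans)
      then show ?thesis using tree_leaves_disjoint[OF tB gB eighth, of m m'] nthB ll N by simp
    qed
  qed
  define U where "U l = - (fst (LL ! l) ` S)" for l
  have "\<forall>l. \<exists>\<alpha>. l < N \<longrightarrow> cocycle 1 (U l) \<alpha> \<and>
      cochain_eval \<alpha> (polygon (fib (fst (LL ! l)) e0 \<circ> rect (-1/4) (1/4) (1/4)) unit_square) = 1"
  proof
    fix l
    show "\<exists>\<alpha>. l < N \<longrightarrow> cocycle 1 (U l) \<alpha> \<and>
      cochain_eval \<alpha> (polygon (fib (fst (LL ! l)) e0 \<circ> rect (-1/4) (1/4) (1/4)) unit_square) = 1"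
    proof (cases "l < N")
      case True
      obtain \<alpha> where "cocycle 1 (- (fst (LL ! l) ` S)) \<alpha>"
        "cochain_eval \<alpha> (polygon (fib (fst (LL ! l)) e0 \<circ> rect (-1/4) (1/4) (1/4)) unit_square) = 1"
        by (rule sphere_cocycle[OF gl(1)[OF True]]) (rule that)
      then show ?thesis unfolding U_def by (intro exI[of _ \<alpha>] impI conjI)
    qed simp
  qed
  from choice[OF this] obtain \<alpha> where \<alpha>: "\<forall>l. l < N \<longrightarrow> cocycle 1 (U l) (\<alpha> l) \<and>
      cochain_eval (\<alpha> l) (polygon (fib (fst (LL ! l)) e0 \<circ> rect (-1/4) (1/4) (1/4)) unit_square) = 1" by (rule exE)
  have U1: "open (U l) \<and> acyc 2 (U l)" if "l < N" for l
    unfolding U_def using closed_good_S[OF gl(1)[OF that]] acyc_2_sphere_complement[OF gl(1)[OF that]] by auto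
  have U2: "U l \<union> U l' = UNIV" if "l < l'" "l' < N" for l l'
  proof -
    have "l < N" using that by simp
    then have "fst (LL ! l) ` S \<inter> fst (LL ! l') ` S = {}"
      using Int_mono[OF SK[of l] SK[OF that(2)]] disj[OF that] by (metis subset_empty)
    then show ?thesis unfolding U_def by blast
  qed
  have U3: "cocycle 1 (U l) (\<alpha> l)" if "l < N" for l using \<alpha>[rule_format, OF that] by (rule conjunct1)
  obtain A where A: "\<And>l. l < N \<Longrightarrow> A l (Suc l) = \<alpha> l" "flat U 0 N A"
    by (rule flat_system_exists[where L = N and U = U and \<alpha> = \<alpha>], erule U1, erule U2, assumption, erule U3, rule that)
  have A1: "cochain_eval (A l (Suc l)) (polygon (fib (fst (LL ! l)) e0 \<circ> rect (-1/4) (1/4) (1/4)) unit_square) = 1" if "l < N" for l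
    unfolding A(1)[OF that] using \<alpha>[rule_format, OF that] by (rule conjunct2)
  interpret F: flat_block U A 0 N by unfold_locales (fact A(2))
  have fl1: "flat U 0 a A" and fl2: "flat U a N A" 
    using flat_subinterval[OF A(2), of 0 a] flat_subinterval[OF A(2), of a N] aN by auto
  interpret F1: flat_block U A 0 a by unfold_locales (fact fl1)
  interpret F2: flat_block U A a N by unfold_locales (fact fl2)
  have UA: "U (0 + l) = - (fst (LA ! l) ` S)" if "l < length LA" for l using that nthA by (simp add: U_def a_def)
  have UB: "U (a + l) = - (fst (LB ! l) ` S)" if "l < length LB" for l using nthB by (simp add: U_def)
  have nA: "cochain_eval (A (0 + l) (Suc (0 + l))) (polygon (fib (fst (LA ! l)) e0 \<circ> rect (-1/4) (1/4) (1/4)) unit_square) = 1"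
    if "l < length LA" for l
  proof -
    have l: "l < a" using that by (simp add: a_def)
    then have "l < N" using aN by simp
    from A1[OF this] show ?thesis unfolding nthA[OF l] add_0 .
  qed
  have nB: "cochain_eval (A (a + l) (Suc (a + l))) (polygon (fib (fst (LB ! l)) e0 \<circ> rect (-1/4) (1/4) (1/4)) unit_square) = 1"
    if "l < length LB" for l
  proof -
    have "a + l < N" using that by (simp add: N)
    from A1[OF this] show ?thesis unfolding nthB .
  qed
  have fl1': "flat U 0 (0 + length LA) A" and fl2': "flat U a (a + length LB) A" using fl1 fl2 by (simp_all add: a_def N)
  have "\<exists>c. c \<noteq> 0 \<and> (\<forall>p q \<gamma>. -1 < p \<longrightarrow> p < -(1/8) \<longrightarrow> 1/8 < q \<longrightarrow> q < 1 \<longrightarrow> 1/8 < \<gamma> \<longrightarrow> \<gamma> < 1/2 \<longrightarrow>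
     flat_block.phol A 0 (0 + length LA) (fib id e0 \<circ> rect p q \<gamma>) unit_square = 1 + corner 0 (0 + length LA) c)"
    by (rule tree_essential[OF tA good_id eighth fl1'], erule UA, erule nA)
  then obtain c where c0: "c \<noteq> 0" and c: "(\<forall>p q \<gamma>. -1 < p \<longrightarrow> p < -(1/8) \<longrightarrow> 1/8 < q \<longrightarrow> q < 1 \<longrightarrow> 1/8 < \<gamma> \<longrightarrow> \<gamma> < 1/2 \<longrightarrow>
     flat_block.phol A 0 (0 + length LA) (fib id e0 \<circ> rect p q \<gamma>) unit_square = 1 + corner 0 (0 + length LA) c)"
    by (elim exE conjE)
  have cA: "F1.phol (\<lambda>p. torus (p,(0,0))) unit_square = 1 + corner 0 a c"
    using c[rule_format, of "-1/4" "1/4" "1/4"] unfolding meridian_torus id_apply add_0 a_def[symmetric] by simp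
  have "\<exists>c. c \<noteq> 0 \<and> (\<forall>p q \<gamma>. -1 < p \<longrightarrow> p < -(1/8) \<longrightarrow> 1/8 < q \<longrightarrow> q < 1 \<longrightarrow> 1/8 < \<gamma> \<longrightarrow> \<gamma> < 1/2 \<longrightarrow>
     flat_block.phol A a (a + length LB) (fib (h \<circ> dual) e0 \<circ> rect p q \<gamma>) unit_square = 1 + corner a (a + length LB) c)"
    by (rule tree_essential[OF tB gB eighth fl2'], erule UB, erule nB)
  then obtain c' where c'0: "c' \<noteq> 0" and c': "(\<forall>p q \<gamma>. -1 < p \<longrightarrow> p < -(1/8) \<longrightarrow> 1/8 < q \<longrightarrow> q < 1 \<longrightarrow> 1/8 < \<gamma> \<longrightarrow> \<gamma> < 1/2 \<longrightarrow>
     flat_block.phol A a (a + length LB) (fib (h \<circ> dual) e0 \<circ> rect p q \<gamma>) unit_square = 1 + corner a (a + length LB) c')"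
    by (elim exE conjE)
  have cB: "F2.phol (\<lambda>q. h (torus ((0,0),q))) unit_square = 1 + corner a N c'"
    using c'[rule_format, of "-1/4" "1/4" "1/4"] unfolding meridian_torus comp_apply dual_torus N[symmetric] by simp
  have W1: "x \<in> F1.W" if "x \<notin> K (1/8)" for x
  proof -
    have "x \<in> (\<Inter>l\<in>{0..<0 + length LA}. U l)"
      by (rule tree_complement[OF tA good_id eighth], erule UA) (use that in simp)
    then show ?thesis unfolding F1.W_def by (simp only: a_def add_0)
  qed
  have W2: "x \<in> F2.W" if "x \<notin> (h \<circ> dual) ` K (1/8)" for x
  proof -
    have "x \<in> (\<Inter>l\<in>{a..<a + length LB}. U l)"
      by (rule tree_complement[OF tB gB eighth], erule UB) (rule that)
    then show ?thesis unfolding F2.W_def by (simp only: N)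
  qed
  have W12: "x \<in> F.W" if "x \<in> F1.W" "x \<in> F2.W" for x
    using that unfolding F.W_def F1.W_def F2.W_def by (auto simp: not_le[symmetric])
  have T1: "torus (p,q) \<in> F1.W" if "p \<in> square_boundary" "\<bar>fst q\<bar> \<le> 1" "\<bar>snd q\<bar> \<le> 1" for p q
    using torus_far[OF that] by (intro W1) force
  have T2: "z \<in> F2.W" if q: "q \<in> square_boundary" "\<bar>fst p\<bar> \<le> 1" "\<bar>snd p\<bar> \<le> 1" and z: "norm (z - torus (p,q)) < 1/64" for p q z
  proof (rule W2, rule notI)
    assume "z \<in> (h \<circ> dual) ` K (1/8)"
    then obtain y where y: "y \<in> K (1/8)" "z = h (dual y)" by auto
    have "dist (torus (p,q)) (dual y) = dist (torus (q,p)) y" unfolding dual_torus[of q p, symmetric] dist_dual ..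
    moreover have "1/32 \<le> dist (torus (q,p)) y" by (rule torus_far[OF q y(1)])
    moreover have "dist (torus (p,q)) (dual y) \<le> dist (torus (p,q)) z + dist z (dual y)" by (rule dist_triangle)
    moreover have "dist (torus (p,q)) z < 1/64" using z by (simp add: dist_norm norm_minus_commute)
    moreover have "dist z (dual y) < 1/64" using h(3)[of "dual y"] y(2) by (simp add: dist_norm)
    ultimately show False by linarith
  qed
  have T2': "torus (p,q) \<in> F2.W" if "q \<in> square_boundary" "\<bar>fst p\<bar> \<le> 1" "\<bar>snd p\<bar> \<le> 1" for p q
    using T2[OF that] by simp
  let ?P = "(-1,-1) :: real \<times> real"
  have us: "unit_square \<noteq> []" "hd unit_square = ?P" "last unit_square = ?P" "?P \<in> square_boundary"
    by (auto simp: unit_square_def square_boundary_def)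
  define MA where "MA = F.phol (\<lambda>p. torus (p,?P)) unit_square"
  define MB where "MB = F.phol (\<lambda>q. torus (?P,q)) unit_square"
  have comm: "MA * MB = MB * MA"
  proof -
    have "torus ` (square_boundary \<times> square_boundary) \<subseteq> F.W"
      using square_boundary_bounds by (auto intro!: W12 T1 T2')
    from F.torus_slide[OF torus_continuous this us(1) _ unit_square_segments _ us(1) unit_square_segments]
    show ?thesis unfolding us MA_def MB_def using us(4) by blast
  qed
  have sq: "set (hd unit_square # tl unit_square) \<subseteq> {-1..1} \<times> {-1..1}" by (auto simp: unit_square_def)
  have cons: "hd unit_square # tl unit_square = unit_square" using us(1) by (rule list.collapse)
  have convsq: "convex ({-1..1::real} \<times> {-1..1::real})" by (intro convex_Times) auto
  have small0: "\<bar>fst ((1 - t) *\<^sub>R ?P)\<bar> \<le> 1" "\<bar>snd ((1 - t) *\<^sub>R ?P)\<bar> \<le> 1" if "t \<in> {0..1}" for t :: real using that by auto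
  \<comment> \<open>Only the leaves of the first tree matter in this block, so the second torus
    coordinate can be shrunk to the origin, even though the loop may then run through the second
    tree.\<close>
  have A_1: "F1.phol (\<lambda>p. torus (p,?P)) unit_square = 1 + corner 0 a c"
  proof -
    let ?H = "\<lambda>tp::real \<times> real \<times> real. torus (snd tp, (1 - fst tp) *\<^sub>R ?P)"
    have "F1.phol (\<lambda>p. ?H (0,p)) unit_square = 1 + corner 0 a c"
    proof (rule F1.loop_slide[where Z = square_boundary])
      show "continuous_on ({0..1} \<times> square_boundary) ?H"
        by (rule continuous_on_compose2[OF torus_continuous[of UNIV]]) (auto intro!: continuous_intros)
      show "?H ` ({0..1} \<times> square_boundary) \<subseteq> F1.W" using T1 small0 by fastforce
      show "F1.phol (\<lambda>p. ?H (1,p)) unit_square = 1 + corner 0 a c" using cA by (simp add: zero_prod_def)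
    qed (use us unit_square_segments in auto)
    then show ?thesis by simp
  qed
  \<comment> \<open>For the other block the whole filled square at the fixed second coordinate is
    off the second tree, so the loop is trivial.\<close>
  have A_2: "F2.phol (\<lambda>p. torus (p,?P)) unit_square = 1"
  proof -
    have im: "(\<lambda>p. torus (p,?P)) ` ({-1..1} \<times> {-1..1}) \<subseteq> F2.W"
      using T2'[OF us(4)] by (auto simp: abs_le_iff)
    have "F2.phol (\<lambda>p. torus (p,?P)) (hd unit_square # tl unit_square) = F2.hol (\<lambda>p. torus (p,?P)) (hd unit_square) (last (hd unit_square # tl unit_square))"
      by (rule F2.phol_convex[OF _ im convsq sq])
        (auto intro!: continuous_on_compose2[OF torus_continuous[of UNIV]] continuous_intros)
    then have "F2.phol (\<lambda>p. torus (p,?P)) unit_square = F2.hol (\<lambda>p. torus (p,?P)) ?P ?P" unfolding cons unfolding us .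
    also have "\<dots> = 1" by (rule F2.hol_self) (use im in auto)
    finally show ?thesis .
  qed
  have B_1: "F1.phol (\<lambda>q. torus (?P,q)) unit_square = 1"
  proof -
    have im: "(\<lambda>q. torus (?P,q)) ` ({-1..1} \<times> {-1..1}) \<subseteq> F1.W"
      using T1[OF us(4)] by (auto simp: abs_le_iff)
    have "F1.phol (\<lambda>q. torus (?P,q)) (hd unit_square # tl unit_square) = F1.hol (\<lambda>q. torus (?P,q)) (hd unit_square) (last (hd unit_square # tl unit_square))"
      by (rule F1.phol_convex[OF _ im convsq sq])
        (auto intro!: continuous_on_compose2[OF torus_continuous[of UNIV]] continuous_intros)
    then have "F1.phol (\<lambda>q. torus (?P,q)) unit_square = F1.hol (\<lambda>q. torus (?P,q)) ?P ?P" unfolding cons unfolding us .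
    also have "\<dots> = 1" by (rule F1.hol_self) (use im in auto)
    finally show ?thesis .
  qed
  \<comment> \<open>The known meridian of the second tree is the displaced loop \<open>h\<close> of
    the torus loop; the straight homotopy back moves each point by less than 1/64 and stays off the
    displaced tube.\<close>
  have B_0: "F2.phol (\<lambda>q. torus ((0,0),q)) unit_square = 1 + corner a N c'"
  proof -
    let ?m = "\<lambda>q. torus ((0,0),q)"
    let ?H = "\<lambda>tq::real \<times> real \<times> real. ?m (snd tq) + fst tq *\<^sub>R (h (?m (snd tq)) - ?m (snd tq))"
    have "F2.phol (\<lambda>q. ?H (0,q)) unit_square = 1 + corner a N c'"
    proof (rule F2.loop_slide[where Z = square_boundary])
      have cm: "continuous_on X (\<lambda>tq::real \<times> real \<times> real. ?m (snd tq))" for X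
        by (rule continuous_on_compose2[OF torus_continuous[of UNIV]]) (auto intro!: continuous_intros)
      show "continuous_on ({0..1} \<times> square_boundary) ?H"
        by (intro continuous_intros cm continuous_on_compose2[OF h(1) cm]) auto
      show "?H ` ({0..1} \<times> square_boundary) \<subseteq> F2.W"
      proof (rule image_subsetI)
        fix tq :: "real \<times> real \<times> real" assume tq: "tq \<in> {0..1} \<times> square_boundary"
        have "norm (fst tq *\<^sub>R (h (?m (snd tq)) - ?m (snd tq))) \<le> 1 * norm (h (?m (snd tq)) - ?m (snd tq))"
          unfolding norm_scaleR using tq by (intro mult_right_mono) auto
        also have "\<dots> < 1/64" using h(3) by simp
        finally have "norm (?H tq - ?m (snd tq)) < 1/64" by simp
        then show "?H tq \<in> F2.W" using tq by (intro T2[of "snd tq" "(0,0)"]) auto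
      qed
      show "F2.phol (\<lambda>q. ?H (1,q)) unit_square = 1 + corner a N c'" using cB by simp
    qed (use us unit_square_segments aN in auto)
    then show ?thesis by simp
  qed
  have B_2: "F2.phol (\<lambda>q. torus (?P,q)) unit_square = 1 + corner a N c'"
  proof -
    let ?H = "\<lambda>tq::real \<times> real \<times> real. torus ((1 - fst tq) *\<^sub>R ?P, snd tq)"
    have "F2.phol (\<lambda>q. ?H (0,q)) unit_square = 1 + corner a N c'"
    proof (rule F2.loop_slide[where Z = square_boundary])
      show "continuous_on ({0..1} \<times> square_boundary) ?H"
        by (rule continuous_on_compose2[OF torus_continuous[of UNIV]]) (auto intro!: continuous_intros)
      show "?H ` ({0..1} \<times> square_boundary) \<subseteq> F2.W" using T2' small0 by fastforce
      show "F2.phol (\<lambda>q. ?H (1,q)) unit_square = 1 + corner a N c'" using B_0 by (simp add: zero_prod_def)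
    qed (use us unit_square_segments aN in auto)
    then show ?thesis by simp
  qed
  \<comment> \<open>The two blocks share the index \<open>a\<close>, so the entries
    \<open>(0, a)\<close> and \<open>(a, N)\<close> multiply to the corner, contrary to commutation
    on the torus.\<close>
  have "MA * MB = MB * MA + corner 0 N (c * c')"
  proof (rule commutator_corner[OF aN])
    note E1 = entry_phol_subblock[OF A(2) order_refl less_imp_le[OF aN(2)]]
    note E2 = entry_phol_subblock[OF A(2) less_imp_le[OF aN(1)] order_refl]
    show "entry MA x y = (if x = 0 \<and> y = a then c else 0)" if "0 \<le> x" "x < y" "y \<le> a" for x y
      using E1[of x y "\<lambda>p. torus (p,?P)" unit_square] that unfolding MA_def A_1 by (simp add: plus_utri.rep_eq one_utri.rep_eq entry_corner)
    show "entry MA x y = 0" if "a \<le> x" "x < y" "y \<le> N" for x y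
      using E2[of x y "\<lambda>p. torus (p,?P)" unit_square] that unfolding MA_def A_2 by (simp add: one_utri.rep_eq)
    show "entry MB x y = 0" if "0 \<le> x" "x < y" "y \<le> a" for x y
      using E1[of x y "\<lambda>q. torus (?P,q)" unit_square] that unfolding MB_def B_1 by (simp add: one_utri.rep_eq)
    show "entry MB x y = (if x = a \<and> y = N then c' else 0)" if "a \<le> x" "x < y" "y \<le> N" for x y
      using E2[of x y "\<lambda>q. torus (?P,q)" unit_square] that unfolding MB_def B_2 by (simp add: plus_utri.rep_eq one_utri.rep_eq entry_corner)
  qed (auto simp: MA_def MB_def F.blocked_phol F.unipotent_phol)
  then have "corner 0 N (c * c') = 0" using comm by simp
  then have "entry (corner 0 N (c * c')) 0 N = 0" by (simp add: zero_utri.rep_eq)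
  then show False using c0 c'0 by (simp add: entry_corner)
qed

end

theorem theorem1:
  assumes "CARD('n::finite) \<ge> 4"
  shows "\<exists>C :: (real^'n) set. is_cantor_set C \<and> sticky C"
proof -
  obtain xs :: "'n list" where xs: "set xs = UNIV" "distinct xs" using finite_distinct_list[of "UNIV :: 'n set"] by auto
  then have len: "4 \<le> length xs" using assms distinct_card[OF xs(2)] by simp
  define i0 i1 i2 i3 where "i0 = xs ! 0" and "i1 = xs ! 1" and "i2 = xs ! 2" and "i3 = xs ! 3"
  have d: "i0 \<noteq> i1" "i0 \<noteq> i2" "i0 \<noteq> i3" "i1 \<noteq> i2" "i1 \<noteq> i3" "i2 \<noteq> i3"
  proof -
    have "xs ! i \<noteq> xs ! j" if "i < j" "j < 4" for i j
      using nth_eq_iff_index_eq[OF xs(2), of i j] len that by auto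
    then show "i0 \<noteq> i1" "i0 \<noteq> i2" "i0 \<noteq> i3" "i1 \<noteq> i2" "i1 \<noteq> i3" "i2 \<noteq> i3"
      unfolding i0_def i1_def i2_def i3_def by simp_all
  qed
  interpret basis_frame4 "axis i0 1 :: real^'n" "axis i1 1" "axis i2 1" "axis i3 1"
    using d by unfold_locales (auto simp: inner_axis_axis axis_in_Basis_iff)
  let ?C = "limit_set id \<union> limit_set dual"
  have "is_cantor_set ?C"
    by (rule is_cantor_set_Un[OF compact_limit[OF good_id] limit_nonempty[OF good_id] limit_totally_disconnected[OF good_id]
          limit_perfect[OF good_id] compact_limit[OF good_dual] limit_totally_disconnected[OF good_dual] limit_perfect[OF good_dual]])
  moreover have "sticky ?C"
    unfolding sticky_def
  proof (intro exI[of _ "1/64"] conjI notI)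
    assume "\<exists>h. ambient_isotopy h \<and> (\<forall>t\<in>{0..1}. \<forall>x. norm (h t x - x) < 1/64) \<and> h 1 ` ?C \<inter> ?C = {}"
    then obtain h where h: "ambient_isotopy h" "\<forall>t\<in>{0..1}. \<forall>x. norm (h t x - x) < 1/64" "h 1 ` ?C \<inter> ?C = {}" by blast
    obtain g where g: "homeomorphism UNIV UNIV (h 1) g" using h(1) unfolding ambient_isotopy_def by (meson atLeastAtMost_iff order_refl zero_le_one)
    have "h 1 ` limit_set dual \<inter> limit_set id \<noteq> {}"
    proof (rule limit_sets_linked)
      show "continuous_on UNIV (h 1)" using g by (simp add: homeomorphism_def)
      show "inj (h 1)" by (rule inj_on_inverseI[of _ g]) (use g in \<open>simp add: homeomorphism_def\<close>)
      show "norm (h 1 x - x) < 1/64" for x using h(2) by simp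
    qed
    then show False using h(3) by blast
  qed simp
  ultimately show ?thesis by blast
qed

end
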